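(* Let $u$ be a weak subsolution of $A_{\mu,p}u=0$ in $\Omega$ and let $\phi=(u-k)_+:=\max\{u-k,0\}$ with $k\in\mathbb{R}$. Then there exists a positive constant $C=C(p)$ such that $$ \begin{aligned} &\alpha\int_{B_r(x_0)} w^p|\nabla\phi|^p\,dx+\int_{(0,1)}C_{N,s,p}\left(\iint_{B_r(x_0)\times B_r(x_0)}\frac{|\phi(x)w(x)-\phi(y)w(y)|^p}{|x-y|^{N+sp}}\,dx\,dy\right)d\mu(s)\\ &\le C\Bigg[\int_{(0,1)}C_{N,s,p}\left(\iint_{B_r(x_0)\times B_r(x_0)}\frac{\max\{\phi(x),\phi(y)\}^p|w(x)-w(y)|^p}{|x-y|^{N+sp}}\,dx\,dy\right)d\mu(s)\\ &\quad+\int_{(0,1)}C_{N,s,p}\left(\operatorname*{ess\,sup}_{x\in\operatorname{supp}(w)}\int_{\mathbb{R}^N\setminus B_r(x_0)}\frac{\phi^{p-1}(y)}{|x-y|^{N+sp}}\,dy\cdot\int_{B_r(x_0)}\phi(x)w^p(x)\,dx\right)d\mu(s)\\ &\quad+\alpha\int_{B_r(x_0)}\phi^p|\nabla w|^p\,dx\Bigg], \end{aligned} $$ where $w$ is any nonnegative function with $w\in C_c^\infty(B_r(x_0))$ and $B_r(x_0)\subset\Omega$.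
   Context: Setting: $p\in(1,\infty)$, $\Omega\subset\mathbb{R}^N$ is a bounded domain, and $\mu$ is a nonnegative finite Borel measure on $[0,1]$, nontrivial on $(0,1)$, with $\mu(\{0\})=0$ and $\alpha:=\mu(\{1\})>0$; $\Sigma:=\operatorname{supp}\mu$. The operator is $A_{\mu,p}u=\int_{(0,1)}(-\Delta)_p^su\,d\mu(s)-\alpha\Delta_pu$. The normalizing constant (written $C_{N,s,p}$ or $C_{N,p,s}$) is $$C_{N,s,p}=\frac{\frac{sp}{2}(1-s)2^{2s-1}}{\pi^{\frac{N-1}{2}}}\,\frac{\Gamma(\frac{N+ps}{2})}{\Gamma(\frac{p+1}{2})\Gamma(2-s)}.$$ $B_r(x_0)$ is the open ball of center $x_0$ and radius $r>0$. Tail: for $u\in L^{p-1}_{loc}(\mathbb{R}^N)$, $$\operatorname{Tail}(u;x_0,r)=\left[\int_{(0,1)}C_{N,s,p}\,r^{sp}\left(\int_{\mathbb{R}^N\setminus B_r(x_0)}\frac{|u(y)|^{p-1}}{|y-x_0|^{N+sp}}\,dy\right)d\mu(s)\right]^{\frac1{p-1}},$$ and $L^{p-1}_{sp,\mu}(\mathbb{R}^N)$ is the set of $u\in L^{p-1}_{loc}(\mathbb{R}^N)$ with $\operatorname{Tail}(u;x,r)<\infty$ for all $x\in\mathbb{R}^N$, $r\in(0,\infty)$. Weak solutions: $W_0^{1,p}(\Omega')$ is the standard Sobolev space, its elements being taken equal to $0$ in $\mathbb{R}^N\setminus\Omega'$. A function $u\in W^{1,p}_{loc}(\Omega)\cap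 L^{p-1}_{sp,\mu}(\mathbb{R}^N)$ is a weak subsolution of $A_{\mu,p}u=0$ in $\Omega$ if for every $\Omega'\Subset\Omega$ and every nonnegative $v\in W_0^{1,p}(\Omega')$, $$\int_{(0,1)}C_{N,s,p}\left(\iint_{\mathbb{R}^{2N}}\frac{|u(x)-u(y)|^{p-2}(u(x)-u(y))(v(x)-v(y))}{|x-y|^{N+sp}}\,dx\,dy\right)d\mu(s)+\alpha\int_\Omega|\nabla u|^{p-2}\nabla u\cdot\nabla v\,dx\le0.$$ *)

theory Defs
  imports "HOL-Probability.Probability"
begin

section \<open>Euclidean space of variable dimension\<close>

text \<open>
  The constant of the theorem depends on \<open>p\<close> only, not on the dimension, so the dimension has to be
  quantified after the constant and cannot be a type. Hence \<open>R^N\<close> is the library's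
  \<^const>\<open>Euclidean_space\<close>: the sequences \<open>nat \<Rightarrow> real\<close> vanishing from index \<open>N\<close> on, with the
  product (that is, the Euclidean) topology. Functions on \<open>R^N\<close> are functions on
  \<open>nat \<Rightarrow> real\<close> whose values outside \<open>R^N\<close> are irrelevant.
\<close>

abbreviation Rn :: "nat \<Rightarrow> (nat \<Rightarrow> real) set" where
  "Rn N \<equiv> topspace (Euclidean_space N)"

definition enorm :: "nat \<Rightarrow> (nat \<Rightarrow> real) \<Rightarrow> real" where
  "enorm N x = L2_set x {..<N}"

definition edist :: "nat \<Rightarrow> (nat \<Rightarrow> real) \<Rightarrow> (nat \<Rightarrow> real) \<Rightarrow> real" where
  "edist N x y = enorm N (\<lambda>i. x i - y i)"

definition einner :: "nat \<Rightarrow> (nat \<Rightarrow> real) \<Rightarrow> (nat \<Rightarrow> real) \<Rightarrow> real" where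
  "einner N x y = (\<Sum>i<N. x i * y i)"

definition euclid_ball :: "nat \<Rightarrow> (nat \<Rightarrow> real) \<Rightarrow> real \<Rightarrow> (nat \<Rightarrow> real) set" where
  "euclid_ball N a r = {x \<in> Rn N. edist N x a < r}"

text \<open>Lebesgue measure on the Borel sets of \<open>R^N\<close>. Its space is \<open>Rn N\<close>; the product measure lives on
  functions that are \<open>undefined\<close> from \<open>N\<close> on, which are re-extended by \<open>0\<close>.\<close>

definition leb :: "nat \<Rightarrow> (nat \<Rightarrow> real) measure" where
  "leb N = distr (Pi\<^sub>M {..<N} (\<lambda>_. lborel)) (restrict_space borel (Rn N))
             (\<lambda>x i. if i < N then x i else 0)"

definition bounded_domain :: "nat \<Rightarrow> (nat \<Rightarrow> real) set \<Rightarrow> bool" where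
  "bounded_domain N U \<longleftrightarrow> U \<noteq> {} \<and> openin (Euclidean_space N) U \<and> connectedin (Euclidean_space N) U
     \<and> (\<exists>R. \<forall>x\<in>U. enorm N x \<le> R)"

definition compactly_inside :: "nat \<Rightarrow> (nat \<Rightarrow> real) set \<Rightarrow> (nat \<Rightarrow> real) set \<Rightarrow> bool" where
  "compactly_inside N V U \<longleftrightarrow> openin (Euclidean_space N) V
     \<and> compactin (Euclidean_space N) (Euclidean_space N closure_of V)
     \<and> Euclidean_space N closure_of V \<subseteq> U"


section \<open>Smooth functions with compact support\<close>

definition pd :: "nat \<Rightarrow> ((nat \<Rightarrow> real) \<Rightarrow> real) \<Rightarrow> (nat \<Rightarrow> real) \<Rightarrow> real" where
  "pd i f x = deriv (\<lambda>t. f (x(i := t))) (x i)"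

primrec Ck :: "nat \<Rightarrow> nat \<Rightarrow> ((nat \<Rightarrow> real) \<Rightarrow> real) \<Rightarrow> bool" where
  "Ck N 0 f \<longleftrightarrow> continuous_map (Euclidean_space N) euclideanreal f"
| "Ck N (Suc k) f \<longleftrightarrow> continuous_map (Euclidean_space N) euclideanreal f
     \<and> (\<forall>i<N. (\<forall>x\<in>Rn N. (\<lambda>t. f (x(i := t))) field_differentiable (at (x i))) \<and> Ck N k (pd i f))"

definition supp :: "nat \<Rightarrow> ((nat \<Rightarrow> real) \<Rightarrow> real) \<Rightarrow> (nat \<Rightarrow> real) set" where
  "supp N f = Euclidean_space N closure_of {x \<in> Rn N. f x \<noteq> 0}"

definition Cc_infty :: "nat \<Rightarrow> (nat \<Rightarrow> real) set \<Rightarrow> ((nat \<Rightarrow> real) \<Rightarrow> real) set" where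
  "Cc_infty N U = {f. (\<forall>k. Ck N k f) \<and> compactin (Euclidean_space N) (supp N f) \<and> supp N f \<subseteq> U}"

definition grad :: "((nat \<Rightarrow> real) \<Rightarrow> real) \<Rightarrow> (nat \<Rightarrow> real) \<Rightarrow> nat \<Rightarrow> real" where
  "grad f x = (\<lambda>i. pd i f x)"


section \<open>Sobolev spaces\<close>

definition Lp :: "nat \<Rightarrow> real \<Rightarrow> (nat \<Rightarrow> real) set \<Rightarrow> ((nat \<Rightarrow> real) \<Rightarrow> real) set" where
  "Lp N p U = {f. set_borel_measurable (leb N) U f
     \<and> (\<integral>\<^sup>+x\<in>U. ennreal (\<bar>f x\<bar> powr p) \<partial>leb N) < \<infinity>}"

definition L1_loc :: "nat \<Rightarrow> (nat \<Rightarrow> real) set \<Rightarrow> ((nat \<Rightarrow> real) \<Rightarrow> real) set" where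
  "L1_loc N U = {f. \<forall>K. compactin (Euclidean_space N) K \<and> K \<subseteq> U \<longrightarrow> set_integrable (leb N) K f}"

definition is_weak_gradient ::
  "nat \<Rightarrow> (nat \<Rightarrow> real) set \<Rightarrow> ((nat \<Rightarrow> real) \<Rightarrow> real) \<Rightarrow> ((nat \<Rightarrow> real) \<Rightarrow> nat \<Rightarrow> real) \<Rightarrow> bool" where
  "is_weak_gradient N U f G \<longleftrightarrow> f \<in> L1_loc N U \<and> (\<forall>i<N. (\<lambda>x. G x i) \<in> L1_loc N U
     \<and> (\<forall>\<psi>\<in>Cc_infty N U.
          (LINT x:U|leb N. f x * pd i \<psi> x) = - (LINT x:U|leb N. G x i * \<psi> x)))"

text \<open>The weak gradient on the open set \<open>U\<close>; it is determined up to null sets only.\<close>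

definition wgrad ::
  "nat \<Rightarrow> (nat \<Rightarrow> real) set \<Rightarrow> ((nat \<Rightarrow> real) \<Rightarrow> real) \<Rightarrow> (nat \<Rightarrow> real) \<Rightarrow> nat \<Rightarrow> real" where
  "wgrad N U f = (SOME G. is_weak_gradient N U f G)"

definition W1p :: "nat \<Rightarrow> real \<Rightarrow> (nat \<Rightarrow> real) set \<Rightarrow> ((nat \<Rightarrow> real) \<Rightarrow> real) set" where
  "W1p N p U = {f \<in> Lp N p U. \<exists>G. is_weak_gradient N U f G \<and> (\<forall>i<N. (\<lambda>x. G x i) \<in> Lp N p U)}"

definition W1p_loc :: "nat \<Rightarrow> real \<Rightarrow> (nat \<Rightarrow> real) set \<Rightarrow> ((nat \<Rightarrow> real) \<Rightarrow> real) set" where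
  "W1p_loc N p U = {f. \<exists>G. is_weak_gradient N U f G
     \<and> (\<forall>V. compactly_inside N V U \<longrightarrow> f \<in> Lp N p V \<and> (\<forall>i<N. (\<lambda>x. G x i) \<in> Lp N p V))}"

text \<open>The closure of the test functions in \<open>W1p\<close>, its elements being extended by \<open>0\<close>.\<close>

definition W1p_0 :: "nat \<Rightarrow> real \<Rightarrow> (nat \<Rightarrow> real) set \<Rightarrow> ((nat \<Rightarrow> real) \<Rightarrow> real) set" where
  "W1p_0 N p U = {f \<in> W1p N p U. (\<forall>x\<in>Rn N - U. f x = 0) \<and>
     (\<exists>\<psi> :: nat \<Rightarrow> (nat \<Rightarrow> real) \<Rightarrow> real. (\<forall>n. \<psi> n \<in> Cc_infty N U) \<and>
        (\<lambda>n. \<integral>\<^sup>+x\<in>U. ennreal (\<bar>\<psi> n x - f x\<bar> powr p) \<partial>leb N) \<longlonglongrightarrow> 0 \<and>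
        (\<lambda>n. \<integral>\<^sup>+x\<in>U. ennreal (edist N (grad (\<psi> n) x) (wgrad N U f x) powr p) \<partial>leb N) \<longlonglongrightarrow> 0)}"


section \<open>The operator, the tail space and weak subsolutions\<close>

definition admissible_measure :: "real measure \<Rightarrow> bool" where
  "admissible_measure \<mu> \<longleftrightarrow> finite_measure \<mu> \<and> sets \<mu> = sets (restrict_space borel {0..1})
     \<and> emeasure \<mu> {0<..<1} > 0 \<and> emeasure \<mu> {0} = 0 \<and> emeasure \<mu> {1} > 0"

definition C_const :: "nat \<Rightarrow> real \<Rightarrow> real \<Rightarrow> real" where
  "C_const N s p = ((s * p / 2) * (1 - s) * 2 powr (2 * s - 1)) / pi powr ((real N - 1) / 2)
     * (Gamma ((real N + p * s) / 2) / (Gamma ((p + 1) / 2) * Gamma (2 - s)))"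

definition tail_integral ::
  "nat \<Rightarrow> real \<Rightarrow> real measure \<Rightarrow> ((nat \<Rightarrow> real) \<Rightarrow> real) \<Rightarrow> (nat \<Rightarrow> real) \<Rightarrow> real \<Rightarrow> ennreal" where
  "tail_integral N p \<mu> u a r =
     (\<integral>\<^sup>+s\<in>{0<..<1}. ennreal (C_const N s p * r powr (s * p)) *
        (\<integral>\<^sup>+y\<in>Rn N - euclid_ball N a r.
           ennreal (\<bar>u y\<bar> powr (p - 1) / edist N y a powr (real N + s * p)) \<partial>leb N) \<partial>\<mu>)"

definition Tail ::
  "nat \<Rightarrow> real \<Rightarrow> real measure \<Rightarrow> ((nat \<Rightarrow> real) \<Rightarrow> real) \<Rightarrow> (nat \<Rightarrow> real) \<Rightarrow> real \<Rightarrow> ennreal" where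
  "Tail N p \<mu> u a r =
     (if tail_integral N p \<mu> u a r = \<infinity> then \<infinity>
      else ennreal (enn2real (tail_integral N p \<mu> u a r) powr (1 / (p - 1))))"

definition tail_space ::
  "nat \<Rightarrow> real \<Rightarrow> real measure \<Rightarrow> ((nat \<Rightarrow> real) \<Rightarrow> real) set" where
  "tail_space N p \<mu> = {u \<in> borel_measurable (leb N).
     (\<forall>K. compactin (Euclidean_space N) K \<longrightarrow> (\<integral>\<^sup>+x\<in>K. ennreal (\<bar>u x\<bar> powr (p - 1)) \<partial>leb N) < \<infinity>)
     \<and> (\<forall>a\<in>Rn N. \<forall>r>0. Tail N p \<mu> u a r < \<infinity>)}"

text \<open>For every \<open>p > 1\<close> the expressions \<open>|t|^(p-2) t\<close> are \<open>0\<close> at \<open>t = 0\<close>, as \<open>0 powr a = 0\<close>.\<close>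

definition weak_subsolution ::
  "nat \<Rightarrow> real \<Rightarrow> real measure \<Rightarrow> (nat \<Rightarrow> real) set \<Rightarrow> ((nat \<Rightarrow> real) \<Rightarrow> real) \<Rightarrow> bool" where
  "weak_subsolution N p \<mu> \<Omega> u \<longleftrightarrow> u \<in> W1p_loc N p \<Omega> \<and> u \<in> tail_space N p \<mu> \<and>
     (\<forall>\<Omega>' v. compactly_inside N \<Omega>' \<Omega> \<and> v \<in> W1p_0 N p \<Omega>' \<and> (\<forall>x\<in>Rn N. 0 \<le> v x) \<longrightarrow>
        (LINT s:{0<..<1}|\<mu>. C_const N s p *
           (LINT (x, y)|(leb N \<Otimes>\<^sub>M leb N).
              \<bar>u x - u y\<bar> powr (p - 2) * (u x - u y) * (v x - v y)
                / edist N x y powr (real N + s * p)))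
        + measure \<mu> {1} *
          (LINT x:\<Omega>|leb N. enorm N (wgrad N \<Omega> u x) powr (p - 2)
              * einner N (wgrad N \<Omega> u x) (wgrad N \<Omega> v x)) \<le> 0)"

end

theory Submission
  imports Defs "HOL-Computational_Algebra.Polynomial"
begin

text \<open>
  The inequality is obtained by testing the equation with \<open>v = (u - k)\<^sub>+ w\<^sup>p\<close>. Write \<open>\<phi> = (u - k)\<^sub>+\<close>.

  For the local term, \<open>\<nabla>v = w\<^sup>p \<nabla>\<phi> + p \<phi> w\<^sup>p\<^sup>-\<^sup>1 \<nabla>w\<close>, and the mixed term of \<open>\<bar>\<nabla>u\<bar>\<^sup>p\<^sup>-\<^sup>2 \<nabla>u \<cdot> \<nabla>v\<close> is
  absorbed by half of \<open>w\<^sup>p \<bar>\<nabla>\<phi>\<bar>\<^sup>p\<close> with the Young inequality (\<open>caccioppoli_local\<close>). The nonlocal term has a discrete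
  counterpart (\<open>caccioppoli_nonlocal_inside\<close>): for two points of the ball the integrand bounds
  \<open>\<bar>\<phi>(x) w(x) - \<phi>(y) w(y)\<bar>\<^sup>p\<close> from above up to a multiple of \<open>max {\<phi>(x), \<phi>(y)}\<^sup>p \<bar>w(x) - w(y)\<bar>\<^sup>p\<close>. If one point
  lies outside the ball, then \<open>v\<close> vanishes there, and the integrand is at least
  \<open>- \<phi>(y)\<^sup>p\<^sup>-\<^sup>1 \<phi>(x) w(x)\<^sup>p\<close> (\<open>caccioppoli_nonlocal_outside\<close>), which yields the tail term. All constants in these
  pointwise inequalities depend on \<open>p\<close> only. Integrating them and adding the two parts gives the claim
  (\<open>nonlocal_part\<close>, \<open>local_part\<close>, \<open>ennreal_absorb\<close>).

  Most of the work is to justify that \<open>v\<close> is an admissible test function and that the integrals involved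
  converge. Weak derivatives are handled through difference quotients. The identity
  \<open>f(x + t e\<^sub>i) - f(x) = t \<integral>\<^sub>0\<^sup>1 g(x + \<theta> t e\<^sub>i) d\<theta>\<close> (\<open>weak_deriv_increment\<close>) shows that the difference quotients of
  \<open>f\<close> converge locally in the mean to the weak derivative \<open>g\<close>, and conversely such convergence implies the
  integration by parts formula (\<open>weak_deriv_from_diffquot\<close>). The chain rule for \<open>(u - k)\<^sub>+\<close> and the product rule
  for \<open>\<phi> w\<^sup>p\<close> then become statements about limits (\<open>weak_deriv_pos_part\<close>, \<open>weak_deriv_mult_C1c\<close>). Since \<open>v\<close> has
  compact support in the domain, its mollifications approximate it in the Sobolev norm
  (\<open>W1p_0_membership\<close>).

  The same identity bounds increments by the weak gradient, \<open>\<integral>\<^sub>K \<bar>f(x + h) - f(x)\<bar>\<^sup>p dx \<le> c \<bar>h\<bar>\<^sup>p\<close>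
  (\<open>increment_bound\<close>), so the nonlocal form converges absolutely near the diagonal, with a bound of order
  \<open>1/(1 - s)\<close>. Away from the diagonal it is controlled by a bound of order \<open>1/s\<close> and by the tail of \<open>u\<close>.
  The normalizing constant is of order \<open>s (1 - s)\<close>, so the form is finite after integration against the
  finite measure \<open>\<mu>\<close> (\<open>nonlocal_form_finite\<close>). This convergence allows both forms to be written as differences
  of finite parts, and these cancel although the terms of the inequality may be infinite.
\<close>

section \<open>Euclidean space: topology and Lebesgue measure\<close>

lemma Rn_iff: "x \<in> Rn N \<longleftrightarrow> (\<forall>i\<ge>N. x i = 0)"
  by (simp add: topspace_Euclidean_space)

definition vadd :: "(nat \<Rightarrow> real) \<Rightarrow> (nat \<Rightarrow> real) \<Rightarrow> nat \<Rightarrow> real" (infixl "\<oplus>" 65) where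
  "x \<oplus> y = (\<lambda>i. x i + y i)"

abbreviation vzero :: "nat \<Rightarrow> real" where "vzero \<equiv> \<lambda>_. 0"

lemma vadd_apply [simp]: "(x \<oplus> y) i = x i + y i"
  by (simp add: vadd_def)

lemma vadd_assoc: "x \<oplus> y \<oplus> z = x \<oplus> (y \<oplus> z)"
  and vadd_commute: "x \<oplus> y = y \<oplus> x"
  and vadd_zero [simp]: "x \<oplus> vzero = x"
  and vadd_uminus [simp]: "x \<oplus> h \<oplus> - h = x" "x \<oplus> - h \<oplus> h = x"
  and vadd_diff [simp]: "x \<oplus> (y - x) = y" "y - x \<oplus> x = y" "x \<oplus> h - x = h" "h \<oplus> x - x = h"
  by (simp_all add: fun_eq_iff)

lemma Rn_add [simp, intro]: "x \<in> Rn N \<Longrightarrow> h \<in> Rn N \<Longrightarrow> x \<oplus> h \<in> Rn N"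
  and Rn_diff [simp, intro]: "x \<in> Rn N \<Longrightarrow> h \<in> Rn N \<Longrightarrow> x - h \<in> Rn N"
  and Rn_uminus [simp, intro]: "x \<in> Rn N \<Longrightarrow> - x \<in> Rn N"
  and Rn_0 [simp, intro]: "vzero \<in> Rn N"
  and Rn_upd [simp, intro]: "x \<in> Rn N \<Longrightarrow> i < N \<Longrightarrow> x(i := t) \<in> Rn N"
  by (auto simp: Rn_iff fun_Compl_def)

lemma Euclidean_space_eq: "Euclidean_space N = top_of_set {x. \<forall>i\<ge>N. x i = 0}"
  by (simp add: Euclidean_space_def euclidean_product_topology)

lemma closed_Rn [simp]: "closed (Rn N)"
  by (rule closedin_Euclidean_imp_closed[OF closedin_topspace])

lemma compactin_iff: "compactin (Euclidean_space N) K \<longleftrightarrow> compact K \<and> K \<subseteq> Rn N"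
  by (simp add: Euclidean_space_eq compactin_subtopology topspace_Euclidean_space)

lemma openin_iff: "openin (Euclidean_space N) U \<longleftrightarrow> (\<exists>T. open T \<and> U = Rn N \<inter> T)"
  by (simp add: Euclidean_space_eq openin_open topspace_Euclidean_space)

lemma openin_subset_Rn: "openin (Euclidean_space N) U \<Longrightarrow> U \<subseteq> Rn N"
  by (rule openin_subset)

lemma continuous_map_real_iff:
  "continuous_map (Euclidean_space N) euclideanreal f \<longleftrightarrow> continuous_on (Rn N) f"
  by (simp add: continuous_map_Euclidean_space_iff)

lemma closure_of_iff: "A \<subseteq> Rn N \<Longrightarrow> Euclidean_space N closure_of A = closure A"
  using closure_minimal[of A "Rn N", OF _ closed_Rn]
  by (simp add: Euclidean_space_eq closure_of_subtopology Int_absorb1 topspace_Euclidean_space)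

lemma continuous_on_coord:
  fixes f :: "'a::topological_space \<Rightarrow> nat \<Rightarrow> real"
  shows "continuous_on S f \<Longrightarrow> continuous_on S (\<lambda>x. f x i)"
  by (rule continuous_on_product_then_coordinatewise)

lemma continuous_on_fun_add [continuous_intros]:
  fixes f :: "'a::topological_space \<Rightarrow> nat \<Rightarrow> real"
  assumes "continuous_on S f" "continuous_on S g"
  shows "continuous_on S (\<lambda>x. f x \<oplus> g x)"
  by (rule continuous_on_coordinatewise_then_product)
    (simp, intro continuous_on_add continuous_on_coord assms)

lemma continuous_on_fun_diff [continuous_intros]:
  fixes f :: "'a::topological_space \<Rightarrow> nat \<Rightarrow> real"
  assumes "continuous_on S f" "continuous_on S g"
  shows "continuous_on S (\<lambda>x. f x - g x)"
  by (rule continuous_on_coordinatewise_then_product)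
    (simp, intro continuous_on_diff continuous_on_coord assms)

subsection \<open>Measurability\<close>

lemma space_leb [simp]: "space (leb N) = Rn N"
  by (simp add: leb_def space_restrict_space)

lemma sets_leb: "sets (leb N) = sets (restrict_space borel (Rn N))"
  by (simp add: leb_def)

lemma sets_leb_iff: "A \<in> sets (leb N) \<longleftrightarrow> A \<in> sets borel \<and> A \<subseteq> Rn N"
  by (subst sets_leb, subst sets_restrict_space_iff) (auto intro: borel_closed)

lemma borel_measurable_fun_coord:
  "(\<lambda>x::nat \<Rightarrow> real. x i) \<in> borel_measurable borel"
  by (intro borel_measurable_continuous_onI continuous_on_product_coordinates)

text \<open>The Borel sets of the sequence space are generated by the coordinates, so measurability into \<open>R\<^sup>N\<close> can be
  checked coordinate by coordinate.\<close>

lemma measurable_into_leb: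
  assumes "\<And>x. x \<in> space M \<Longrightarrow> f x \<in> Rn N" and [measurable]: "\<And>i. (\<lambda>x. f x i) \<in> borel_measurable M"
  shows "f \<in> measurable M (leb N)"
proof -
  have "f \<in> measurable M (restrict_space borel (Rn N))"
    using assms(1) by (intro measurable_restrict_space2 measurable_coordinatewise_then_product assms) auto
  then show ?thesis
    by (rule measurable_cong_sets[THEN equalityD1, THEN subsetD, rotated 2]) (auto simp: sets_leb)
qed

lemma measurable_leb_coord:
  assumes "f \<in> measurable M (leb N)"
  shows "(\<lambda>x. f x i) \<in> borel_measurable M"
proof -
  have "(\<lambda>x. x i) \<in> borel_measurable (leb N)"
    by (subst measurable_cong_sets[OF sets_leb refl])
      (intro measurable_restrict_space1 borel_measurable_fun_coord)
  from measurable_compose[OF assms this] show ?thesis .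
qed

lemma measurable_leb_space: "f \<in> measurable M (leb N) \<Longrightarrow> x \<in> space M \<Longrightarrow> f x \<in> Rn N"
  by (metis measurable_space space_leb)

lemma measurable_leb_add [measurable (raw)]:
  assumes [measurable]: "f \<in> measurable M (leb N)" "g \<in> measurable M (leb N)"
  shows "(\<lambda>x. f x \<oplus> g x) \<in> measurable M (leb N)"
proof (rule measurable_into_leb)
  have [measurable]: "(\<lambda>x. f x i) \<in> borel_measurable M" "(\<lambda>x. g x i) \<in> borel_measurable M" for i
    by (rule measurable_leb_coord[OF assms(1)], rule measurable_leb_coord[OF assms(2)])
  show "(\<lambda>x. (f x \<oplus> g x) i) \<in> borel_measurable M" for i by simp
qed (use measurable_leb_space[OF assms(1)] measurable_leb_space[OF assms(2)] in auto)

lemma measurable_leb_diff [measurable (raw)]: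
  assumes [measurable]: "f \<in> measurable M (leb N)" "g \<in> measurable M (leb N)"
  shows "(\<lambda>x. f x - g x) \<in> measurable M (leb N)"
proof (rule measurable_into_leb)
  have [measurable]: "(\<lambda>x. f x i) \<in> borel_measurable M" "(\<lambda>x. g x i) \<in> borel_measurable M" for i
    by (rule measurable_leb_coord[OF assms(1)], rule measurable_leb_coord[OF assms(2)])
  show "(\<lambda>x. (f x - g x) i) \<in> borel_measurable M" for i by simp
qed (use measurable_leb_space[OF assms(1)] measurable_leb_space[OF assms(2)] in auto)

lemma measurable_leb_translate: "h \<in> Rn N \<Longrightarrow> (\<lambda>x. x \<oplus> h) \<in> measurable (leb N) (leb N)"
  by (rule measurable_leb_add) auto

lemma borel_measurable_leb_continuous:
  "continuous_on (Rn N) f \<Longrightarrow> f \<in> borel_measurable (leb N)" for f :: "_ \<Rightarrow> real"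
  by (subst measurable_cong_sets[OF sets_leb refl]) (rule borel_measurable_continuous_on_restrict)

lemma sets_leb_compact: "compact K \<Longrightarrow> K \<subseteq> Rn N \<Longrightarrow> K \<in> sets (leb N)"
  by (simp add: sets_leb_iff borel_compact)

lemma sets_leb_openin: "openin (Euclidean_space N) U \<Longrightarrow> U \<in> sets (leb N)"
  unfolding openin_iff sets_leb_iff using borel_closed[OF closed_Rn] by (auto intro: sets.Int borel_open)

lemma measurable_enorm [measurable (raw)]:
  assumes [measurable]: "f \<in> measurable M (leb N)"
  shows "(\<lambda>x. enorm m (f x)) \<in> borel_measurable M"
proof -
  have [measurable]: "(\<lambda>x. f x i) \<in> borel_measurable M" for i by (rule measurable_leb_coord[OF assms])
  show ?thesis unfolding enorm_def L2_set_def by measurable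
qed

lemma edist_eq: "edist N x y = enorm N (x - y)"
  by (simp add: edist_def fun_diff_def)

lemma measurable_edist [measurable (raw)]:
  assumes [measurable]: "f \<in> measurable M (leb N)" "g \<in> measurable M (leb N)"
  shows "(\<lambda>x. edist N (f x) (g x)) \<in> borel_measurable M"
  unfolding edist_eq by measurable

subsection \<open>Boxes and translations\<close>

interpretation lb: product_sigma_finite "\<lambda>_::nat. lborel :: real measure"
  by standard

definition ext0 :: "nat \<Rightarrow> (nat \<Rightarrow> real) \<Rightarrow> nat \<Rightarrow> real" where
  "ext0 N x = (\<lambda>i. if i < N then x i else 0)"

lemma ext0_measurable [measurable]: "ext0 N \<in> measurable (Pi\<^sub>M {..<N} (\<lambda>_. lborel)) (leb N)"
proof (rule measurable_into_leb)
  fix i show "(\<lambda>x. ext0 N x i) \<in> borel_measurable (Pi\<^sub>M {..<N} (\<lambda>_. lborel))"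
  proof (cases "i < N")
    case True
    then have "(\<lambda>x. x i) \<in> measurable (Pi\<^sub>M {..<N} (\<lambda>_. lborel)) lborel"
      by (intro measurable_component_singleton) simp
    then show ?thesis using True by (simp add: ext0_def)
  qed (simp add: ext0_def)
qed (auto simp: ext0_def Rn_iff)

lemma leb_eq: "leb N = distr (Pi\<^sub>M {..<N} (\<lambda>_. lborel)) (leb N) (ext0 N)"
  by (subst leb_def, rule distr_cong) (auto simp: sets_leb ext0_def)

lemma sets_leb_box:
  assumes [measurable]: "\<And>i. i < N \<Longrightarrow> A i \<in> sets borel"
  shows "{x \<in> Rn N. \<forall>i<N. x i \<in> A i} \<in> sets (leb N)"
proof -
  have "{x \<in> space (leb N). x i \<in> A i} \<in> sets (leb N)" if "i < N" for i
  proof -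
    have "(\<lambda>x::nat \<Rightarrow> real. x i) \<in> borel_measurable (leb N)"
      by (rule measurable_leb_coord[of "\<lambda>x. x" _ N]) simp
    from measurable_sets[OF this assms[OF that]]
    have "(\<lambda>x. x i) -` A i \<inter> Rn N \<in> sets (leb N)" by simp
    also have "(\<lambda>x. x i) -` A i \<inter> Rn N = {x \<in> space (leb N). x i \<in> A i}" by auto
    finally show ?thesis .
  qed
  then have "{x \<in> space (leb N). \<forall>i\<in>{..<N}. x i \<in> A i} \<in> sets (leb N)"
    by (intro sets.sets_Collect_finite_All) auto
  also have "{x \<in> space (leb N). \<forall>i\<in>{..<N}. x i \<in> A i} = {x \<in> Rn N. \<forall>i<N. x i \<in> A i}"
    unfolding space_leb by blast
  finally show ?thesis .
qed

lemma emeasure_leb_box: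
  assumes [measurable]: "\<And>i. i < N \<Longrightarrow> A i \<in> sets borel"
  shows "emeasure (leb N) {x \<in> Rn N. \<forall>i<N. x i \<in> A i} = (\<Prod>i<N. emeasure lborel (A i))"
proof -
  have B: "{x \<in> Rn N. \<forall>i<N. x i \<in> A i} \<in> sets (leb N)"
    by (rule sets_leb_box) (rule assms)
  have "emeasure (leb N) {x \<in> Rn N. \<forall>i<N. x i \<in> A i}
      = emeasure (Pi\<^sub>M {..<N} (\<lambda>_. lborel)) (ext0 N -` {x \<in> Rn N. \<forall>i<N. x i \<in> A i} \<inter> space (Pi\<^sub>M {..<N} (\<lambda>_. lborel :: real measure)))"
    by (rule emeasure_distr[OF ext0_measurable B, folded leb_eq])
  also have "ext0 N -` {x \<in> Rn N. \<forall>i<N. x i \<in> A i} \<inter> space (Pi\<^sub>M {..<N} (\<lambda>_. lborel :: real measure)) = Pi\<^sub>E {..<N} A"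
    by (auto simp: ext0_def Rn_iff space_PiM PiE_def)
  also have "emeasure (Pi\<^sub>M {..<N} (\<lambda>_. lborel :: real measure)) (Pi\<^sub>E {..<N} A) = (\<Prod>i<N. emeasure lborel (A i))"
    by (rule lb.emeasure_PiM) auto
  finally show ?thesis .
qed

definition cube :: "nat \<Rightarrow> real \<Rightarrow> (nat \<Rightarrow> real) set" where
  "cube N d = {x \<in> Rn N. \<forall>i<N. \<bar>x i\<bar> \<le> d}"

lemma cube_alt: "cube N d = {x \<in> Rn N. \<forall>i<N. x i \<in> {-d..d}}"
  by (auto simp: cube_def abs_le_iff)

lemma sets_cube [measurable, simp]: "cube N d \<in> sets (leb N)"
  unfolding cube_alt by (rule sets_leb_box) auto

lemma cube_subset_Rn: "cube N d \<subseteq> Rn N"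
  by (auto simp: cube_def)

lemma emeasure_cube: "0 \<le> d \<Longrightarrow> emeasure (leb N) (cube N d) = ennreal ((2 * d) ^ N)"
  unfolding cube_alt by (subst emeasure_leb_box) (auto simp: ennreal_power)

lemma Rn_eq_UN_cube: "Rn N = (\<Union>n. cube N (real n))"
proof -
  have "\<exists>n::nat. \<forall>i<N. \<bar>x i\<bar> \<le> real n" for x :: "nat \<Rightarrow> real"
  proof -
    obtain n :: nat where "(\<Sum>i<N. \<bar>x i\<bar>) \<le> real n"
      using real_arch_simple by blast
    moreover have "\<bar>x i\<bar> \<le> (\<Sum>i<N. \<bar>x i\<bar>)" if "i < N" for i
      using that by (intro member_le_sum) auto
    ultimately show ?thesis by (meson order_trans)
  qed
  then show ?thesis by (auto simp: cube_def)
qed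

lemma sigma_finite_leb: "sigma_finite_measure (leb N)"
proof
  show "\<exists>A. countable A \<and> A \<subseteq> sets (leb N) \<and> \<Union>A = space (leb N) \<and> (\<forall>a\<in>A. emeasure (leb N) a \<noteq> \<infinity>)"
    by (intro exI[of _ "range (\<lambda>n. cube N (real n))"]) (auto simp: emeasure_cube Rn_eq_UN_cube)
qed

interpretation leb: sigma_finite_measure "leb N" for N
  by (rule sigma_finite_leb)

interpretation lebp: pair_sigma_finite "leb N" "leb M" for N M ..

interpretation lebl: pair_sigma_finite "leb N" "lborel :: real measure" for N ..

text \<open>On boxes the claim is the invariance of the one-dimensional measure in each coordinate, and boxes
  determine a product measure.\<close>

lemma leb_translate:
  assumes h: "h \<in> Rn N"
  shows "distr (leb N) (leb N) (\<lambda>x. x \<oplus> h) = leb N"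
proof -
  let ?P = "Pi\<^sub>M {..<N} (\<lambda>_. lborel :: real measure)"
  define T where "T = (\<lambda>x::nat \<Rightarrow> real. \<lambda>i\<in>{..<N}. x i + h i)"
  have [measurable]: "T \<in> measurable ?P ?P"
    unfolding T_def by measurable
  have tr [measurable]: "(\<lambda>x. x \<oplus> h) \<in> measurable (leb N) (leb N)"
    by (rule measurable_leb_translate[OF h])
  have "distr ?P ?P T = ?P"
  proof (rule lb.PiM_eqI)
    fix A :: "nat \<Rightarrow> real set" assume A: "\<And>i. i \<in> {..<N} \<Longrightarrow> A i \<in> sets lborel"
    have "emeasure (distr ?P ?P T) (Pi\<^sub>E {..<N} A) = emeasure ?P (T -` (Pi\<^sub>E {..<N} A) \<inter> space ?P)"
      using A by (intro emeasure_distr) (auto intro!: sets_PiM_I_finite)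
    also have "T -` (Pi\<^sub>E {..<N} A) \<inter> space ?P = Pi\<^sub>E {..<N} (\<lambda>i. {t. t + h i \<in> A i})"
      unfolding T_def space_PiM by (intro set_eqI iffI; clarsimp simp: PiE_iff)
    also have "emeasure ?P \<dots> = (\<Prod>i<N. emeasure lborel {t. t + h i \<in> A i})"
    proof (rule lb.emeasure_PiM)
      fix i assume "i \<in> {..<N}"
      with A have [measurable]: "A i \<in> sets borel" by auto
      have "(\<lambda>t. t + h i) -` A i \<inter> space borel \<in> sets borel"
        by (rule measurable_sets[of _ borel borel]) auto
      then show "{t. t + h i \<in> A i} \<in> sets lborel" by (simp add: vimage_def)
    qed simp
    also have "\<dots> = (\<Prod>i<N. emeasure lborel (A i))"
    proof (rule prod.cong[OF refl])
      fix i assume i: "i \<in> {..<N}"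
      have "emeasure lborel (A i) = emeasure (distr lborel borel ((+) (h i))) (A i)"
        using lborel_distr_plus[of "h i"] by simp
      also have "\<dots> = emeasure lborel ((+) (h i) -` A i \<inter> space lborel)"
        using A[OF i] by (intro emeasure_distr) auto
      also have "(+) (h i) -` A i \<inter> space lborel = {t. t + h i \<in> A i}"
        by (auto simp: add.commute)
      finally show "emeasure lborel {t. t + h i \<in> A i} = emeasure lborel (A i)" ..
    qed
    finally show "emeasure (distr ?P ?P T) (Pi\<^sub>E {..<N} A) = (\<Prod>i\<in>{..<N}. emeasure lborel (A i))" .
  qed auto
  then have "leb N = distr (distr ?P ?P T) (leb N) (ext0 N)"
    by (metis leb_eq)
  also have "\<dots> = distr ?P (leb N) (ext0 N \<circ> T)"
    by (rule distr_distr) auto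
  also have "ext0 N \<circ> T = (\<lambda>x. x \<oplus> h) \<circ> ext0 N"
    using h by (auto simp: ext0_def T_def fun_eq_iff Rn_iff)
  also have "distr ?P (leb N) \<dots> = distr (distr ?P (leb N) (ext0 N)) (leb N) (\<lambda>x. x \<oplus> h)"
    by (rule distr_distr[symmetric]) auto
  also have "\<dots> = distr (leb N) (leb N) (\<lambda>x. x \<oplus> h)"
    by (metis leb_eq)
  finally show ?thesis ..
qed

lemma nn_integral_translate:
  assumes "h \<in> Rn N" and [measurable]: "f \<in> borel_measurable (leb N)"
  shows "(\<integral>\<^sup>+x. f (x \<oplus> h) \<partial>leb N) = (\<integral>\<^sup>+x. f x \<partial>leb N)"
  by (subst (2) leb_translate[OF assms(1), symmetric], subst nn_integral_distr)
    (auto intro: measurable_leb_translate[OF assms(1)])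

lemma integral_translate:
  fixes f :: "_ \<Rightarrow> real"
  assumes "h \<in> Rn N" and [measurable]: "f \<in> borel_measurable (leb N)"
  shows "(LINT x|leb N. f (x \<oplus> h)) = (LINT x|leb N. f x)"
  by (subst (2) leb_translate[OF assms(1), symmetric], subst integral_distr)
    (auto intro: measurable_leb_translate[OF assms(1)])

lemma integrable_translate:
  fixes f :: "_ \<Rightarrow> real"
  assumes "h \<in> Rn N" "integrable (leb N) f"
  shows "integrable (leb N) (\<lambda>x. f (x \<oplus> h))"
proof -
  have "integrable (distr (leb N) (leb N) (\<lambda>x. x \<oplus> h)) f"
    using assms leb_translate by metis
  then show ?thesis
    by (subst (asm) integrable_distr_eq) (use assms in \<open>auto intro: measurable_leb_translate\<close>)
qed

lemma compact_coord_bound: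
  fixes K :: "(nat \<Rightarrow> real) set"
  assumes "compact K"
  obtains R :: real where "0 < R" "\<And>x i. x \<in> K \<Longrightarrow> i < N \<Longrightarrow> \<bar>x i\<bar> \<le> R"
proof -
  have "\<exists>R. \<forall>x\<in>K. \<bar>x i\<bar> \<le> R" for i
  proof -
    have "compact ((\<lambda>x. x i) ` K)"
      using assms by (intro compact_continuous_image continuous_on_subset[OF continuous_on_product_coordinates]) auto
    then show ?thesis
      by (auto dest!: compact_imp_bounded simp: bounded_iff)
  qed
  then obtain R where R: "\<And>i x. x \<in> K \<Longrightarrow> \<bar>x i\<bar> \<le> R i" by metis
  show ?thesis
  proof (rule that[of "1 + (\<Sum>i<N. \<bar>R i\<bar>)"])
    show "0 < 1 + (\<Sum>i<N. \<bar>R i\<bar>)" by (simp add: add_pos_nonneg sum_nonneg)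
    fix x i assume "x \<in> K" "i < N"
    from \<open>i < N\<close> have "\<bar>R i\<bar> \<le> (\<Sum>i<N. \<bar>R i\<bar>)" by (intro member_le_sum) auto
    with R[OF \<open>x \<in> K\<close>, of i] show "\<bar>x i\<bar> \<le> 1 + (\<Sum>i<N. \<bar>R i\<bar>)" by linarith
  qed
qed

lemma compact_subset_cube:
  assumes "compact K" "K \<subseteq> Rn N"
  obtains R where "0 < R" "K \<subseteq> cube N R"
proof -
  obtain R where "0 < R" "\<And>x i. x \<in> K \<Longrightarrow> i < N \<Longrightarrow> \<bar>x i\<bar> \<le> R"
    using compact_coord_bound[OF assms(1), of N] by blast
  then show ?thesis using assms(2) by (intro that[of R]) (auto simp: cube_def)
qed

lemma compact_cube [simp]: "compact (cube N d)"
proof -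
  let ?A = "\<lambda>i. if i < N then {-d..d} else {0::real}"
  have "compactin (product_topology (\<lambda>i. euclideanreal) UNIV) (PiE UNIV ?A)"
    by (subst compactin_PiE) simp
  moreover have "PiE UNIV ?A = cube N d"
  proof (intro set_eqI iffI)
    fix x assume "x \<in> PiE UNIV ?A"
    then have "x i \<in> ?A i" for i by (auto simp: PiE_iff)
    then have "i < N \<Longrightarrow> x i \<in> {-d..d}" "N \<le> i \<Longrightarrow> x i = 0" for i
      by (metis, metis not_less singletonD)
    then show "x \<in> cube N d" unfolding cube_alt by (auto simp: Rn_iff)
  next
    fix x assume "x \<in> cube N d"
    then show "x \<in> PiE UNIV ?A" unfolding cube_alt by (auto simp: Rn_iff)
  qed
  ultimately show ?thesis by (simp add: euclidean_product_topology)
qed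

lemma emeasure_compact_finite:
  assumes "compact K" "K \<subseteq> Rn N"
  shows "emeasure (leb N) K < \<infinity>"
proof -
  obtain R where "0 < R" "K \<subseteq> cube N R" using compact_subset_cube[OF assms] by metis
  then have "emeasure (leb N) K \<le> emeasure (leb N) (cube N R)"
    by (intro emeasure_mono) auto
  also have "\<dots> < \<infinity>" using \<open>0 < R\<close> by (simp add: emeasure_cube)
  finally show ?thesis .
qed

text \<open>Neighbourhoods are built from cubes instead of balls: the sum of two cubes is a cube, and the
  smoothing kernels used below are products over the coordinates and are supported in cubes.\<close>

definition thick :: "nat \<Rightarrow> (nat \<Rightarrow> real) set \<Rightarrow> real \<Rightarrow> (nat \<Rightarrow> real) set" where
  "thick N K d = {x \<oplus> h |x h. x \<in> K \<and> h \<in> cube N d}"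

lemma thickI: "x \<in> K \<Longrightarrow> h \<in> cube N d \<Longrightarrow> x \<oplus> h \<in> thick N K d"
  by (auto simp: thick_def)

lemma compact_thick: "compact K \<Longrightarrow> compact (thick N K d)"
proof -
  assume "compact K"
  then have "compact ((\<lambda>z. fst z \<oplus> snd z) ` (K \<times> cube N d))"
    by (intro compact_continuous_image continuous_intros compact_Times compact_cube)
  also have "(\<lambda>z. fst z \<oplus> snd z) ` (K \<times> cube N d) = thick N K d"
    by (force simp: thick_def)
  finally show ?thesis .
qed

lemma thick_subset_Rn: "K \<subseteq> Rn N \<Longrightarrow> thick N K d \<subseteq> Rn N"
  using cube_subset_Rn by (force simp: thick_def)

lemma zero_in_cube: "0 \<le> d \<Longrightarrow> vzero \<in> cube N d"
  by (auto simp: cube_def)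

lemma cube_mono: "d \<le> d' \<Longrightarrow> cube N d \<subseteq> cube N d'"
  by (force simp: cube_def)

lemma cube_add: "x \<in> cube N d \<Longrightarrow> y \<in> cube N d' \<Longrightarrow> x \<oplus> y \<in> cube N (d + d')"
  unfolding cube_def by (auto intro: order_trans[OF abs_triangle_ineq] add_mono)

lemma cube_uminus: "x \<in> cube N d \<Longrightarrow> - x \<in> cube N d"
  by (auto simp: cube_def)

lemma thick_mono: "d \<le> d' \<Longrightarrow> thick N K d \<subseteq> thick N K d'"
  using cube_mono by (force simp: thick_def)

lemma subset_thick: "0 \<le> d \<Longrightarrow> K \<subseteq> thick N K d"
  using thickI[of _ K vzero N d] zero_in_cube by (auto simp: subset_iff)

lemma thick_thick: "thick N (thick N K d) d' \<subseteq> thick N K (d + d')"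
proof
  fix z assume "z \<in> thick N (thick N K d) d'"
  then obtain x h h' where "z = x \<oplus> h \<oplus> h'" "x \<in> K" "h \<in> cube N d" "h' \<in> cube N d'"
    by (auto simp: thick_def)
  then show "z \<in> thick N K (d + d')"
    unfolding thick_def using cube_add vadd_assoc by blast
qed

text \<open>By sequential compactness: a sequence of escaping sums would accumulate at a point of \<open>K\<close>
  that does not lie in the open set.\<close>

lemma thick_subset_open:
  assumes K: "compact K" "K \<subseteq> U" and U: "openin (Euclidean_space N) U"
  obtains d where "0 < d" "thick N K d \<subseteq> U"
proof (rule ccontr)
  assume "\<not> thesis"
  then have "\<not> thick N K (1 / real (Suc n)) \<subseteq> U" for n
    using that[of "1 / real (Suc n)"] by auto
  then have "\<exists>x h. x \<in> K \<and> h \<in> cube N (1 / real (Suc n)) \<and> x \<oplus> h \<notin> U" for n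
    unfolding thick_def by blast
  then obtain x h where xh: "\<And>n. x n \<in> K" "\<And>n. h n \<in> cube N (1 / real (Suc n))" "\<And>n. x n \<oplus> h n \<notin> U"
    by metis
  obtain T where T: "open T" "U = Rn N \<inter> T" using U openin_iff by auto
  obtain l r where lr: "l \<in> K" "strict_mono (r :: nat \<Rightarrow> nat)" "(x \<circ> r) \<longlonglongrightarrow> l"
    using K(1) xh(1) unfolding compact_def by metis
  have lim: "(\<lambda>n. (x \<circ> r) n i) \<longlonglongrightarrow> l i" for i
  proof -
    have "isCont (\<lambda>x::nat\<Rightarrow>real. x i) l"
      by (metis continuous_on_product_coordinates continuous_on_eq_continuous_at open_UNIV UNIV_I)
    from isCont_tendsto_compose[OF this lr(3)] show ?thesis .
  qed
  have h0: "(\<lambda>n. h (r n) i) \<longlonglongrightarrow> 0" for i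
  proof (rule Lim_null_comparison)
    show "\<forall>\<^sub>F n in sequentially. norm (h (r n) i) \<le> 1 / real (Suc (r n))"
      using xh(2) by (auto simp: cube_def Rn_iff not_less intro!: always_eventually) (metis abs_zero le_less_linear of_nat_0_le_iff zero_le_divide_1_iff add_nonneg_nonneg zero_le_one)
    have "(\<lambda>n. 1 / real (Suc n)) \<longlonglongrightarrow> 0" by (rule LIMSEQ_Suc[OF lim_1_over_n])
    from LIMSEQ_subseq_LIMSEQ[OF this lr(2)] show "(\<lambda>n. 1 / real (Suc (r n))) \<longlonglongrightarrow> 0"
      by (simp add: o_def)
  qed
  have "((\<lambda>n. x (r n) \<oplus> h (r n)) \<longlongrightarrow> l) sequentially"
  proof -
    have "limitin (product_topology (\<lambda>i. euclideanreal) UNIV) (\<lambda>n. x (r n) \<oplus> h (r n)) l sequentially"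
      by (subst limitin_componentwise) (auto intro!: always_eventually tendsto_add[OF lim h0, simplified])
    then show ?thesis by (simp add: euclidean_product_topology)
  qed
  moreover have "l \<in> T" using lr(1) K(2) T(2) by auto
  ultimately have "\<forall>\<^sub>F n in sequentially. x (r n) \<oplus> h (r n) \<in> T"
    by (rule topological_tendstoD[OF _ T(1)])
  then obtain n where "x (r n) \<oplus> h (r n) \<in> T" by (auto simp: eventually_sequentially)
  moreover have "x (r n) \<oplus> h (r n) \<in> Rn N"
    using xh(1,2)[of "r n"] K(2) T(2) cube_subset_Rn by (intro Rn_add) auto
  ultimately show False using xh(3) T(2) by auto
qed

text \<open>Locally uniform statements on compact sets become almost everywhere statements on open sets
  through this countable exhaustion.\<close>

lemma open_exhaustion:
  assumes U: "openin (Euclidean_space N) U"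
  obtains K where "\<And>n::nat. compact (K n)" "U = (\<Union>n. K n)"
proof -
  obtain T where T: "open T" "U = Rn N \<inter> T" using U openin_iff by auto
  obtain F :: "nat \<Rightarrow> (nat \<Rightarrow> real) set" where F: "range F \<subseteq> Collect closed" "T = (\<Union>n. F n)"
  proof -
    have "fsigma_in euclidean T"
      using T(1) by (intro open_imp_fsigma_in metrizable_space_euclidean) auto
    then show ?thesis using that unfolding fsigma_in_ascending by (metis closed_closedin image_subset_iff mem_Collect_eq)
  qed
  show ?thesis
  proof (rule that[of "\<lambda>n. cube N (real (fst (prod_decode n))) \<inter> F (snd (prod_decode n))"])
    show "compact (cube N (real (fst (prod_decode n))) \<inter> F (snd (prod_decode n)))" for n
      using F(1) by (intro compact_Int_closed) auto
    have "x \<in> cube N (real a) \<Longrightarrow> x \<in> F b \<Longrightarrow> \<exists>n. x \<in> cube N (real (fst (prod_decode n))) \<inter> F (snd (prod_decode n))" for x a b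
      by (rule exI[of _ "prod_encode (a, b)"]) simp
    then show "U = (\<Union>n. cube N (real (fst (prod_decode n))) \<inter> F (snd (prod_decode n)))"
      unfolding T(2) F(2) Rn_eq_UN_cube by blast
  qed
qed

text \<open>Unfolding sums into coordinates would hide the translation structure from the simplifier.\<close>

declare vadd_apply [simp del]

section \<open>A smooth bump function\<close>

text \<open>The functions \<open>P(1/t) exp(-1/t)\<close> for \<open>t > 0\<close>, extended by \<open>0\<close>. The family is closed under
  differentiation, and this is what makes the bump function smooth.\<close>

definition flatexp :: "real poly \<Rightarrow> real \<Rightarrow> real" where
  "flatexp P t = (if t > 0 then poly P (1 / t) * exp (- (1 / t)) else 0)"

definition flatD :: "real poly \<Rightarrow> real poly" where
  "flatD P = [:0, 0, 1:] * (P - pderiv P)"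

lemma poly_exp_tendsto_0: "((\<lambda>x::real. poly P x * exp (- x)) \<longlongrightarrow> 0) at_top"
proof -
  have "((\<lambda>x::real. \<Sum>i\<le>degree P. coeff P i * (x ^ i / exp x)) \<longlongrightarrow> (\<Sum>i\<le>degree P. coeff P i * 0)) at_top"
    by (intro tendsto_sum tendsto_mult tendsto_const tendsto_power_div_exp_0)
  then show ?thesis
    by (simp add: poly_altdef sum_distrib_right exp_minus divide_inverse mult.assoc)
qed

lemma flat_tendsto_0: "(flatexp P \<longlongrightarrow> 0) (at 0)"
proof -
  have "filterlim (\<lambda>t::real. 1 / t) at_top (at_right 0)"
    using filterlim_inverse_at_top_right by (simp add: inverse_eq_divide)
  from filterlim_compose[OF poly_exp_tendsto_0[of P] this]
  have "(flatexp P \<longlongrightarrow> 0) (at_right 0)"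
    by (rule Lim_transform_eventually) (auto simp: eventually_at_filter flatexp_def)
  moreover have "(flatexp P \<longlongrightarrow> 0) (at_left 0)"
    by (rule tendsto_eventually) (auto simp: eventually_at_filter flatexp_def)
  ultimately show ?thesis by (simp add: filterlim_at_split)
qed

lemma flat_deriv: "(flatexp P has_real_derivative flatexp (flatD P) t) (at t)"
proof -
  consider "t > 0" | "t < 0" | "t = 0" by linarith
  then show ?thesis
  proof cases
    case 1
    have "((\<lambda>t. poly P (1 / t) * exp (- (1 / t))) has_real_derivative
        flatexp (flatD P) t) (at t)"
      using 1 by (auto intro!: derivative_eq_intros simp: flatexp_def flatD_def power2_eq_square field_simps)
    then show ?thesis
      by (rule has_field_derivative_transform_within_open[of _ _ _ "{0<..}"]) (use 1 in \<open>auto simp: flatexp_def\<close>)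
  next
    case 2
    have "((\<lambda>t::real. 0) has_real_derivative 0) (at t)" by simp
    then have "(flatexp P has_real_derivative 0) (at t)"
      by (rule has_field_derivative_transform_within_open[of _ _ _ "{..<0}"]) (use 2 in \<open>auto simp: flatexp_def\<close>)
    then show ?thesis using 2 by (simp add: flatexp_def)
  next
    case 3
    have "(\<lambda>h. (flatexp P (0 + h) - flatexp P 0) / h) = flatexp ([:0, 1:] * P)"
      by (auto simp: flatexp_def fun_eq_iff)
    then show ?thesis
      using flat_tendsto_0[of "[:0, 1:] * P"] 3 by (simp add: DERIV_def) (simp add: flatexp_def)
  qed
qed

text \<open>The derivatives of the bump function \<open>exp(-1/(1+t)) exp(-1/(1-t))\<close> on \<open>]-1,1[\<close>, as lists of pairs of
  polynomials: each differentiation replaces a product by the two terms of the product rule. The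
  sign of \<open>- flatD Q\<close> comes from the inner derivative of \<open>1 - t\<close>.\<close>

fun bump_terms :: "nat \<Rightarrow> (real poly \<times> real poly) list" where
  "bump_terms 0 = [(1, 1)]"
| "bump_terms (Suc n) = concat (map (\<lambda>(P, Q). [(flatD P, Q), (P, - flatD Q)]) (bump_terms n))"

definition bump_val :: "(real poly \<times> real poly) list \<Rightarrow> real \<Rightarrow> real" where
  "bump_val L t = (\<Sum>(P, Q)\<leftarrow>L. flatexp P (1 + t) * flatexp Q (1 - t))"

lemma flat_minus: "flatexp (- P) t = - flatexp P t"
  by (simp add: flatexp_def)

lemma bump_val_deriv:
  "(bump_val L has_real_derivative
     bump_val (concat (map (\<lambda>(P, Q). [(flatD P, Q), (P, - flatD Q)]) L)) t) (at t)"
proof (induction L)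
  case Nil
  then show ?case by (simp add: bump_val_def[abs_def])
next
  case (Cons a L)
  obtain P Q where a: "a = (P, Q)" by force
  have 1: "((\<lambda>t. flatexp P (1 + t)) has_real_derivative flatexp (flatD P) (1 + t)) (at t)"
    using DERIV_chain2[where f = "flatexp P" and g = "\<lambda>t. 1 + t" and x = t, OF flat_deriv DERIV_add[OF DERIV_const DERIV_ident]] by simp
  have 2: "((\<lambda>t. flatexp Q (1 - t)) has_real_derivative flatexp (flatD Q) (1 - t) * (-1)) (at t)"
    using DERIV_chain2[where f = "flatexp Q" and g = "\<lambda>t. 1 - t" and x = t, OF flat_deriv DERIV_diff[OF DERIV_const DERIV_ident]] by simp
  have eq: "bump_val (a # L) = (\<lambda>t. flatexp P (1 + t) * flatexp Q (1 - t) + bump_val L t)"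
    by (simp add: fun_eq_iff bump_val_def a)
  show ?case
    unfolding eq using DERIV_add[OF DERIV_mult[OF 1 2] Cons]
    by (simp add: bump_val_def a flat_minus algebra_simps)
qed

definition bump0 :: "nat \<Rightarrow> real \<Rightarrow> real" where
  "bump0 n t = bump_val (bump_terms n) t"

lemma bump0_deriv: "(bump0 n has_real_derivative bump0 (Suc n) t) (at t)"
  using bump_val_deriv[of "bump_terms n" t] by (simp add: bump0_def[abs_def])

lemma bump0_eq_0: "1 \<le> \<bar>t\<bar> \<Longrightarrow> bump0 n t = 0"
proof -
  assume "1 \<le> \<bar>t\<bar>"
  then have "1 + t \<le> 0 \<or> 1 - t \<le> 0" by linarith
  then have "bump_val L t = 0" for L
    by (induction L) (auto simp: bump_val_def flatexp_def)
  then show ?thesis by (simp add: bump0_def)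
qed

lemma bump0_pos: "\<bar>t\<bar> < 1 \<Longrightarrow> 0 < bump0 0 t"
  by (auto simp: bump0_def bump_val_def flatexp_def)

lemma bump0_nonneg: "0 \<le> bump0 0 t"
  by (auto simp: bump0_def bump_val_def flatexp_def)

lemma bump0_cont: "continuous_on A (bump0 n)"
  by (rule DERIV_continuous_on[OF has_field_derivative_at_within[OF bump0_deriv]])

lemma bump0_measurable [measurable]: "bump0 n \<in> borel_measurable borel"
  by (rule borel_measurable_continuous_onI[OF bump0_cont])

lemma bump0_integrable: "integrable lborel (bump0 n)"
proof -
  have "set_integrable lborel {-1..1} (bump0 n)"
    unfolding set_integrable_def by (rule borel_integrable_compact) (auto intro: bump0_cont)
  moreover have "(\<lambda>x. indicator {-1..1} x *\<^sub>R bump0 n x) = bump0 n"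
  proof
    fix x show "indicator {-1..1} x *\<^sub>R bump0 n x = bump0 n x"
      using bump0_eq_0[of x n] by (cases "x \<in> {-1..1}") (auto simp: abs_le_iff)
  qed
  ultimately show ?thesis by (simp add: set_integrable_def)
qed

definition bump_mass :: real where
  "bump_mass = (LINT t|lborel. bump0 0 t)"

lemma bump_mass_pos: "0 < bump_mass"
proof -
  have "bump_mass \<noteq> 0"
  proof
    assume "bump_mass = 0"
    then have "AE t in lborel. bump0 0 t = 0"
      unfolding bump_mass_def
      by (subst (asm) integral_nonneg_eq_0_iff_AE[OF bump0_integrable]) (auto simp: bump0_nonneg)
    then have "AE t in lborel. t \<notin> {-1<..<1::real}"
      by eventually_elim (use bump0_pos in \<open>force simp: abs_less_iff\<close>)
    then have "emeasure lborel {-1<..<1::real} = 0"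
      by (subst (asm) AE_iff_measurable[of "{-1<..<1::real}"]) auto
    then show False by simp
  qed
  moreover have "0 \<le> bump_mass"
    unfolding bump_mass_def by (simp add: bump0_nonneg)
  ultimately show ?thesis by simp
qed

text \<open>The \<open>n\<close>-th derivative of the bump function of width \<open>d\<close> and integral \<open>1\<close>.\<close>

definition bmp :: "real \<Rightarrow> nat \<Rightarrow> real \<Rightarrow> real" where
  "bmp d n t = bump0 n (t / d) / (bump_mass * d ^ Suc n)"

lemma bmp_deriv: "0 < d \<Longrightarrow> (bmp d n has_real_derivative bmp d (Suc n) t) (at t)"
proof -
  assume d: "0 < d"
  have "((\<lambda>t. bump0 n (t / d)) has_real_derivative bump0 (Suc n) (t / d) * (1 / d)) (at t)"
    using DERIV_chain2[where f = "bump0 n" and g = "\<lambda>t. t / d" and x = t, OF bump0_deriv DERIV_cdivide[OF DERIV_ident]] .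
  from DERIV_cdivide[OF this, of "bump_mass * d ^ Suc n"] show ?thesis
    using d by (simp add: bmp_def[abs_def] field_simps)
qed

lemma bmp_eq_0: "0 < d \<Longrightarrow> d \<le> \<bar>t\<bar> \<Longrightarrow> bmp d n t = 0"
  unfolding bmp_def by (subst bump0_eq_0) (auto simp: field_simps)

lemma bmp_nonneg: "0 < d \<Longrightarrow> 0 \<le> bmp d 0 t"
  using bump_mass_pos bump0_nonneg by (simp add: bmp_def)

lemma bmp_cont: "0 < d \<Longrightarrow> continuous_on A (bmp d n)"
  by (rule DERIV_continuous_on[OF has_field_derivative_at_within[OF bmp_deriv]])

lemma bmp_measurable [measurable]: "bmp d n \<in> borel_measurable borel"
  unfolding bmp_def[abs_def] by measurable

lemma bmp_integral:
  assumes "0 < d"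
  shows "(\<integral>\<^sup>+t. ennreal (bmp d 0 t) \<partial>lborel) = 1"
proof -
  have "(\<integral>\<^sup>+t. ennreal (bump0 0 t) \<partial>lborel) = ennreal bump_mass"
    unfolding bump_mass_def by (rule nn_integral_eq_integral[OF bump0_integrable]) (simp add: bump0_nonneg)
  moreover have "(\<integral>\<^sup>+t. ennreal (bump0 0 t) \<partial>lborel) = d' * (\<integral>\<^sup>+t. ennreal (bump0 0 (0 + (1/d) * t)) \<partial>lborel)"
    if "d' = ennreal \<bar>1/d\<bar>" for d'
    unfolding that by (rule nn_integral_real_affine) (use assms in auto)
  ultimately have "ennreal (1/d) * (\<integral>\<^sup>+t. ennreal (bump0 0 (t/d)) \<partial>lborel) = ennreal bump_mass"
    using assms by simp
  moreover have "(\<integral>\<^sup>+t. ennreal (bmp d 0 t) \<partial>lborel)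
     = (\<integral>\<^sup>+t. ennreal (1 / bump_mass) * (ennreal (1/d) * ennreal (bump0 0 (t/d))) \<partial>lborel)"
    using assms bump_mass_pos bump0_nonneg
    by (auto intro!: nn_integral_cong simp: bmp_def ennreal_mult[symmetric])
  moreover have "\<dots> = ennreal (1 / bump_mass) * (ennreal (1/d) * (\<integral>\<^sup>+t. ennreal (bump0 0 (t/d)) \<partial>lborel))"
    by (subst nn_integral_cmult, simp, subst nn_integral_cmult) auto
  ultimately show ?thesis
    using bump_mass_pos by (simp add: ennreal_mult[symmetric])
qed

lemma bmp_bounded:
  assumes "0 < d"
  obtains B where "0 \<le> B" "\<And>t. \<bar>bmp d n t\<bar> \<le> B"
proof -
  have "compact (bmp d n ` {-d..d})"
    by (intro compact_continuous_image bmp_cont assms) simp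
  then have "\<exists>B. \<forall>t\<in>{-d..d}. \<bar>bmp d n t\<bar> \<le> B"
    by (auto dest!: compact_imp_bounded simp: bounded_iff simp del: atLeastAtMost_iff)
  then obtain B where B: "\<And>t. t \<in> {-d..d} \<Longrightarrow> \<bar>bmp d n t\<bar> \<le> B" by blast
  show ?thesis
  proof (rule that[of "\<bar>B\<bar>"])
    fix t show "\<bar>bmp d n t\<bar> \<le> \<bar>B\<bar>"
      using B[of t] bmp_eq_0[OF assms, of t n] by (cases "t \<in> {-d..d}") (auto simp: abs_le_iff)
  qed simp
qed

section \<open>Mollification\<close>

text \<open>Product kernels. The multi-index \<open>m\<close> counts the derivatives in each coordinate, so that all partial
  derivatives of a kernel are again kernels of the same family.\<close>

definition ker :: "nat \<Rightarrow> real \<Rightarrow> (nat \<Rightarrow> nat) \<Rightarrow> (nat \<Rightarrow> real) \<Rightarrow> real" where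
  "ker N d m z = (\<Prod>i<N. bmp d (m i) (z i))"

lemma ker_eq_0: "0 < d \<Longrightarrow> z \<in> Rn N \<Longrightarrow> z \<notin> cube N d \<Longrightarrow> ker N d m z = 0"
  unfolding ker_def cube_def using bmp_eq_0[of d] by (force simp: not_le)

lemma ker_nonneg: "0 < d \<Longrightarrow> 0 \<le> ker N d (\<lambda>_. 0) z"
  unfolding ker_def by (intro prod_nonneg) (simp add: bmp_nonneg)

lemma continuous_on_ker [continuous_intros]:
  "0 < d \<Longrightarrow> continuous_on A f \<Longrightarrow> continuous_on A (\<lambda>x. ker N d m (f x))"
  unfolding ker_def
  by (intro continuous_on_prod continuous_on_compose2[OF bmp_cont[of d UNIV]] continuous_on_coord) auto

lemma measurable_ker [measurable (raw)]:
  "f \<in> measurable M (leb N') \<Longrightarrow> (\<lambda>x. ker N d m (f x)) \<in> borel_measurable M"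
proof -
  assume f: "f \<in> measurable M (leb N')"
  have [measurable]: "(\<lambda>x. f x i) \<in> borel_measurable M" for i by (rule measurable_leb_coord[OF f])
  show ?thesis unfolding ker_def by measurable
qed

lemma ker_bounded:
  assumes "0 < d"
  obtains B where "0 \<le> B" "\<And>z. \<bar>ker N d m z\<bar> \<le> B"
proof -
  have "\<exists>B. 0 \<le> B \<and> (\<forall>t. \<bar>bmp d (m i) t\<bar> \<le> B)" for i
    using bmp_bounded[OF assms, of "m i"] by metis
  then obtain B where B: "\<And>i. 0 \<le> B i" "\<And>i t. \<bar>bmp d (m i) t\<bar> \<le> B i" by metis
  show ?thesis
  proof (rule that[of "\<Prod>i<N. B i"])
    show "0 \<le> (\<Prod>i<N. B i)" using B by (intro prod_nonneg) auto
    show "\<bar>ker N d m z\<bar> \<le> (\<Prod>i<N. B i)" for z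
      unfolding ker_def abs_prod using B by (intro prod_mono) auto
  qed
qed

lemma ker_deriv:
  assumes "0 < d" "i < N"
  shows "((\<lambda>t. ker N d m (z(i := t))) has_real_derivative ker N d (m(i := Suc (m i))) (z(i := t))) (at t)"
proof -
  have ker_upd: "ker N d m' (z(i := t)) = bmp d (m' i) t * (\<Prod>j\<in>{..<N}-{i}. bmp d (m' j) (z j))" for m' t
    unfolding ker_def using assms(2)
    by (subst prod.remove[of _ i]) auto
  have *: "(\<Prod>j\<in>{..<N}-{i}. bmp d ((m(i := Suc (m i))) j) (z j)) = (\<Prod>j\<in>{..<N}-{i}. bmp d (m j) (z j))"
    by (intro prod.cong) auto
  show ?thesis
    unfolding ker_upd * using DERIV_cmult_right[OF bmp_deriv[OF assms(1), of "m i" t]] by simp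
qed

lemma nn_integral_ker:
  assumes "0 < d"
  shows "(\<integral>\<^sup>+z. ennreal (ker N d (\<lambda>_. 0) z) \<partial>leb N) = 1"
proof -
  have [measurable]: "(\<lambda>z. ennreal (ker N d (\<lambda>_. 0) z)) \<in> borel_measurable (leb N)"
    by (intro measurable_compose[OF measurable_ker[OF measurable_ident_sets[OF refl]]]) simp
  have "(\<integral>\<^sup>+z. ennreal (ker N d (\<lambda>_. 0) z) \<partial>leb N)
     = (\<integral>\<^sup>+z. ennreal (ker N d (\<lambda>_. 0) (ext0 N z)) \<partial>Pi\<^sub>M {..<N} (\<lambda>_. lborel))"
    by (subst leb_eq, subst nn_integral_distr) auto
  also have "\<dots> = (\<integral>\<^sup>+z. (\<Prod>i\<in>{..<N}. ennreal (bmp d 0 (z i))) \<partial>Pi\<^sub>M {..<N} (\<lambda>_. lborel))"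
    by (intro nn_integral_cong) (auto simp: ker_def ext0_def prod_ennreal bmp_nonneg assms intro!: arg_cong[of _ _ ennreal] prod.cong)
  also have "\<dots> = (\<Prod>i\<in>{..<N}. (\<integral>\<^sup>+t. ennreal (bmp d 0 t) \<partial>lborel))"
    by (rule lb.product_nn_integral_prod) auto
  also have "\<dots> = 1" by (simp add: bmp_integral assms)
  finally show ?thesis .
qed

text \<open>The kernel with \<open>m = 0\<close> is even, so in this case the formula is the usual convolution. Writing
  \<open>y - x\<close> for \<open>x - y\<close> makes the integrand a multiple of a translated kernel as a function of \<open>y\<close>, which
  can serve as a test function; the price is one sign for each derivative.\<close>

definition conv :: "nat \<Rightarrow> real \<Rightarrow> (nat \<Rightarrow> nat) \<Rightarrow> ((nat \<Rightarrow> real) \<Rightarrow> real) \<Rightarrow> (nat \<Rightarrow> real) \<Rightarrow> real" where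
  "conv N d m f x = (LINT y|leb N. f y * ker N d m (y - x))"

lemma continuous_on_conv:
  assumes d: "0 < d" and f: "integrable (leb N) f"
  shows "continuous_on (Rn N) (conv N d m f)"
  unfolding continuous_on_sequentially
proof safe
  fix x a assume x: "\<forall>n. x n \<in> Rn N" and a: "a \<in> Rn N" and lim: "x \<longlonglongrightarrow> a"
  have [measurable]: "f \<in> borel_measurable (leb N)" using f by auto
  obtain B where B: "0 \<le> B" "\<And>z. \<bar>ker N d m z\<bar> \<le> B" using ker_bounded[OF d] by metis
  have m: "(\<lambda>y. f y * ker N d m (y - b)) \<in> borel_measurable (leb N)" if "b \<in> Rn N" for b
    by (intro borel_measurable_times measurable_ker[of _ _ N] measurable_leb_diff) (use that in auto)
  have "(\<lambda>n. LINT y|leb N. f y * ker N d m (y - x n)) \<longlonglongrightarrow> (LINT y|leb N. f y * ker N d m (y - a))"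
  proof (rule integral_dominated_convergence[where w = "\<lambda>y. \<bar>f y\<bar> * B"])
    show "integrable (leb N) (\<lambda>y. \<bar>f y\<bar> * B)" using f by simp
    show "AE y in leb N. (\<lambda>n. f y * ker N d m (y - x n)) \<longlonglongrightarrow> f y * ker N d m (y - a)"
    proof (rule AE_I2)
      fix y
      have "continuous_on UNIV (\<lambda>x. ker N d m (y - x))"
        by (intro continuous_on_ker d continuous_on_fun_diff continuous_on_const continuous_on_id)
      then have "isCont (\<lambda>x. ker N d m (y - x)) a" by (simp add: continuous_on_eq_continuous_at)
      from isCont_tendsto_compose[OF this lim]
      show "(\<lambda>n. f y * ker N d m (y - x n)) \<longlonglongrightarrow> f y * ker N d m (y - a)"
        by (intro tendsto_mult tendsto_const)
    qed
    show "AE y in leb N. norm (f y * ker N d m (y - x n)) \<le> \<bar>f y\<bar> * B" for n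
      using B by (auto simp: abs_mult intro!: mult_left_mono)
  qed (use x a m in auto)
  then show "(conv N d m f \<circ> x) \<longlonglongrightarrow> conv N d m f a" by (simp add: conv_def o_def)
qed

text \<open>Differentiation under the integral sign: the difference quotients of the kernel are bounded by the
  supremum of the next derivative, so dominated convergence applies to every integrable \<open>f\<close>.\<close>

lemma conv_deriv:
  assumes d: "0 < d" and f: "integrable (leb N) f" and i: "i < N" and x: "x \<in> Rn N"
  shows "((\<lambda>t. conv N d m f (x(i := t))) has_real_derivative - conv N d (m(i := Suc (m i))) f x) (at (x i))"
proof -
  have [measurable]: "f \<in> borel_measurable (leb N)" using f by auto
  let ?m = "m(i := Suc (m i))"
  obtain B where B: "0 \<le> B" "\<And>z. \<bar>ker N d ?m z\<bar> \<le> B" using ker_bounded[OF d] by metis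
  have m [measurable]: "(\<lambda>y. f y * ker N d m' (y - b)) \<in> borel_measurable (leb N)" if "b \<in> Rn N" for b m'
    by (intro borel_measurable_times measurable_ker[of _ _ N] measurable_leb_diff) (use that in auto)
  have sub: "y - x(i := t) = (y - x)(i := y i - t)" for y t
    by (auto simp: fun_eq_iff)
  have der: "((\<lambda>t. ker N d m (y - x(i := t))) has_real_derivative - ker N d ?m (y - x(i := t))) (at t)" for y t
    unfolding sub
    using DERIV_chain2[where f = "\<lambda>t. ker N d m ((y - x)(i := t))" and g = "\<lambda>t. y i - t" and x = t,
        OF ker_deriv[OF d i] DERIV_diff[OF DERIV_const DERIV_ident]] by simp
  have lip: "\<bar>ker N d m (y - x(i := s)) - ker N d m (y - x(i := t))\<bar> \<le> B * \<bar>s - t\<bar>" for y s t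
  proof -
    have "norm (ker N d m (y - x(i := s)) - ker N d m (y - x(i := t))) \<le> B * norm (s - t)"
      by (rule field_differentiable_bound[of UNIV "\<lambda>t. ker N d m (y - x(i := t))" "\<lambda>t. - ker N d ?m (y - x(i := t))"])
        (use B der in auto)
    then show ?thesis by simp
  qed
  have int: "integrable (leb N) (\<lambda>y. f y * ker N d m' (y - b))" if b: "b \<in> Rn N" for b m'
  proof -
    obtain B where B: "0 \<le> B" "\<And>z. \<bar>ker N d m' z\<bar> \<le> B" using ker_bounded[OF d] by metis
    show ?thesis
      by (rule Bochner_Integration.integrable_bound[of _ "\<lambda>y. \<bar>f y\<bar> * B"])
        (use f B m[OF b] in \<open>auto simp: abs_mult intro!: mult_left_mono\<close>)
  qed
  show ?thesis
    unfolding has_field_derivative_iff tendsto_at_iff_sequentially o_def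
  proof safe
    fix X :: "nat \<Rightarrow> real" assume X: "\<forall>n. X n \<in> UNIV - {x i}" "X \<longlonglongrightarrow> x i"
    have "(\<lambda>n. LINT y|leb N. f y * ((ker N d m (y - x(i := X n)) - ker N d m (y - x)) / (X n - x i)))
        \<longlonglongrightarrow> (LINT y|leb N. f y * (- ker N d ?m (y - x)))"
    proof (rule integral_dominated_convergence[where w = "\<lambda>y. \<bar>f y\<bar> * B"])
      show "integrable (leb N) (\<lambda>y. \<bar>f y\<bar> * B)" using f by simp
      show "AE y in leb N. (\<lambda>n. f y * ((ker N d m (y - x(i := X n)) - ker N d m (y - x)) / (X n - x i)))
          \<longlonglongrightarrow> f y * (- ker N d ?m (y - x))"
      proof (rule AE_I2)
        fix y
        have "((\<lambda>t. (ker N d m (y - x(i := t)) - ker N d m (y - x)) / (t - x i)) \<longlongrightarrow> - ker N d ?m (y - x)) (at (x i))"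
          using der[of y "x i"] by (simp add: has_field_derivative_iff)
        then have "(\<lambda>n. (ker N d m (y - x(i := X n)) - ker N d m (y - x)) / (X n - x i)) \<longlonglongrightarrow> - ker N d ?m (y - x)"
          using X unfolding tendsto_at_iff_sequentially o_def by blast
        then show "(\<lambda>n. f y * ((ker N d m (y - x(i := X n)) - ker N d m (y - x)) / (X n - x i)))
          \<longlonglongrightarrow> f y * (- ker N d ?m (y - x))" by (intro tendsto_mult tendsto_const)
      qed
      show "AE y in leb N. norm (f y * ((ker N d m (y - x(i := X n)) - ker N d m (y - x)) / (X n - x i))) \<le> \<bar>f y\<bar> * B" for n
      proof (rule AE_I2)
        fix y
        have "\<bar>(ker N d m (y - x(i := X n)) - ker N d m (y - x)) / (X n - x i)\<bar> \<le> B"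
          using lip[of y "X n" "x i"] X(1) by (simp add: field_simps)
        then show "norm (f y * ((ker N d m (y - x(i := X n)) - ker N d m (y - x)) / (X n - x i))) \<le> \<bar>f y\<bar> * B"
          by (simp add: abs_mult mult_left_mono del: times_divide_eq_right)
      qed
      show "(\<lambda>y. f y * - ker N d ?m (y - x)) \<in> borel_measurable (leb N)"
        using m[OF x, of ?m] by simp
      show "(\<lambda>y. f y * ((ker N d m (y - x(i := X n)) - ker N d m (y - x)) / (X n - x i))) \<in> borel_measurable (leb N)" for n
        using borel_measurable_divide[OF borel_measurable_diff[OF m[OF Rn_upd[OF x i], of m "X n"] m[OF x, of m]] borel_measurable_const[of "X n - x i"]]
        by (simp add: algebra_simps)
    qed
    moreover have "(LINT y|leb N. f y * ((ker N d m (y - x(i := X n)) - ker N d m (y - x)) / (X n - x i)))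
        = (conv N d m f (x(i := X n)) - conv N d m f (x(i := x i))) / (X n - x i)" for n
    proof -
      have "(LINT y|leb N. f y * ((ker N d m (y - x(i := X n)) - ker N d m (y - x)) / (X n - x i)))
          = (LINT y|leb N. (f y * ker N d m (y - x(i := X n)) - f y * ker N d m (y - x)) / (X n - x i))"
        by (intro Bochner_Integration.integral_cong refl) (simp only: right_diff_distrib times_divide_eq_right)
      also have "\<dots> = (LINT y|leb N. f y * ker N d m (y - x(i := X n)) - f y * ker N d m (y - x)) / (X n - x i)"
        by (rule integral_divide_zero)
      also have "(LINT y|leb N. f y * ker N d m (y - x(i := X n)) - f y * ker N d m (y - x)) =
          conv N d m f (x(i := X n)) - conv N d m f x"
        unfolding conv_def by (rule Bochner_Integration.integral_diff[OF int[OF Rn_upd[OF x i]] int[OF x]])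
      finally show ?thesis by (simp only: fun_upd_triv)
    qed
    moreover have "(LINT y|leb N. f y * (- ker N d ?m (y - x))) = - conv N d ?m f x"
      by (simp add: conv_def)
    ultimately show "(\<lambda>n. (conv N d m f (x(i := X n)) - conv N d m f (x(i := x i))) / (X n - x i)) \<longlonglongrightarrow> - conv N d ?m f x"
      by (simp only:)
  qed
qed

lemma pd_eqI: "((\<lambda>t. f (x(i := t))) has_real_derivative D) (at (x i)) \<Longrightarrow> pd i f x = D"
  unfolding pd_def by (rule DERIV_imp_deriv)

lemma pd_cong: "(\<And>x. x \<in> Rn N \<Longrightarrow> f x = g x) \<Longrightarrow> i < N \<Longrightarrow> x \<in> Rn N \<Longrightarrow> pd i f x = pd i g x"
  unfolding pd_def by (intro arg_cong[of _ _ "\<lambda>h. deriv h (x i)"] ext) auto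

lemma Ck_cong: "(\<And>x. x \<in> Rn N \<Longrightarrow> f x = g x) \<Longrightarrow> Ck N k f = Ck N k g"
proof (induction k arbitrary: f g)
  case 0
  then show ?case by (simp add: continuous_map_real_iff cong: continuous_on_cong)
next
  case (Suc k)
  have "(\<lambda>t. f (x(i := t))) = (\<lambda>t. g (x(i := t)))" if "x \<in> Rn N" "i < N" for x i
    using Suc.prems that by auto
  moreover have "Ck N k (pd i f) = Ck N k (pd i g)" if "i < N" for i
    by (rule Suc.IH) (use pd_cong[of N f g] Suc.prems that in auto)
  ultimately show ?case
    using Suc.prems by (simp add: continuous_map_real_iff cong: continuous_on_cong)
qed

text \<open>A family of functions that is closed under partial derivatives consists of smooth functions.\<close>

lemma Ck_coinduct:
  assumes "F f"
    and step: "\<And>f. F f \<Longrightarrow> continuous_on (Rn N) f \<and>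
      (\<forall>i<N. \<exists>g. F g \<and> (\<forall>x\<in>Rn N. ((\<lambda>t. f (x(i := t))) has_real_derivative g x) (at (x i))))"
  shows "Ck N k f"
  using assms(1)
proof (induction k arbitrary: f)
  case 0
  then show ?case using step by (simp add: continuous_map_real_iff)
next
  case (Suc k)
  have "(\<forall>x\<in>Rn N. (\<lambda>t. f (x(i := t))) field_differentiable (at (x i))) \<and> Ck N k (pd i f)" if i: "i < N" for i
  proof -
    obtain g where g: "F g" "\<forall>x\<in>Rn N. ((\<lambda>t. f (x(i := t))) has_real_derivative g x) (at (x i))"
      using step[OF Suc.prems] i by blast
    have "Ck N k (pd i f) = Ck N k g"
      by (rule Ck_cong) (use g(2) pd_eqI in blast)
    then show ?thesis using g Suc.IH[OF g(1)] by (auto simp: field_differentiable_def)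
  qed
  then show ?case using step[OF Suc.prems] by (simp add: continuous_map_real_iff)
qed

lemma Ck_conv:
  assumes d: "0 < d" and f: "integrable (leb N) f"
  shows "Ck N k (conv N d m f)"
proof (rule Ck_coinduct[where F = "\<lambda>g. \<exists>m c. g = (\<lambda>x. c * conv N d m f x)"])
  show "\<exists>m' c. conv N d m f = (\<lambda>x. c * conv N d m' f x)"
    by (rule exI[of _ m], rule exI[of _ 1]) simp
  fix g assume "\<exists>m c. g = (\<lambda>x. c * conv N d m f x)"
  then obtain m c where g: "g = (\<lambda>x. c * conv N d m f x)" by blast
  have "\<exists>h. (\<exists>m c. h = (\<lambda>x. c * conv N d m f x)) \<and>
      (\<forall>x\<in>Rn N. ((\<lambda>t. g (x(i := t))) has_real_derivative h x) (at (x i)))" if i: "i < N" for i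
  proof (rule exI[of _ "\<lambda>x. (- c) * conv N d (m(i := Suc (m i))) f x"], intro conjI ballI)
    show "\<exists>m' c'. (\<lambda>x. (- c) * conv N d (m(i := Suc (m i))) f x) = (\<lambda>x. c' * conv N d m' f x)" by blast
    show "((\<lambda>t. g (x(i := t))) has_real_derivative (- c) * conv N d (m(i := Suc (m i))) f x) (at (x i))" if "x \<in> Rn N" for x
      using DERIV_cmult[OF conv_deriv[OF d f i that], of c m] by (simp add: g)
  qed
  then show "continuous_on (Rn N) g \<and> (\<forall>i<N. \<exists>h. (\<exists>m c. h = (\<lambda>x. c * conv N d m f x)) \<and>
      (\<forall>x\<in>Rn N. ((\<lambda>t. g (x(i := t))) has_real_derivative h x) (at (x i))))"
    unfolding g using continuous_on_conv[OF d f] by (auto intro!: continuous_intros)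
qed

lemma ker_shift_deriv:
  assumes "0 < d" "i < N"
  shows "((\<lambda>t. ker N d m (y(i := t) - x)) has_real_derivative ker N d (m(i := Suc (m i))) (y - x)) (at (y i))"
proof -
  have sub: "y(i := t) - x = (y - x)(i := t - x i)" for t
    by (auto simp: fun_eq_iff)
  have "(y - x)(i := y i - x i) = y - x" by (auto simp: fun_eq_iff)
  then show ?thesis unfolding sub
    using DERIV_chain2[where f = "\<lambda>t. ker N d m ((y - x)(i := t))" and g = "\<lambda>t. t - x i" and x = "y i",
        OF ker_deriv[OF assms] DERIV_diff[OF DERIV_ident DERIV_const]] by simp
qed

lemma Ck_ker: "0 < d \<Longrightarrow> Ck N k (\<lambda>y. ker N d m (y - x))"
proof (rule Ck_coinduct[where F = "\<lambda>g. \<exists>m. g = (\<lambda>y. ker N d m (y - x))"])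
  assume d: "0 < d"
  fix g assume "\<exists>m. g = (\<lambda>y. ker N d m (y - x))"
  then obtain m where g: "g = (\<lambda>y. ker N d m (y - x))" by blast
  show "continuous_on (Rn N) g \<and> (\<forall>i<N. \<exists>h. (\<exists>m. h = (\<lambda>y. ker N d m (y - x))) \<and>
      (\<forall>y\<in>Rn N. ((\<lambda>t. g (y(i := t))) has_real_derivative h y) (at (y i))))"
    unfolding g
  proof (intro conjI allI impI)
    show "continuous_on (Rn N) (\<lambda>y. ker N d m (y - x))"
      by (intro continuous_on_ker d continuous_on_fun_diff continuous_on_const continuous_on_id)
    fix i assume "i < N"
    with ker_shift_deriv[OF d this, of m _ x]
    show "\<exists>h. (\<exists>m. h = (\<lambda>y. ker N d m (y - x))) \<and>
      (\<forall>y\<in>Rn N. ((\<lambda>t. ker N d m (y(i := t) - x)) has_real_derivative h y) (at (y i)))"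
      by (intro exI[of _ "\<lambda>y. ker N d (m(i := Suc (m i))) (y - x)"]) blast
  qed
qed auto

lemma supp_subset_closed:
  assumes "closed S" "\<And>x. x \<in> Rn N \<Longrightarrow> x \<notin> S \<Longrightarrow> f x = 0"
  shows "supp N f \<subseteq> S"
proof -
  have "supp N f = closure {x \<in> Rn N. f x \<noteq> 0}"
    unfolding supp_def by (rule closure_of_iff) auto
  then show ?thesis using closure_minimal[of "{x \<in> Rn N. f x \<noteq> 0}" S] assms by blast
qed

lemma Cc_inftyI:
  assumes "\<And>k. Ck N k f" "compact S" "S \<subseteq> Rn N" "S \<subseteq> U" "\<And>x. x \<in> Rn N \<Longrightarrow> x \<notin> S \<Longrightarrow> f x = 0"
  shows "f \<in> Cc_infty N U"
proof -
  have "supp N f \<subseteq> S"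
    by (rule supp_subset_closed) (use assms in \<open>auto intro: compact_imp_closed\<close>)
  moreover have "closed (supp N f)"
    unfolding supp_def by (subst closure_of_iff) auto
  ultimately have "compact (supp N f)"
    using assms(2) compact_Int_closed[of S "supp N f"] by (metis Int_absorb1)
  with \<open>supp N f \<subseteq> S\<close> show ?thesis
    using assms by (auto simp: Cc_infty_def compactin_iff)
qed

lemma ker_Cc_infty:
  assumes d: "0 < d" and x: "x \<in> Rn N" and sub: "thick N {x} d \<subseteq> U"
  shows "(\<lambda>y. ker N d m (y - x)) \<in> Cc_infty N U"
proof (rule Cc_inftyI[OF Ck_ker[OF d] _ _ sub])
  show "compact (thick N {x} d)" by (rule compact_thick) simp
  show "thick N {x} d \<subseteq> Rn N" by (rule thick_subset_Rn) (use x in auto)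
  fix y assume "y \<in> Rn N" "y \<notin> thick N {x} d"
  then have "y - x \<notin> cube N d" using thickI[of x "{x}" "y - x" N d] by auto
  then show "ker N d m (y - x) = 0"
    using \<open>y \<in> Rn N\<close> x by (intro ker_eq_0 d) auto
qed

lemma pd_ker: "0 < d \<Longrightarrow> i < N \<Longrightarrow> pd i (\<lambda>y. ker N d m (y - x)) y = ker N d (m(i := Suc (m i))) (y - x)"
  by (rule pd_eqI) (rule ker_shift_deriv)

section \<open>Continuity of translations in the p-th mean\<close>

text \<open>The \<open>p\<close>-th power of the \<open>L\<^sup>p\<close> norm. Working with the integral itself avoids roots and makes sense for
  infinite values; instead of the triangle inequality the quasi-triangle inequality \<open>pint_add\<close> is used.\<close>

definition pint :: "nat \<Rightarrow> real \<Rightarrow> ((nat \<Rightarrow> real) \<Rightarrow> real) \<Rightarrow> ennreal" where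
  "pint N p f = (\<integral>\<^sup>+x. ennreal (\<bar>f x\<bar> powr p) \<partial>leb N)"

lemma powr_abs_add_le:
  fixes a b p :: real
  assumes "0 \<le> p"
  shows "\<bar>a + b\<bar> powr p \<le> 2 powr p * (\<bar>a\<bar> powr p + \<bar>b\<bar> powr p)"
proof -
  have "\<bar>a + b\<bar> powr p \<le> (2 * max \<bar>a\<bar> \<bar>b\<bar>) powr p"
    using assms by (intro powr_mono2) auto
  also have "\<dots> = 2 powr p * max \<bar>a\<bar> \<bar>b\<bar> powr p" by (simp add: powr_mult)
  also have "max \<bar>a\<bar> \<bar>b\<bar> powr p \<le> \<bar>a\<bar> powr p + \<bar>b\<bar> powr p"
    by (cases "\<bar>a\<bar> \<le> \<bar>b\<bar>") (auto simp: max_def)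
  finally show ?thesis by simp
qed

lemma pint_add:
  assumes [measurable]: "f \<in> borel_measurable (leb N)" "g \<in> borel_measurable (leb N)" and p: "0 \<le> p"
  shows "pint N p (\<lambda>x. f x + g x) \<le> ennreal (2 powr p) * (pint N p f + pint N p g)"
proof -
  have "pint N p (\<lambda>x. f x + g x) \<le> (\<integral>\<^sup>+x. ennreal (2 powr p) * (ennreal (\<bar>f x\<bar> powr p) + ennreal (\<bar>g x\<bar> powr p)) \<partial>leb N)"
    unfolding pint_def using powr_abs_add_le[OF p]
    by (intro nn_integral_mono) (simp flip: ennreal_plus ennreal_mult)
  also have "\<dots> = ennreal (2 powr p) * (pint N p f + pint N p g)"
    unfolding pint_def by (simp add: nn_integral_cmult nn_integral_add)
  finally show ?thesis .
qed

lemma pint_translate: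
  assumes "h \<in> Rn N" and [measurable]: "f \<in> borel_measurable (leb N)"
  shows "pint N p (\<lambda>x. f (x \<oplus> h)) = pint N p f"
  unfolding pint_def by (rule nn_integral_translate[OF assms(1), of "\<lambda>x. ennreal (\<bar>f x\<bar> powr p)"]) simp

lemma measurable_translate_fun:
  assumes "f \<in> borel_measurable (leb N)" "h \<in> Rn N"
  shows "(\<lambda>x. f (x \<oplus> h) :: real) \<in> borel_measurable (leb N)"
  by (rule measurable_compose[OF measurable_leb_translate[OF assms(2)] assms(1)])

lemma ennreal_tendsto_0I:
  assumes "\<And>e. 0 < e \<Longrightarrow> \<forall>\<^sub>F n in F. f n \<le> ennreal e"
  shows "(f \<longlongrightarrow> (0::ennreal)) F"
proof (rule order_tendstoI)
  fix a :: ennreal assume "0 < a"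
  then obtain b where b: "0 < b" "b < a" using dense by blast
  then obtain e where e: "b = ennreal e" "0 \<le> e" by (cases b) auto
  then have "0 < e" "ennreal e < a" using b by auto
  from assms[OF this(1)] show "\<forall>\<^sub>F n in F. f n < a"
    by eventually_elim (use \<open>ennreal e < a\<close> in auto)
qed auto

lemma ennreal_tendsto_0D:
  assumes "(f \<longlongrightarrow> (0::ennreal)) F" "0 < e"
  shows "\<forall>\<^sub>F n in F. f n \<le> ennreal e"
  using order_tendstoD(2)[OF assms(1), of "ennreal e"] assms(2) by (auto elim: eventually_mono)

lemma ennreal_tendsto_0_le:
  assumes "\<And>n. f n \<le> g n" "(g \<longlongrightarrow> (0::ennreal)) F"
  shows "(f \<longlongrightarrow> 0) F"
  by (rule tendsto_sandwich[OF _ _ tendsto_const assms(2)]) (auto intro!: always_eventually assms(1))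

lemma tendsto_coordinatewise:
  fixes f :: "'a \<Rightarrow> nat \<Rightarrow> real"
  assumes "\<And>i. ((\<lambda>n. f n i) \<longlongrightarrow> l i) F"
  shows "(f \<longlongrightarrow> l) F"
proof -
  have "limitin (product_topology (\<lambda>i. euclideanreal) UNIV) f l F"
    by (subst limitin_componentwise) (use assms in auto)
  then show ?thesis by (simp add: euclidean_product_topology)
qed

definition null_shifts :: "nat \<Rightarrow> (nat \<Rightarrow> nat \<Rightarrow> real) \<Rightarrow> bool" where
  "null_shifts N h \<longleftrightarrow> (\<forall>n. h n \<in> Rn N) \<and> (\<forall>i. (\<lambda>n. h n i) \<longlonglongrightarrow> 0)"

definition translation_cont :: "nat \<Rightarrow> real \<Rightarrow> ((nat \<Rightarrow> real) \<Rightarrow> real) \<Rightarrow> bool" where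
  "translation_cont N p f \<longleftrightarrow> f \<in> borel_measurable (leb N) \<and>
     (\<forall>h. null_shifts N h \<longrightarrow> (\<lambda>n. pint N p (\<lambda>x. f (x \<oplus> h n) - f x)) \<longlonglongrightarrow> 0)"

lemma null_shifts_bounded:
  assumes "null_shifts N h"
  obtains R where "0 < R" "\<And>n. h n \<in> cube N R"
proof -
  have "\<exists>B. \<forall>n. \<bar>h n i\<bar> \<le> B" for i
    using assms convergent_imp_Bseq[of "\<lambda>n. h n i"]
    by (auto simp: null_shifts_def convergent_def Bseq_def)
  then obtain B where B: "\<And>i n. \<bar>h n i\<bar> \<le> B i" by metis
  show ?thesis
  proof (rule that[of "1 + (\<Sum>i<N. \<bar>B i\<bar>)"])
    show "0 < 1 + (\<Sum>i<N. \<bar>B i\<bar>)" by (simp add: add_pos_nonneg sum_nonneg)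
    have "\<bar>h n i\<bar> \<le> 1 + (\<Sum>i<N. \<bar>B i\<bar>)" if "i < N" for i n
    proof -
      have "\<bar>B i\<bar> \<le> (\<Sum>i<N. \<bar>B i\<bar>)" by (rule member_le_sum) (use that in auto)
      with B[of n i] show ?thesis by linarith
    qed
    then show "h n \<in> cube N (1 + (\<Sum>i<N. \<bar>B i\<bar>))" for n
      using assms by (simp add: cube_def null_shifts_def)
  qed
qed

lemma null_shifts_tendsto: "null_shifts N h \<Longrightarrow> (\<lambda>n. x \<oplus> h n) \<longlonglongrightarrow> x"
  unfolding null_shifts_def
  by (rule tendsto_coordinatewise) (auto simp: vadd_apply intro!: tendsto_eq_intros)

text \<open>For a compact set the positive part of the difference tends to \<open>0\<close> everywhere, because
  points outside a closed set stay outside under small shifts; the negative part has the same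
  integral by translation invariance.\<close>

lemma translation_cont_compact:
  assumes K: "compact K" "K \<subseteq> Rn N" and p: "0 < p"
  shows "translation_cont N p (indicator K)"
  unfolding translation_cont_def
proof (intro conjI allI impI)
  have [measurable]: "K \<in> sets (leb N)" by (rule sets_leb_compact[OF K])
  show "indicator K \<in> borel_measurable (leb N)" by measurable
  fix h assume h: "null_shifts N h"
  obtain R where R: "0 < R" "\<And>n. h n \<in> cube N R" using null_shifts_bounded[OF h] by metis
  have hR: "h n \<in> Rn N" for n using h by (simp add: null_shifts_def)
  define u where "u = (indicator K :: (nat \<Rightarrow> real) \<Rightarrow> real)"
  have [measurable]: "u \<in> borel_measurable (leb N)" unfolding u_def by measurable
  have m [measurable]: "(\<lambda>x. u (x \<oplus> h n)) \<in> borel_measurable (leb N)" for n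
    by (rule measurable_translate_fun[OF _ hR]) simp
  have fin: "emeasure (leb N) K < \<infinity>" by (rule emeasure_compact_finite[OF K])
  have iu: "integrable (leb N) u" unfolding u_def
    using fin by (intro integrable_real_indicator) auto
  have iuh: "integrable (leb N) (\<lambda>x. u (x \<oplus> h n))" for n
    by (rule integrable_translate[OF hR iu])
  let ?T = "thick N K R"
  have T: "compact ?T" "?T \<subseteq> Rn N" using compact_thick thick_subset_Rn K by auto
  have [measurable]: "?T \<in> sets (leb N)" by (rule sets_leb_compact[OF T])
  have lim: "(\<lambda>n. LINT x|leb N. max (u (x \<oplus> h n) - u x) 0) \<longlonglongrightarrow> (LINT x|leb N. 0)"
  proof (rule integral_dominated_convergence[where w = "indicator ?T"])
    show "integrable (leb N) (indicator ?T :: _ \<Rightarrow> real)"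
      using emeasure_compact_finite[OF T] by (intro integrable_real_indicator) auto
    show "AE x in leb N. (\<lambda>n. max (u (x \<oplus> h n) - u x) 0) \<longlonglongrightarrow> 0"
    proof (rule AE_I2)
      fix x
      show "(\<lambda>n. max (u (x \<oplus> h n) - u x) 0) \<longlonglongrightarrow> 0"
      proof (cases "x \<in> K")
        case True
        then have "max (u (x \<oplus> h n) - u x) 0 = 0" for n by (simp add: u_def indicator_def)
        then show ?thesis by simp
      next
        case False
        then have "\<forall>\<^sub>F n in sequentially. x \<oplus> h n \<in> - K"
          using compact_imp_closed[OF K(1)] by (intro topological_tendstoD[OF null_shifts_tendsto[OF h]]) auto
        then have "\<forall>\<^sub>F n in sequentially. max (u (x \<oplus> h n) - u x) 0 = 0"
          by eventually_elim (simp add: u_def)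
        then show ?thesis by (rule tendsto_eventually)
      qed
    qed
    show "AE x in leb N. norm (max (u (x \<oplus> h n) - u x) 0) \<le> indicator ?T x" for n
    proof (rule AE_I2)
      fix x assume "x \<in> space (leb N)"
      have "x \<in> ?T" if "x \<oplus> h n \<in> K"
        using thickI[OF that cube_uminus[OF R(2)[of n]]] by simp
      then show "norm (max (u (x \<oplus> h n) - u x) 0) \<le> indicator ?T x"
        by (auto simp: u_def indicator_def)
    qed
  qed measurable
  have abs: "(LINT x|leb N. \<bar>u (x \<oplus> h n) - u x\<bar>) = 2 * (LINT x|leb N. max (u (x \<oplus> h n) - u x) 0)" for n
  proof -
    have i1: "integrable (leb N) (\<lambda>x. max (u (x \<oplus> h n) - u x) 0)"
      using iu iuh[of n] by (intro integrable_max) auto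
    have "(LINT x|leb N. \<bar>u (x \<oplus> h n) - u x\<bar>)
        = (LINT x|leb N. 2 * max (u (x \<oplus> h n) - u x) 0 - (u (x \<oplus> h n) - u x))"
      by (intro Bochner_Integration.integral_cong) (auto simp: max_def)
    also have "\<dots> = 2 * (LINT x|leb N. max (u (x \<oplus> h n) - u x) 0)
        - ((LINT x|leb N. u (x \<oplus> h n)) - (LINT x|leb N. u x))"
      using i1 iu iuh[of n] by simp
    also have "(LINT x|leb N. u (x \<oplus> h n)) = (LINT x|leb N. u x)"
      by (rule integral_translate[OF hR]) simp
    finally show ?thesis unfolding diff_self diff_0_right .
  qed
  have "pint N p (\<lambda>x. u (x \<oplus> h n) - u x) = ennreal (LINT x|leb N. \<bar>u (x \<oplus> h n) - u x\<bar>)" for n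
  proof -
    have "pint N p (\<lambda>x. u (x \<oplus> h n) - u x) = (\<integral>\<^sup>+x. ennreal \<bar>u (x \<oplus> h n) - u x\<bar> \<partial>leb N)"
      unfolding pint_def using p by (intro nn_integral_cong) (auto simp: u_def indicator_def)
    also have "\<dots> = ennreal (LINT x|leb N. \<bar>u (x \<oplus> h n) - u x\<bar>)"
      using iu iuh[of n] by (intro nn_integral_eq_integral) auto
    finally show ?thesis .
  qed
  moreover have "(\<lambda>n. ennreal (2 * (LINT x|leb N. max (u (x \<oplus> h n) - u x) 0))) \<longlonglongrightarrow> ennreal (2 * 0)"
    using lim by (intro tendsto_ennrealI tendsto_mult tendsto_const) simp
  ultimately show "(\<lambda>n. pint N p (\<lambda>x. indicator K (x \<oplus> h n) - indicator K x)) \<longlonglongrightarrow> 0"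
    unfolding abs by (simp add: u_def)
qed

text \<open>A three-term estimate: the shifted error \<open>f(x + h) - g(x + h)\<close> has the same integral as the
  error \<open>f - g\<close>, so only the translation of the approximant \<open>g\<close> matters.\<close>

lemma translation_cont_approx:
  assumes [measurable]: "f \<in> borel_measurable (leb N)" and p: "0 < p"
    and approx: "\<And>e. 0 < e \<Longrightarrow> \<exists>g. translation_cont N p g \<and> pint N p (\<lambda>x. f x - g x) \<le> ennreal e"
  shows "translation_cont N p f"
  unfolding translation_cont_def
proof (intro conjI allI impI)
  fix h assume h: "null_shifts N h"
  have hR: "h n \<in> Rn N" for n using h by (simp add: null_shifts_def)
  show "(\<lambda>n. pint N p (\<lambda>x. f (x \<oplus> h n) - f x)) \<longlonglongrightarrow> 0"
  proof (rule ennreal_tendsto_0I)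
    fix e :: real assume e: "0 < e"
    define c where "c = 2 powr p"
    have c: "0 < c" by (simp add: c_def)
    define e' where "e' = e / (c + 2 * c * c)"
    have e': "0 < e'" using e c by (simp add: e'_def add_pos_pos)
    obtain g where g: "translation_cont N p g" "pint N p (\<lambda>x. f x - g x) \<le> ennreal e'"
      using approx[OF e'] by blast
    have [measurable]: "g \<in> borel_measurable (leb N)" using g by (simp add: translation_cont_def)
    have mm [measurable]: "(\<lambda>x. f (x \<oplus> h n)) \<in> borel_measurable (leb N)" "(\<lambda>x. g (x \<oplus> h n)) \<in> borel_measurable (leb N)" for n
      by (auto intro!: measurable_translate_fun hR)
    have "\<forall>\<^sub>F n in sequentially. pint N p (\<lambda>x. g (x \<oplus> h n) - g x) \<le> ennreal e'"
      using g(1) h e' by (intro ennreal_tendsto_0D) (auto simp: translation_cont_def)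
    then show "\<forall>\<^sub>F n in sequentially. pint N p (\<lambda>x. f (x \<oplus> h n) - f x) \<le> ennreal e"
    proof eventually_elim
      case (elim n)
      have 1: "pint N p (\<lambda>x. f (x \<oplus> h n) - g (x \<oplus> h n)) \<le> ennreal e'"
        using g(2) by (subst pint_translate[OF hR, of "\<lambda>x. f x - g x"]) auto
      have 2: "pint N p (\<lambda>x. g x - f x) \<le> ennreal e'"
        using g(2) by (simp add: pint_def abs_minus_commute)
      have "pint N p (\<lambda>x. (g (x \<oplus> h n) - g x) + ((f (x \<oplus> h n) - g (x \<oplus> h n)) + (g x - f x)))
         \<le> ennreal c * (pint N p (\<lambda>x. g (x \<oplus> h n) - g x) + pint N p (\<lambda>x. (f (x \<oplus> h n) - g (x \<oplus> h n)) + (g x - f x)))"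
        unfolding c_def using p by (intro pint_add) auto
      also have "\<dots> \<le> ennreal c * (ennreal e' + ennreal c * (ennreal e' + ennreal e'))"
      proof (intro mult_left_mono add_mono elim)
        have "pint N p (\<lambda>x. (f (x \<oplus> h n) - g (x \<oplus> h n)) + (g x - f x))
           \<le> ennreal c * (pint N p (\<lambda>x. f (x \<oplus> h n) - g (x \<oplus> h n)) + pint N p (\<lambda>x. g x - f x))"
          unfolding c_def using p by (intro pint_add) auto
        also have "\<dots> \<le> ennreal c * (ennreal e' + ennreal e')"
          by (intro mult_left_mono add_mono 1 2) auto
        finally show "pint N p (\<lambda>x. (f (x \<oplus> h n) - g (x \<oplus> h n)) + (g x - f x)) \<le> ennreal c * (ennreal e' + ennreal e')" .
      qed auto
      also have "\<dots> = ennreal (c * (e' + c * (e' + e')))"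
        using c e' by (simp only: ennreal_mult ennreal_plus less_imp_le mult_nonneg_nonneg add_nonneg_nonneg)
      also have "c * (e' + c * (e' + e')) = e' * (c + 2 * c * c)" by (simp add: algebra_simps)
      also have "\<dots> = e" using c by (simp add: e'_def add_pos_pos less_imp_neq[symmetric])
      finally have "pint N p (\<lambda>x. (g (x \<oplus> h n) - g x) + ((f (x \<oplus> h n) - g (x \<oplus> h n)) + (g x - f x))) \<le> ennreal e" .
      moreover have "(g (x \<oplus> h n) - g x) + ((f (x \<oplus> h n) - g (x \<oplus> h n)) + (g x - f x)) = f (x \<oplus> h n) - f x" for x
        by simp
      ultimately show ?case by (simp only:)
    qed
  qed
qed simp

lemma translation_cont_add:
  assumes "translation_cont N p f" "translation_cont N p g" "0 < p"
  shows "translation_cont N p (\<lambda>x. f x + g x)"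
  unfolding translation_cont_def
proof (intro conjI allI impI)
  have [measurable]: "f \<in> borel_measurable (leb N)" "g \<in> borel_measurable (leb N)"
    using assms by (auto simp: translation_cont_def)
  show "(\<lambda>x. f x + g x) \<in> borel_measurable (leb N)" by measurable
  fix h assume h: "null_shifts N h"
  have hR: "h n \<in> Rn N" for n using h by (simp add: null_shifts_def)
  have [measurable]: "(\<lambda>x. f (x \<oplus> h n)) \<in> borel_measurable (leb N)" "(\<lambda>x. g (x \<oplus> h n)) \<in> borel_measurable (leb N)" for n
    by (auto intro!: measurable_translate_fun hR)
  have le: "pint N p (\<lambda>x. f (x \<oplus> h n) + g (x \<oplus> h n) - (f x + g x)) \<le>
      ennreal (2 powr p) * (pint N p (\<lambda>x. f (x \<oplus> h n) - f x) + pint N p (\<lambda>x. g (x \<oplus> h n) - g x))" for n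
    using pint_add[of "\<lambda>x. f (x \<oplus> h n) - f x" N "\<lambda>x. g (x \<oplus> h n) - g x" p] assms(3)
    by (simp add: algebra_simps)
  have lim: "(\<lambda>n. ennreal (2 powr p) * (pint N p (\<lambda>x. f (x \<oplus> h n) - f x) + pint N p (\<lambda>x. g (x \<oplus> h n) - g x)))
      \<longlonglongrightarrow> ennreal (2 powr p) * (0 + 0)"
    using assms h by (intro ennreal_tendsto_cmult tendsto_add) (auto simp: translation_cont_def)
  show "(\<lambda>n. pint N p (\<lambda>x. f (x \<oplus> h n) + g (x \<oplus> h n) - (f x + g x))) \<longlonglongrightarrow> 0"
    by (rule ennreal_tendsto_0_le[OF le]) (use lim in simp)
qed

lemma translation_cont_scale:
  assumes "translation_cont N p f"
  shows "translation_cont N p (\<lambda>x. c * f x)"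
  unfolding translation_cont_def
proof (intro conjI allI impI)
  have [measurable]: "f \<in> borel_measurable (leb N)"
    using assms by (auto simp: translation_cont_def)
  show "(\<lambda>x. c * f x) \<in> borel_measurable (leb N)" by measurable
  fix h assume h: "null_shifts N h"
  have hR: "h n \<in> Rn N" for n using h by (simp add: null_shifts_def)
  have [measurable]: "(\<lambda>x. f (x \<oplus> h n)) \<in> borel_measurable (leb N)" for n
    by (auto intro!: measurable_translate_fun hR)
  have "pint N p (\<lambda>x. c * f (x \<oplus> h n) - c * f x) = ennreal (\<bar>c\<bar> powr p) * pint N p (\<lambda>x. f (x \<oplus> h n) - f x)" for n
    unfolding pint_def
    by (subst nn_integral_cmult[symmetric]) (auto simp: powr_mult abs_mult ennreal_mult[symmetric] simp flip: right_diff_distrib)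
  moreover have "(\<lambda>n. ennreal (\<bar>c\<bar> powr p) * pint N p (\<lambda>x. f (x \<oplus> h n) - f x)) \<longlonglongrightarrow> ennreal (\<bar>c\<bar> powr p) * 0"
    using assms h by (intro ennreal_tendsto_cmult) (auto simp: translation_cont_def)
  ultimately show "(\<lambda>n. pint N p (\<lambda>x. c * f (x \<oplus> h n) - c * f x)) \<longlonglongrightarrow> 0" by simp
qed

lemma translation_cont_0: "translation_cont N p (\<lambda>x. 0)"
  by (simp add: translation_cont_def pint_def)

lemma translation_cont_sum:
  assumes "finite I" "\<And>i. i \<in> I \<Longrightarrow> translation_cont N p (f i)" "0 < p"
  shows "translation_cont N p (\<lambda>x. \<Sum>i\<in>I. f i x)"
  using assms by (induction I rule: finite_induct) (auto intro: translation_cont_0 translation_cont_add)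

text \<open>Inner regularity of Lebesgue measure on a cube reduces measurable sets to compact sets.\<close>

lemma translation_cont_set:
  assumes A [measurable]: "A \<in> sets (leb N)" "A \<subseteq> cube N R" and p: "0 < p"
  shows "translation_cont N p (indicator A)"
proof (rule translation_cont_approx[OF _ p])
  fix e :: real assume e: "0 < e"
  define M where "M = distr (density (leb N) (indicator (cube N R))) borel (\<lambda>x. x)"
  have id [measurable]: "(\<lambda>x. x) \<in> measurable (leb N) borel"
    by (subst measurable_cong_sets[OF sets_leb refl]) (rule measurable_restrict_space1, simp)
  have M: "emeasure M B = emeasure (leb N) (B \<inter> cube N R)" if "B \<in> sets borel" for B
  proof -
    have "emeasure M B = emeasure (density (leb N) (indicator (cube N R))) (B \<inter> Rn N)"
      unfolding M_def by (subst emeasure_distr) (use that id in \<open>auto\<close>)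
    also have "\<dots> = (\<integral>\<^sup>+x. indicator (cube N R) x * indicator (B \<inter> Rn N) x \<partial>leb N)"
      using that by (intro emeasure_density) (auto simp: sets_leb_iff)
    also have "\<dots> = (\<integral>\<^sup>+x. indicator (B \<inter> cube N R) x \<partial>leb N)"
      by (intro nn_integral_cong) (auto simp: indicator_def)
    also have "\<dots> = emeasure (leb N) (B \<inter> cube N R)"
    proof (rule nn_integral_indicator)
      have "B \<inter> cube N R \<subseteq> Rn N" using cube_subset_Rn by auto
      moreover have "cube N R \<in> sets borel" using sets_cube[of N R] sets_leb_iff by blast
      ultimately show "B \<inter> cube N R \<in> sets (leb N)"
        unfolding sets_leb_iff using that by auto
    qed
    finally show ?thesis .
  qed
  have fin: "emeasure (leb N) (cube N R) < \<infinity>"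
    by (rule emeasure_compact_finite[OF compact_cube cube_subset_Rn])
  have Ab: "A \<in> sets borel" using A sets_leb_iff by auto
  have MA: "emeasure M A = emeasure (leb N) A"
    using M[OF Ab] A(2) by (simp add: Int_absorb2)
  have finA: "emeasure (leb N) A < \<infinity>"
    using emeasure_mono[OF A(2) sets_cube] fin by (rule le_less_trans)
  have reg: "emeasure M A = (SUP K \<in> {K. K \<subseteq> A \<and> compact K}. emeasure M K)"
  proof (rule inner_regular)
    show "sets M = sets borel" by (simp add: M_def)
    have "space M = UNIV" by (simp add: M_def)
    then show "emeasure M (space M) \<noteq> \<infinity>" using M[of UNIV] fin by (simp add: less_top)
  qed (rule Ab)
  have "\<exists>K. K \<subseteq> A \<and> compact K \<and> emeasure M A \<le> emeasure M K + ennreal e"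
  proof (cases "emeasure M A = 0")
    case True
    then show ?thesis by (intro exI[of _ "{}"]) auto
  next
    case False
    then have "emeasure M A - ennreal e < emeasure M A"
      using finA e unfolding MA by (intro ennreal_between) (auto simp: zero_less_iff_neq_zero)
    then obtain K where "K \<subseteq> A" "compact K" "emeasure M A - ennreal e < emeasure M K"
      by (subst (asm) (2) reg) (auto simp: less_SUP_iff)
    then show ?thesis
      using ennreal_minus_le_iff[of "emeasure M A" "ennreal e" "emeasure M K"]
      by (intro exI[of _ K]) (auto simp: add.commute less_imp_le)
  qed
  then obtain K where K: "K \<subseteq> A" "compact K" "emeasure M A \<le> emeasure M K + ennreal e" by blast
  have KR: "K \<subseteq> Rn N" using K(1) A(2) cube_subset_Rn by blast
  have [measurable]: "K \<in> sets (leb N)" by (rule sets_leb_compact[OF K(2) KR])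
  have MK: "emeasure M K = emeasure (leb N) K"
    using M[of K] K(1,2) A(2) by (simp add: borel_compact Int_absorb2)
  have "pint N p (\<lambda>x. indicator A x - indicator K x) = (\<integral>\<^sup>+x. indicator (A - K) x \<partial>leb N)"
    unfolding pint_def using p K(1) by (intro nn_integral_cong) (auto simp: indicator_def)
  also have "\<dots> = emeasure (leb N) A - emeasure (leb N) K"
    using K(1) finA emeasure_mono[OF K(1), of "leb N"] by (subst nn_integral_indicator, simp, subst emeasure_Diff) auto
  also have "\<dots> \<le> ennreal e"
    using K(3) finA unfolding MA MK by (simp add: ennreal_minus_le_iff less_top)
  finally show "\<exists>g. translation_cont N p g \<and> pint N p (\<lambda>x. indicator A x - g x) \<le> ennreal e"
    using translation_cont_compact[OF K(2) KR p] by blast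
qed simp

text \<open>Translations are continuous in the \<open>p\<close>-th mean, for functions of bounded support: the property passes
  from compact sets to measurable sets, then to simple functions, and finally to limits, since a
  function with finite \<open>p\<close>-th integral is approximated by simple functions dominated by it.\<close>

theorem translation_cont_bounded_support:
  assumes f [measurable]: "f \<in> borel_measurable (leb N)" and fin: "pint N p f < \<infinity>"
    and out: "\<And>x. x \<in> Rn N \<Longrightarrow> x \<notin> cube N R \<Longrightarrow> f x = 0" and p: "0 < p"
  shows "translation_cont N p f"
proof (rule translation_cont_approx[OF f p])
  fix e :: real assume e: "0 < e"
  obtain F where F: "\<And>i. simple_function (leb N) (F i)" "\<And>x. x \<in> space (leb N) \<Longrightarrow> (\<lambda>i. F i x) \<longlonglongrightarrow> f x"
    "\<And>i x. x \<in> space (leb N) \<Longrightarrow> dist (F i x) 0 \<le> 2 * dist (f x) 0"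
    using borel_measurable_implies_sequence_metric[OF f, of 0] by blast
  have [measurable]: "F i \<in> borel_measurable (leb N)" for i by (rule borel_measurable_simple_function[OF F(1)])
  have TF: "translation_cont N p (F i)" for i
  proof -
    have fi: "finite (F i ` Rn N)" using F(1)[of i] by (simp add: simple_function_def)
    have lev [measurable]: "F i -` {c} \<inter> Rn N \<in> sets (leb N)" for c
      using measurable_sets[of "F i" "leb N" borel "{c}"] by simp
    have "translation_cont N p (\<lambda>x. \<Sum>c\<in>F i ` Rn N. c * indicator (F i -` {c} \<inter> Rn N) x)"
    proof (rule translation_cont_sum[OF fi _ p])
      fix c
      show "translation_cont N p (\<lambda>x. c * indicator (F i -` {c} \<inter> Rn N) x)"
      proof (cases "c = 0")
        case False
        have "F i x = 0" if "x \<in> Rn N" "x \<notin> cube N R" for x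
          using F(3)[of x i] out[OF that] that by simp
        then have "F i -` {c} \<inter> Rn N \<subseteq> cube N R" using False by auto
        then show ?thesis by (intro translation_cont_scale translation_cont_set[OF lev _ p])
      qed (simp add: translation_cont_0)
    qed
    also have "?this \<longleftrightarrow> translation_cont N p (F i)"
    proof -
      have eq: "(\<Sum>c\<in>F i ` Rn N. c * indicator (F i -` {c} \<inter> Rn N) x) = F i x" if "x \<in> Rn N" for x
      proof -
        have "(\<Sum>c\<in>F i ` Rn N. c * indicator (F i -` {c} \<inter> Rn N) x) = (\<Sum>c\<in>F i ` Rn N. if c = F i x then c else 0)"
          using that by (intro sum.cong) (auto simp: indicator_def)
        then show ?thesis using fi that by simp
      qed
      have "pint N p (\<lambda>x. (\<Sum>c\<in>F i ` Rn N. c * indicator (F i -` {c} \<inter> Rn N) (x \<oplus> h)) - (\<Sum>c\<in>F i ` Rn N. c * indicator (F i -` {c} \<inter> Rn N) x))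
          = pint N p (\<lambda>x. F i (x \<oplus> h) - F i x)" if "h \<in> Rn N" for h
        unfolding pint_def using that by (intro nn_integral_cong) (simp add: eq)
      then show ?thesis
        unfolding translation_cont_def null_shifts_def by simp
    qed
    finally show ?thesis .
  qed
  have "(\<lambda>i. \<integral>\<^sup>+x. ennreal (\<bar>f x - F i x\<bar> powr p) \<partial>leb N) \<longlonglongrightarrow> (\<integral>\<^sup>+x. 0 \<partial>leb N)"
  \<comment> \<open>The factor 3: the approximants satisfy \<open>\<bar>F\<bar> \<le> 2 \<bar>f\<bar>\<close>.\<close>
  proof (rule nn_integral_dominated_convergence[where w = "\<lambda>x. ennreal (3 powr p * \<bar>f x\<bar> powr p)"])
    have "(\<integral>\<^sup>+x. ennreal (3 powr p * \<bar>f x\<bar> powr p) \<partial>leb N) = ennreal (3 powr p) * pint N p f"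
      unfolding pint_def by (subst nn_integral_cmult[symmetric]) (auto simp: ennreal_mult)
    then show "(\<integral>\<^sup>+x. ennreal (3 powr p * \<bar>f x\<bar> powr p) \<partial>leb N) < \<infinity>"
      using fin by (simp add: ennreal_mult_less_top)
    show "AE x in leb N. ennreal (\<bar>f x - F i x\<bar> powr p) \<le> ennreal (3 powr p * \<bar>f x\<bar> powr p)" for i
    proof (rule AE_I2)
      fix x assume "x \<in> space (leb N)"
      from F(3)[OF this, of i] have "\<bar>f x - F i x\<bar> \<le> 3 * \<bar>f x\<bar>" by simp
      then have "\<bar>f x - F i x\<bar> powr p \<le> (3 * \<bar>f x\<bar>) powr p" using p by (intro powr_mono2) auto
      then show "ennreal (\<bar>f x - F i x\<bar> powr p) \<le> ennreal (3 powr p * \<bar>f x\<bar> powr p)"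
        by (intro ennreal_leI) (simp add: powr_mult)
    qed
    show "AE x in leb N. (\<lambda>i. ennreal (\<bar>f x - F i x\<bar> powr p)) \<longlonglongrightarrow> 0"
    proof (rule AE_I2)
      fix x assume "x \<in> space (leb N)"
      from tendsto_diff[OF tendsto_const[of "f x"] F(2)[OF this]]
      have "(\<lambda>i. \<bar>f x - F i x\<bar>) \<longlonglongrightarrow> 0" by (intro tendsto_rabs_zero) simp
      then have "(\<lambda>i. \<bar>f x - F i x\<bar> powr p) \<longlonglongrightarrow> 0 powr p"
        using p by (intro tendsto_powr') auto
      then show "(\<lambda>i. ennreal (\<bar>f x - F i x\<bar> powr p)) \<longlonglongrightarrow> 0"
        using tendsto_ennrealI[of _ "0 powr p"] p by simp
    qed
  qed auto
  then have "(\<lambda>i. pint N p (\<lambda>x. f x - F i x)) \<longlonglongrightarrow> 0" by (simp add: pint_def)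
  from ennreal_tendsto_0D[OF this e] obtain i where "pint N p (\<lambda>x. f x - F i x) \<le> ennreal e"
    by (auto simp: eventually_sequentially)
  then show "\<exists>g. translation_cont N p g \<and> pint N p (\<lambda>x. f x - g x) \<le> ennreal e"
    using TF by blast
qed

lemma translation_cont_eps:
  assumes f: "translation_cont N p f" and e: "0 < e"
  obtains d where "0 < d" "\<And>h. h \<in> cube N d \<Longrightarrow> pint N p (\<lambda>x. f (x \<oplus> h) - f x) \<le> ennreal e"
proof (rule ccontr)
  assume "\<not> thesis"
  then have "\<exists>h\<in>cube N (1 / real (Suc n)). \<not> pint N p (\<lambda>x. f (x \<oplus> h) - f x) \<le> ennreal e" for n
    using that[of "1 / real (Suc n)"] by auto
  then obtain h where h: "\<And>n. h n \<in> cube N (1 / real (Suc n))" "\<And>n. \<not> pint N p (\<lambda>x. f (x \<oplus> h n) - f x) \<le> ennreal e"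
    by metis
  have "null_shifts N h"
    unfolding null_shifts_def
  proof (intro conjI allI)
    show "h n \<in> Rn N" for n using h(1)[of n] by (simp add: cube_def)
    fix i show "(\<lambda>n. h n i) \<longlonglongrightarrow> 0"
    proof (rule Lim_null_comparison[OF _ LIMSEQ_Suc[OF lim_1_over_n]])
      have "\<bar>h n i\<bar> \<le> 1 / real (Suc n)" for n
        using h(1)[of n] by (cases "i < N") (auto simp: cube_def Rn_iff)
      then show "\<forall>\<^sub>F n in sequentially. norm (h n i) \<le> 1 / real (Suc n)" by simp
    qed
  qed
  then have "(\<lambda>n. pint N p (\<lambda>x. f (x \<oplus> h n) - f x)) \<longlonglongrightarrow> 0"
    using f by (simp add: translation_cont_def)
  from ennreal_tendsto_0D[OF this e] show False using h(2) by (auto simp: eventually_sequentially)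
qed

section \<open>Convergence of mollifications\<close>

text \<open>The power function lies above its tangent at \<open>m\<close>. This form of convexity
  yields the Jensen inequality, and later the estimate of a difference of two \<open>p\<close>-th powers.\<close>

lemma powr_tangent:
  fixes a m p :: real
  assumes "1 \<le> p" "0 \<le> a" "0 \<le> m"
  shows "p * m powr (p - 1) * a \<le> a powr p + (p - 1) * m powr p"
proof (cases "p = 1")
  case True
  then show ?thesis using assms by (cases "m = 0") auto
next
  case False
  then have p: "1 < p" using assms by simp
  define q where "q = p / (p - 1)"
  have q: "1 < q" "1 / p + 1 / q = 1" using p by (auto simp: q_def field_simps)
  have "a * m powr (p - 1) \<le> a powr p / p + (m powr (p - 1)) powr q / q"
    by (rule Youngs_inequality) (use p q assms in auto)
  also have "(m powr (p - 1)) powr q = m powr p"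
    using p by (simp add: powr_powr q_def)
  finally have "p * (a * m powr (p - 1)) \<le> p * (a powr p / p + m powr p / q)"
    using p by (intro mult_left_mono) auto
  also have "\<dots> = a powr p + (p - 1) * m powr p"
    using p by (simp add: q_def field_simps)
  finally show ?thesis by (simp add: mult_ac)
qed

text \<open>The tangent inequality at the mean of \<open>\<bar>X\<bar>\<close>, integrated. If \<open>X\<close> is not integrable, its expectation is \<open>0\<close>
  by convention and the claim is trivial.\<close>

lemma (in prob_space) jensen_powr:
  fixes X :: "'a \<Rightarrow> real"
  assumes [measurable]: "X \<in> borel_measurable M" and p: "1 \<le> p"
  shows "ennreal (\<bar>expectation X\<bar> powr p) \<le> (\<integral>\<^sup>+x. ennreal (\<bar>X x\<bar> powr p) \<partial>M)"
proof (cases "integrable M X \<and> (\<integral>\<^sup>+x. ennreal (\<bar>X x\<bar> powr p) \<partial>M) < \<infinity>")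
  case False
  then show ?thesis using p by (auto simp: not_integrable_integral_eq less_top[symmetric])
next
  case True
  then have X: "integrable M X" by simp
  have Xp: "integrable M (\<lambda>x. \<bar>X x\<bar> powr p)"
    using True by (intro integrableI_bounded) auto
  define m where "m = \<bar>expectation X\<bar>"
  have "p * m powr (p - 1) * m \<le> p * m powr (p - 1) * expectation (\<lambda>x. \<bar>X x\<bar>)"
    unfolding m_def using p by (intro mult_left_mono integral_abs_bound) auto
  also have "\<dots> = expectation (\<lambda>x. p * m powr (p - 1) * \<bar>X x\<bar>)" by simp
  also have "\<dots> \<le> expectation (\<lambda>x. \<bar>X x\<bar> powr p + (p - 1) * m powr p)"
    using X Xp powr_tangent[OF p] by (intro integral_mono) (auto simp: m_def)
  also have "\<dots> = expectation (\<lambda>x. \<bar>X x\<bar> powr p) + (p - 1) * m powr p"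
    using Xp by (simp add: prob_space)
  also have "p * m powr (p - 1) * m = p * m powr p"
  proof (cases "m = 0")
    case False
    then have "m powr (p - 1) * m = m powr p"
      using powr_add[of m "p - 1" 1] by (simp add: m_def)
    then show ?thesis by (simp add: mult.assoc)
  qed simp
  finally have "m powr p \<le> expectation (\<lambda>x. \<bar>X x\<bar> powr p)" by (simp add: algebra_simps)
  then show ?thesis
    using nn_integral_eq_integral[OF Xp] by (simp add: m_def ennreal_leI)
qed

abbreviation moll :: "nat \<Rightarrow> real \<Rightarrow> ((nat \<Rightarrow> real) \<Rightarrow> real) \<Rightarrow> (nat \<Rightarrow> real) \<Rightarrow> real" where
  "moll N d \<equiv> conv N d (\<lambda>_. 0)"

lemma conv_shift:
  assumes x: "x \<in> Rn N" and [measurable]: "f \<in> borel_measurable (leb N)"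
  shows "conv N d m f x = (LINT z|leb N. f (z \<oplus> x) * ker N d m z)"
proof -
  have "(LINT z|leb N. f (z \<oplus> x) * ker N d m (z \<oplus> x - x)) = (LINT y|leb N. f y * ker N d m (y - x))"
  proof (rule integral_translate[OF x, of "\<lambda>y. f y * ker N d m (y - x)"])
    show "(\<lambda>y. f y * ker N d m (y - x)) \<in> borel_measurable (leb N)"
      by (intro borel_measurable_times measurable_ker[of _ _ N] measurable_leb_diff) (use x in auto)
  qed
  then show ?thesis unfolding conv_def vadd_diff by (rule sym)
qed

lemma integrable_ker_mult:
  assumes d: "0 < d" and f: "integrable (leb N) f"
  shows "integrable (leb N) (\<lambda>z. f z * ker N d m z)"
proof -
  obtain B where B: "0 \<le> B" "\<And>z. \<bar>ker N d m z\<bar> \<le> B" using ker_bounded[OF d] by blast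
  have [measurable]: "(\<lambda>z. ker N d m z) \<in> borel_measurable (leb N)" by (rule measurable_ker[of _ _ N]) simp
  have [measurable]: "f \<in> borel_measurable (leb N)" using f by (rule borel_measurable_integrable)
  show ?thesis
  proof (rule Bochner_Integration.integrable_bound)
    show "integrable (leb N) (\<lambda>y. \<bar>f y\<bar> * B)" using f by simp
    have "\<bar>f z\<bar> * \<bar>ker N d m z\<bar> \<le> \<bar>f z\<bar> * B" for z using B(2)[of z] by (rule mult_left_mono) simp
    then show "AE z in leb N. norm (f z * ker N d m z) \<le> norm (\<bar>f z\<bar> * B)"
      using B(1) by (simp add: abs_mult)
  qed simp
qed

lemma integrable_ker: "0 < d \<Longrightarrow> integrable (leb N) (ker N d (\<lambda>_. 0))"
  and integral_ker: "0 < d \<Longrightarrow> (LINT z|leb N. ker N d (\<lambda>_. 0) z) = 1"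
proof -
  assume d: "0 < d"
  have [measurable]: "ker N d (\<lambda>_. 0) \<in> borel_measurable (leb N)" by (rule measurable_ker[of _ _ N]) simp
  show "integrable (leb N) (ker N d (\<lambda>_. 0))"
    by (rule integrableI_nonneg) (use d ker_nonneg nn_integral_ker in auto)
  show "(LINT z|leb N. ker N d (\<lambda>_. 0) z) = 1"
    by (subst integral_eq_nn_integral) (use d ker_nonneg nn_integral_ker in auto)
qed

lemma pint_finite_imp_integrable:
  assumes [measurable]: "f \<in> borel_measurable (leb N)" and fin: "pint N p f < \<infinity>"
    and out: "\<And>x. x \<in> Rn N \<Longrightarrow> x \<notin> cube N R \<Longrightarrow> f x = 0" and p: "1 \<le> p"
  shows "integrable (leb N) f"
proof (rule integrableI_bounded)
  have le: "\<bar>t\<bar> \<le> 1 + \<bar>t\<bar> powr p" for t :: real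
  proof (cases "\<bar>t\<bar> \<le> 1")
    case False
    then have "\<bar>t\<bar> powr 1 \<le> \<bar>t\<bar> powr p" using p by (intro powr_mono) auto
    then show ?thesis using False by simp
  qed (auto intro: order_trans)
  have "(\<integral>\<^sup>+x. ennreal (norm (f x)) \<partial>leb N) \<le> (\<integral>\<^sup>+x. indicator (cube N R) x + ennreal (\<bar>f x\<bar> powr p) \<partial>leb N)"
  proof (rule nn_integral_mono)
    fix x assume "x \<in> space (leb N)"
    then show "ennreal (norm (f x)) \<le> indicator (cube N R) x + ennreal (\<bar>f x\<bar> powr p)"
      using out[of x] le[of "f x"] by (cases "x \<in> cube N R") (auto simp flip: ennreal_plus ennreal_1)
  qed
  also have "\<dots> = emeasure (leb N) (cube N R) + pint N p f"
    unfolding pint_def by (subst nn_integral_add) auto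
  also have "\<dots> < \<infinity>"
    using fin emeasure_compact_finite[OF compact_cube[of N R] cube_subset_Rn] by simp
  finally show "(\<integral>\<^sup>+x. ennreal (norm (f x)) \<partial>leb N) < \<infinity>" .
qed simp

text \<open>The mollification minus \<open>f\<close> is the average of the increments \<open>f(x + z) - f(x)\<close> over the kernel. By the
  Jensen inequality and the Fubini theorem its \<open>p\<close>-th integral is at most the average over \<open>z\<close> of the \<open>p\<close>-th
  integrals of these increments, which are small by the continuity of translations.\<close>

theorem moll_converges:
  assumes f [measurable]: "f \<in> borel_measurable (leb N)" and fin: "pint N p f < \<infinity>"
    and out: "\<And>x. x \<in> Rn N \<Longrightarrow> x \<notin> cube N R \<Longrightarrow> f x = 0" and p: "1 \<le> p" and e: "0 < e"
  obtains d0 where "0 < d0" "\<And>d. 0 < d \<Longrightarrow> d \<le> d0 \<Longrightarrow> pint N p (\<lambda>x. moll N d f x - f x) \<le> ennreal e"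
proof -
  have "translation_cont N p f"
    by (rule translation_cont_bounded_support[OF f fin out]) (use p in auto)
  then obtain d0 where d0: "0 < d0" "\<And>h. h \<in> cube N d0 \<Longrightarrow> pint N p (\<lambda>x. f (x \<oplus> h) - f x) \<le> ennreal e"
    using translation_cont_eps[OF _ e] by blast
  have fi: "integrable (leb N) f" by (rule pint_finite_imp_integrable[OF f fin out p])
  show ?thesis
  proof (rule that[OF d0(1)])
    fix d :: real assume d: "0 < d" "d \<le> d0"
    let ?k = "ker N d (\<lambda>_. 0)"
    have k [measurable]: "?k \<in> borel_measurable (leb N)" by (rule measurable_ker[of _ _ N]) simp
    let ?M = "density (leb N) (\<lambda>z. ennreal (?k z))"
    interpret M: prob_space ?M
    proof
      have "emeasure ?M (space ?M) = (\<integral>\<^sup>+z. ennreal (?k z) * indicator (space (leb N)) z \<partial>leb N)"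
        by (subst emeasure_density) (auto simp del: space_leb)
      also have "\<dots> = (\<integral>\<^sup>+z. ennreal (?k z) \<partial>leb N)" by (intro nn_integral_cong) simp
      finally show "emeasure ?M (space ?M) = 1" by (simp add: nn_integral_ker[OF d(1)])
    qed
    have pw: "ennreal (\<bar>moll N d f x - f x\<bar> powr p) \<le> (\<integral>\<^sup>+z. ennreal (?k z) * ennreal (\<bar>f (x \<oplus> z) - f x\<bar> powr p) \<partial>leb N)"
      if x: "x \<in> Rn N" for x
    proof -
      have [measurable]: "(\<lambda>z. f (z \<oplus> x)) \<in> borel_measurable (leb N)"
        by (rule measurable_translate_fun[OF f x])
      have i: "integrable (leb N) (\<lambda>z. f (z \<oplus> x) * ?k z)"
        by (rule integrable_ker_mult[OF d(1) integrable_translate[OF x fi]])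
      have "moll N d f x - f x = (LINT z|leb N. f (z \<oplus> x) * ?k z) - (LINT z|leb N. f x * ?k z)"
        using integral_ker[OF d(1), of N] by (simp add: conv_shift[OF x f])
      also have "\<dots> = (LINT z|leb N. f (z \<oplus> x) * ?k z - f x * ?k z)"
        by (rule Bochner_Integration.integral_diff[OF i, symmetric]) (use integrable_ker[OF d(1)] in auto)
      also have "\<dots> = (LINT z|leb N. ?k z *\<^sub>R (f (x \<oplus> z) - f x))"
        by (intro Bochner_Integration.integral_cong) (auto simp: algebra_simps vadd_commute)
      also have "\<dots> = (LINT z|?M. f (x \<oplus> z) - f x)"
        by (rule integral_density[symmetric]) (auto simp: vadd_commute[of x] ker_nonneg[OF d(1)])
      finally have "moll N d f x - f x = (LINT z|?M. f (x \<oplus> z) - f x)" .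
      moreover have "ennreal (\<bar>LINT z|?M. f (x \<oplus> z) - f x\<bar> powr p) \<le> (\<integral>\<^sup>+z. ennreal (\<bar>f (x \<oplus> z) - f x\<bar> powr p) \<partial>?M)"
        by (rule M.jensen_powr) (auto simp: vadd_commute[of x] p)
      moreover have "(\<integral>\<^sup>+z. ennreal (\<bar>f (x \<oplus> z) - f x\<bar> powr p) \<partial>?M) = (\<integral>\<^sup>+z. ennreal (?k z) * ennreal (\<bar>f (x \<oplus> z) - f x\<bar> powr p) \<partial>leb N)"
        by (rule nn_integral_density) (auto simp: vadd_commute[of x])
      ultimately show ?thesis by simp
    qed
    have "pint N p (\<lambda>x. moll N d f x - f x) \<le> (\<integral>\<^sup>+x. \<integral>\<^sup>+z. ennreal (?k z) * ennreal (\<bar>f (x \<oplus> z) - f x\<bar> powr p) \<partial>leb N \<partial>leb N)"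
      unfolding pint_def by (rule nn_integral_mono) (simp add: pw)
    also have "\<dots> = (\<integral>\<^sup>+z. \<integral>\<^sup>+x. ennreal (?k z) * ennreal (\<bar>f (x \<oplus> z) - f x\<bar> powr p) \<partial>leb N \<partial>leb N)"
    proof (rule lebp.Fubini')
      show "(\<lambda>(z, x). ennreal (?k z) * ennreal (\<bar>f (x \<oplus> z) - f x\<bar> powr p)) \<in> borel_measurable (leb N \<Otimes>\<^sub>M leb N)"
        unfolding case_prod_beta by measurable
    qed
    also have "\<dots> \<le> (\<integral>\<^sup>+z. ennreal (?k z) * ennreal e \<partial>leb N)"
    proof (rule nn_integral_mono)
      fix z assume "z \<in> space (leb N)"
      then have z: "z \<in> Rn N" by simp
      have [measurable]: "(\<lambda>x. f (x \<oplus> z)) \<in> borel_measurable (leb N)"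
        by (rule measurable_translate_fun[OF f z])
      have "(\<integral>\<^sup>+x. ennreal (?k z) * ennreal (\<bar>f (x \<oplus> z) - f x\<bar> powr p) \<partial>leb N) = ennreal (?k z) * pint N p (\<lambda>x. f (x \<oplus> z) - f x)"
        unfolding pint_def by (rule nn_integral_cmult) simp
      also have "\<dots> \<le> ennreal (?k z) * ennreal e"
      proof (cases "z \<in> cube N d")
        case True
        then have "z \<in> cube N d0" using cube_mono[OF d(2)] by blast
        then show ?thesis by (intro mult_left_mono d0(2)) auto
      qed (simp add: ker_eq_0[OF d(1) z])
      finally show "(\<integral>\<^sup>+x. ennreal (?k z) * ennreal (\<bar>f (x \<oplus> z) - f x\<bar> powr p) \<partial>leb N) \<le> ennreal (?k z) * ennreal e" .
    qed
    also have "\<dots> = ennreal e"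
      by (subst nn_integral_multc) (auto simp: nn_integral_ker[OF d(1)])
    finally show "pint N p (\<lambda>x. moll N d f x - f x) \<le> ennreal e" .
  qed
qed

section \<open>Continuously differentiable functions with compact support\<close>

definition ax :: "nat \<Rightarrow> real \<Rightarrow> nat \<Rightarrow> real" where
  "ax i t = (\<lambda>j. if j = i then t else 0)"

lemma ax_Rn [simp, intro]: "i < N \<Longrightarrow> ax i t \<in> Rn N"
  by (auto simp: ax_def Rn_iff)

lemma vadd_ax: "x \<oplus> ax i t = x(i := x i + t)"
  by (auto simp: ax_def fun_eq_iff vadd_apply)

lemma ax_cube: "i < N \<Longrightarrow> \<bar>t\<bar> \<le> d \<Longrightarrow> ax i t \<in> cube N d"
  using abs_ge_zero[of t] ax_Rn[of i N t] unfolding cube_def by (auto simp: ax_def[THEN fun_cong])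

lemma ax_add: "x \<oplus> ax i s \<oplus> ax i t = x \<oplus> ax i (s + t)"
  by (auto simp: ax_def fun_eq_iff vadd_apply)

lemma ax_uminus: "- ax i t = ax i (- t)"
  by (auto simp: ax_def fun_eq_iff vadd_apply)

lemma ax_0: "x \<oplus> ax i 0 = x"
  by (auto simp: ax_def fun_eq_iff vadd_apply)

lemma isCont_vadd_ax: "isCont (\<lambda>t. x \<oplus> ax i t) s"
proof -
  have "continuous_on UNIV (\<lambda>t. x \<oplus> ax i t)"
  proof (rule continuous_on_coordinatewise_then_product)
    show "continuous_on UNIV (\<lambda>t. (x \<oplus> ax i t) j)" for j
      by (cases "j = i") (auto simp: ax_def vadd_apply intro!: continuous_intros)
  qed
  then show ?thesis by (simp add: continuous_on_eq_continuous_at)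
qed

text \<open>A relational form of continuous differentiability with compact support: the partial derivatives and
  a compact set that carries the function are parameters, so that \<open>w\<^sup>p\<close>, which need not be smooth, is
  covered as well as smooth test functions.\<close>

definition C1c :: "nat \<Rightarrow> ((nat \<Rightarrow> real) \<Rightarrow> real) \<Rightarrow> (nat \<Rightarrow> (nat \<Rightarrow> real) \<Rightarrow> real) \<Rightarrow> (nat \<Rightarrow> real) set \<Rightarrow> bool" where
  "C1c N f D S \<longleftrightarrow> compact S \<and> S \<subseteq> Rn N \<and> continuous_on (Rn N) f \<and> (\<forall>i<N. continuous_on (Rn N) (D i))
     \<and> (\<forall>x\<in>Rn N - S. f x = 0 \<and> (\<forall>i<N. D i x = 0))
     \<and> (\<forall>i<N. \<forall>x\<in>Rn N. ((\<lambda>t. f (x(i := t))) has_real_derivative D i x) (at (x i)))"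

lemma C1c_D:
  assumes "C1c N f D S"
  shows "compact S" "S \<subseteq> Rn N" "continuous_on (Rn N) f" "i < N \<Longrightarrow> continuous_on (Rn N) (D i)"
    "x \<in> Rn N \<Longrightarrow> x \<notin> S \<Longrightarrow> f x = 0" "x \<in> Rn N \<Longrightarrow> x \<notin> S \<Longrightarrow> i < N \<Longrightarrow> D i x = 0"
    "f \<in> borel_measurable (leb N)" "i < N \<Longrightarrow> D i \<in> borel_measurable (leb N)"
  using assms by (auto simp: C1c_def intro: borel_measurable_leb_continuous)

lemma C1c_line_deriv:
  assumes "C1c N f D S" "i < N" "x \<in> Rn N"
  shows "((\<lambda>t. f (x \<oplus> ax i t)) has_real_derivative D i (x \<oplus> ax i s)) (at s)"
proof -
  have "x(i := x i + s) \<in> Rn N" using assms by simp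
  moreover have "\<forall>x\<in>Rn N. ((\<lambda>t. f (x(i := t))) has_real_derivative D i x) (at (x i))"
    using assms unfolding C1c_def by blast
  ultimately have "((\<lambda>t. f ((x(i := x i + s))(i := t))) has_real_derivative D i (x(i := x i + s))) (at ((x(i := x i + s)) i))"
    by (rule bspec[rotated])
  then have "((\<lambda>t. f (x(i := t))) has_real_derivative D i (x(i := x i + s))) (at (x i + s))"
    unfolding fun_upd_upd fun_upd_same .
  from DERIV_chain2[where f = "\<lambda>t. f (x(i := t))" and g = "\<lambda>t. x i + t" and x = s, OF this DERIV_add[OF DERIV_const DERIV_ident]]
  show ?thesis unfolding vadd_ax by simp
qed

lemma C1c_bounded:
  assumes C: "C1c N f D S"
  obtains B where "0 \<le> B" "\<And>x. x \<in> Rn N \<Longrightarrow> \<bar>f x\<bar> \<le> B" "\<And>x i. x \<in> Rn N \<Longrightarrow> i < N \<Longrightarrow> \<bar>D i x\<bar> \<le> B"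
proof -
  note S = C1c_D(1,2)[OF C]
  have bd: "\<exists>B\<ge>0. \<forall>x\<in>S. \<bar>g x\<bar> \<le> B" if "continuous_on (Rn N) g" for g :: "(nat \<Rightarrow> real) \<Rightarrow> real"
  proof -
    have "compact (g ` S)" by (rule compact_continuous_image[OF continuous_on_subset[OF that S(2)] S(1)])
    then obtain B where "\<forall>x\<in>S. \<bar>g x\<bar> \<le> B" by (auto dest!: compact_imp_bounded simp: bounded_iff)
    then show ?thesis by (intro exI[of _ "\<bar>B\<bar>"]) force
  qed
  obtain B0 where B0: "B0 \<ge> 0" "\<forall>x\<in>S. \<bar>f x\<bar> \<le> B0" using bd[OF C1c_D(3)[OF C]] by blast
  have "\<forall>i. \<exists>B. i < N \<longrightarrow> B \<ge> 0 \<and> (\<forall>x\<in>S. \<bar>D i x\<bar> \<le> B)" using bd[OF C1c_D(4)[OF C]] by blast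
  then obtain B where B: "\<And>i. i < N \<Longrightarrow> B i \<ge> 0" "\<And>i x. i < N \<Longrightarrow> x \<in> S \<Longrightarrow> \<bar>D i x\<bar> \<le> B i" by metis
  have sB: "B i \<le> (\<Sum>i<N. B i)" if "i < N" for i
    by (rule member_le_sum) (use that B in auto)
  have s0: "0 \<le> (\<Sum>i<N. B i)" by (rule sum_nonneg) (use B in auto)
  show ?thesis
  proof (rule that[of "B0 + (\<Sum>i<N. B i)"])
    show "0 \<le> B0 + (\<Sum>i<N. B i)" using B0 s0 by simp
    fix x assume x: "x \<in> Rn N"
    show "\<bar>f x\<bar> \<le> B0 + (\<Sum>i<N. B i)"
      using B0 s0 C1c_D(5)[OF C x] by (cases "x \<in> S") (auto intro: add_increasing2)
    fix i assume i: "i < N"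
    show "\<bar>D i x\<bar> \<le> B0 + (\<Sum>i<N. B i)"
      using B0(1) s0 C1c_D(6)[OF C x _ i] B(2)[OF i, of x] sB[OF i] by (cases "x \<in> S") auto
  qed
qed

lemma C1c_lipschitz:
  assumes C: "C1c N f D S" and i: "i < N" and x: "x \<in> Rn N" and B: "\<And>x. x \<in> Rn N \<Longrightarrow> \<bar>D i x\<bar> \<le> B"
  shows "\<bar>f (x \<oplus> ax i t) - f x\<bar> \<le> B * \<bar>t\<bar>"
proof -
  have "norm (f (x \<oplus> ax i t) - f (x \<oplus> ax i 0)) \<le> B * norm (t - 0)"
    by (rule field_differentiable_bound[of UNIV "\<lambda>t. f (x \<oplus> ax i t)" "\<lambda>t. D i (x \<oplus> ax i t)"])
      (use C1c_line_deriv[OF C i x] B x i in auto)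
  then show ?thesis by (simp add: ax_0)
qed

lemma Cc_infty_C1c:
  assumes "\<psi> \<in> Cc_infty N U"
  shows "C1c N \<psi> (\<lambda>i. pd i \<psi>) (supp N \<psi>)" and "supp N \<psi> \<subseteq> U" and "compact (supp N \<psi>)" and "supp N \<psi> \<subseteq> Rn N"
proof -
  have Ck: "Ck N k \<psi>" for k using assms by (simp add: Cc_infty_def)
  show S: "compact (supp N \<psi>)" "supp N \<psi> \<subseteq> Rn N" and "supp N \<psi> \<subseteq> U"
    using assms by (auto simp: Cc_infty_def compactin_iff)
  have c: "continuous_on (Rn N) \<psi>" using Ck[of 0] by (simp add: continuous_map_real_iff)
  have cd: "continuous_on (Rn N) (pd i \<psi>)" if "i < N" for i
    using Ck[of "Suc 0"] that by (simp add: continuous_map_real_iff)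
  have der: "((\<lambda>t. \<psi> (x(i := t))) has_real_derivative pd i \<psi> x) (at (x i))" if "i < N" "x \<in> Rn N" for i x
    using Ck[of "Suc 0"] that DERIV_deriv_iff_field_differentiable by (auto simp: pd_def)
  have sub: "{x \<in> Rn N. \<psi> x \<noteq> 0} \<subseteq> supp N \<psi>"
    unfolding supp_def by (subst closure_of_iff) (auto intro: closure_subset[THEN subsetD])
  have d0: "pd i \<psi> x = 0" if i: "i < N" and x: "x \<in> Rn N" "x \<notin> supp N \<psi>" for i x
  proof (rule pd_eqI)
    have "continuous_on UNIV (\<lambda>t. x(i := t))"
    proof (rule continuous_on_coordinatewise_then_product)
      show "continuous_on UNIV (\<lambda>t. (x(i := t)) j)" for j
        by (cases "j = i") (auto intro!: continuous_intros)
    qed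
    moreover have "open (- supp N \<psi>)" using compact_imp_closed[OF S(1)] by auto
    ultimately have "open ((\<lambda>t. x(i := t)) -` (- supp N \<psi>))"
      by (rule open_vimage[rotated])
    then show "((\<lambda>t. \<psi> (x(i := t))) has_real_derivative 0) (at (x i))"
      using x i sub by (intro has_field_derivative_transform_within_open[OF DERIV_const[of 0]]) auto
  qed
  show "C1c N \<psi> (\<lambda>i. pd i \<psi>) (supp N \<psi>)"
    unfolding C1c_def using S c cd der d0 sub by auto
qed

lemma Cc_infty_translate:
  assumes \<psi>: "\<psi> \<in> Cc_infty N V" and h: "h \<in> Rn N" and sub: "\<And>x. x \<in> supp N \<psi> \<Longrightarrow> x \<oplus> h \<in> U"
  shows "(\<lambda>x. \<psi> (x \<oplus> - h)) \<in> Cc_infty N U"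
    and "i < N \<Longrightarrow> x \<in> Rn N \<Longrightarrow> pd i (\<lambda>x. \<psi> (x \<oplus> - h)) x = pd i \<psi> (x \<oplus> - h)"
proof -
  have sh: "x(i := t) \<oplus> - h = (x \<oplus> - h)(i := t - h i)" for x i t
    by (auto simp: fun_eq_iff vadd_apply)
  have der: "((\<lambda>t. f (x(i := t) \<oplus> - h)) has_real_derivative pd i f (x \<oplus> - h)) (at (x i))"
    if f: "\<forall>k. Ck N k f" and i: "i < N" and x: "x \<in> Rn N" for f x i
  proof -
    have "x \<oplus> - h \<in> Rn N" using x h by auto
    moreover have "\<forall>x\<in>Rn N. (\<lambda>t. f (x(i := t))) field_differentiable (at (x i))"
      using f[rule_format, of "Suc 0"] i by simp
    ultimately have "(\<lambda>t. f ((x \<oplus> - h)(i := t))) field_differentiable (at ((x \<oplus> - h) i))"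
      by (rule bspec[rotated])
    then have "((\<lambda>t. f ((x \<oplus> - h)(i := t))) has_real_derivative pd i f (x \<oplus> - h)) (at (x i - h i))"
      unfolding pd_def DERIV_deriv_iff_field_differentiable[symmetric] by (simp add: vadd_apply)
    from DERIV_chain2[where f = "\<lambda>t. f ((x \<oplus> - h)(i := t))" and g = "\<lambda>t. t - h i" and x = "x i", OF this DERIV_diff[OF DERIV_ident DERIV_const]]
    show ?thesis unfolding sh by simp
  qed
  have Ck: "\<forall>k. Ck N k \<psi>" using \<psi> by (simp add: Cc_infty_def)
  show "pd i (\<lambda>x. \<psi> (x \<oplus> - h)) x = pd i \<psi> (x \<oplus> - h)" if "i < N" "x \<in> Rn N"
    by (rule pd_eqI[OF der[OF Ck that]])
  note S = Cc_infty_C1c[OF \<psi>]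
  show "(\<lambda>x. \<psi> (x \<oplus> - h)) \<in> Cc_infty N U"
  proof (rule Cc_inftyI)
    show "Ck N k (\<lambda>x. \<psi> (x \<oplus> - h))" for k
    proof (rule Ck_coinduct[where F = "\<lambda>g. \<exists>f. (\<forall>k. Ck N k f) \<and> g = (\<lambda>x. f (x \<oplus> - h))"])
      show "\<exists>f. (\<forall>k. Ck N k f) \<and> (\<lambda>x. \<psi> (x \<oplus> - h)) = (\<lambda>x. f (x \<oplus> - h))" using Ck by blast
      fix g assume "\<exists>f. (\<forall>k. Ck N k f) \<and> g = (\<lambda>x. f (x \<oplus> - h))"
      then obtain f where f: "\<forall>k. Ck N k f" "g = (\<lambda>x. f (x \<oplus> - h))" by blast
      have "\<exists>g'. (\<exists>f. (\<forall>k. Ck N k f) \<and> g' = (\<lambda>x. f (x \<oplus> - h))) \<and>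
          (\<forall>x\<in>Rn N. ((\<lambda>t. g (x(i := t))) has_real_derivative g' x) (at (x i)))" if i: "i < N" for i
      proof (rule exI[of _ "\<lambda>x. pd i f (x \<oplus> - h)"], rule conjI, rule_tac [2] ballI)
        have "Ck N k (pd i f)" for k using f(1)[rule_format, of "Suc k"] i by simp
        then show "\<exists>f'. (\<forall>k. Ck N k f') \<and> (\<lambda>x. pd i f (x \<oplus> - h)) = (\<lambda>x. f' (x \<oplus> - h))" by blast
        show "((\<lambda>t. g (x(i := t))) has_real_derivative pd i f (x \<oplus> - h)) (at (x i))" if "x \<in> Rn N" for x
          unfolding f(2) by (rule der[OF f(1) i that])
      qed
      moreover have "continuous_on (Rn N) g"
      proof -
        have "continuous_on (Rn N) f" using f(1)[rule_format, of 0] by (simp add: continuous_map_real_iff)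
        then show ?thesis unfolding f(2)
          by (rule continuous_on_compose2[OF _ continuous_on_fun_add[OF continuous_on_id continuous_on_const]]) (use h in auto)
      qed
      ultimately show "continuous_on (Rn N) g \<and> (\<forall>i<N. \<exists>g'. (\<exists>f. (\<forall>k. Ck N k f) \<and> g' = (\<lambda>x. f (x \<oplus> - h))) \<and>
          (\<forall>x\<in>Rn N. ((\<lambda>t. g (x(i := t))) has_real_derivative g' x) (at (x i))))" by blast
    qed
    show "compact ((\<lambda>x. x \<oplus> h) ` supp N \<psi>)"
      by (intro compact_continuous_image S continuous_on_fun_add continuous_on_id continuous_on_const)
    show "(\<lambda>x. x \<oplus> h) ` supp N \<psi> \<subseteq> Rn N" using S(4) h by auto
    show "(\<lambda>x. x \<oplus> h) ` supp N \<psi> \<subseteq> U" using sub by auto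
    fix x assume x: "x \<in> Rn N" "x \<notin> (\<lambda>x. x \<oplus> h) ` supp N \<psi>"
    then have "x \<oplus> - h \<notin> supp N \<psi>" by (metis image_eqI vadd_uminus(2))
    then show "\<psi> (x \<oplus> - h) = 0" using C1c_D(5)[OF S(1)] x h by auto
  qed
qed

section \<open>Locally integrable functions and weak derivatives\<close>

text \<open>Restriction to a set by extension with zero. For a locally integrable function and a compact
  set the result is globally integrable, hence it can be translated and mollified.\<close>

definition cut :: "(nat \<Rightarrow> real) set \<Rightarrow> ((nat \<Rightarrow> real) \<Rightarrow> real) \<Rightarrow> (nat \<Rightarrow> real) \<Rightarrow> real" where
  "cut K f x = indicator K x * f x"

lemma cut_in [simp]: "x \<in> K \<Longrightarrow> cut K f x = f x" and cut_out [simp]: "x \<notin> K \<Longrightarrow> cut K f x = 0"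
  by (auto simp: cut_def)

lemma set_integral_cut: "(LINT x:U|M. f x) = (LINT x|M. cut U f x)"
  by (simp add: set_lebesgue_integral_def cut_def[abs_def])

lemma L1_loc_iff:
  "f \<in> L1_loc N U \<longleftrightarrow> (\<forall>K. compact K \<longrightarrow> K \<subseteq> Rn N \<longrightarrow> K \<subseteq> U \<longrightarrow> integrable (leb N) (cut K f))"
  by (auto simp: L1_loc_def compactin_iff set_integrable_def cut_def[abs_def])

lemma L1_loc_mono: "f \<in> L1_loc N U \<Longrightarrow> V \<subseteq> U \<Longrightarrow> f \<in> L1_loc N V"
  unfolding L1_loc_iff by blast

text \<open>A single component of \<^const>\<open>is_weak_gradient\<close>. All rules of calculus below act on one coordinate
  at a time.\<close>

definition weak_deriv :: "nat \<Rightarrow> (nat \<Rightarrow> real) set \<Rightarrow> nat \<Rightarrow> ((nat \<Rightarrow> real) \<Rightarrow> real) \<Rightarrow> ((nat \<Rightarrow> real) \<Rightarrow> real) \<Rightarrow> bool" where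
  "weak_deriv N U i f g \<longleftrightarrow> f \<in> L1_loc N U \<and> g \<in> L1_loc N U \<and>
     (\<forall>\<psi>\<in>Cc_infty N U. (LINT x:U|leb N. f x * pd i \<psi> x) = - (LINT x:U|leb N. g x * \<psi> x))"

lemma is_weak_gradient_iff:
  "is_weak_gradient N U f G \<longleftrightarrow> f \<in> L1_loc N U \<and> (\<forall>i<N. weak_deriv N U i f (\<lambda>x. G x i))"
  by (auto simp: is_weak_gradient_def weak_deriv_def)

text \<open>The test functions \<open>y \<mapsto> ker (y - x)\<close> show that the mollifications of \<open>g\<close> vanish on \<open>K\<close>, and the
  mollifications converge to \<open>g\<close> in the mean.\<close>

lemma fundamental_lemma_compact:
  assumes K: "compact K" "K \<subseteq> Rn N" and d: "0 < d" and g: "integrable (leb N) (cut (thick N K d) g)"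
    and test: "\<And>\<psi>. \<psi> \<in> Cc_infty N (thick N K d) \<Longrightarrow> (LINT x|leb N. cut (thick N K d) g x * \<psi> x) = 0"
  shows "AE x in leb N. x \<in> K \<longrightarrow> g x = 0"
proof -
  let ?T = "thick N K d"
  define f where "f = cut ?T g"
  have [measurable]: "f \<in> borel_measurable (leb N)" using g unfolding f_def by (rule borel_measurable_integrable)
  have [measurable]: "K \<in> sets (leb N)" by (rule sets_leb_compact[OF K])
  have T: "compact ?T" "?T \<subseteq> Rn N" using compact_thick thick_subset_Rn K by auto
  obtain R where R: "0 < R" "?T \<subseteq> cube N R" using compact_subset_cube[OF T] by metis
  have fin: "pint N 1 f < \<infinity>"
    using g unfolding f_def pint_def by (simp add: integrable_iff_bounded)
  have zero: "moll N d' f x = 0" if d': "0 < d'" "d' \<le> d" and x: "x \<in> K" for d' x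
    unfolding conv_def f_def
  proof (rule test, rule ker_Cc_infty[OF d'(1)])
    show "x \<in> Rn N" using x K by auto
    show "thick N {x} d' \<subseteq> ?T" using x cube_mono[OF d'(2)] by (force simp: thick_def)
  qed
  have "(\<integral>\<^sup>+x. indicator K x * ennreal \<bar>f x\<bar> \<partial>leb N) \<le> 0 + ennreal e" if e: "0 < e" for e
  proof -
    obtain d0 where d0: "0 < d0" "\<And>d. 0 < d \<Longrightarrow> d \<le> d0 \<Longrightarrow> pint N 1 (\<lambda>x. moll N d f x - f x) \<le> ennreal e"
    proof (rule moll_converges[of f N 1 R e])
      show "f x = 0" if "x \<in> Rn N" "x \<notin> cube N R" for x
        unfolding f_def by (rule cut_out) (use R that in auto)
    qed (use fin e in auto)
    let ?d = "min d d0"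
    have "(\<integral>\<^sup>+x. indicator K x * ennreal \<bar>f x\<bar> \<partial>leb N) \<le> pint N 1 (\<lambda>x. moll N ?d f x - f x)"
      unfolding pint_def
    proof (rule nn_integral_mono)
      fix x
      show "indicator K x * ennreal \<bar>f x\<bar> \<le> ennreal (\<bar>moll N ?d f x - f x\<bar> powr 1)"
        using zero[of ?d x] d d0(1) by (cases "x \<in> K") auto
    qed
    also have "\<dots> \<le> ennreal e" by (rule d0(2)) (use d d0(1) in auto)
    finally show ?thesis by simp
  qed
  then have "(\<integral>\<^sup>+x. indicator K x * ennreal \<bar>f x\<bar> \<partial>leb N) \<le> 0"
    by (rule ennreal_le_epsilon)
  then have "(\<integral>\<^sup>+x. indicator K x * ennreal \<bar>f x\<bar> \<partial>leb N) = 0" by simp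
  then have "AE x in leb N. indicator K x * ennreal \<bar>f x\<bar> = 0"
    using nn_integral_0_iff_AE[of "\<lambda>x. indicator K x * ennreal \<bar>f x\<bar>" "leb N"] by simp
  then show ?thesis
  proof eventually_elim
    case (elim x)
    show ?case
    proof
      assume "x \<in> K"
      moreover then have "x \<in> ?T" using subset_thick[of d K N] d by auto
      ultimately show "g x = 0" using elim by (simp add: f_def)
    qed
  qed
qed

lemma AE_open_from_compact:
  assumes U: "openin (Euclidean_space N) U"
    and K: "\<And>K. compact K \<Longrightarrow> K \<subseteq> Rn N \<Longrightarrow> K \<subseteq> U \<Longrightarrow> AE x in leb N. x \<in> K \<longrightarrow> P x"
  shows "AE x in leb N. x \<in> U \<longrightarrow> P x"
proof -
  obtain C where C: "\<And>n::nat. compact (C n)" "U = (\<Union>n. C n)" using open_exhaustion[OF U] by blast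
  have "AE x in leb N. \<forall>n. x \<in> C n \<longrightarrow> P x"
    unfolding AE_all_countable
  proof
    fix n
    have "C n \<subseteq> U" using C(2) by auto
    with openin_subset_Rn[OF U] show "AE x in leb N. x \<in> C n \<longrightarrow> P x"
      by (intro K C(1)) auto
  qed
  then show ?thesis unfolding C(2)
    by eventually_elim blast
qed

text \<open>Only the restrictions to compact sets are known to be measurable; their limit along an exhaustion by
  compact sets is measurable.\<close>

lemma L1_loc_measurable:
  assumes U: "openin (Euclidean_space N) U" and f: "f \<in> L1_loc N U"
  shows "cut U f \<in> borel_measurable (leb N)"
proof -
  obtain C where C: "\<And>n::nat. compact (C n)" "U = (\<Union>n. C n)" using open_exhaustion[OF U] by blast
  define D where "D n = (\<Union>k\<le>n. C k)" for n
  have D: "compact (D n)" "D n \<subseteq> U" "D n \<subseteq> Rn N" for n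
    using C openin_subset_Rn[OF U] unfolding D_def by (auto intro!: compact_UN)
  have [measurable]: "cut (D n) f \<in> borel_measurable (leb N)" for n
    by (rule borel_measurable_integrable) (use f D[of n] in \<open>simp add: L1_loc_iff\<close>)
  show ?thesis
  proof (rule borel_measurable_LIMSEQ_real[where u = "\<lambda>n. cut (D n) f"])
    fix x
    show "(\<lambda>n. cut (D n) f x) \<longlonglongrightarrow> cut U f x"
    proof (cases "x \<in> U")
      case True
      then obtain n where n: "x \<in> C n" using C by auto
      have "\<forall>\<^sub>F m in sequentially. cut (D m) f x = cut U f x"
        using eventually_ge_at_top[of n]
      proof eventually_elim
        case (elim m)
        then have "x \<in> D m" using n by (auto simp: D_def)
        then show ?case using True by simp
      qed
      then show ?thesis by (rule tendsto_eventually)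
    next
      case False
      then have "cut (D n) f x = 0" for n using D(2)[of n] by (intro cut_out) auto
      then show ?thesis using False by simp
    qed
  qed measurable
qed

lemma test_integral_cut:
  assumes "\<psi> \<in> Cc_infty N K" "K \<subseteq> U"
  shows "(LINT x:U|leb N. g x * \<psi> x) = (LINT x|leb N. cut K g x * \<psi> x)"
    and "i < N \<Longrightarrow> (LINT x:U|leb N. g x * pd i \<psi> x) = (LINT x|leb N. cut K g x * pd i \<psi> x)"
proof -
  note S = Cc_infty_C1c[OF assms(1)]
  have out: "\<psi> x = 0" "i < N \<Longrightarrow> pd i \<psi> x = 0" if "x \<in> Rn N" "x \<notin> K" for x i
    using C1c_D(5,6)[OF S(1) that(1)] that(2) S(2) by auto
  show "(LINT x:U|leb N. g x * \<psi> x) = (LINT x|leb N. cut K g x * \<psi> x)"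
    unfolding set_integral_cut
    by (rule Bochner_Integration.integral_cong) (use out assms(2) in \<open>auto simp: cut_def indicator_def\<close>)
  show "(LINT x:U|leb N. g x * pd i \<psi> x) = (LINT x|leb N. cut K g x * pd i \<psi> x)" if "i < N"
    unfolding set_integral_cut
    by (rule Bochner_Integration.integral_cong) (use out that assms(2) in \<open>auto simp: cut_def indicator_def\<close>)
qed

lemma Cc_infty_mono: "\<psi> \<in> Cc_infty N V \<Longrightarrow> V \<subseteq> U \<Longrightarrow> \<psi> \<in> Cc_infty N U"
  by (auto simp: Cc_infty_def)

theorem fundamental_lemma:
  assumes U: "openin (Euclidean_space N) U" and g: "g \<in> L1_loc N U"
    and test: "\<And>\<psi>. \<psi> \<in> Cc_infty N U \<Longrightarrow> (LINT x:U|leb N. g x * \<psi> x) = 0"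
  shows "AE x in leb N. x \<in> U \<longrightarrow> g x = 0"
proof (rule AE_open_from_compact[OF U])
  fix K assume K: "compact K" "K \<subseteq> Rn N" "K \<subseteq> U"
  obtain d where d: "0 < d" "thick N K d \<subseteq> U" using thick_subset_open[OF K(1,3) U] by blast
  show "AE x in leb N. x \<in> K \<longrightarrow> g x = 0"
  proof (rule fundamental_lemma_compact[OF K(1,2) d(1)])
    show "integrable (leb N) (cut (thick N K d) g)"
      using g compact_thick[OF K(1)] thick_subset_Rn[OF K(2)] d(2) unfolding L1_loc_iff by blast
    fix \<psi> assume \<psi>: "\<psi> \<in> Cc_infty N (thick N K d)"
    show "(LINT x|leb N. cut (thick N K d) g x * \<psi> x) = 0"
      using test[OF Cc_infty_mono[OF \<psi> d(2)]] test_integral_cut(1)[OF \<psi> d(2)] by simp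
  qed
qed

lemma integrable_test_mult:
  assumes \<psi>: "C1c N \<psi> D S" and f: "integrable (leb N) f"
  shows "integrable (leb N) (\<lambda>x. f x * \<psi> x)" and "i < N \<Longrightarrow> integrable (leb N) (\<lambda>x. f x * D i x)"
proof -
  have [measurable]: "f \<in> borel_measurable (leb N)" using f by auto
  have bd: "integrable (leb N) (\<lambda>x. f x * q x)" if q [measurable]: "q \<in> borel_measurable (leb N)"
    and B: "0 \<le> B" "\<And>x. x \<in> Rn N \<Longrightarrow> \<bar>q x\<bar> \<le> B" for q B
  proof (rule Bochner_Integration.integrable_bound)
    show "integrable (leb N) (\<lambda>x. \<bar>f x\<bar> * B)" using f by simp
    have "\<bar>f x\<bar> * \<bar>q x\<bar> \<le> \<bar>f x\<bar> * B" if "x \<in> Rn N" for x using B(2)[OF that] by (rule mult_left_mono) simp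
    then show "AE x in leb N. norm (f x * q x) \<le> norm (\<bar>f x\<bar> * B)"
      using B(1) by (intro AE_I2) (simp add: abs_mult)
  qed simp
  obtain B where B: "0 \<le> B" "\<And>x. x \<in> Rn N \<Longrightarrow> \<bar>\<psi> x\<bar> \<le> B" "\<And>x i. x \<in> Rn N \<Longrightarrow> i < N \<Longrightarrow> \<bar>D i x\<bar> \<le> B"
    using C1c_bounded[OF \<psi>] by blast
  show "integrable (leb N) (\<lambda>x. f x * \<psi> x)" by (rule bd[OF C1c_D(7)[OF \<psi>] B(1,2)])
  show "integrable (leb N) (\<lambda>x. f x * D i x)" if "i < N" by (rule bd[OF C1c_D(8)[OF \<psi> that] B(1) B(3)[OF _ that]])
qed

lemma L1_loc_diff: "f \<in> L1_loc N U \<Longrightarrow> g \<in> L1_loc N U \<Longrightarrow> (\<lambda>x. f x - g x) \<in> L1_loc N U"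
proof -
  have "cut K (\<lambda>x. f x - g x) = (\<lambda>x. cut K f x - cut K g x)" for K by (auto simp: cut_def fun_eq_iff algebra_simps)
  then show "f \<in> L1_loc N U \<Longrightarrow> g \<in> L1_loc N U \<Longrightarrow> (\<lambda>x. f x - g x) \<in> L1_loc N U"
    unfolding L1_loc_iff by simp
qed

theorem weak_deriv_unique:
  assumes U: "openin (Euclidean_space N) U" and "weak_deriv N U i f g" "weak_deriv N U i f g'"
  shows "AE x in leb N. x \<in> U \<longrightarrow> g x = g' x"
proof -
  have g: "g \<in> L1_loc N U" "g' \<in> L1_loc N U" using assms by (auto simp: weak_deriv_def)
  have "AE x in leb N. x \<in> U \<longrightarrow> g x - g' x = 0"
  proof (rule fundamental_lemma[OF U])
    show "(\<lambda>x. g x - g' x) \<in> L1_loc N U" by (rule L1_loc_diff[OF g])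
    fix \<psi> assume \<psi>: "\<psi> \<in> Cc_infty N U"
    note S = Cc_infty_C1c[OF \<psi>]
    have \<psi>S: "\<psi> \<in> Cc_infty N (supp N \<psi>)" using \<psi> by (auto simp: Cc_infty_def)
    have i: "integrable (leb N) (\<lambda>x. cut (supp N \<psi>) h x * \<psi> x)" if "h \<in> L1_loc N U" for h
      using that S(2-4) unfolding L1_loc_iff by (intro integrable_test_mult[OF S(1)]) blast
    have "(LINT x|leb N. cut (supp N \<psi>) g x * \<psi> x) = (LINT x|leb N. cut (supp N \<psi>) g' x * \<psi> x)"
    proof -
      have "- (LINT x:U|leb N. g x * \<psi> x) = - (LINT x:U|leb N. g' x * \<psi> x)"
        using assms(2,3) \<psi> unfolding weak_deriv_def by metis
      then show ?thesis unfolding test_integral_cut(1)[OF \<psi>S S(2)] neg_equal_iff_equal .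
    qed
    then have "(LINT x|leb N. cut (supp N \<psi>) g x * \<psi> x - cut (supp N \<psi>) g' x * \<psi> x) = 0"
      using i g by simp
    then show "(LINT x:U|leb N. (g x - g' x) * \<psi> x) = 0"
      unfolding test_integral_cut(1)[OF \<psi>S S(2)] by (simp add: cut_def algebra_simps)
  qed
  then show ?thesis by eventually_elim simp
qed

section \<open>Difference quotients of weakly differentiable functions\<close>

text \<open>The uniform distribution on \<open>[0,1]\<close>, so that the Jensen inequality applies to averages along a segment.\<close>

definition U01 :: "real measure" where
  "U01 = density lborel (\<lambda>\<theta>. ennreal (indicator {0..1} \<theta>))"

lemma sets_U01 [measurable_cong]: "sets U01 = sets borel"
  by (simp add: U01_def)

lemma space_U01 [simp]: "space U01 = UNIV"
  by (simp add: U01_def)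

interpretation U01: prob_space U01
proof
  have "emeasure U01 (space U01) = (\<integral>\<^sup>+\<theta>. ennreal (indicator {0..1} \<theta>) * indicator UNIV \<theta> \<partial>(lborel :: real measure))"
    unfolding U01_def by (subst emeasure_density) auto
  also have "\<dots> = (\<integral>\<^sup>+\<theta>. (indicator {0..1} \<theta> :: ennreal) \<partial>(lborel :: real measure))"
    by (intro nn_integral_cong) (auto simp: indicator_def)
  also have "\<dots> = 1" by simp
  finally show "emeasure U01 (space U01) = 1" .
qed

lemma U01_mass [simp]: "emeasure U01 UNIV = 1" "U01.prob UNIV = 1"
  using U01.emeasure_space_1 U01.prob_space by simp_all

interpretation lebU: pair_sigma_finite "leb N" U01 for N ..

lemma AE_U01: "AE \<theta> in U01. 0 \<le> \<theta> \<and> \<theta> \<le> 1"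
  unfolding U01_def by (subst AE_density) (auto simp: indicator_def)

lemma integral_U01:
  fixes f :: "real \<Rightarrow> real"
  assumes [measurable]: "f \<in> borel_measurable borel"
  shows "(LINT \<theta>|U01. f \<theta>) = (\<integral>\<theta>. f \<theta> * indicator {0..1} \<theta> \<partial>lborel)"
  unfolding U01_def using integral_density[of f lborel "indicator {0..1}"] by (simp add: mult.commute)

lemma measurable_ax_shift [measurable]:
  assumes "i < N"
  shows "(\<lambda>w. fst w \<oplus> ax i (snd w * t)) \<in> measurable (leb N \<Otimes>\<^sub>M U01) (leb N)"
proof (rule measurable_leb_add[OF measurable_fst])
  show "(\<lambda>w. ax i (snd w * t)) \<in> measurable (leb N \<Otimes>\<^sub>M U01) (leb N)"
  proof (rule measurable_into_leb)
    show "(\<lambda>w. ax i (snd w * t) j) \<in> borel_measurable (leb N \<Otimes>\<^sub>M U01)" for j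
      by (cases "j = i") (auto simp: ax_def)
  qed (use assms in auto)
qed

lemma C1c_FTC:
  assumes C: "C1c N f D S" and i: "i < N" and x: "x \<in> Rn N"
  shows "f (x \<oplus> ax i t) - f x = t * (LINT \<theta>|U01. D i (x \<oplus> ax i (\<theta> * t)))"
proof -
  have cont: "isCont (\<lambda>\<theta>. D i (x \<oplus> ax i (\<theta> * t))) s" for s
  proof -
    have "continuous_on UNIV (\<lambda>\<theta>. D i (x \<oplus> ax i (\<theta> * t)))"
    proof (rule continuous_on_compose2[OF C1c_D(4)[OF C i]])
      have "continuous_on UNIV (\<lambda>\<theta>. x \<oplus> ax i \<theta>)"
        using isCont_vadd_ax by (simp add: continuous_on_eq_continuous_at)
      then show "continuous_on UNIV (\<lambda>\<theta>. x \<oplus> ax i (\<theta> * t))"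
        by (rule continuous_on_compose2) (auto intro!: continuous_intros)
    qed (use x i in auto)
    then show ?thesis by (simp add: continuous_on_eq_continuous_at)
  qed
  have "(\<integral>\<theta>. (t * D i (x \<oplus> ax i (\<theta> * t))) * indicator {0..1} \<theta> \<partial>lborel) = f (x \<oplus> ax i (1 * t)) - f (x \<oplus> ax i (0 * t))"
  proof (rule integral_FTC_Icc_real)
    fix s :: real
    show "((\<lambda>\<theta>. f (x \<oplus> ax i (\<theta> * t))) has_real_derivative t * D i (x \<oplus> ax i (s * t))) (at s)"
      using DERIV_chain2[where f = "\<lambda>u. f (x \<oplus> ax i u)" and g = "\<lambda>\<theta>. \<theta> * t" and x = s,
          OF C1c_line_deriv[OF C i x] DERIV_cmult_right[OF DERIV_ident]] by (simp add: mult.commute)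
    show "isCont (\<lambda>\<theta>. t * D i (x \<oplus> ax i (\<theta> * t))) s" by (intro continuous_intros cont)
  qed simp
  moreover have "(\<lambda>\<theta>. t * D i (x \<oplus> ax i (\<theta> * t))) \<in> borel_measurable borel"
    by (intro borel_measurable_continuous_onI continuous_at_imp_continuous_on ballI continuous_intros cont)
  ultimately have "(LINT \<theta>|U01. t * D i (x \<oplus> ax i (\<theta> * t))) = f (x \<oplus> ax i t) - f x"
    by (subst integral_U01) (simp_all add: ax_0)
  then show ?thesis by simp
qed

lemma integrable_shift_mult:
  fixes f :: "(nat \<Rightarrow> real) \<Rightarrow> real" and q :: "(nat \<Rightarrow> real) \<times> real \<Rightarrow> real"
  assumes f: "integrable (leb N) f" and i: "i < N"
    and q [measurable]: "q \<in> borel_measurable (leb N \<Otimes>\<^sub>M U01)"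
    and B: "0 \<le> B" "\<And>x \<theta>. x \<in> Rn N \<Longrightarrow> \<bar>q (x, \<theta>)\<bar> \<le> B"
  shows "integrable (leb N \<Otimes>\<^sub>M U01) (\<lambda>(x, \<theta>). f (x \<oplus> ax i (\<theta> * t)) * q (x, \<theta>))"
proof (rule integrableI_bounded)
  have fm [measurable]: "f \<in> borel_measurable (leb N)" using f by (rule borel_measurable_integrable)
  have [measurable]: "(\<lambda>w. f (fst w \<oplus> ax i (snd w * t))) \<in> borel_measurable (leb N \<Otimes>\<^sub>M U01)"
    by (rule measurable_compose[OF measurable_ax_shift[OF i] fm])
  show "(\<lambda>(x, \<theta>). f (x \<oplus> ax i (\<theta> * t)) * q (x, \<theta>)) \<in> borel_measurable (leb N \<Otimes>\<^sub>M U01)"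
    unfolding case_prod_beta by measurable
  have "(\<integral>\<^sup>+w. ennreal (norm (case w of (x, \<theta>) \<Rightarrow> f (x \<oplus> ax i (\<theta> * t)) * q (x, \<theta>))) \<partial>(leb N \<Otimes>\<^sub>M U01))
      \<le> (\<integral>\<^sup>+w. ennreal B * ennreal \<bar>f (fst w \<oplus> ax i (snd w * t))\<bar> \<partial>(leb N \<Otimes>\<^sub>M U01))"
  proof (rule nn_integral_mono)
    fix w assume "w \<in> space (leb N \<Otimes>\<^sub>M U01)"
    then have "fst w \<in> Rn N" by (auto simp: space_pair_measure)
    with B have "\<bar>f (fst w \<oplus> ax i (snd w * t))\<bar> * \<bar>q w\<bar> \<le> \<bar>f (fst w \<oplus> ax i (snd w * t))\<bar> * B"
      by (intro mult_left_mono) (metis prod.collapse, simp)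
    then show "ennreal (norm (case w of (x, \<theta>) \<Rightarrow> f (x \<oplus> ax i (\<theta> * t)) * q (x, \<theta>))) \<le> ennreal B * ennreal \<bar>f (fst w \<oplus> ax i (snd w * t))\<bar>"
      using B(1) by (simp add: case_prod_beta abs_mult mult.commute flip: ennreal_mult)
  qed
  also have "\<dots> = ennreal B * (\<integral>\<^sup>+w. ennreal \<bar>f (fst w \<oplus> ax i (snd w * t))\<bar> \<partial>(leb N \<Otimes>\<^sub>M U01))"
    by (rule nn_integral_cmult) measurable
  also have "(\<integral>\<^sup>+w. ennreal \<bar>f (fst w \<oplus> ax i (snd w * t))\<bar> \<partial>(leb N \<Otimes>\<^sub>M U01))
      = (\<integral>\<^sup>+\<theta>. \<integral>\<^sup>+x. ennreal \<bar>f (x \<oplus> ax i (\<theta> * t))\<bar> \<partial>leb N \<partial>U01)"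
    by (subst lebU.nn_integral_snd[symmetric]) auto
  also have "\<dots> = (\<integral>\<^sup>+\<theta>. (\<integral>\<^sup>+x. ennreal \<bar>f x\<bar> \<partial>leb N) \<partial>U01)"
    by (intro nn_integral_cong nn_integral_translate[of _ N "\<lambda>x. ennreal \<bar>f x\<bar>"]) (use i in auto)
  also have "\<dots> = (\<integral>\<^sup>+x. ennreal \<bar>f x\<bar> \<partial>leb N)"
    by simp
  also have "ennreal B * \<dots> < \<infinity>"
    using f by (simp add: integrable_iff_bounded ennreal_mult_less_top)
  finally show "(\<integral>\<^sup>+w. ennreal (norm (case w of (x, \<theta>) \<Rightarrow> f (x \<oplus> ax i (\<theta> * t)) * q (x, \<theta>))) \<partial>(leb N \<Otimes>\<^sub>M U01)) < \<infinity>" .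
qed

lemma thick_shift: "x \<in> thick N K d \<Longrightarrow> i < N \<Longrightarrow> \<bar>t\<bar> \<le> d' \<Longrightarrow> x \<oplus> ax i t \<in> thick N K (d + d')"
  using thickI[of x "thick N K d" "ax i t" N d'] thick_thick[of N K d d'] ax_cube by auto

text \<open>The identity \<open>f(x + t e\<^sub>i) - f(x) = t \<integral>\<^sub>0\<^sup>1 g(x + \<theta> t e\<^sub>i) d\<theta>\<close> holds for test functions; by duality it
  passes to weak derivatives.\<close>

theorem weak_deriv_increment:
  assumes w: "weak_deriv N U i f g" and i: "i < N" and K: "compact K" "K \<subseteq> Rn N"
    and d: "0 < d" and T: "thick N K (2 * d) \<subseteq> U" and t: "\<bar>t\<bar> \<le> d"
  shows "AE x in leb N. x \<in> K \<longrightarrow>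
    f (x \<oplus> ax i t) - f x = t * (LINT \<theta>|U01. cut (thick N K (2 * d)) g (x \<oplus> ax i (\<theta> * t)))"
proof -
  let ?T = "thick N K (2 * d)"
  define F where "F = cut ?T f"
  define G where "G = cut ?T g"
  have cT: "compact ?T" "?T \<subseteq> Rn N" using compact_thick thick_subset_Rn K by auto
  have Fi: "integrable (leb N) F" and Gi: "integrable (leb N) G"
    using w cT T by (auto simp: weak_deriv_def L1_loc_iff F_def G_def)
  note [measurable] = borel_measurable_integrable[OF Fi] borel_measurable_integrable[OF Gi]
  define I where "I x = (LINT \<theta>|U01. G (x \<oplus> ax i (\<theta> * t)))" for x
  define H where "H x = F (x \<oplus> ax i t) - F x - t * I x" for x
  have Ii: "integrable (leb N) I"
    unfolding I_def
    using lebU.integrable_fst'[OF integrable_shift_mult[OF Gi i, of "\<lambda>_. 1" 1 t]] by simp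
  have Fti: "integrable (leb N) (\<lambda>x. F (x \<oplus> ax i t))"
    by (rule integrable_translate[OF ax_Rn[OF i] Fi])
  have Hi: "integrable (leb N) H" unfolding H_def using Fi Fti Ii by simp
  have "AE x in leb N. x \<in> K \<longrightarrow> H x = 0"
  \<comment> \<open>The difference of both sides annihilates every test function; the translations are moved to the test function.\<close>
  proof (rule fundamental_lemma_compact[OF K d])
    let ?T1 = "thick N K d"
    have T1: "compact ?T1" "?T1 \<subseteq> Rn N" using compact_thick thick_subset_Rn K by auto
    have [measurable]: "?T1 \<in> sets (leb N)" by (rule sets_leb_compact[OF T1])
    show "integrable (leb N) (cut ?T1 H)"
      using integrable_mult_indicator[OF _ Hi, of ?T1] by (simp add: cut_def[abs_def])
    fix \<psi> assume \<psi>: "\<psi> \<in> Cc_infty N ?T1"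
    note S = Cc_infty_C1c[OF \<psi>]
    note C = S(1)
    have \<psi>t: "(\<lambda>x. \<psi> (x \<oplus> ax i (- s))) \<in> Cc_infty N ?T"
      "x \<in> Rn N \<Longrightarrow> pd i (\<lambda>x. \<psi> (x \<oplus> ax i (- s))) x = pd i \<psi> (x \<oplus> ax i (- s))" if s: "\<bar>s\<bar> \<le> d" for s x
      using Cc_infty_translate[OF \<psi> ax_Rn[OF i], of s ?T, unfolded ax_uminus] thick_shift[of _ N K d i s d] S(2) s i
      by (auto simp: subset_iff)
    obtain B where B: "0 \<le> B" "\<And>x. x \<in> Rn N \<Longrightarrow> \<bar>\<psi> x\<bar> \<le> B" "\<And>x i. x \<in> Rn N \<Longrightarrow> i < N \<Longrightarrow> \<bar>pd i \<psi> x\<bar> \<le> B"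
      using C1c_bounded[OF C] by blast
    note [measurable] = C1c_D(7)[OF C] C1c_D(8)[OF C i]
    have out: "cut ?T1 H x * \<psi> x = H x * \<psi> x" if "x \<in> Rn N" for x
      using C1c_D(5)[OF C that] S(2) by (cases "x \<in> ?T1") auto
    have e1: "(LINT x|leb N. F (x \<oplus> ax i t) * \<psi> x) = (LINT x|leb N. F x * \<psi> (x \<oplus> ax i (- t)))"
    proof -
      have [measurable]: "(\<lambda>x. \<psi> (x \<oplus> ax i (- t))) \<in> borel_measurable (leb N)"
        by (rule measurable_translate_fun) (use i in auto)
      have "(LINT x|leb N. F (x \<oplus> ax i t) * \<psi> (x \<oplus> ax i t \<oplus> ax i (- t))) = (LINT x|leb N. F x * \<psi> (x \<oplus> ax i (- t)))"
        by (rule integral_translate[OF ax_Rn[OF i], of "\<lambda>x. F x * \<psi> (x \<oplus> ax i (- t))"]) measurable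
      then show ?thesis by (simp add: ax_add ax_0)
    qed
    have e2: "(LINT x|leb N. I x * \<psi> x) = - (LINT x|leb N. F x * (LINT \<theta>|U01. pd i \<psi> (x \<oplus> ax i (- (\<theta> * t)))))"
    proof -
      have "(LINT x|leb N. I x * \<psi> x) = (LINT x|leb N. (LINT \<theta>|U01. G (x \<oplus> ax i (\<theta> * t)) * \<psi> x))"
        unfolding I_def by simp
      also have "\<dots> = (LINT \<theta>|U01. (LINT x|leb N. G (x \<oplus> ax i (\<theta> * t)) * \<psi> x))"
        by (rule lebU.Fubini_integral[symmetric])
          (rule integrable_shift_mult[OF Gi i, of "\<lambda>w. \<psi> (fst w)" B t, simplified], use B in auto)
      also have "\<dots> = (LINT \<theta>|U01. - (LINT x|leb N. F x * pd i \<psi> (x \<oplus> ax i (- (\<theta> * t)))))"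
      proof (rule integral_cong_AE)
        show "AE \<theta> in U01. (LINT x|leb N. G (x \<oplus> ax i (\<theta> * t)) * \<psi> x) = - (LINT x|leb N. F x * pd i \<psi> (x \<oplus> ax i (- (\<theta> * t))))"
          using AE_U01
        proof eventually_elim
          case (elim \<theta>)
          have s: "\<bar>\<theta> * t\<bar> \<le> d"
          proof -
            have "\<bar>\<theta>\<bar> * \<bar>t\<bar> \<le> 1 * d" using elim t by (intro mult_mono) auto
            then show ?thesis by (simp add: abs_mult)
          qed
          have [measurable]: "(\<lambda>x. \<psi> (x \<oplus> ax i (- (\<theta> * t)))) \<in> borel_measurable (leb N)"
            by (rule measurable_translate_fun) (use i in auto)
          have "(LINT x|leb N. G (x \<oplus> ax i (\<theta> * t)) * \<psi> (x \<oplus> ax i (\<theta> * t) \<oplus> ax i (- (\<theta> * t))))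
              = (LINT x|leb N. G x * \<psi> (x \<oplus> ax i (- (\<theta> * t))))"
            by (rule integral_translate[OF ax_Rn[OF i], of "\<lambda>x. G x * \<psi> (x \<oplus> ax i (- (\<theta> * t)))"]) measurable
          then have "(LINT x|leb N. G (x \<oplus> ax i (\<theta> * t)) * \<psi> x) = (LINT x|leb N. G x * \<psi> (x \<oplus> ax i (- (\<theta> * t))))"
            by (simp add: ax_add ax_0)
          also have "\<dots> = (LINT x:U|leb N. g x * \<psi> (x \<oplus> ax i (- (\<theta> * t))))"
            unfolding G_def by (rule test_integral_cut(1)[OF \<psi>t(1)[OF s] T, symmetric])
          also have "\<dots> = - (LINT x:U|leb N. f x * pd i (\<lambda>x. \<psi> (x \<oplus> ax i (- (\<theta> * t)))) x)"
          proof -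
            have "(LINT x:U|leb N. f x * pd i (\<lambda>x. \<psi> (x \<oplus> ax i (- (\<theta> * t)))) x) = - (LINT x:U|leb N. g x * \<psi> (x \<oplus> ax i (- (\<theta> * t))))"
              using w Cc_infty_mono[OF \<psi>t(1)[OF s] T] unfolding weak_deriv_def by blast
            then show ?thesis by simp
          qed
          also have "(LINT x:U|leb N. f x * pd i (\<lambda>x. \<psi> (x \<oplus> ax i (- (\<theta> * t)))) x)
              = (LINT x|leb N. F x * pd i (\<lambda>x. \<psi> (x \<oplus> ax i (- (\<theta> * t)))) x)"
            unfolding F_def by (rule test_integral_cut(2)[OF \<psi>t(1)[OF s] T i])
          also have "\<dots> = (LINT x|leb N. F x * pd i \<psi> (x \<oplus> ax i (- (\<theta> * t))))"
            by (rule Bochner_Integration.integral_cong) (use \<psi>t(2)[OF s] in auto)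
          finally show ?case .
        qed
        have [measurable]: "(\<lambda>w. G (fst w \<oplus> ax i (snd w * t))) \<in> borel_measurable (leb N \<Otimes>\<^sub>M U01)"
          by (rule measurable_compose[OF measurable_ax_shift[OF i]]) simp
        show "(\<lambda>\<theta>. LINT x|leb N. G (x \<oplus> ax i (\<theta> * t)) * \<psi> x) \<in> borel_measurable U01"
        proof (rule leb.borel_measurable_lebesgue_integral)
          have "(\<lambda>w. G (snd w \<oplus> ax i (fst w * t))) \<in> borel_measurable (U01 \<Otimes>\<^sub>M leb N)"
            using measurable_compose[OF measurable_pair_swap' \<open>(\<lambda>w. G (fst w \<oplus> ax i (snd w * t))) \<in> _\<close>]
            by (simp add: case_prod_beta)
          then show "(\<lambda>(\<theta>, x). G (x \<oplus> ax i (\<theta> * t)) * \<psi> x) \<in> borel_measurable (U01 \<Otimes>\<^sub>M leb N)"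
            unfolding case_prod_beta by measurable
        qed
        show "(\<lambda>\<theta>. - (LINT x|leb N. F x * pd i \<psi> (x \<oplus> ax i (- (\<theta> * t))))) \<in> borel_measurable U01"
        proof (intro borel_measurable_uminus leb.borel_measurable_lebesgue_integral)
          have "(\<lambda>w. pd i \<psi> (fst w \<oplus> ax i (snd w * - t))) \<in> borel_measurable (leb N \<Otimes>\<^sub>M U01)"
            by (rule measurable_compose[OF measurable_ax_shift[OF i]]) simp
          from measurable_compose[OF measurable_pair_swap' this]
          have "(\<lambda>w. pd i \<psi> (snd w \<oplus> ax i (- (fst w * t)))) \<in> borel_measurable (U01 \<Otimes>\<^sub>M leb N)"
            by (simp add: case_prod_beta)
          then show "(\<lambda>(\<theta>, x). F x * pd i \<psi> (x \<oplus> ax i (- (\<theta> * t)))) \<in> borel_measurable (U01 \<Otimes>\<^sub>M leb N)"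
            unfolding case_prod_beta by measurable
        qed
      qed
      also have "\<dots> = - (LINT \<theta>|U01. (LINT x|leb N. F x * pd i \<psi> (x \<oplus> ax i (- (\<theta> * t)))))" by simp
      also have "(LINT \<theta>|U01. (LINT x|leb N. F x * pd i \<psi> (x \<oplus> ax i (- (\<theta> * t)))))
          = (LINT x|leb N. (LINT \<theta>|U01. F x * pd i \<psi> (x \<oplus> ax i (- (\<theta> * t)))))"
      proof (rule lebU.Fubini_integral)
        have m: "(\<lambda>w. pd i \<psi> (fst w \<oplus> ax i (snd w * - t))) \<in> borel_measurable (leb N \<Otimes>\<^sub>M U01)"
          by (rule measurable_compose[OF measurable_ax_shift[OF i]]) simp
        have "\<bar>pd i \<psi> (x \<oplus> ax i (\<theta> * - t))\<bar> \<le> B" if "x \<in> Rn N" for x \<theta>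
          using that i by (intro B(3)) auto
        with integrable_shift_mult[OF Fi i m B(1), of 0]
        show "integrable (leb N \<Otimes>\<^sub>M U01) (\<lambda>(x, \<theta>). F x * pd i \<psi> (x \<oplus> ax i (- (\<theta> * t))))"
          by (simp add: ax_0)
      qed
      finally show ?thesis by simp
    qed
    have e3: "\<psi> (x \<oplus> ax i (- t)) - \<psi> x = - t * (LINT \<theta>|U01. pd i \<psi> (x \<oplus> ax i (- (\<theta> * t))))" if "x \<in> Rn N" for x
      using C1c_FTC[OF C i that, of "- t"] by simp
    have i1: "integrable (leb N) (\<lambda>x. F x * \<psi> x)" "integrable (leb N) (\<lambda>x. F (x \<oplus> ax i t) * \<psi> x)" "integrable (leb N) (\<lambda>x. I x * \<psi> x)"
      by (rule integrable_test_mult(1)[OF C]; fact)+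
    have i2: "integrable (leb N) (\<lambda>x. F x * \<psi> (x \<oplus> ax i (- t)))"
      by (rule integrable_test_mult(1)[OF Cc_infty_C1c(1)[OF \<psi>t(1)[OF t]] Fi])
    have "(LINT x|leb N. cut ?T1 H x * \<psi> x) = (LINT x|leb N. F (x \<oplus> ax i t) * \<psi> x - F x * \<psi> x - t * (I x * \<psi> x))"
    proof (rule Bochner_Integration.integral_cong[OF refl])
      fix x assume "x \<in> space (leb N)"
      then have "cut ?T1 H x * \<psi> x = H x * \<psi> x" by (simp only: space_leb out)
      also have "\<dots> = F (x \<oplus> ax i t) * \<psi> x - F x * \<psi> x - t * (I x * \<psi> x)"
        unfolding H_def by (simp only: left_diff_distrib mult.assoc)
      finally show "cut ?T1 H x * \<psi> x = F (x \<oplus> ax i t) * \<psi> x - F x * \<psi> x - t * (I x * \<psi> x)" .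
    qed
    also have "\<dots> = (LINT x|leb N. F (x \<oplus> ax i t) * \<psi> x) - (LINT x|leb N. F x * \<psi> x) - t * (LINT x|leb N. I x * \<psi> x)"
      using i1 by simp
    also have "\<dots> = ((LINT x|leb N. F x * \<psi> (x \<oplus> ax i (- t))) - (LINT x|leb N. F x * \<psi> x)) + t * (LINT x|leb N. F x * (LINT \<theta>|U01. pd i \<psi> (x \<oplus> ax i (- (\<theta> * t)))))"
      unfolding e1 e2 by simp
    also have "(LINT x|leb N. F x * \<psi> (x \<oplus> ax i (- t))) - (LINT x|leb N. F x * \<psi> x)
        = (LINT x|leb N. F x * \<psi> (x \<oplus> ax i (- t)) - F x * \<psi> x)"
      by (rule Bochner_Integration.integral_diff[OF i2 i1(1), symmetric])
    also have "\<dots> = (LINT x|leb N. (- t) * (F x * (LINT \<theta>|U01. pd i \<psi> (x \<oplus> ax i (- (\<theta> * t))))))"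
    proof (rule Bochner_Integration.integral_cong[OF refl])
      fix x assume "x \<in> space (leb N)"
      then have "F x * \<psi> (x \<oplus> ax i (- t)) - F x * \<psi> x = F x * (- t * (LINT \<theta>|U01. pd i \<psi> (x \<oplus> ax i (- (\<theta> * t)))))"
        using e3[of x] by (simp flip: right_diff_distrib)
      then show "F x * \<psi> (x \<oplus> ax i (- t)) - F x * \<psi> x = (- t) * (F x * (LINT \<theta>|U01. pd i \<psi> (x \<oplus> ax i (- (\<theta> * t)))))"
        by simp
    qed
    also have "\<dots> = - t * (LINT x|leb N. F x * (LINT \<theta>|U01. pd i \<psi> (x \<oplus> ax i (- (\<theta> * t)))))"
      by simp
    finally show "(LINT x|leb N. cut ?T1 H x * \<psi> x) = 0" by simp
  qed
  then show ?thesis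
  proof eventually_elim
    case (elim x)
    show ?case
    proof
      assume x: "x \<in> K"
      have "x \<in> ?T" using x subset_thick[of "2 * d" K N] d by auto
      moreover have "x \<oplus> ax i t \<in> ?T" using x i t d by (intro thickI ax_cube) auto
      ultimately show "f (x \<oplus> ax i t) - f x = t * (LINT \<theta>|U01. cut ?T g (x \<oplus> ax i (\<theta> * t)))"
        using elim x by (simp add: H_def F_def I_def G_def)
    qed
  qed
qed

text \<open>The Jensen inequality along the segment, and invariance of the integral under translation.\<close>

lemma weak_deriv_increment_bound:
  assumes w: "weak_deriv N U i f g" and i: "i < N" and K: "compact K" "K \<subseteq> Rn N"
    and d: "0 < d" and T: "thick N K (2 * d) \<subseteq> U" and t: "\<bar>t\<bar> \<le> d" and q: "1 \<le> q"
  shows "(\<integral>\<^sup>+x. indicator K x * ennreal (\<bar>f (x \<oplus> ax i t) - f x\<bar> powr q) \<partial>leb N)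
    \<le> ennreal (\<bar>t\<bar> powr q) * pint N q (cut (thick N K (2 * d)) g)"
proof -
  let ?T = "thick N K (2 * d)"
  define G where "G = cut ?T g"
  have cT: "compact ?T" "?T \<subseteq> Rn N" using compact_thick thick_subset_Rn K by auto
  have Gi: "integrable (leb N) G" using w cT T by (auto simp: weak_deriv_def L1_loc_iff G_def)
  note [measurable] = borel_measurable_integrable[OF Gi]
  have Gm [measurable]: "(\<lambda>w. G (fst w \<oplus> ax i (snd w * t))) \<in> borel_measurable (leb N \<Otimes>\<^sub>M U01)"
    by (rule measurable_compose[OF measurable_ax_shift[OF i]]) simp
  have "(\<integral>\<^sup>+x. indicator K x * ennreal (\<bar>f (x \<oplus> ax i t) - f x\<bar> powr q) \<partial>leb N)
     \<le> (\<integral>\<^sup>+x. ennreal (\<bar>t\<bar> powr q) * (\<integral>\<^sup>+\<theta>. ennreal (\<bar>G (x \<oplus> ax i (\<theta> * t))\<bar> powr q) \<partial>U01) \<partial>leb N)"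
  proof (rule nn_integral_mono_AE)
    show "AE x in leb N. indicator K x * ennreal (\<bar>f (x \<oplus> ax i t) - f x\<bar> powr q)
      \<le> ennreal (\<bar>t\<bar> powr q) * (\<integral>\<^sup>+\<theta>. ennreal (\<bar>G (x \<oplus> ax i (\<theta> * t))\<bar> powr q) \<partial>U01)"
      using weak_deriv_increment[OF w i K d T t] AE_space
    proof eventually_elim
      case (elim x)
      show ?case
      proof (cases "x \<in> K")
        case True
        have "(\<lambda>\<theta>. G (x \<oplus> ax i (\<theta> * t))) \<in> borel_measurable U01"
          using measurable_compose[OF measurable_Pair1'[OF elim(2)] Gm] by simp
        from U01.jensen_powr[OF this q]
        have "ennreal (\<bar>t\<bar> powr q) * ennreal (\<bar>LINT \<theta>|U01. G (x \<oplus> ax i (\<theta> * t))\<bar> powr q)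
          \<le> ennreal (\<bar>t\<bar> powr q) * (\<integral>\<^sup>+\<theta>. ennreal (\<bar>G (x \<oplus> ax i (\<theta> * t))\<bar> powr q) \<partial>U01)"
          by (rule mult_left_mono) simp
        then show ?thesis using True elim(1)
          by (simp add: G_def abs_mult powr_mult ennreal_mult)
      qed simp
    qed
  qed
  also have "\<dots> = ennreal (\<bar>t\<bar> powr q) * (\<integral>\<^sup>+x. (\<integral>\<^sup>+\<theta>. ennreal (\<bar>G (x \<oplus> ax i (\<theta> * t))\<bar> powr q) \<partial>U01) \<partial>leb N)"
  proof (rule nn_integral_cmult)
    show "(\<lambda>x. \<integral>\<^sup>+\<theta>. ennreal (\<bar>G (x \<oplus> ax i (\<theta> * t))\<bar> powr q) \<partial>U01) \<in> borel_measurable (leb N)"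
      by (rule U01.borel_measurable_nn_integral) (simp add: case_prod_beta)
  qed
  also have "(\<integral>\<^sup>+x. (\<integral>\<^sup>+\<theta>. ennreal (\<bar>G (x \<oplus> ax i (\<theta> * t))\<bar> powr q) \<partial>U01) \<partial>leb N)
     = (\<integral>\<^sup>+\<theta>. (\<integral>\<^sup>+x. ennreal (\<bar>G (x \<oplus> ax i (\<theta> * t))\<bar> powr q) \<partial>leb N) \<partial>U01)"
    by (rule lebU.Fubini'[symmetric]) (simp add: case_prod_beta)
  also have "\<dots> = (\<integral>\<^sup>+\<theta>. pint N q G \<partial>U01)"
    by (intro nn_integral_cong) (use i pint_translate[of _ N G q] in \<open>auto simp: pint_def\<close>)
  also have "\<dots> = pint N q G" by simp
  finally show ?thesis by (simp add: G_def)
qed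

definition diffquot :: "nat \<Rightarrow> real \<Rightarrow> ((nat \<Rightarrow> real) \<Rightarrow> real) \<Rightarrow> (nat \<Rightarrow> real) \<Rightarrow> real" where
  "diffquot i t f x = (f (x \<oplus> ax i t) - f x) / t"

lemma measurable_diffquot:
  assumes [measurable]: "f \<in> borel_measurable (leb N)" and i: "i < N"
  shows "(\<lambda>x. diffquot i t f x) \<in> borel_measurable (leb N)"
proof -
  have [measurable]: "(\<lambda>x. f (x \<oplus> ax i t)) \<in> borel_measurable (leb N)"
    by (rule measurable_translate_fun) (use i in auto)
  show ?thesis unfolding diffquot_def by measurable
qed

text \<open>The difference quotient is the average of the weak derivative along a segment, so its distance to the
  weak derivative is controlled by the continuity of translations in the mean.\<close>

lemma weak_deriv_diffquot_tendsto:
  assumes w: "weak_deriv N U i f g" and i: "i < N" and K: "compact K" "K \<subseteq> Rn N" "K \<subseteq> U"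
    and U: "openin (Euclidean_space N) U" and h: "h \<longlonglongrightarrow> 0" "\<And>n. h n \<noteq> 0"
  shows "(\<lambda>n. \<integral>\<^sup>+x. indicator K x * ennreal \<bar>diffquot i (h n) f x - g x\<bar> \<partial>leb N) \<longlonglongrightarrow> 0"
proof (rule ennreal_tendsto_0I)
  fix e :: real assume e: "0 < e"
  obtain d' where d': "0 < d'" "thick N K d' \<subseteq> U" using thick_subset_open[OF K(1,3) U] by blast
  define d where "d = d' / 2"
  have d: "0 < d" "thick N K (2 * d) \<subseteq> U" using d' by (auto simp: d_def)
  let ?T = "thick N K (2 * d)"
  define G where "G = cut ?T g"
  have cT: "compact ?T" "?T \<subseteq> Rn N" using compact_thick thick_subset_Rn K by auto
  have Gi: "integrable (leb N) G" using w cT d by (auto simp: weak_deriv_def L1_loc_iff G_def)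
  note [measurable] = borel_measurable_integrable[OF Gi]
  obtain R where R: "0 < R" "?T \<subseteq> cube N R" using compact_subset_cube[OF cT] by metis
  have "translation_cont N 1 G"
  proof (rule translation_cont_bounded_support)
    show "pint N 1 G < \<infinity>" using Gi unfolding pint_def by (simp add: integrable_iff_bounded)
    show "G x = 0" if "x \<in> Rn N" "x \<notin> cube N R" for x
      unfolding G_def by (rule cut_out) (use R that in auto)
  qed auto
  then obtain d1 where d1: "0 < d1" "\<And>h. h \<in> cube N d1 \<Longrightarrow> pint N 1 (\<lambda>x. G (x \<oplus> h) - G x) \<le> ennreal e"
    using translation_cont_eps[OF _ e] by blast
  have "\<forall>\<^sub>F n in sequentially. \<bar>h n\<bar> < min d d1"
    using tendsto_rabs_zero[OF h(1)] d d1 by (intro order_tendstoD) auto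
  then show "\<forall>\<^sub>F n in sequentially. (\<integral>\<^sup>+x. indicator K x * ennreal \<bar>diffquot i (h n) f x - g x\<bar> \<partial>leb N) \<le> ennreal e"
  proof eventually_elim
    case (elim n)
    define t where "t = h n"
    have t: "\<bar>t\<bar> \<le> d" "\<bar>t\<bar> \<le> d1" "t \<noteq> 0" using elim h(2) by (auto simp: t_def)
    have Gm [measurable]: "(\<lambda>w. G (fst w \<oplus> ax i (snd w * t))) \<in> borel_measurable (leb N \<Otimes>\<^sub>M U01)"
      by (rule measurable_compose[OF measurable_ax_shift[OF i]]) simp
    have i2: "integrable (leb N \<Otimes>\<^sub>M U01) (\<lambda>(x, \<theta>). G (x \<oplus> ax i (\<theta> * t)))"
      using integrable_shift_mult[OF Gi i, of "\<lambda>_. 1" 1 t] by simp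
    have "(\<integral>\<^sup>+x. indicator K x * ennreal \<bar>diffquot i t f x - g x\<bar> \<partial>leb N)
       \<le> (\<integral>\<^sup>+x. (\<integral>\<^sup>+\<theta>. ennreal \<bar>G (x \<oplus> ax i (\<theta> * t)) - G x\<bar> \<partial>U01) \<partial>leb N)"
    proof (rule nn_integral_mono_AE)
      have "AE x in leb N. integrable U01 (\<lambda>\<theta>. G (x \<oplus> ax i (\<theta> * t)))"
        using lebU.AE_integrable_fst[OF i2] by simp
      with weak_deriv_increment[OF w i K(1,2) d t(1)]
      show "AE x in leb N. indicator K x * ennreal \<bar>diffquot i t f x - g x\<bar> \<le> (\<integral>\<^sup>+\<theta>. ennreal \<bar>G (x \<oplus> ax i (\<theta> * t)) - G x\<bar> \<partial>U01)"
      proof eventually_elim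
        case (elim x)
        show ?case
        proof (cases "x \<in> K")
          case True
          then have "x \<in> ?T" using subset_thick[of "2 * d" K N] d by auto
          then have "g x = (LINT \<theta>|U01. G x)" by (simp add: G_def)
          moreover have "diffquot i t f x = (LINT \<theta>|U01. G (x \<oplus> ax i (\<theta> * t)))"
            using elim(1) True t(3) by (simp add: diffquot_def G_def)
          ultimately have "diffquot i t f x - g x = (LINT \<theta>|U01. G (x \<oplus> ax i (\<theta> * t)) - G x)"
            using elim(2) by simp
          moreover have "ennreal \<bar>LINT \<theta>|U01. G (x \<oplus> ax i (\<theta> * t)) - G x\<bar> \<le> (\<integral>\<^sup>+\<theta>. ennreal \<bar>G (x \<oplus> ax i (\<theta> * t)) - G x\<bar> \<partial>U01)"
            using integral_norm_bound_ennreal[of U01 "\<lambda>\<theta>. G (x \<oplus> ax i (\<theta> * t)) - G x"] elim(2) by simp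
          ultimately show ?thesis using True by simp
        qed simp
      qed
    qed
    also have "\<dots> = (\<integral>\<^sup>+\<theta>. (\<integral>\<^sup>+x. ennreal \<bar>G (x \<oplus> ax i (\<theta> * t)) - G x\<bar> \<partial>leb N) \<partial>U01)"
      by (rule lebU.Fubini'[symmetric]) (simp add: case_prod_beta)
    also have "\<dots> \<le> (\<integral>\<^sup>+\<theta>. ennreal e \<partial>U01)"
    proof (rule nn_integral_mono_AE)
      show "AE \<theta> in U01. (\<integral>\<^sup>+x. ennreal \<bar>G (x \<oplus> ax i (\<theta> * t)) - G x\<bar> \<partial>leb N) \<le> ennreal e"
        using AE_U01
      proof eventually_elim
        case (elim \<theta>)
        have "\<bar>\<theta>\<bar> * \<bar>t\<bar> \<le> 1 * d1" using elim t by (intro mult_mono) auto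
        then have "ax i (\<theta> * t) \<in> cube N d1" using i by (intro ax_cube) (auto simp: abs_mult)
        from d1(2)[OF this] show ?case by (simp add: pint_def)
      qed
    qed
    also have "\<dots> = ennreal e" by simp
    finally show ?case by (simp add: t_def)
  qed
qed

section \<open>Chain rule for truncations and product rule\<close>

lemma C1c_diffquot_tendsto:
  assumes C: "C1c N f D S" and i: "i < N" and x: "x \<in> Rn N" and h: "h \<longlonglongrightarrow> 0" "\<And>n. h n \<noteq> 0"
  shows "(\<lambda>n. diffquot i (h n) f x) \<longlonglongrightarrow> D i x"
proof -
  have "((\<lambda>t. (f (x \<oplus> ax i t) - f (x \<oplus> ax i 0)) / (t - 0)) \<longlongrightarrow> D i (x \<oplus> ax i 0)) (at 0)"
    using C1c_line_deriv[OF C i x, of 0] by (simp add: has_field_derivative_iff)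
  then have "((\<lambda>t. diffquot i t f x) \<longlongrightarrow> D i x) (at 0)"
    by (simp add: ax_0 diffquot_def)
  then show ?thesis
    using h unfolding tendsto_at_iff_sequentially o_def by auto
qed

lemma C1c_diffquot_bound:
  assumes C: "C1c N f D S" and i: "i < N" and x: "x \<in> Rn N" and B: "\<And>x. x \<in> Rn N \<Longrightarrow> \<bar>D i x\<bar> \<le> B" and t: "t \<noteq> 0"
  shows "\<bar>diffquot i t f x\<bar> \<le> B"
  using C1c_lipschitz[OF C i x B, of t] t by (simp add: diffquot_def field_simps)

text \<open>A converse of the preceding convergence: shifting the difference quotient from \<open>f\<close> to the test function
  and passing to the limit on both sides recovers the integration by parts formula. Together, the
  two statements turn rules of calculus for weak derivatives into limits of difference quotients.\<close>

theorem weak_deriv_from_diffquot: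
  assumes U: "openin (Euclidean_space N) U" and f: "f \<in> L1_loc N U" and g: "g \<in> L1_loc N U" and i: "i < N"
    and \<psi>: "\<psi> \<in> Cc_infty N U" and h: "h \<longlonglongrightarrow> 0" "\<And>n. h n \<noteq> 0"
    and lim: "(\<lambda>n. \<integral>\<^sup>+x. indicator (supp N \<psi>) x * ennreal \<bar>diffquot i (h n) f x - g x\<bar> \<partial>leb N) \<longlonglongrightarrow> 0"
  shows "(LINT x:U|leb N. f x * pd i \<psi> x) = - (LINT x:U|leb N. g x * \<psi> x)"
proof -
  let ?S = "supp N \<psi>"
  note S = Cc_infty_C1c[OF \<psi>]
  note C = S(1)
  obtain d where d: "0 < d" "thick N ?S d \<subseteq> U" using thick_subset_open[OF S(3,2) U] by blast
  let ?T = "thick N ?S d"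
  define F where "F = cut ?T f"
  define G where "G = cut ?T g"
  have cT: "compact ?T" "?T \<subseteq> Rn N" using compact_thick thick_subset_Rn S by auto
  have Fi: "integrable (leb N) F" and Gi: "integrable (leb N) G"
    using f g cT d by (auto simp: L1_loc_iff F_def G_def)
  note [measurable] = borel_measurable_integrable[OF Fi] borel_measurable_integrable[OF Gi]
  note [measurable] = C1c_D(7)[OF C] C1c_D(8)[OF C i]
  have [measurable]: "?S \<in> sets (leb N)" by (rule sets_leb_compact[OF S(3,4)])
  obtain B where B: "0 \<le> B" "\<And>x. x \<in> Rn N \<Longrightarrow> \<bar>\<psi> x\<bar> \<le> B" "\<And>x i. x \<in> Rn N \<Longrightarrow> i < N \<Longrightarrow> \<bar>pd i \<psi> x\<bar> \<le> B"
    using C1c_bounded[OF C] by blast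
  have shm: "(\<lambda>x. q (x \<oplus> ax i s)) \<in> borel_measurable (leb N)" if "q \<in> borel_measurable (leb N)" for q :: "_ \<Rightarrow> real" and s
    by (rule measurable_translate_fun[OF that]) (use i in auto)
  note dqm = measurable_diffquot[OF _ i]
  have lim1: "(\<lambda>n. LINT x|leb N. F x * diffquot i (- h n) \<psi> x) \<longlonglongrightarrow> (LINT x|leb N. F x * pd i \<psi> x)"
  proof (rule integral_dominated_convergence[where w = "\<lambda>x. \<bar>F x\<bar> * B"])
    show "integrable (leb N) (\<lambda>x. \<bar>F x\<bar> * B)" using Fi by simp
    show "(\<lambda>x. F x * pd i \<psi> x) \<in> borel_measurable (leb N)" by measurable
    show "(\<lambda>x. F x * diffquot i (- h n) \<psi> x) \<in> borel_measurable (leb N)" for n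
      by (intro borel_measurable_times dqm) measurable
    show "AE x in leb N. (\<lambda>n. F x * diffquot i (- h n) \<psi> x) \<longlonglongrightarrow> F x * pd i \<psi> x"
      using tendsto_minus[OF h(1)] h(2)
      by (intro AE_I2 tendsto_mult tendsto_const C1c_diffquot_tendsto[OF C i]) auto
    show "AE x in leb N. norm (F x * diffquot i (- h n) \<psi> x) \<le> \<bar>F x\<bar> * B" for n
      using C1c_diffquot_bound[OF C i _ B(3)[OF _ i]] h(2)
      by (intro AE_I2) (auto simp: abs_mult intro!: mult_left_mono)
  qed
  have eq: "(LINT x|leb N. F x * diffquot i (- t) \<psi> x) = - (LINT x|leb N. diffquot i t F x * \<psi> x)" if t: "t \<noteq> 0" for t
  proof -
    have Fti: "integrable (leb N) (\<lambda>x. F (x \<oplus> ax i t))"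
      by (rule integrable_translate[OF ax_Rn[OF i] Fi])
    have [measurable]: "(\<lambda>x. \<psi> (x \<oplus> ax i (- t))) \<in> borel_measurable (leb N)" by (rule shm) measurable
    have "(LINT x|leb N. F (x \<oplus> ax i t) * \<psi> (x \<oplus> ax i t \<oplus> ax i (- t))) = (LINT x|leb N. F x * \<psi> (x \<oplus> ax i (- t)))"
      by (rule integral_translate[OF ax_Rn[OF i], of "\<lambda>x. F x * \<psi> (x \<oplus> ax i (- t))"]) measurable
    then have e1: "(LINT x|leb N. F x * \<psi> (x \<oplus> ax i (- t))) = (LINT x|leb N. F (x \<oplus> ax i t) * \<psi> x)"
      by (simp add: ax_add ax_0)
    have i1: "integrable (leb N) (\<lambda>x. F x * \<psi> x)" "integrable (leb N) (\<lambda>x. F (x \<oplus> ax i t) * \<psi> x)"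
      by (rule integrable_test_mult(1)[OF C]; fact)+
    have i2: "integrable (leb N) (\<lambda>x. F x * \<psi> (x \<oplus> ax i (- t)))"
    proof (rule Bochner_Integration.integrable_bound[of _ "\<lambda>x. \<bar>F x\<bar> * B"])
      show "AE x in leb N. norm (F x * \<psi> (x \<oplus> ax i (- t))) \<le> norm (\<bar>F x\<bar> * B)"
        using B(1,2) i by (intro AE_I2) (auto simp: abs_mult intro!: mult_left_mono)
    qed (use Fi in auto)
    have "(LINT x|leb N. F x * diffquot i (- t) \<psi> x) = (LINT x|leb N. (F x * \<psi> (x \<oplus> ax i (- t)) - F x * \<psi> x) / (- t))"
      by (rule Bochner_Integration.integral_cong[OF refl]) (simp add: diffquot_def right_diff_distrib)
    also have "\<dots> = (LINT x|leb N. F x * \<psi> (x \<oplus> ax i (- t)) - F x * \<psi> x) / (- t)"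
      by (rule integral_divide_zero)
    also have "(LINT x|leb N. F x * \<psi> (x \<oplus> ax i (- t)) - F x * \<psi> x) = (LINT x|leb N. F (x \<oplus> ax i t) * \<psi> x) - (LINT x|leb N. F x * \<psi> x)"
      using Bochner_Integration.integral_diff[OF i2 i1(1)] e1 by simp
    also have "\<dots> = (LINT x|leb N. F (x \<oplus> ax i t) * \<psi> x - F x * \<psi> x)"
      using Bochner_Integration.integral_diff[OF i1(2) i1(1)] by simp
    also have "\<dots> / (- t) = - ((LINT x|leb N. F (x \<oplus> ax i t) * \<psi> x - F x * \<psi> x) / t)" by simp
    also have "(LINT x|leb N. F (x \<oplus> ax i t) * \<psi> x - F x * \<psi> x) / t = (LINT x|leb N. (F (x \<oplus> ax i t) * \<psi> x - F x * \<psi> x) / t)"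
      by (rule integral_divide_zero[symmetric])
    also have "\<dots> = (LINT x|leb N. diffquot i t F x * \<psi> x)"
      by (rule Bochner_Integration.integral_cong[OF refl]) (simp add: diffquot_def left_diff_distrib)
    finally show ?thesis .
  qed
  have dqi: "integrable (leb N) (\<lambda>x. diffquot i t F x)" for t
    unfolding diffquot_def using integrable_translate[OF ax_Rn[OF i] Fi] Fi by simp
  have lim2: "(\<lambda>n. LINT x|leb N. diffquot i (h n) F x * \<psi> x) \<longlonglongrightarrow> (LINT x|leb N. G x * \<psi> x)"
  proof -
    have bd: "\<forall>\<^sub>F n in sequentially. ennreal \<bar>(LINT x|leb N. diffquot i (h n) F x * \<psi> x) - (LINT x|leb N. G x * \<psi> x)\<bar>
       \<le> ennreal B * (\<integral>\<^sup>+x. indicator ?S x * ennreal \<bar>diffquot i (h n) f x - g x\<bar> \<partial>leb N)"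
    proof -
      have "\<forall>\<^sub>F n in sequentially. \<bar>h n\<bar> < d"
        using tendsto_rabs_zero[OF h(1)] d by (intro order_tendstoD) auto
      then show ?thesis
      proof eventually_elim
        case (elim n)
        have i1: "integrable (leb N) (\<lambda>x. diffquot i (h n) F x * \<psi> x)" "integrable (leb N) (\<lambda>x. G x * \<psi> x)"
          by (rule integrable_test_mult(1)[OF C dqi], rule integrable_test_mult(1)[OF C Gi])
        let ?k = "\<lambda>x. diffquot i (h n) F x * \<psi> x - G x * \<psi> x"
        have "ennreal \<bar>(LINT x|leb N. diffquot i (h n) F x * \<psi> x) - (LINT x|leb N. G x * \<psi> x)\<bar> = ennreal (norm (LINT x|leb N. ?k x))"
          using i1 by simp
        also have "\<dots> \<le> (\<integral>\<^sup>+x. ennreal (norm (?k x)) \<partial>leb N)"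
          by (rule integral_norm_bound_ennreal) (use i1 in auto)
        also have "\<dots> \<le> (\<integral>\<^sup>+x. ennreal B * (indicator ?S x * ennreal \<bar>diffquot i (h n) F x - G x\<bar>) \<partial>leb N)"
        proof (rule nn_integral_mono)
          fix x assume "x \<in> space (leb N)"
          then have x: "x \<in> Rn N" by simp
          show "ennreal (norm (?k x)) \<le> ennreal B * (indicator ?S x * ennreal \<bar>diffquot i (h n) F x - G x\<bar>)"
          proof (cases "x \<in> ?S")
            case True
            have "norm (?k x) = \<bar>\<psi> x\<bar> * \<bar>diffquot i (h n) F x - G x\<bar>"
              by (simp add: abs_mult flip: left_diff_distrib)
            also have "\<dots> \<le> B * \<bar>diffquot i (h n) F x - G x\<bar>"
              using B(2)[OF x] by (rule mult_right_mono) simp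
            finally show ?thesis using True B(1) by (simp add: ennreal_mult[symmetric])
          qed (use C1c_D(5)[OF C x] in simp)
        qed
        also have "\<dots> = ennreal B * (\<integral>\<^sup>+x. indicator ?S x * ennreal \<bar>diffquot i (h n) F x - G x\<bar> \<partial>leb N)"
        proof (rule nn_integral_cmult)
          have [measurable]: "(\<lambda>x. diffquot i (h n) F x) \<in> borel_measurable (leb N)" by (rule dqm) simp
          show "(\<lambda>x. indicator ?S x * ennreal \<bar>diffquot i (h n) F x - G x\<bar>) \<in> borel_measurable (leb N)"
            by measurable
        qed
        also have "(\<integral>\<^sup>+x. indicator ?S x * ennreal \<bar>diffquot i (h n) F x - G x\<bar> \<partial>leb N)
            = (\<integral>\<^sup>+x. indicator ?S x * ennreal \<bar>diffquot i (h n) f x - g x\<bar> \<partial>leb N)"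
        proof (rule nn_integral_cong)
          fix x
          show "indicator ?S x * ennreal \<bar>diffquot i (h n) F x - G x\<bar> = indicator ?S x * ennreal \<bar>diffquot i (h n) f x - g x\<bar>"
          proof (cases "x \<in> ?S")
            case True
            then have "x \<in> ?T" "x \<oplus> ax i (h n) \<in> ?T"
              using subset_thick[of d ?S N] d elim i by (auto intro!: thickI ax_cube)
            then show ?thesis by (simp add: F_def G_def diffquot_def)
          qed simp
        qed
        finally show ?case .
      qed
    qed
    have "(\<lambda>n. ennreal B * (\<integral>\<^sup>+x. indicator ?S x * ennreal \<bar>diffquot i (h n) f x - g x\<bar> \<partial>leb N)) \<longlonglongrightarrow> ennreal B * 0"
      by (intro ennreal_tendsto_cmult lim) simp
    then have "(\<lambda>n. ennreal \<bar>(LINT x|leb N. diffquot i (h n) F x * \<psi> x) - (LINT x|leb N. G x * \<psi> x)\<bar>) \<longlonglongrightarrow> 0"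
      by (intro tendsto_sandwich[OF _ bd tendsto_const]) auto
    then have "(\<lambda>n. \<bar>(LINT x|leb N. diffquot i (h n) F x * \<psi> x) - (LINT x|leb N. G x * \<psi> x)\<bar>) \<longlonglongrightarrow> 0"
      by (subst (asm) ennreal_tendsto_0_iff) auto
    then show ?thesis by (simp add: tendsto_rabs_zero_iff LIM_zero_iff)
  qed
  have "(\<lambda>n. LINT x|leb N. F x * diffquot i (- h n) \<psi> x) \<longlonglongrightarrow> - (LINT x|leb N. G x * \<psi> x)"
    unfolding eq[OF h(2)] by (rule tendsto_minus[OF lim2])
  from LIMSEQ_unique[OF lim1 this]
  have "(LINT x|leb N. F x * pd i \<psi> x) = - (LINT x|leb N. G x * \<psi> x)" .
  moreover have \<psi>T: "\<psi> \<in> Cc_infty N ?T"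
    using \<psi> subset_thick[of d ?S N] d by (auto simp: Cc_infty_def)
  ultimately show ?thesis
    unfolding test_integral_cut(1)[OF \<psi>T d(2)] test_integral_cut(2)[OF \<psi>T d(2) i] F_def G_def by simp
qed

text \<open>At \<open>a = c\<close> the positive part has a kink, and the limit depends on the sign \<open>s\<close> of the increments.\<close>

lemma pos_part_diffquot_tendsto:
  fixes a c \<gamma> :: real
  assumes D: "D \<longlonglongrightarrow> \<gamma>" and t: "t \<longlonglongrightarrow> 0" "\<And>n. 0 < s * t n" and s: "s = 1 \<or> s = -1"
  shows "(\<lambda>n. (max (a + t n * D n - c) 0 - max (a - c) 0) / t n) \<longlonglongrightarrow>
    (if c < a then \<gamma> else if a = c then s * max (s * \<gamma>) 0 else 0)"
proof -
  have tD: "(\<lambda>n. a + t n * D n - c) \<longlonglongrightarrow> a - c"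
    using tendsto_diff[OF tendsto_add[OF tendsto_const[of a] tendsto_mult[OF t(1) D]] tendsto_const[of c]] by simp
  have nz: "t n \<noteq> 0" for n using t(2)[of n] by auto
  consider "c < a" | "a < c" | "a = c" by linarith
  then show ?thesis
  proof cases
    case 1
    then have "\<forall>\<^sub>F n in sequentially. 0 < a + t n * D n - c" by (intro order_tendstoD(1)[OF tD]) simp
    then have "\<forall>\<^sub>F n in sequentially. (max (a + t n * D n - c) 0 - max (a - c) 0) / t n = D n"
      by eventually_elim (use 1 nz in \<open>simp add: max_def field_simps\<close>)
    then have "(\<lambda>n. (max (a + t n * D n - c) 0 - max (a - c) 0) / t n) \<longlonglongrightarrow> \<gamma>"
      using D by (simp add: tendsto_cong)
    then show ?thesis using 1 by simp
  next
    case 2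
    then have "\<forall>\<^sub>F n in sequentially. a + t n * D n - c < 0" by (intro order_tendstoD(2)[OF tD]) simp
    then have "\<forall>\<^sub>F n in sequentially. (max (a + t n * D n - c) 0 - max (a - c) 0) / t n = 0"
      by eventually_elim (use 2 in \<open>simp add: max_def\<close>)
    then show ?thesis using 2 by (simp add: tendsto_eventually)
  next
    case 3
    have "max (t n * D n) 0 / t n = s * max (s * D n) 0" for n
      using s
    proof
      assume "s = 1"
      then show ?thesis using t(2)[of n] by (auto simp: max_def mult_le_0_iff zero_le_mult_iff)
    next
      assume "s = -1"
      then show ?thesis using t(2)[of n] by (auto simp: max_def mult_le_0_iff zero_le_mult_iff)
    qed
    moreover have "(\<lambda>n. s * max (s * D n) 0) \<longlonglongrightarrow> s * max (s * \<gamma>) 0"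
      by (intro tendsto_mult tendsto_max tendsto_const D)
    ultimately show ?thesis using 3 by simp
  qed
qed

lemma L1_loc_bounded:
  assumes U: "openin (Euclidean_space N) U" and f: "f \<in> L1_loc N U" and g: "g \<in> borel_measurable (leb N)"
    and le: "\<And>x. x \<in> U \<Longrightarrow> \<bar>g x\<bar> \<le> a * \<bar>f x\<bar> + b" and ab: "0 \<le> a" "0 \<le> b"
  shows "g \<in> L1_loc N U"
  unfolding L1_loc_iff
proof (intro allI impI)
  fix K assume K: "compact K" "K \<subseteq> Rn N" "K \<subseteq> U"
  note g [measurable]
  have Km [measurable]: "K \<in> sets (leb N)" by (rule sets_leb_compact[OF K(1,2)])
  have fi: "integrable (leb N) (cut K f)" using f K by (auto simp: L1_loc_iff)
  have bi: "integrable (leb N) (indicator K :: _ \<Rightarrow> real)"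
    using emeasure_compact_finite[OF K(1,2)] by (intro integrable_real_indicator) auto
  show "integrable (leb N) (cut K g)"
  proof (rule Bochner_Integration.integrable_bound)
    show "integrable (leb N) (\<lambda>x. a * \<bar>cut K f x\<bar> + b * indicator K x)" using fi bi by simp
    show "cut K g \<in> borel_measurable (leb N)" unfolding cut_def[abs_def] by measurable
    show "AE x in leb N. norm (cut K g x) \<le> norm (a * \<bar>cut K f x\<bar> + b * indicator K x)"
    proof (rule AE_I2)
      fix x
      show "norm (cut K g x) \<le> norm (a * \<bar>cut K f x\<bar> + b * indicator K x)"
        using le[of x] K(3) ab by (cases "x \<in> K") auto
    qed
  qed
qed

lemma weak_deriv_cong_AE:
  assumes U: "openin (Euclidean_space N) U" and w: "weak_deriv N U i f g" and g': "g' \<in> borel_measurable (leb N)" "g \<in> borel_measurable (leb N)"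
    and AE: "AE x in leb N. x \<in> U \<longrightarrow> g x = g' x"
  shows "weak_deriv N U i f g'"
proof -
  have "g' \<in> L1_loc N U"
    unfolding L1_loc_iff
  proof (intro allI impI)
    fix K assume K: "compact K" "K \<subseteq> Rn N" "K \<subseteq> U"
    note g' [measurable]
    have [measurable]: "K \<in> sets (leb N)" by (rule sets_leb_compact[OF K(1,2)])
    have "integrable (leb N) (cut K g)" using w K by (auto simp: L1_loc_iff weak_deriv_def)
    moreover have "AE x in leb N. cut K g x = cut K g' x"
      using AE by eventually_elim (use K in \<open>auto simp: cut_def indicator_def\<close>)
    ultimately show "integrable (leb N) (cut K g')"
      by (subst (asm) integrable_cong_AE[of _ _ "cut K g'"]) (auto simp: cut_def[abs_def])
  qed
  moreover have "(LINT x:U|leb N. g x * \<psi> x) = (LINT x:U|leb N. g' x * \<psi> x)" if \<psi>: "\<psi> \<in> Cc_infty N U" for \<psi>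
    unfolding set_integral_cut
  proof (rule integral_cong_AE)
    note g' [measurable]
    note [measurable] = C1c_D(7)[OF Cc_infty_C1c(1)[OF \<psi>]] sets_leb_openin[OF U]
    show "cut U (\<lambda>x. g x * \<psi> x) \<in> borel_measurable (leb N)" "cut U (\<lambda>x. g' x * \<psi> x) \<in> borel_measurable (leb N)"
      unfolding cut_def[abs_def] by measurable
    show "AE x in leb N. cut U (\<lambda>x. g x * \<psi> x) x = cut U (\<lambda>x. g' x * \<psi> x) x"
      using AE by eventually_elim (auto simp: cut_def indicator_def)
  qed
  ultimately show ?thesis using w by (auto simp: weak_deriv_def)
qed

text \<open>The difference quotients of \<open>(u - c)\<^sub>+\<close> converge almost everywhere; where \<open>u = c\<close> the limits
  for positive and for negative increments are \<open>max g 0\<close> and \<open>min g 0\<close>. Both are weak derivatives,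
  so by uniqueness \<open>g = 0\<close> almost everywhere on the level set.\<close>

theorem weak_deriv_pos_part:
  assumes U: "openin (Euclidean_space N) U" and w: "weak_deriv N U i u g" and i: "i < N"
    and um [measurable]: "u \<in> borel_measurable (leb N)" and gm [measurable]: "g \<in> borel_measurable (leb N)"
  shows "weak_deriv N U i (\<lambda>x. max (u x - c) 0) (\<lambda>x. if c < u x then g x else 0)"
proof -
  define \<phi> where "\<phi> x = max (u x - c) 0" for x
  \<comment> \<open>The candidate obtained from increments of sign \<open>s\<close>; the candidates differ only where \<open>u = c\<close>.\<close>
  define H where "H s x = (if c < u x then g x else if u x = c then s * max (s * g x) 0 else 0)" for s x
  have uL: "u \<in> L1_loc N U" and gL: "g \<in> L1_loc N U" using w by (auto simp: weak_deriv_def)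
  have [measurable]: "\<phi> \<in> borel_measurable (leb N)" unfolding \<phi>_def by measurable
  have [measurable]: "H s \<in> borel_measurable (leb N)" for s unfolding H_def by measurable
  have \<phi>L: "\<phi> \<in> L1_loc N U"
    by (rule L1_loc_bounded[OF U uL, of _ 1 "\<bar>c\<bar>"]) (auto simp: \<phi>_def)
  have Hg: "\<bar>H s x\<bar> \<le> \<bar>g x\<bar>" if "s = 1 \<or> s = -1" for s x
    using that by (auto simp: H_def max_def)
  have HL: "H s \<in> L1_loc N U" if "s = 1 \<or> s = -1" for s
    by (rule L1_loc_bounded[OF U gL, of _ 1 0]) (use Hg[OF that] in auto)
  have wH: "weak_deriv N U i \<phi> (H s)" if s: "s = 1 \<or> s = -1" for s
    unfolding weak_deriv_def
  proof (intro conjI ballI \<phi>L HL[OF s])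
    fix \<psi> assume \<psi>: "\<psi> \<in> Cc_infty N U"
    let ?S = "supp N \<psi>"
    note S = Cc_infty_C1c[OF \<psi>]
    have Sm [measurable]: "?S \<in> sets (leb N)" by (rule sets_leb_compact[OF S(3,4)])
    obtain d where d: "0 < d" "thick N ?S d \<subseteq> U" using thick_subset_open[OF S(3,2) U] by blast
    let ?T = "thick N ?S d"
    have cT: "compact ?T" "?T \<subseteq> Rn N" using compact_thick thick_subset_Rn S by auto
    define t where "t n = s * (d / real (Suc n))" for n
    have t: "t \<longlonglongrightarrow> 0"
    proof -
      have "(\<lambda>n. s * (d * (1 / real (Suc n)))) \<longlonglongrightarrow> s * (d * 0)"
        by (intro tendsto_mult tendsto_const LIMSEQ_Suc[OF lim_1_over_n])
      then show ?thesis by (simp add: t_def[abs_def])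
    qed
    have st: "0 < s * t n" "t n \<noteq> 0" "\<bar>t n\<bar> \<le> d" for n
      using s d by (auto simp: t_def field_simps)
    let ?D = "\<lambda>n x. diffquot i (t n) u x"
    note dqm = measurable_diffquot[OF _ i]
    have [measurable]: "(\<lambda>x. diffquot i (t n) u x) \<in> borel_measurable (leb N)" "(\<lambda>x. diffquot i (t n) \<phi> x) \<in> borel_measurable (leb N)" for n
      by (rule dqm, measurable)+
    have L1: "(\<lambda>n. \<integral>\<^sup>+x. indicator ?S x * ennreal \<bar>?D n x - g x\<bar> \<partial>leb N) \<longlonglongrightarrow> 0"
      by (rule weak_deriv_diffquot_tendsto[OF w i S(3,4,2) U t st(2)])
    define e where "e n x = indicator ?S x * (?D n x - g x)" for n x
    have gi: "integrable (leb N) (\<lambda>x. indicator ?S x * g x)"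
      using gL S(2-4) by (simp add: L1_loc_iff cut_def[abs_def])
    have ei: "integrable (leb N) (e n)" for n
    proof -
      have "integrable (leb N) (cut ?T u)" using uL cT d(2) by (auto simp: L1_loc_iff)
      from integrable_translate[OF ax_Rn[OF i] this]
      have "integrable (leb N) (\<lambda>x. cut ?T u (x \<oplus> ax i (t n)))" .
      from integrable_mult_indicator[OF Sm this]
      have 1: "integrable (leb N) (\<lambda>x. indicator ?S x * cut ?T u (x \<oplus> ax i (t n)))" by simp
      have 2: "integrable (leb N) (\<lambda>x. indicator ?S x * u x)"
        using uL S(2-4) by (simp add: L1_loc_iff cut_def[abs_def])
      have "e n = (\<lambda>x. (indicator ?S x * cut ?T u (x \<oplus> ax i (t n)) - indicator ?S x * u x) / t n - indicator ?S x * g x)"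
      proof
        fix x
        have "x \<in> ?S \<Longrightarrow> x \<oplus> ax i (t n) \<in> ?T" using i st(3)[of n] by (intro thickI ax_cube) auto
        then show "e n x = (indicator ?S x * cut ?T u (x \<oplus> ax i (t n)) - indicator ?S x * u x) / t n - indicator ?S x * g x"
          by (cases "x \<in> ?S") (auto simp: e_def diffquot_def)
      qed
      then show ?thesis using 1 2 gi by simp
    qed
    have "(\<lambda>n. LINT x|leb N. norm (e n x)) \<longlonglongrightarrow> 0"
    proof -
      have "ennreal (LINT x|leb N. norm (e n x)) = (\<integral>\<^sup>+x. indicator ?S x * ennreal \<bar>?D n x - g x\<bar> \<partial>leb N)" for n
      proof -
        have "ennreal (LINT x|leb N. norm (e n x)) = (\<integral>\<^sup>+x. ennreal (norm (e n x)) \<partial>leb N)"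
          by (rule nn_integral_eq_integral[symmetric]) (use ei in auto)
        also have "\<dots> = (\<integral>\<^sup>+x. indicator ?S x * ennreal \<bar>?D n x - g x\<bar> \<partial>leb N)"
          by (intro nn_integral_cong) (auto simp: e_def indicator_def)
        finally show ?thesis .
      qed
      then have "(\<lambda>n. ennreal (LINT x|leb N. norm (e n x))) \<longlonglongrightarrow> 0" using L1 by simp
      then show ?thesis by (subst (asm) ennreal_tendsto_0_iff) auto
    qed
    from tendsto_L1_AE_subseq[OF ei this]
    obtain r where r: "strict_mono (r :: nat \<Rightarrow> nat)" "AE x in leb N. (\<lambda>n. e (r n) x) \<longlonglongrightarrow> 0" by blast
    have tr: "(\<lambda>n. t (r n)) \<longlonglongrightarrow> 0" using LIMSEQ_subseq_LIMSEQ[OF t r(1)] by (simp add: o_def)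
    \<comment> \<open>The part of the error that is not controlled by the error of the quotients of \<open>u\<close>. It is dominated by \<open>2 \<bar>g\<bar>\<close>, because truncation is a contraction, although the quotients themselves are not dominated.\<close>
    let ?E = "\<lambda>n x. indicator ?S x * max (\<bar>diffquot i (t (r n)) \<phi> x - H s x\<bar> - \<bar>?D (r n) x - g x\<bar>) 0"
    have contr: "\<bar>diffquot i (t n) \<phi> x\<bar> \<le> \<bar>?D n x\<bar>" for n x
    proof -
      have "\<bar>\<phi> (x \<oplus> ax i (t n)) - \<phi> x\<bar> \<le> \<bar>u (x \<oplus> ax i (t n)) - u x\<bar>"
        by (auto simp: \<phi>_def max_def)
      then show ?thesis by (simp add: diffquot_def divide_right_mono)
    qed
    have limE: "(\<lambda>n. \<integral>\<^sup>+x. ennreal (?E n x) \<partial>leb N) \<longlonglongrightarrow> (\<integral>\<^sup>+x. 0 \<partial>leb N)"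
    proof (rule nn_integral_dominated_convergence[where w = "\<lambda>x. ennreal (2 * \<bar>indicator ?S x * g x\<bar>)"])
      have "integrable (leb N) (\<lambda>x. 2 * \<bar>indicator ?S x * g x\<bar>)" using gi by simp
      then show "(\<integral>\<^sup>+x. ennreal (2 * \<bar>indicator ?S x * g x\<bar>) \<partial>leb N) < \<infinity>"
        by (subst nn_integral_eq_integral) auto
      show "AE x in leb N. ennreal (?E n x) \<le> ennreal (2 * \<bar>indicator ?S x * g x\<bar>)" for n
      proof (intro AE_I2 ennreal_leI)
        fix x
        show "?E n x \<le> 2 * \<bar>indicator ?S x * g x\<bar>"
          using contr[of "r n" x] Hg[OF s, of x] by (cases "x \<in> ?S") auto
      qed
      show "AE x in leb N. (\<lambda>n. ennreal (?E n x)) \<longlonglongrightarrow> 0"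
        using r(2)
      proof eventually_elim
        case (elim x)
        have "(\<lambda>n. ?E n x) \<longlonglongrightarrow> 0"
        proof (cases "x \<in> ?S")
          case True
          then have D: "(\<lambda>n. ?D (r n) x) \<longlonglongrightarrow> g x" using elim by (simp add: e_def LIM_zero_iff)
          have "(\<lambda>n. (max (u x + t (r n) * ?D (r n) x - c) 0 - max (u x - c) 0) / t (r n)) \<longlonglongrightarrow> H s x"
            unfolding H_def by (rule pos_part_diffquot_tendsto[OF D tr st(1) s])
          moreover have "u x + t (r n) * ?D (r n) x = u (x \<oplus> ax i (t (r n)))" for n
            using st(2)[of "r n"] by (simp add: diffquot_def)
          ultimately have P: "(\<lambda>n. diffquot i (t (r n)) \<phi> x) \<longlonglongrightarrow> H s x"
            by (simp add: diffquot_def \<phi>_def)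
          have "(\<lambda>n. max (\<bar>diffquot i (t (r n)) \<phi> x - H s x\<bar> - \<bar>?D (r n) x - g x\<bar>) 0) \<longlonglongrightarrow> max (\<bar>H s x - H s x\<bar> - \<bar>g x - g x\<bar>) 0"
            by (intro tendsto_max tendsto_diff tendsto_rabs P D tendsto_const)
          then show ?thesis using True by simp
        qed simp
        then show ?case using tendsto_ennrealI[of "\<lambda>n. ?E n x" 0] by simp
      qed
    qed measurable
    show "(LINT x:U|leb N. \<phi> x * pd i \<psi> x) = - (LINT x:U|leb N. H s x * \<psi> x)"
    proof (rule weak_deriv_from_diffquot[OF U \<phi>L HL[OF s] i \<psi> tr st(2)])
      have le: "(\<integral>\<^sup>+x. indicator ?S x * ennreal \<bar>diffquot i (t (r n)) \<phi> x - H s x\<bar> \<partial>leb N)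
          \<le> (\<integral>\<^sup>+x. indicator ?S x * ennreal \<bar>?D (r n) x - g x\<bar> \<partial>leb N) + (\<integral>\<^sup>+x. ennreal (?E n x) \<partial>leb N)" for n
      proof -
        have "(\<integral>\<^sup>+x. indicator ?S x * ennreal \<bar>diffquot i (t (r n)) \<phi> x - H s x\<bar> \<partial>leb N)
          \<le> (\<integral>\<^sup>+x. indicator ?S x * ennreal \<bar>?D (r n) x - g x\<bar> + ennreal (?E n x) \<partial>leb N)"
        proof (rule nn_integral_mono)
          fix x
          have *: "ennreal a \<le> ennreal b + ennreal (max (a - b) 0)" if "0 \<le> b" for a b :: real
          proof -
            have "ennreal a \<le> ennreal (b + max (a - b) 0)" by (rule ennreal_leI) simp
            also have "\<dots> = ennreal b + ennreal (max (a - b) 0)" using that by (intro ennreal_plus) auto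
            finally show ?thesis .
          qed
          show "indicator ?S x * ennreal \<bar>diffquot i (t (r n)) \<phi> x - H s x\<bar> \<le> indicator ?S x * ennreal \<bar>?D (r n) x - g x\<bar> + ennreal (?E n x)"
          proof (cases "x \<in> ?S")
            case True
            then show ?thesis
              using *[of "\<bar>?D (r n) x - g x\<bar>" "\<bar>diffquot i (t (r n)) \<phi> x - H s x\<bar>"] by simp
          qed simp
        qed
        also have "\<dots> = (\<integral>\<^sup>+x. indicator ?S x * ennreal \<bar>?D (r n) x - g x\<bar> \<partial>leb N) + (\<integral>\<^sup>+x. ennreal (?E n x) \<partial>leb N)"
          by (rule nn_integral_add) measurable
        finally show ?thesis .
      qed
      have "(\<lambda>n. \<integral>\<^sup>+x. indicator ?S x * ennreal \<bar>?D (r n) x - g x\<bar> \<partial>leb N) \<longlonglongrightarrow> 0"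
        using LIMSEQ_subseq_LIMSEQ[OF L1 r(1)] by (simp add: o_def)
      from tendsto_add[OF this limE]
      have "(\<lambda>n. (\<integral>\<^sup>+x. indicator ?S x * ennreal \<bar>?D (r n) x - g x\<bar> \<partial>leb N) + (\<integral>\<^sup>+x. ennreal (?E n x) \<partial>leb N)) \<longlonglongrightarrow> 0"
        by simp
      from ennreal_tendsto_0_le[OF le this]
      show "(\<lambda>n. \<integral>\<^sup>+x. indicator ?S x * ennreal \<bar>diffquot i (t (r n)) \<phi> x - H s x\<bar> \<partial>leb N) \<longlonglongrightarrow> 0" .
    qed
  qed
  have "AE x in leb N. x \<in> U \<longrightarrow> H 1 x = H (-1) x"
    by (rule weak_deriv_unique[OF U wH wH]) auto
  then have "AE x in leb N. x \<in> U \<longrightarrow> H 1 x = (if c < u x then g x else 0)"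
    by eventually_elim (auto simp: H_def max_def split: if_splits)
  from weak_deriv_cong_AE[OF U wH _ _ this]
  show ?thesis unfolding \<phi>_def[abs_def] by simp
qed

text \<open>The discrete product rule splits the error of the difference quotient into the error for \<open>f\<close>, the oscillation of
  \<open>z\<close> times the derivative of \<open>f\<close>, and \<open>f\<close> times the error for \<open>z\<close>; each part tends to \<open>0\<close> in the mean.\<close>

theorem weak_deriv_mult_C1c:
  assumes U: "openin (Euclidean_space N) U" and w: "weak_deriv N U i f g" and i: "i < N" and C: "C1c N z D Z"
    and [measurable]: "f \<in> borel_measurable (leb N)" "g \<in> borel_measurable (leb N)"
  shows "weak_deriv N U i (\<lambda>x. f x * z x) (\<lambda>x. g x * z x + f x * D i x)"
proof -
  have fL: "f \<in> L1_loc N U" and gL: "g \<in> L1_loc N U" using w by (auto simp: weak_deriv_def)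
  note [measurable] = C1c_D(7)[OF C] C1c_D(8)[OF C i]
  obtain B where B: "0 \<le> B" "\<And>x. x \<in> Rn N \<Longrightarrow> \<bar>z x\<bar> \<le> B" "\<And>x i. x \<in> Rn N \<Longrightarrow> i < N \<Longrightarrow> \<bar>D i x\<bar> \<le> B"
    using C1c_bounded[OF C] by blast
  have URn: "U \<subseteq> Rn N" by (rule openin_subset_Rn[OF U])
  have mL: "(\<lambda>x. q x * k x) \<in> L1_loc N U" if "q \<in> L1_loc N U" and [measurable]: "q \<in> borel_measurable (leb N)" "k \<in> borel_measurable (leb N)"
    and k: "\<And>x. x \<in> Rn N \<Longrightarrow> \<bar>k x\<bar> \<le> B" for q k
  proof (rule L1_loc_bounded[OF U that(1), of _ B 0])
    fix x assume "x \<in> U"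
    then have "\<bar>q x\<bar> * \<bar>k x\<bar> \<le> \<bar>q x\<bar> * B" using k[of x] URn by (intro mult_left_mono) auto
    then show "\<bar>q x * k x\<bar> \<le> B * \<bar>q x\<bar> + 0" by (simp add: abs_mult mult.commute)
  qed (use B in auto)
  have addL: "(\<lambda>x. a x + b x) \<in> L1_loc N U" if "a \<in> L1_loc N U" "b \<in> L1_loc N U" for a b
  proof -
    have "cut K (\<lambda>x. a x + b x) = (\<lambda>x. cut K a x + cut K b x)" for K by (auto simp: cut_def fun_eq_iff algebra_simps)
    then show ?thesis using that unfolding L1_loc_iff by simp
  qed
  have fzL: "(\<lambda>x. f x * z x) \<in> L1_loc N U" by (rule mL[OF fL]) (use B in auto)
  have GL: "(\<lambda>x. g x * z x + f x * D i x) \<in> L1_loc N U"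
    by (intro addL mL fL gL) (use B i in auto)
  note dqm = measurable_diffquot[OF _ i]
  show ?thesis
    unfolding weak_deriv_def
  proof (intro conjI ballI fzL GL)
    fix \<psi> assume \<psi>: "\<psi> \<in> Cc_infty N U"
    let ?S = "supp N \<psi>"
    note S = Cc_infty_C1c[OF \<psi>]
    have Sm [measurable]: "?S \<in> sets (leb N)" by (rule sets_leb_compact[OF S(3,4)])
    define t where "t n = 1 / real (Suc n)" for n
    have t: "t \<longlonglongrightarrow> 0" unfolding t_def by (rule LIMSEQ_Suc[OF lim_1_over_n])
    have t0: "t n \<noteq> 0" for n by (simp add: t_def)
    have [measurable]: "(\<lambda>x. diffquot i (t n) z x) \<in> borel_measurable (leb N)" "(\<lambda>x. diffquot i (t n) f x) \<in> borel_measurable (leb N)" for n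
      by (rule dqm, measurable)+
    have fi: "integrable (leb N) (\<lambda>x. indicator ?S x * f x)" and gi: "integrable (leb N) (\<lambda>x. indicator ?S x * g x)"
      using fL gL S(2-4) by (auto simp: L1_loc_iff cut_def[abs_def])
    let ?a = "\<lambda>n. \<integral>\<^sup>+x. indicator ?S x * ennreal \<bar>diffquot i (t n) f x - g x\<bar> \<partial>leb N"
    let ?b = "\<lambda>n. \<integral>\<^sup>+x. ennreal \<bar>indicator ?S x * g x\<bar> \<partial>leb N"
    let ?c = "\<lambda>n. \<integral>\<^sup>+x. ennreal (\<bar>indicator ?S x * f x\<bar> * \<bar>diffquot i (t n) z x - D i x\<bar>) \<partial>leb N"
    have la: "?a \<longlonglongrightarrow> 0" by (rule weak_deriv_diffquot_tendsto[OF w i S(3,4,2) U t t0])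
    have bfin: "?b 0 < \<top>" using gi by (simp add: integrable_iff_bounded)
    have lc: "?c \<longlonglongrightarrow> (\<integral>\<^sup>+x. 0 \<partial>leb N)"
    proof (rule nn_integral_dominated_convergence[where w = "\<lambda>x. ennreal (2 * B * \<bar>indicator ?S x * f x\<bar>)"])
      have "integrable (leb N) (\<lambda>x. 2 * B * \<bar>indicator ?S x * f x\<bar>)" using fi by simp
      then show "(\<integral>\<^sup>+x. ennreal (2 * B * \<bar>indicator ?S x * f x\<bar>) \<partial>leb N) < \<infinity>"
        using B(1) by (subst nn_integral_eq_integral) auto
      show "AE x in leb N. ennreal (\<bar>indicator ?S x * f x\<bar> * \<bar>diffquot i (t n) z x - D i x\<bar>) \<le> ennreal (2 * B * \<bar>indicator ?S x * f x\<bar>)" for n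
      proof (intro AE_I2 ennreal_leI)
        fix x assume "x \<in> space (leb N)"
        then have x: "x \<in> Rn N" by simp
        have "\<bar>diffquot i (t n) z x - D i x\<bar> \<le> 2 * B"
          using C1c_diffquot_bound[OF C i x B(3)[OF _ i] t0[of n]] B(3)[OF x i] by linarith
        then have "\<bar>indicator ?S x * f x\<bar> * \<bar>diffquot i (t n) z x - D i x\<bar> \<le> \<bar>indicator ?S x * f x\<bar> * (2 * B)"
          by (rule mult_left_mono) simp
        then show "\<bar>indicator ?S x * f x\<bar> * \<bar>diffquot i (t n) z x - D i x\<bar> \<le> 2 * B * \<bar>indicator ?S x * f x\<bar>"
          by (simp only: mult_ac)
      qed
      show "AE x in leb N. (\<lambda>n. ennreal (\<bar>indicator ?S x * f x\<bar> * \<bar>diffquot i (t n) z x - D i x\<bar>)) \<longlonglongrightarrow> 0"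
      proof (rule AE_I2)
        fix x assume "x \<in> space (leb N)"
        then have "(\<lambda>n. \<bar>indicator ?S x * f x\<bar> * \<bar>diffquot i (t n) z x - D i x\<bar>) \<longlonglongrightarrow> \<bar>indicator ?S x * f x\<bar> * \<bar>D i x - D i x\<bar>"
          by (intro tendsto_mult tendsto_rabs tendsto_diff tendsto_const C1c_diffquot_tendsto[OF C i _ t t0]) simp
        then show "(\<lambda>n. ennreal (\<bar>indicator ?S x * f x\<bar> * \<bar>diffquot i (t n) z x - D i x\<bar>)) \<longlonglongrightarrow> 0"
          using tendsto_ennrealI[of _ 0] by simp
      qed
    qed measurable
    show "(LINT x:U|leb N. f x * z x * pd i \<psi> x) = - (LINT x:U|leb N. (g x * z x + f x * D i x) * \<psi> x)"
    proof (rule weak_deriv_from_diffquot[OF U fzL GL i \<psi> t t0])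
      have le: "(\<integral>\<^sup>+x. indicator ?S x * ennreal \<bar>diffquot i (t n) (\<lambda>x. f x * z x) x - (g x * z x + f x * D i x)\<bar> \<partial>leb N)
         \<le> ennreal B * ?a n + (ennreal (B * t n) * ?b n + ?c n)" for n
      proof -
        have "(\<integral>\<^sup>+x. indicator ?S x * ennreal \<bar>diffquot i (t n) (\<lambda>x. f x * z x) x - (g x * z x + f x * D i x)\<bar> \<partial>leb N)
         \<le> (\<integral>\<^sup>+x. ennreal B * (indicator ?S x * ennreal \<bar>diffquot i (t n) f x - g x\<bar>)
             + (ennreal (B * t n) * ennreal \<bar>indicator ?S x * g x\<bar> + ennreal (\<bar>indicator ?S x * f x\<bar> * \<bar>diffquot i (t n) z x - D i x\<bar>)) \<partial>leb N)"
        proof (rule nn_integral_mono)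
          fix x assume "x \<in> space (leb N)"
          then have x: "x \<in> Rn N" by simp
          show "indicator ?S x * ennreal \<bar>diffquot i (t n) (\<lambda>x. f x * z x) x - (g x * z x + f x * D i x)\<bar>
            \<le> ennreal B * (indicator ?S x * ennreal \<bar>diffquot i (t n) f x - g x\<bar>)
             + (ennreal (B * t n) * ennreal \<bar>indicator ?S x * g x\<bar> + ennreal (\<bar>indicator ?S x * f x\<bar> * \<bar>diffquot i (t n) z x - D i x\<bar>))"
          proof (cases "x \<in> ?S")
            case True
            let ?x = "x \<oplus> ax i (t n)"
            define P where "P = diffquot i (t n) f x - g x"
            define Q where "Q = z ?x - z x"
            define R where "R = diffquot i (t n) z x - D i x"
            have "diffquot i (t n) (\<lambda>x. f x * z x) x - (g x * z x + f x * D i x) = z ?x * P + (Q * g x + f x * R)"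
              using t0[of n] by (simp add: diffquot_def P_def Q_def R_def field_simps)
            also have "abs (z ?x * P + (Q * g x + f x * R)) \<le> abs (z ?x * P) + abs (Q * g x + f x * R)"
              by (rule abs_triangle_ineq)
            also have "abs (Q * g x + f x * R) \<le> abs (Q * g x) + abs (f x * R)"
              by (rule abs_triangle_ineq)
            also have "abs (z ?x * P) \<le> B * abs P"
              unfolding abs_mult using B(2)[of ?x] x i by (intro mult_right_mono) auto
            also have "abs (Q * g x) \<le> B * t n * abs (g x)"
              unfolding abs_mult Q_def using C1c_lipschitz[OF C i x B(3)[OF _ i], of "t n"]
              by (intro mult_right_mono) (auto simp: t_def)
            also have "abs (f x * R) = abs (f x) * abs R" by (rule abs_mult)
            finally show ?thesis using True B(1)
              by (simp add: P_def R_def t_def ennreal_leI flip: ennreal_plus ennreal_mult)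
          qed simp
        qed
        also have "\<dots> = (\<integral>\<^sup>+x. ennreal B * (indicator ?S x * ennreal \<bar>diffquot i (t n) f x - g x\<bar>) \<partial>leb N)
             + (\<integral>\<^sup>+x. ennreal (B * t n) * ennreal \<bar>indicator ?S x * g x\<bar> + ennreal (\<bar>indicator ?S x * f x\<bar> * \<bar>diffquot i (t n) z x - D i x\<bar>) \<partial>leb N)"
          by (rule nn_integral_add) measurable
        also have "(\<integral>\<^sup>+x. ennreal B * (indicator ?S x * ennreal \<bar>diffquot i (t n) f x - g x\<bar>) \<partial>leb N) = ennreal B * ?a n"
          by (rule nn_integral_cmult) measurable
        also have "(\<integral>\<^sup>+x. ennreal (B * t n) * ennreal \<bar>indicator ?S x * g x\<bar> + ennreal (\<bar>indicator ?S x * f x\<bar> * \<bar>diffquot i (t n) z x - D i x\<bar>) \<partial>leb N)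
          = (\<integral>\<^sup>+x. ennreal (B * t n) * ennreal \<bar>indicator ?S x * g x\<bar> \<partial>leb N) + ?c n"
          by (rule nn_integral_add) measurable
        also have "(\<integral>\<^sup>+x. ennreal (B * t n) * ennreal \<bar>indicator ?S x * g x\<bar> \<partial>leb N) = ennreal (B * t n) * ?b n"
          by (rule nn_integral_cmult) measurable
        finally show ?thesis .
      qed
      have "(\<lambda>n. ennreal B * ?a n + (ennreal (B * t n) * ?b n + ?c n)) \<longlonglongrightarrow> ennreal B * 0 + (0 + (\<integral>\<^sup>+x. 0 \<partial>leb N))"
      proof (intro tendsto_add ennreal_tendsto_cmult la lc)
        have "(\<lambda>n. ennreal (B * t n)) \<longlonglongrightarrow> ennreal (B * 0)"
          by (intro tendsto_ennrealI tendsto_mult tendsto_const t)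
        then have "(\<lambda>n. ?b 0 * ennreal (B * t n)) \<longlonglongrightarrow> ?b 0 * 0"
          using bfin by (intro ennreal_tendsto_cmult) auto
        then show "(\<lambda>n. ennreal (B * t n) * ?b n) \<longlonglongrightarrow> 0" by (simp add: mult.commute)
      qed simp
      then have "(\<lambda>n. ennreal B * ?a n + (ennreal (B * t n) * ?b n + ?c n)) \<longlonglongrightarrow> 0" by simp
      from ennreal_tendsto_0_le[OF le this]
      show "(\<lambda>n. \<integral>\<^sup>+x. indicator ?S x * ennreal \<bar>diffquot i (t n) (\<lambda>x. f x * z x) x - (g x * z x + f x * D i x)\<bar> \<partial>leb N) \<longlonglongrightarrow> 0" .
    qed
  qed
qed

section \<open>Membership in the space of admissible test functions\<close>

lemma weak_deriv_mono:
  assumes w: "weak_deriv N U i f g" and VU: "V \<subseteq> U" and i: "i < N"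
  shows "weak_deriv N V i f g"
  unfolding weak_deriv_def
proof (intro conjI ballI)
  show "f \<in> L1_loc N V" "g \<in> L1_loc N V" using w L1_loc_mono[OF _ VU] by (auto simp: weak_deriv_def)
  fix \<psi> assume \<psi>: "\<psi> \<in> Cc_infty N V"
  have "(LINT x:U|leb N. f x * pd i \<psi> x) = - (LINT x:U|leb N. g x * \<psi> x)"
    using w Cc_infty_mono[OF \<psi> VU] by (auto simp: weak_deriv_def)
  then show "(LINT x:V|leb N. f x * pd i \<psi> x) = - (LINT x:V|leb N. g x * \<psi> x)"
    unfolding test_integral_cut(1)[OF \<psi> VU] test_integral_cut(2)[OF \<psi> VU i]
      test_integral_cut(1)[OF \<psi> order_refl] test_integral_cut(2)[OF \<psi> order_refl i] .
qed

lemma weak_deriv_cut: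
  assumes w: "weak_deriv N U i f g"
  shows "weak_deriv N U i f (cut U g)"
proof -
  have "cut K (cut U g) = cut K g" if "K \<subseteq> U" for K
    using that by (auto simp: cut_def fun_eq_iff indicator_def)
  then have "cut U g \<in> L1_loc N U" using w by (auto simp: weak_deriv_def L1_loc_iff)
  moreover have "(LINT x:U|leb N. cut U g x * \<psi> x) = (LINT x:U|leb N. g x * \<psi> x)" for \<psi>
    unfolding set_lebesgue_integral_def
    by (intro Bochner_Integration.integral_cong) (auto simp: cut_def indicator_def)
  ultimately show ?thesis using w by (auto simp: weak_deriv_def)
qed

text \<open>Weak gradients are unique almost everywhere, so the choice made by \<^const>\<open>wgrad\<close> can be replaced by any
  explicit representative.\<close>

lemma wgrad_AE:
  assumes U: "openin (Euclidean_space N) U" and G: "is_weak_gradient N U f G"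
  shows "is_weak_gradient N U f (wgrad N U f)"
    and "AE x in leb N. x \<in> U \<longrightarrow> (\<forall>i<N. wgrad N U f x i = G x i)"
proof -
  show w: "is_weak_gradient N U f (wgrad N U f)"
    unfolding wgrad_def by (rule someI[of "is_weak_gradient N U f", OF G])
  have "AE x in leb N. \<forall>i\<in>{..<N}. x \<in> U \<longrightarrow> wgrad N U f x i = G x i"
  proof (rule AE_finite_allI)
    fix i assume "i \<in> {..<N}"
    then show "AE x in leb N. x \<in> U \<longrightarrow> wgrad N U f x i = G x i"
      using w G by (intro weak_deriv_unique[OF U]) (auto simp: is_weak_gradient_iff)
  qed simp
  then show "AE x in leb N. x \<in> U \<longrightarrow> (\<forall>i<N. wgrad N U f x i = G x i)"
    by eventually_elim auto
qed

lemma compactly_inside_nbhd: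
  assumes K: "compact K" "K \<subseteq> U" and U: "openin (Euclidean_space N) U"
  obtains V where "K \<subseteq> V" "compactly_inside N V U" "openin (Euclidean_space N) V" "V \<subseteq> U"
proof -
  obtain d where d: "0 < d" "thick N K d \<subseteq> U" using thick_subset_open[OF K U] by blast
  have KR: "K \<subseteq> Rn N" using K openin_subset_Rn[OF U] by auto
  define O' where "O' = (\<Union>k\<in>K. \<Inter>i<N. {x :: nat \<Rightarrow> real. k i - d < x i} \<inter> {x. x i < k i + d})"
  have oO: "open O'"
    unfolding O'_def
    by (intro open_UN ballI open_INT open_Int open_Collect_less continuous_on_const continuous_on_product_coordinates) auto
  define V where "V = Rn N \<inter> O'"
  have oV: "openin (Euclidean_space N) V" unfolding openin_iff V_def using oO by blast
  have KV: "K \<subseteq> V"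
  proof
    fix x assume "x \<in> K"
    then show "x \<in> V" using KR d by (force simp: V_def O'_def)
  qed
  have VT: "V \<subseteq> thick N K d"
  proof
    fix x assume x: "x \<in> V"
    then obtain k where k: "k \<in> K" "\<And>i. i < N \<Longrightarrow> k i - d < x i \<and> x i < k i + d"
      by (auto simp: V_def O'_def)
    have "\<bar>(x - k) i\<bar> \<le> d" if "i < N" for i using k(2)[OF that] by (simp add: abs_le_iff)
    then have "x - k \<in> cube N d" using x k KR by (auto simp: cube_def V_def)
    from thickI[OF k(1) this] show "x \<in> thick N K d" by simp
  qed
  have cT: "compact (thick N K d)" "thick N K d \<subseteq> Rn N" using compact_thick[OF K(1)] thick_subset_Rn[OF KR] by auto
  have cl: "Euclidean_space N closure_of V = closure V"
    by (rule closure_of_iff) (use VT cT in auto)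
  have clT: "closure V \<subseteq> thick N K d" by (rule closure_minimal[OF VT compact_imp_closed[OF cT(1)]])
  have "compact (closure V)" using compact_Int_closed[OF cT(1) closed_closure, of V] clT by (simp add: Int_absorb1)
  then have "compactly_inside N V U"
    unfolding compactly_inside_def cl using oV clT cT d by (auto simp: compactin_iff)
  with KV oV VT d show ?thesis by (intro that[of V]) auto
qed

lemma abs_powr_deriv:
  fixes p \<tau> :: real
  assumes p: "1 < p"
  shows "((\<lambda>\<tau>. \<bar>\<tau>\<bar> powr p) has_real_derivative p * \<bar>\<tau>\<bar> powr (p - 1) * sgn \<tau>) (at \<tau>)"
proof -
  consider "0 < \<tau>" | "\<tau> < 0" | "\<tau> = 0" by linarith
  then show ?thesis
  proof cases
    case 1
    have "((\<lambda>\<tau>. \<tau> powr p) has_real_derivative p * \<tau> powr (p - 1)) (at \<tau>)"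
      by (rule has_real_derivative_powr[OF 1])
    then have "((\<lambda>\<tau>. \<bar>\<tau>\<bar> powr p) has_real_derivative p * \<tau> powr (p - 1)) (at \<tau>)"
      by (rule has_field_derivative_transform_within_open[of _ _ _ "{0<..}"]) (use 1 in auto)
    then show ?thesis using 1 by simp
  next
    case 2
    have "((\<lambda>\<tau>. (- \<tau>) powr p) has_real_derivative (p * (- \<tau>) powr (p - 1)) * (- 1)) (at \<tau>)"
      by (rule DERIV_chain2[where f = "\<lambda>\<tau>. \<tau> powr p" and g = "\<lambda>\<tau>. - \<tau>", OF has_real_derivative_powr DERIV_minus[OF DERIV_ident]]) (use 2 in auto)
    then have "((\<lambda>\<tau>. \<bar>\<tau>\<bar> powr p) has_real_derivative (p * (- \<tau>) powr (p - 1)) * (- 1)) (at \<tau>)"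
      by (rule has_field_derivative_transform_within_open[of _ _ _ "{..<0}"]) (use 2 in auto)
    then show ?thesis using 2 by simp
  next
    case 3
    have "((\<lambda>h::real. \<bar>h\<bar>) \<longlongrightarrow> 0) (at 0)" by (intro tendsto_rabs_zero tendsto_ident_at)
    then have "((\<lambda>h::real. \<bar>h\<bar> powr (p - 1)) \<longlongrightarrow> 0 powr (p - 1)) (at 0)"
      by (rule tendsto_powr'[OF _ tendsto_const]) (use p in auto)
    then have lim: "((\<lambda>h::real. \<bar>h\<bar> powr (p - 1)) \<longlongrightarrow> 0) (at 0)" using p by simp
    have le: "norm (\<bar>h\<bar> powr p / h) \<le> \<bar>h\<bar> powr (p - 1)" if "h \<noteq> 0" for h :: real
      using that powr_diff[of "\<bar>h\<bar>" p 1] by simp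
    have "\<forall>\<^sub>F h::real in at 0. norm (\<bar>h\<bar> powr p / h) \<le> \<bar>h\<bar> powr (p - 1)"
      using eventually_neq_at_within[of 0 0 UNIV] by eventually_elim (rule le)
    then have "((\<lambda>h::real. \<bar>h\<bar> powr p / h) \<longlongrightarrow> 0) (at 0)"
      by (rule Lim_null_comparison[OF _ lim])
    then show ?thesis using 3 p by (simp add: DERIV_def)
  qed
qed

text \<open>For \<open>p > 1\<close> the map \<open>t \<mapsto> \<bar>t\<bar>\<^sup>p\<close> is continuously differentiable on the whole line. It agrees with
  \<open>t\<^sup>p\<close> at the values of the nonnegative function \<open>w\<close>, also in the zeros of \<open>w\<close>.\<close>

lemma C1c_powr:
  assumes C: "C1c N w D S" and p: "1 < p" and nn: "\<And>x. x \<in> Rn N \<Longrightarrow> 0 \<le> w x"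
  shows "C1c N (\<lambda>x. w x powr p) (\<lambda>i x. p * w x powr (p - 1) * D i x) S"
  unfolding C1c_def
proof (intro conjI allI impI ballI)
  note w = C1c_D[OF C]
  show "compact S" "S \<subseteq> Rn N" by (fact w)+
  show "continuous_on (Rn N) (\<lambda>x. w x powr p)"
    using nn p by (intro continuous_on_powr' w continuous_on_const) auto
  show "continuous_on (Rn N) (\<lambda>x. p * w x powr (p - 1) * D i x)" if "i < N" for i
    using nn p that by (intro continuous_on_mult continuous_on_powr' w continuous_on_const) auto
  fix x assume x: "x \<in> Rn N - S"
  then show "w x powr p = 0" using w(5)[of x] by simp
  show "p * w x powr (p - 1) * D i x = 0" if "i < N" for i using x w(6)[of x i] that by simp
next
  fix i x assume i: "i < N" and x: "x \<in> Rn N"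
  have "((\<lambda>t. w (x(i := t))) has_real_derivative D i x) (at (x i))"
    using C i x unfolding C1c_def by blast
  from DERIV_chain2[where f = "\<lambda>\<tau>. \<bar>\<tau>\<bar> powr p" and g = "\<lambda>t. w (x(i := t))", OF abs_powr_deriv[OF p] this]
  have "((\<lambda>t. \<bar>w (x(i := t))\<bar> powr p) has_real_derivative p * \<bar>w x\<bar> powr (p - 1) * sgn (w x) * D i x) (at (x i))"
    by simp
  moreover have "\<bar>w (x(i := t))\<bar> = w (x(i := t))" for t using nn[of "x(i := t)"] x i by simp
  moreover have "p * \<bar>w x\<bar> powr (p - 1) * sgn (w x) * D i x = p * w x powr (p - 1) * D i x"
    using nn[OF x] by (cases "w x = 0") auto
  ultimately show "((\<lambda>t. w (x(i := t)) powr p) has_real_derivative p * w x powr (p - 1) * D i x) (at (x i))" by simp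
qed

lemma pint_mono:
  "(\<And>x. x \<in> Rn N \<Longrightarrow> \<bar>f x\<bar> \<le> \<bar>g x\<bar>) \<Longrightarrow> 0 \<le> p \<Longrightarrow> pint N p f \<le> pint N p g"
  unfolding pint_def by (intro nn_integral_mono ennreal_leI powr_mono2) auto

lemma pint_scale: "f \<in> borel_measurable (leb N) \<Longrightarrow> pint N p (\<lambda>x. c * f x) = ennreal (\<bar>c\<bar> powr p) * pint N p f"
  unfolding pint_def by (subst nn_integral_cmult[symmetric]) (auto simp: abs_mult powr_mult ennreal_mult)

lemma abs_sum_powr_le:
  fixes N :: nat and a :: "nat \<Rightarrow> real"
  assumes p: "0 \<le> p"
  shows "\<bar>\<Sum>j<N. a j\<bar> powr p \<le> real N powr p * (\<Sum>j<N. \<bar>a j\<bar> powr p)"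
proof (cases "N = 0")
  case False
  define M where "M = Max ((\<lambda>i. \<bar>a i\<bar>) ` {..<N})"
  have M: "\<bar>a i\<bar> \<le> M" if "i < N" for i unfolding M_def by (rule Max_ge) (use that in auto)
  have "M \<in> (\<lambda>i. \<bar>a i\<bar>) ` {..<N}" unfolding M_def by (rule Max_in) (use False in auto)
  then obtain j where j: "j < N" "M = \<bar>a j\<bar>" by auto
  have "\<bar>\<Sum>j<N. a j\<bar> \<le> (\<Sum>i<N. \<bar>a i\<bar>)" by (rule sum_abs)
  also have "\<dots> \<le> real N * M"
    using sum_bounded_above[of "{..<N}" "\<lambda>i. \<bar>a i\<bar>" M] M by simp
  finally have "\<bar>\<Sum>j<N. a j\<bar> powr p \<le> (real N * M) powr p"
    using p by (intro powr_mono2) auto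
  also have "\<dots> = real N powr p * \<bar>a j\<bar> powr p" using j by (simp add: powr_mult)
  also have "\<bar>a j\<bar> powr p \<le> (\<Sum>i<N. \<bar>a i\<bar> powr p)"
    by (rule member_le_sum[of j "{..<N}" "\<lambda>i. \<bar>a i\<bar> powr p"]) (use j in auto)
  finally show ?thesis by (simp add: mult_left_mono)
qed simp

lemma edist_powr_le:
  assumes p: "1 \<le> p"
  shows "edist N a b powr p \<le> real N powr p * (\<Sum>i<N. \<bar>a i - b i\<bar> powr p)"
proof -
  have "edist N a b \<le> \<bar>\<Sum>i<N. \<bar>a i - b i\<bar>\<bar>"
    unfolding edist_def enorm_def using L2_set_le_sum_abs[of "\<lambda>i. a i - b i" "{..<N}"] by linarith
  then have "edist N a b powr p \<le> \<bar>\<Sum>i<N. \<bar>a i - b i\<bar>\<bar> powr p"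
    using p by (intro powr_mono2) (auto simp: edist_def enorm_def)
  also have "\<dots> \<le> real N powr p * (\<Sum>i<N. \<bar>\<bar>a i - b i\<bar>\<bar> powr p)"
    using p by (intro abs_sum_powr_le) simp
  finally show ?thesis by simp
qed

text \<open>Mollification commutes with the weak derivative as long as the kernels are admissible test
  functions; here the function vanishes near the boundary, so this holds everywhere.\<close>

lemma pd_moll:
  assumes w: "weak_deriv N V i v g" and i: "i < N" and S: "compact S" "S \<subseteq> Rn N"
    and d: "0 < d" "thick N S (2 * d) \<subseteq> V"
    and v: "integrable (leb N) v" "\<And>x. x \<in> Rn N \<Longrightarrow> x \<notin> S \<Longrightarrow> v x = 0"
    and g: "integrable (leb N) g" "\<And>x. x \<in> Rn N \<Longrightarrow> x \<notin> S \<Longrightarrow> g x = 0"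
    and x: "x \<in> Rn N"
  shows "pd i (moll N d v) x = moll N d g x"
    and "x \<notin> thick N S d \<Longrightarrow> conv N d m v x = 0"
proof -
  have far: "conv N d m q x = 0" if "x \<notin> thick N S d" and q: "\<And>x. x \<in> Rn N \<Longrightarrow> x \<notin> S \<Longrightarrow> q x = 0" for q m
  proof -
    have "q y * ker N d m (y - x) = 0" if y: "y \<in> Rn N" for y
    proof (cases "y \<in> S")
      case True
      have "y - x \<notin> cube N d"
      proof
        assume "y - x \<in> cube N d"
        from thickI[OF True cube_uminus[OF this]] have "y \<oplus> - (y - x) \<in> thick N S d" .
        also have "y \<oplus> - (y - x) = x" by (simp add: fun_eq_iff vadd_apply)
        finally show False using \<open>x \<notin> thick N S d\<close> by simp
      qed
      then show ?thesis using ker_eq_0[OF d(1), of "y - x" N m] x y by auto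
    qed (use q y in simp)
    then have "conv N d m q x = (LINT y|leb N. 0)"
      unfolding conv_def by (intro Bochner_Integration.integral_cong) auto
    then show ?thesis by simp
  qed
  show "conv N d m v x = 0" if "x \<notin> thick N S d" by (rule far[OF that v(2)])
  let ?m = "(\<lambda>_. 0)(i := Suc 0) :: nat \<Rightarrow> nat"
  have "pd i (moll N d v) x = - conv N d ?m v x"
    using pd_eqI[OF conv_deriv[OF d(1) v(1) i x, of "\<lambda>_. 0"]] by simp
  also have "\<dots> = moll N d g x"
  proof (cases "x \<in> thick N S d")
    case False
    then show ?thesis using far[OF False v(2)] far[OF False g(2)] by simp
  next
    case True
    have "thick N {x} d \<subseteq> thick N (thick N S d) d" using True by (auto simp: thick_def)
    also have "\<dots> \<subseteq> thick N S (2 * d)" using thick_thick[of N S d d] by simp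
    finally have "thick N {x} d \<subseteq> V" using d(2) by auto
    then have k: "(\<lambda>y. ker N d (\<lambda>_. 0) (y - x)) \<in> Cc_infty N V" by (rule ker_Cc_infty[OF d(1) x])
    have SV: "S \<subseteq> V" using subset_thick[of "2 * d" S N] d by auto
    have cutv: "cut V (\<lambda>y. q y * r y) y = q y * r y" if "y \<in> Rn N" "\<And>x. x \<in> Rn N \<Longrightarrow> x \<notin> S \<Longrightarrow> q x = 0" for q r y
      using that SV by (cases "y \<in> V") auto
    have "conv N d ?m v x = (LINT y:V|leb N. v y * pd i (\<lambda>y. ker N d (\<lambda>_. 0) (y - x)) y)"
      unfolding conv_def set_integral_cut
    proof (rule Bochner_Integration.integral_cong[OF refl])
      fix y assume "y \<in> space (leb N)"
      then show "v y * ker N d ?m (y - x) = cut V (\<lambda>y. v y * pd i (\<lambda>y. ker N d (\<lambda>_. 0) (y - x)) y) y"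
        using cutv[of y v] v(2) pd_ker[OF d(1) i, of "\<lambda>_. 0" x y] by simp
    qed
    also have "\<dots> = - (LINT y:V|leb N. g y * ker N d (\<lambda>_. 0) (y - x))"
      using w k unfolding weak_deriv_def by blast
    also have "(LINT y:V|leb N. g y * ker N d (\<lambda>_. 0) (y - x)) = moll N d g x"
      unfolding conv_def set_integral_cut
      by (rule Bochner_Integration.integral_cong[OF refl]) (use cutv[of _ g] g(2) in simp)
    finally show ?thesis by (simp only: minus_minus)
  qed
  finally show "pd i (moll N d v) x = moll N d g x" .
qed

text \<open>Mollifications with small kernels are test functions on \<open>V\<close>, because \<open>v\<close> vanishes off a compact subset of \<open>V\<close>. They
  converge to \<open>v\<close>, and their gradients, which are the mollifications of the weak gradient, converge too.\<close>

theorem W1p_0_membership: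
  assumes V: "openin (Euclidean_space N) V" and p: "1 \<le> p"
    and w: "\<And>i. i < N \<Longrightarrow> weak_deriv N V i v (g i)"
    and S: "compact S" "S \<subseteq> V"
    and v [measurable]: "v \<in> borel_measurable (leb N)" and v0: "\<And>x. x \<in> Rn N \<Longrightarrow> x \<notin> S \<Longrightarrow> v x = 0" and vp: "pint N p v < \<infinity>"
    and g [measurable]: "\<And>i. i < N \<Longrightarrow> g i \<in> borel_measurable (leb N)"
    and g0: "\<And>i x. i < N \<Longrightarrow> x \<in> Rn N \<Longrightarrow> x \<notin> S \<Longrightarrow> g i x = 0" and gp: "\<And>i. i < N \<Longrightarrow> pint N p (g i) < \<infinity>"
    and vL: "v \<in> L1_loc N V"
  shows "v \<in> W1p_0 N p V"
proof -
  have VR: "V \<subseteq> Rn N" by (rule openin_subset_Rn[OF V])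
  have SR: "S \<subseteq> Rn N" using S VR by auto
  have [measurable]: "V \<in> sets (leb N)" by (rule sets_leb_openin[OF V])
  have Lp: "q \<in> Lp N p V" if [measurable]: "q \<in> borel_measurable (leb N)" and "pint N p q < \<infinity>" for q
  proof -
    have "(\<integral>\<^sup>+x\<in>V. ennreal (\<bar>q x\<bar> powr p) \<partial>leb N) \<le> pint N p q"
      unfolding pint_def by (intro nn_integral_mono) (auto simp: indicator_def)
    then show ?thesis using that(2) by (auto simp: Lp_def set_borel_measurable_def intro: le_less_trans)
  qed
  have G: "is_weak_gradient N V v (\<lambda>x i. g i x)"
    using w vL by (simp add: is_weak_gradient_iff)
  have W1p: "v \<in> W1p N p V"
    unfolding W1p_def using Lp[OF v vp] Lp[OF g gp] G by blast
  obtain d where d: "0 < d" "thick N S d \<subseteq> V" using thick_subset_open[OF S V] by blast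
  obtain R where R: "0 < R" "S \<subseteq> cube N R" using compact_subset_cube[OF S(1) SR] by metis
  have vi: "integrable (leb N) v" by (rule pint_finite_imp_integrable[OF v vp _ p, of R]) (use v0 R in auto)
  have gi: "integrable (leb N) (g i)" if "i < N" for i
    by (rule pint_finite_imp_integrable[OF g gp _ p, of _ R]) (use that g0 R in auto)
  define \<delta> where "\<delta> n = d / 2 / real (Suc n)" for n
  have \<delta>: "0 < \<delta> n" "2 * \<delta> n \<le> d" for n
    using d by (auto simp: \<delta>_def field_simps)
  have TV: "thick N S (2 * \<delta> n) \<subseteq> V" for n using thick_mono[OF \<delta>(2), of N S n] d by auto
  have \<delta>0: "\<delta> \<longlonglongrightarrow> 0"
  proof -
    have "(\<lambda>n. d / 2 * (1 / real (Suc n))) \<longlonglongrightarrow> d / 2 * 0"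
      by (intro tendsto_mult tendsto_const LIMSEQ_Suc[OF lim_1_over_n])
    then show ?thesis by (simp add: \<delta>_def[abs_def])
  qed
  define \<psi> where "\<psi> n = moll N (\<delta> n) v" for n
  have \<psi>C: "\<psi> n \<in> Cc_infty N V" for n
    unfolding \<psi>_def
  proof (rule Cc_inftyI[OF Ck_conv[OF \<delta>(1) vi]])
    show "compact (thick N S (\<delta> n))" "thick N S (\<delta> n) \<subseteq> Rn N"
      using compact_thick thick_subset_Rn S SR by auto
    have "thick N S (\<delta> n) \<subseteq> thick N S (2 * \<delta> n)" by (rule thick_mono) (use \<delta>(1)[of n] in simp)
    then show "thick N S (\<delta> n) \<subseteq> V" using TV by auto
    fix x assume x: "x \<in> Rn N" "x \<notin> thick N S (\<delta> n)"
    show "moll N (\<delta> n) v x = 0"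
    \<comment> \<open>Commuting with a derivative requires a coordinate; a space of dimension \<open>0\<close> is a single point.\<close>
    proof (cases "N = 0")
      case False
      then have "0 < N" by simp
      show ?thesis
        by (rule pd_moll(2)[OF w[OF \<open>0 < N\<close>] \<open>0 < N\<close> S(1) SR \<delta>(1) TV vi v0 gi[OF \<open>0 < N\<close>] g0[OF \<open>0 < N\<close>] x])
    next
      case True
      have "x \<in> thick N S (\<delta> n) \<or> S = {}"
      proof (rule disjCI)
        assume "S \<noteq> {}"
        then obtain s where "s \<in> S" by auto
        then have "s = x" using SR x(1) True by (auto simp: Rn_iff fun_eq_iff)
        then show "x \<in> thick N S (\<delta> n)" using \<open>s \<in> S\<close> subset_thick[of "\<delta> n" S N] \<delta>(1)[of n] by auto
      qed
      then have "S = {}" using x by simp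
      then have "moll N (\<delta> n) v x = (LINT y|leb N. 0)"
        unfolding conv_def using v0 by (intro Bochner_Integration.integral_cong) auto
      then show ?thesis by simp
    qed
  qed
  have conv0: "(\<lambda>n. pint N p (\<lambda>x. moll N (\<delta> n) q x - q x)) \<longlonglongrightarrow> 0"
    if q: "q \<in> borel_measurable (leb N)" "pint N p q < \<infinity>" "\<And>x. x \<in> Rn N \<Longrightarrow> x \<notin> S \<Longrightarrow> q x = 0" for q
  proof (rule ennreal_tendsto_0I)
    fix e :: real assume e: "0 < e"
    obtain d0 where d0: "0 < d0" "\<And>d. 0 < d \<Longrightarrow> d \<le> d0 \<Longrightarrow> pint N p (\<lambda>x. moll N d q x - q x) \<le> ennreal e"
      by (rule moll_converges[OF q(1,2) _ p e, of R]) (use q(3) R in auto)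
    have "\<forall>\<^sub>F n in sequentially. \<delta> n < d0" by (rule order_tendstoD(2)[OF \<delta>0 d0(1)])
    then show "\<forall>\<^sub>F n in sequentially. pint N p (\<lambda>x. moll N (\<delta> n) q x - q x) \<le> ennreal e"
      by eventually_elim (rule d0(2)[OF \<delta>(1)], simp)
  qed
  have lim1: "(\<lambda>n. \<integral>\<^sup>+x\<in>V. ennreal (\<bar>\<psi> n x - v x\<bar> powr p) \<partial>leb N) \<longlonglongrightarrow> 0"
  proof (rule ennreal_tendsto_0_le[OF _ conv0[OF v vp v0]])
    show "(\<integral>\<^sup>+x\<in>V. ennreal (\<bar>\<psi> n x - v x\<bar> powr p) \<partial>leb N) \<le> pint N p (\<lambda>x. moll N (\<delta> n) v x - v x)" for n
      unfolding pint_def \<psi>_def by (intro nn_integral_mono) (auto simp: indicator_def)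
  qed
  have lim2: "(\<lambda>n. \<integral>\<^sup>+x\<in>V. ennreal (edist N (grad (\<psi> n) x) (wgrad N V v x) powr p) \<partial>leb N) \<longlonglongrightarrow> 0"
  proof (rule ennreal_tendsto_0_le)
    have "(\<lambda>n. ennreal (real N powr p) * (\<Sum>i<N. pint N p (\<lambda>x. moll N (\<delta> n) (g i) x - g i x))) \<longlonglongrightarrow> ennreal (real N powr p) * (\<Sum>i<N. 0)"
      by (intro ennreal_tendsto_cmult tendsto_sum conv0 g gp g0) auto
    then show "(\<lambda>n. ennreal (real N powr p) * (\<Sum>i<N. pint N p (\<lambda>x. moll N (\<delta> n) (g i) x - g i x))) \<longlonglongrightarrow> 0" by simp
    fix n
    have mm: "(\<lambda>x. moll N (\<delta> n) (g i) x) \<in> borel_measurable (leb N)" if "i < N" for i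
      by (rule borel_measurable_leb_continuous[OF continuous_on_conv[OF \<delta>(1) gi[OF that]]])
    have "(\<integral>\<^sup>+x\<in>V. ennreal (edist N (grad (\<psi> n) x) (wgrad N V v x) powr p) \<partial>leb N)
       \<le> (\<integral>\<^sup>+x. ennreal (real N powr p) * (\<Sum>i<N. ennreal (\<bar>moll N (\<delta> n) (g i) x - g i x\<bar> powr p)) \<partial>leb N)"
    proof (rule nn_integral_mono_AE)
      show "AE x in leb N. ennreal (edist N (grad (\<psi> n) x) (wgrad N V v x) powr p) * indicator V x
        \<le> ennreal (real N powr p) * (\<Sum>i<N. ennreal (\<bar>moll N (\<delta> n) (g i) x - g i x\<bar> powr p))"
        using wgrad_AE(2)[OF V G] AE_space
      proof eventually_elim
        case (elim x)
        have xR: "x \<in> Rn N" using elim(2) unfolding space_leb .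
        show ?case
        proof (cases "x \<in> V")
          case True
          have "grad (\<psi> n) x i = moll N (\<delta> n) (g i) x" if "i < N" for i
            unfolding grad_def \<psi>_def
            by (rule pd_moll(1)[OF w[OF that] that S(1) SR \<delta>(1) TV vi v0 gi[OF that] g0[OF that] xR])
          then have "(\<Sum>i<N. \<bar>grad (\<psi> n) x i - wgrad N V v x i\<bar> powr p) = (\<Sum>i<N. \<bar>moll N (\<delta> n) (g i) x - g i x\<bar> powr p)"
            using elim(1) True by (intro sum.cong) auto
          with edist_powr_le[OF p, of N "grad (\<psi> n) x" "wgrad N V v x"]
          have "edist N (grad (\<psi> n) x) (wgrad N V v x) powr p \<le> real N powr p * (\<Sum>i<N. \<bar>moll N (\<delta> n) (g i) x - g i x\<bar> powr p)"
            by simp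
          then have "ennreal (edist N (grad (\<psi> n) x) (wgrad N V v x) powr p) \<le> ennreal (real N powr p * (\<Sum>i<N. \<bar>moll N (\<delta> n) (g i) x - g i x\<bar> powr p))"
            by (rule ennreal_leI)
          also have "\<dots> = ennreal (real N powr p) * (\<Sum>i<N. ennreal (\<bar>moll N (\<delta> n) (g i) x - g i x\<bar> powr p))"
            by (subst ennreal_mult) (auto intro: sum_nonneg)
          finally show ?thesis using True by simp
        qed simp
      qed
    qed
    also have "\<dots> = ennreal (real N powr p) * (\<integral>\<^sup>+x. (\<Sum>i<N. ennreal (\<bar>moll N (\<delta> n) (g i) x - g i x\<bar> powr p)) \<partial>leb N)"
      by (rule nn_integral_cmult) (use mm in measurable)
    also have "(\<integral>\<^sup>+x. (\<Sum>i<N. ennreal (\<bar>moll N (\<delta> n) (g i) x - g i x\<bar> powr p)) \<partial>leb N) = (\<Sum>i<N. pint N p (\<lambda>x. moll N (\<delta> n) (g i) x - g i x))"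
      unfolding pint_def by (rule nn_integral_sum) (use mm in measurable)
    finally show "(\<integral>\<^sup>+x\<in>V. ennreal (edist N (grad (\<psi> n) x) (wgrad N V v x) powr p) \<partial>leb N)
      \<le> ennreal (real N powr p) * (\<Sum>i<N. pint N p (\<lambda>x. moll N (\<delta> n) (g i) x - g i x))" .
  qed
  have "\<forall>x\<in>Rn N - V. v x = 0" using v0 S by auto
  with W1p \<psi>C lim1 lim2 show ?thesis unfolding W1p_0_def by blast
qed

section \<open>Integrals of the singular kernel\<close>

lemma enorm_nonneg [simp]: "0 \<le> enorm N x"
  by (simp add: enorm_def)

lemma coord_le_enorm: "i < N \<Longrightarrow> \<bar>x i\<bar> \<le> enorm N x"
  unfolding enorm_def using member_le_L2_set[of "{..<N}" i "\<lambda>i. \<bar>x i\<bar>"] by (simp add: L2_set_def)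

lemma enorm_triangle: "enorm N (x \<oplus> y) \<le> enorm N x + enorm N y"
  unfolding enorm_def vadd_def by (rule L2_set_triangle_ineq)

lemma enorm_uminus: "enorm N (- x) = enorm N x"
  by (simp add: enorm_def L2_set_def)

lemma edist_commute: "edist N x y = edist N y x"
  by (simp add: edist_def enorm_def L2_set_def power2_commute)

lemma edist_shift: "edist N x (h \<oplus> x) = enorm N h"
proof -
  have "x - (h \<oplus> x) = - h" by (simp add: fun_eq_iff vadd_apply)
  then show ?thesis by (simp add: edist_eq enorm_uminus)
qed

lemma edist_shift': "edist N x (x \<oplus> h) = enorm N h"
  using edist_shift[of N x h] by (simp only: vadd_commute)

lemma edist_nonneg [simp]: "0 \<le> edist N x y"
  by (simp add: edist_def)

lemma enorm_le_cube: "x \<in> Rn N \<Longrightarrow> enorm N x \<le> r \<Longrightarrow> x \<in> cube N r"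
  using coord_le_enorm[of _ N x] by (force simp: cube_def)

text \<open>The integrals of the singular kernel are estimated over dyadic shells: \<open>c j\<close> bounds the kernel on the
  \<open>j\<close>-th shell, which lies in a cube of known volume, and the sum is dominated by a geometric series. This
  replaces polar coordinates.\<close>

lemma dyadic_sum_bound:
  assumes f: "\<And>h. h \<in> X \<Longrightarrow> h \<in> Rn N \<Longrightarrow> \<exists>j::nat. h \<in> A j \<and> f h \<le> c j"
    and A: "\<And>j. A j \<in> sets (leb N)" "\<And>j. A j \<subseteq> cube N (\<rho> j)" and \<rho>: "\<And>j. 0 \<le> \<rho> j" and c: "\<And>j. 0 \<le> c j"
    and b: "\<And>j. c j * (2 * \<rho> j) ^ N \<le> M * t ^ j" and t: "0 \<le> t" "t < 1" and M: "0 \<le> M"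
  shows "(\<integral>\<^sup>+h. indicator X h * ennreal (f h) \<partial>leb N) \<le> ennreal (M / (1 - t))"
proof -
  note [measurable] = A(1)
  have "(\<integral>\<^sup>+h. indicator X h * ennreal (f h) \<partial>leb N) \<le> (\<integral>\<^sup>+h. (\<Sum>j. ennreal (c j) * indicator (A j) h) \<partial>leb N)"
  proof (rule nn_integral_mono)
    fix h assume h: "h \<in> space (leb N)"
    show "indicator X h * ennreal (f h) \<le> (\<Sum>j. ennreal (c j) * indicator (A j) h)"
    proof (cases "h \<in> X")
      case True
      with f h obtain j where j: "h \<in> A j" "f h \<le> c j" by auto
      have "indicator X h * ennreal (f h) \<le> ennreal (c j) * indicator (A j) h" using True j by (simp add: ennreal_leI)
      also have "\<dots> \<le> (\<Sum>j. ennreal (c j) * indicator (A j) h)"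
      proof -
        have "g j \<le> suminf g" for g :: "nat \<Rightarrow> ennreal" using sum_le_suminf[of g "{j}"] by simp
        then show ?thesis .
      qed
      finally show ?thesis .
    qed simp
  qed
  also have "\<dots> = (\<Sum>j. \<integral>\<^sup>+h. ennreal (c j) * indicator (A j) h \<partial>leb N)"
    by (rule nn_integral_suminf) measurable
  also have "\<dots> = (\<Sum>j. ennreal (c j) * emeasure (leb N) (A j))"
    by (simp add: nn_integral_cmult_indicator)
  also have "\<dots> \<le> (\<Sum>j. ennreal (M * t ^ j))"
  proof (intro suminf_le allI)
    fix j
    have "ennreal (c j) * emeasure (leb N) (A j) \<le> ennreal (c j) * ennreal ((2 * \<rho> j) ^ N)"
      using emeasure_mono[OF A(2) sets_cube, of j] emeasure_cube[OF \<rho>, of N j] by (intro mult_left_mono) auto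
    also have "\<dots> = ennreal (c j * (2 * \<rho> j) ^ N)" using c \<rho> by (simp add: ennreal_mult)
    also have "\<dots> \<le> ennreal (M * t ^ j)" using b by (rule ennreal_leI)
    finally show "ennreal (c j) * emeasure (leb N) (A j) \<le> ennreal (M * t ^ j)" .
  qed auto
  also have "\<dots> = ennreal (M * (1 / (1 - t)))"
    using t M by (intro suminf_ennreal_eq sums_mult geometric_sums) auto
  finally show ?thesis by simp
qed

lemma ex_dyadic_small:
  fixes x d :: real
  assumes "0 < x" "x < d"
  shows "\<exists>j::nat. d / 2 ^ Suc j \<le> x \<and> x < d / 2 ^ j"
proof -
  have "(\<lambda>j. d * (1/2) ^ j) \<longlonglongrightarrow> d * 0"
    by (intro tendsto_mult tendsto_const LIMSEQ_power_zero) auto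
  then have "\<forall>\<^sub>F j in sequentially. d * (1/2) ^ j < x" using assms by (intro order_tendstoD) auto
  then have ex: "\<exists>j. d / 2 ^ j \<le> x" by (auto simp: eventually_sequentially power_divide intro: less_imp_le)
  define j where "j = (LEAST j. d / 2 ^ j \<le> x)"
  have j: "d / 2 ^ j \<le> x" unfolding j_def using ex by (rule LeastI_ex)
  then have "j \<noteq> 0" using assms by (cases j) auto
  then obtain k where k: "j = Suc k" by (cases j) auto
  have "\<not> d / 2 ^ k \<le> x" using not_less_Least[of k "\<lambda>j. d / 2 ^ j \<le> x"] k by (simp add: j_def)
  then show ?thesis using j k by (intro exI[of _ k]) auto
qed

lemma ex_dyadic_large:
  fixes x d :: real
  assumes "0 < d" "d \<le> x"
  shows "\<exists>j::nat. d * 2 ^ j \<le> x \<and> x < d * 2 ^ Suc j"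
proof -
  obtain n where n: "x / d < 2 ^ n" using real_arch_pow[of 2 "x / d"] by auto
  then have ex: "\<exists>j. x < d * 2 ^ j" using assms by (intro exI[of _ n]) (simp add: field_simps)
  define j where "j = (LEAST j. x < d * 2 ^ j)"
  have j: "x < d * 2 ^ j" unfolding j_def using ex by (rule LeastI_ex)
  then have "j \<noteq> 0" using assms by (cases j) auto
  then obtain k where k: "j = Suc k" by (cases j) auto
  have "\<not> x < d * 2 ^ k" using not_less_Least[of k "\<lambda>j. x < d * 2 ^ j"] k by (simp add: j_def)
  then show ?thesis using j k by (intro exI[of _ k]) auto
qed

lemma kernel_near:
  assumes q: "0 < q" and d: "0 < d"
  shows "(\<integral>\<^sup>+h. indicator {h. 0 < enorm N h \<and> enorm N h < d} h * ennreal (enorm N h powr q / enorm N h powr real N) \<partial>leb N)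
    \<le> ennreal (4 ^ N * d powr q / (1 - 2 powr (- q)))"
proof (rule dyadic_sum_bound)
  let ?A = "\<lambda>j. {h \<in> space (leb N). d / 2 ^ Suc j \<le> enorm N h \<and> enorm N h < d / 2 ^ j}"
  let ?c = "\<lambda>j::nat. (d / 2 ^ j) powr q / (d / 2 ^ Suc j) ^ N"
  let ?r = "\<lambda>j::nat. d / 2 ^ j"
  show "?A j \<in> sets (leb N)" for j by measurable
  show "?A j \<subseteq> cube N (?r j)" for j by (auto intro!: enorm_le_cube)
  show "0 \<le> ?r j" for j using d by simp
  show "0 \<le> ?c j" for j using d by simp
  fix h assume h: "h \<in> {h. 0 < enorm N h \<and> enorm N h < d}" "h \<in> Rn N"
  then obtain j where j: "d / 2 ^ Suc j \<le> enorm N h" "enorm N h < d / 2 ^ j"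
    using ex_dyadic_small[of "enorm N h" d] by auto
  have "enorm N h powr q / enorm N h powr real N \<le> ?c j"
  proof (rule frac_le)
    show "enorm N h powr q \<le> (d / 2 ^ j) powr q" using q j by (intro powr_mono2) auto
    have "(d / 2 ^ Suc j) ^ N = (d / 2 ^ Suc j) powr real N" using d by (simp add: powr_realpow)
    also have "\<dots> \<le> enorm N h powr real N" using j d by (intro powr_mono2) auto
    finally show "(d / 2 ^ Suc j) ^ N \<le> enorm N h powr real N" .
  qed (use d in auto)
  with j h(2) show "\<exists>j. h \<in> ?A j \<and> enorm N h powr q / enorm N h powr real N \<le> ?c j"
    by (intro exI[of _ j]) simp
next
  fix j :: nat
  have "2 * (d / 2 ^ j) = 4 * (d / 2 ^ Suc j)" by simp
  then have "(2 * (d / 2 ^ j)) ^ N = 4 ^ N * (d / 2 ^ Suc j) ^ N" by (simp only: power_mult_distrib)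
  then have A: "(d / 2 ^ j) powr q / (d / 2 ^ Suc j) ^ N * (2 * (d / 2 ^ j)) ^ N = 4 ^ N * (d / 2 ^ j) powr q"
    using d by simp
  have B: "(d / 2 ^ j) powr q = d powr q * (2 powr (- q)) ^ j"
  proof -
    have "(2 ^ j) powr q = (2 powr q) ^ j" for j :: nat
      by (simp add: powr_realpow[symmetric] powr_powr powr_mult_base mult.commute)
    moreover have "(d / 2 ^ j) powr q = d powr q / (2 ^ j) powr q" using d by (simp add: powr_divide)
    ultimately show ?thesis by (simp add: powr_minus power_inverse divide_inverse)
  qed
  show "(d / 2 ^ j) powr q / (d / 2 ^ Suc j) ^ N * (2 * (d / 2 ^ j)) ^ N \<le> 4 ^ N * d powr q * (2 powr (- q)) ^ j"
    unfolding A unfolding B by (simp only: mult.assoc order_refl)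
qed (use q powr_less_one[of 2 "- q"] in auto)

lemma kernel_far:
  assumes q: "0 < q" and d: "0 < d"
  shows "(\<integral>\<^sup>+h. indicator {h. d \<le> enorm N h} h * ennreal (1 / enorm N h powr (real N + q)) \<partial>leb N)
    \<le> ennreal (4 ^ N * d powr (- q) / (1 - 2 powr (- q)))"
proof (rule dyadic_sum_bound)
  let ?A = "\<lambda>j. {h \<in> space (leb N). d * 2 ^ j \<le> enorm N h \<and> enorm N h < d * 2 ^ Suc j}"
  let ?c = "\<lambda>j::nat. 1 / ((d * 2 ^ j) ^ N * (d * 2 ^ j) powr q)"
  let ?r = "\<lambda>j::nat. d * 2 ^ Suc j"
  show "?A j \<in> sets (leb N)" for j by measurable
  show "?A j \<subseteq> cube N (?r j)" for j by (auto intro!: enorm_le_cube)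
  show "0 \<le> ?r j" for j using d by simp
  show "0 \<le> ?c j" for j using d by simp
  fix h assume h: "h \<in> {h. d \<le> enorm N h}" "h \<in> Rn N"
  then obtain j where j: "d * 2 ^ j \<le> enorm N h" "enorm N h < d * 2 ^ Suc j"
    using ex_dyadic_large[of d "enorm N h"] d by auto
  have "1 / enorm N h powr (real N + q) \<le> ?c j"
  proof (rule frac_le)
    have "(d * 2 ^ j) ^ N * (d * 2 ^ j) powr q = (d * 2 ^ j) powr (real N + q)" using d by (simp add: powr_realpow powr_add)
    also have "\<dots> \<le> enorm N h powr (real N + q)" using j d q by (intro powr_mono2) auto
    finally show "(d * 2 ^ j) ^ N * (d * 2 ^ j) powr q \<le> enorm N h powr (real N + q)" .
  qed (use d in auto)
  with j h(2) show "\<exists>j. h \<in> ?A j \<and> 1 / enorm N h powr (real N + q) \<le> ?c j"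
    by (intro exI[of _ j]) simp
next
  fix j :: nat
  have "2 * (d * 2 ^ Suc j) = 4 * (d * 2 ^ j)" by simp
  then have "(2 * (d * 2 ^ Suc j)) ^ N = 4 ^ N * (d * 2 ^ j) ^ N" by (simp only: power_mult_distrib)
  then have "1 / ((d * 2 ^ j) ^ N * (d * 2 ^ j) powr q) * (2 * (d * 2 ^ Suc j)) ^ N = 4 ^ N * (1 / (d * 2 ^ j) powr q)"
    using d by simp
  also have "1 / (d * 2 ^ j) powr q = d powr (- q) * (2 powr (- q)) ^ j"
  proof -
    have "(2 ^ j) powr q = (2 powr q) ^ j" for j :: nat
      by (simp add: powr_realpow[symmetric] powr_powr powr_mult_base mult.commute)
    then show ?thesis using d by (simp add: powr_mult powr_minus power_inverse divide_inverse)
  qed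
  finally show "1 / ((d * 2 ^ j) ^ N * (d * 2 ^ j) powr q) * (2 * (d * 2 ^ Suc j)) ^ N \<le> 4 ^ N * d powr (- q) * (2 powr (- q)) ^ j"
    by (simp only: mult.assoc)
qed (use q powr_less_one[of 2 "- q"] in auto)

text \<open>The geometric series degenerates like \<open>1/q\<close> as \<open>q\<close> tends to \<open>0\<close>. The rate is needed, since \<open>q\<close> will be
  \<open>sp\<close> or \<open>(1-s)p\<close>, and the constant \<open>C\<^sub>N\<^sub>,\<^sub>s\<^sub>,\<^sub>p\<close> compensates exactly this blow-up.\<close>

lemma geometric_factor_bound:
  fixes p q :: real
  assumes q: "0 < q" "q \<le> p"
  shows "1 / (1 - 2 powr (- q)) \<le> ((1 + p * ln 2) / ln 2) / q"
proof -
  have L: "0 < ln (2::real)" by simp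
  define y where "y = q * ln 2"
  have y: "0 < y" using q L by (simp add: y_def)
  have "2 powr (- q) = exp (- y)" by (simp add: powr_def y_def)
  also have "\<dots> \<le> 1 / (1 + y)"
    using exp_ge_add_one_self[of y] y by (simp add: exp_minus field_simps)
  finally have "y / (1 + y) \<le> 1 - 2 powr (- q)" using y by (simp add: field_simps)
  then have "1 / (1 - 2 powr (- q)) \<le> 1 / (y / (1 + y))"
  proof (rule divide_left_mono)
    have "0 < y / (1 + y)" using y by simp
    with \<open>y / (1 + y) \<le> 1 - 2 powr (- q)\<close> show "0 < (1 - 2 powr (- q)) * (y / (1 + y))" by (intro mult_pos_pos) auto
  qed (use \<open>y / (1 + y) \<le> 1 - 2 powr (- q)\<close> in auto)
  also have "\<dots> = (1 + q * ln 2) / ln 2 / q" using q by (simp add: y_def field_simps)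
  also have "\<dots> \<le> (1 + p * ln 2) / ln 2 / q" using q L by (intro divide_right_mono add_left_mono mult_right_mono) auto
  finally show ?thesis .
qed

text \<open>The Gamma factors are continuous and positive on \<open>[0,1]\<close>, so the constant behaves like \<open>s (1 - s)\<close>, which
  absorbs the divergence of the kernel integrals at both ends.\<close>

lemma C_const_cont:
  assumes N: "1 \<le> N" and p: "1 < p"
  shows "continuous_on {0..1} (\<lambda>s. C_const N s p)"
    and "\<exists>K\<ge>0. \<forall>s\<in>{0<..<1}. C_const N s p \<le> K * (s * (1 - s))"
    and "\<And>s. s \<in> {0<..<1} \<Longrightarrow> 0 < C_const N s p"
proof -
  define F where "F s = p / 2 * 2 powr (2 * s - 1) / pi powr ((real N - 1) / 2) * (Gamma ((real N + p * s) / 2) / (Gamma ((p + 1) / 2) * Gamma (2 - s)))" for s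
  have eq: "C_const N s p = s * (1 - s) * F s" for s by (simp add: C_const_def F_def)
  have G: "0 < Gamma ((p + 1) / 2)" using p by (intro Gamma_real_pos) auto
  have arg: "0 < (real N + p * s) / 2" "0 < 2 - s" if "s \<in> {0..1}" for s
    using that p N by (auto intro!: add_pos_nonneg)
  have G1: "0 < Gamma ((real N + p * s) / 2)" "0 < Gamma (2 - s)" if "s \<in> {0..1}" for s
    using arg[OF that] by (auto intro!: Gamma_real_pos)
  have cG: "continuous_on {0<..} (Gamma :: real \<Rightarrow> real)"
    by (rule continuous_on_Gamma) (auto dest: nonpos_Ints_nonpos)
  have c1: "continuous_on {0..1} (\<lambda>s. Gamma ((real N + p * s) / 2))"
    by (rule continuous_on_compose2[OF cG]) (use arg in \<open>auto intro!: continuous_intros\<close>)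
  have c2: "continuous_on {0..1} (\<lambda>s. Gamma (2 - s :: real))"
    by (rule continuous_on_compose2[OF cG]) (use arg in \<open>auto intro!: continuous_intros\<close>)
  have cF: "continuous_on {0..1} F"
    unfolding F_def using G G1 by (intro continuous_intros c1 c2) (auto simp: less_imp_neq[symmetric])
  show "continuous_on {0..1} (\<lambda>s. C_const N s p)"
    unfolding eq by (intro continuous_intros cF)
  have "compact (F ` {0..1})" by (rule compact_continuous_image[OF cF]) simp
  then have "\<exists>B. \<forall>s\<in>{0..1}. \<bar>F s\<bar> \<le> B" by (auto dest!: compact_imp_bounded simp: bounded_iff simp del: atLeastAtMost_iff)
  then obtain B where B: "\<forall>s\<in>{0..1}. \<bar>F s\<bar> \<le> B" by blast
  show "\<exists>K\<ge>0. \<forall>s\<in>{0<..<1}. C_const N s p \<le> K * (s * (1 - s))"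
  proof (intro exI[of _ "\<bar>B\<bar>"] conjI ballI)
    fix s :: real assume s: "s \<in> {0<..<1}"
    then have "\<bar>F s\<bar> \<le> B" using B[rule_format, of s] by auto
    then have "F s \<le> \<bar>B\<bar>" by linarith
    then have "s * (1 - s) * F s \<le> s * (1 - s) * \<bar>B\<bar>" using s by (intro mult_left_mono) auto
    then show "C_const N s p \<le> \<bar>B\<bar> * (s * (1 - s))" unfolding eq by (simp only: mult_ac)
  qed simp
  show "0 < C_const N s p" if "s \<in> {0<..<1}" for s
    unfolding eq F_def using that G G1[of s] p by (intro mult_pos_pos divide_pos_pos) auto
qed

text \<open>An increment in an arbitrary direction is the sum of \<open>N\<close> increments along the coordinate axes.\<close>

lemma increment_bound:
  assumes w: "\<And>i. i < N \<Longrightarrow> weak_deriv N U i f (g i)" and fm [measurable]: "f \<in> borel_measurable (leb N)"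
    and K: "compact K" "K \<subseteq> Rn N" and d: "0 < d" and T: "thick N (thick N K d) (2 * d) \<subseteq> U"
    and p: "1 \<le> p" and h: "h \<in> cube N d"
  shows "(\<integral>\<^sup>+x. indicator K x * ennreal (\<bar>f (x \<oplus> h) - f x\<bar> powr p) \<partial>leb N)
    \<le> ennreal (enorm N h powr p) * (ennreal (real N powr p) * (\<Sum>j<N. pint N p (cut (thick N (thick N K d) (2 * d)) (g j))))"
proof -
  let ?K1 = "thick N K d"
  have K1: "compact ?K1" "?K1 \<subseteq> Rn N" using compact_thick thick_subset_Rn K by auto
  have [measurable]: "K \<in> sets (leb N)" by (rule sets_leb_compact[OF K])
  have K1m [measurable]: "?K1 \<in> sets (leb N)" by (rule sets_leb_compact[OF K1])
  define H where "H j = (\<lambda>i. if i < j then h i else 0)" for j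
  have HR: "H j \<in> Rn N" for j using h by (auto simp: H_def cube_def Rn_iff)
  have Hc: "H j \<in> cube N d" for j using h d HR[of j] by (auto simp: H_def cube_def)
  have H0: "x \<oplus> H 0 = x" for x by (simp add: H_def)
  have HN: "H N = h" using h by (auto simp: H_def cube_def Rn_iff fun_eq_iff)
  have Hs: "x \<oplus> H (Suc j) = (x \<oplus> H j) \<oplus> ax j (h j)" for x j
    by (auto simp: H_def ax_def fun_eq_iff vadd_apply less_Suc_eq)
  have tm [measurable]: "(\<lambda>x. f (x \<oplus> H j)) \<in> borel_measurable (leb N)" for j by (rule measurable_translate_fun[OF fm HR])
  have tele: "f (x \<oplus> h) - f x = (\<Sum>j<N. f (x \<oplus> H (Suc j)) - f (x \<oplus> H j))" for x
    using sum_lessThan_telescope[of "\<lambda>j. f (x \<oplus> H j)" N] by (simp add: H0 HN)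
  have "(\<integral>\<^sup>+x. indicator K x * ennreal (\<bar>f (x \<oplus> h) - f x\<bar> powr p) \<partial>leb N)
    \<le> (\<integral>\<^sup>+x. ennreal (real N powr p) * (\<Sum>j<N. indicator K x * ennreal (\<bar>f (x \<oplus> H (Suc j)) - f (x \<oplus> H j)\<bar> powr p)) \<partial>leb N)"
  proof (rule nn_integral_mono)
    fix x
    have "ennreal (\<bar>f (x \<oplus> h) - f x\<bar> powr p) \<le> ennreal (real N powr p * (\<Sum>j<N. \<bar>f (x \<oplus> H (Suc j)) - f (x \<oplus> H j)\<bar> powr p))"
      unfolding tele by (rule ennreal_leI, rule abs_sum_powr_le) (use p in simp)
    also have "\<dots> = ennreal (real N powr p) * (\<Sum>j<N. ennreal (\<bar>f (x \<oplus> H (Suc j)) - f (x \<oplus> H j)\<bar> powr p))"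
      by (subst ennreal_mult) (auto intro: sum_nonneg)
    finally show "indicator K x * ennreal (\<bar>f (x \<oplus> h) - f x\<bar> powr p)
      \<le> ennreal (real N powr p) * (\<Sum>j<N. indicator K x * ennreal (\<bar>f (x \<oplus> H (Suc j)) - f (x \<oplus> H j)\<bar> powr p))"
      by (cases "x \<in> K") auto
  qed
  also have "\<dots> = ennreal (real N powr p) * (\<integral>\<^sup>+x. (\<Sum>j<N. indicator K x * ennreal (\<bar>f (x \<oplus> H (Suc j)) - f (x \<oplus> H j)\<bar> powr p)) \<partial>leb N)"
    by (rule nn_integral_cmult) measurable
  also have "(\<integral>\<^sup>+x. (\<Sum>j<N. indicator K x * ennreal (\<bar>f (x \<oplus> H (Suc j)) - f (x \<oplus> H j)\<bar> powr p)) \<partial>leb N)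
    = (\<Sum>j<N. \<integral>\<^sup>+x. indicator K x * ennreal (\<bar>f (x \<oplus> H (Suc j)) - f (x \<oplus> H j)\<bar> powr p) \<partial>leb N)"
    by (rule nn_integral_sum) measurable
  also have "\<dots> \<le> (\<Sum>j<N. ennreal (enorm N h powr p) * pint N p (cut (thick N ?K1 (2 * d)) (g j)))"
  proof (rule sum_mono)
    fix j assume "j \<in> {..<N}"
    then have j: "j < N" by simp
    have fj [measurable]: "(\<lambda>x. f (x \<oplus> ax j (h j))) \<in> borel_measurable (leb N)" by (rule measurable_translate_fun[OF fm ax_Rn[OF j]])
    have "(\<integral>\<^sup>+x. indicator K x * ennreal (\<bar>f (x \<oplus> H (Suc j)) - f (x \<oplus> H j)\<bar> powr p) \<partial>leb N)
      \<le> (\<integral>\<^sup>+x. indicator ?K1 (x \<oplus> H j) * ennreal (\<bar>f ((x \<oplus> H j) \<oplus> ax j (h j)) - f (x \<oplus> H j)\<bar> powr p) \<partial>leb N)"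
    proof (rule nn_integral_mono)
      fix x
      show "indicator K x * ennreal (\<bar>f (x \<oplus> H (Suc j)) - f (x \<oplus> H j)\<bar> powr p)
        \<le> indicator ?K1 (x \<oplus> H j) * ennreal (\<bar>f ((x \<oplus> H j) \<oplus> ax j (h j)) - f (x \<oplus> H j)\<bar> powr p)"
        using thickI[OF _ Hc, of x K j] by (cases "x \<in> K") (auto simp: Hs)
    qed
    also have "\<dots> = (\<integral>\<^sup>+x. indicator ?K1 x * ennreal (\<bar>f (x \<oplus> ax j (h j)) - f x\<bar> powr p) \<partial>leb N)"
      by (rule nn_integral_translate[OF HR, of "\<lambda>x. indicator ?K1 x * ennreal (\<bar>f (x \<oplus> ax j (h j)) - f x\<bar> powr p)"]) measurable
    also have "\<dots> \<le> ennreal (\<bar>h j\<bar> powr p) * pint N p (cut (thick N ?K1 (2 * d)) (g j))"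
      by (rule weak_deriv_increment_bound[OF w[OF j] j K1 d T _ p]) (use h j in \<open>auto simp: cube_def\<close>)
    also have "\<dots> \<le> ennreal (enorm N h powr p) * pint N p (cut (thick N ?K1 (2 * d)) (g j))"
      using coord_le_enorm[OF j, of h] p by (intro mult_right_mono ennreal_leI powr_mono2) auto
    finally show "(\<integral>\<^sup>+x. indicator K x * ennreal (\<bar>f (x \<oplus> H (Suc j)) - f (x \<oplus> H j)\<bar> powr p) \<partial>leb N)
      \<le> ennreal (enorm N h powr p) * pint N p (cut (thick N ?K1 (2 * d)) (g j))" .
  qed
  finally show ?thesis
    by (simp add: sum_distrib_left[symmetric] mult.left_commute mult_left_mono)
qed

section \<open>Absolute convergence of the nonlocal form\<close>

text \<open>The increments contribute the factor \<open>\<bar>h\<bar>\<^sup>p\<close>, which leaves the integrable kernel \<open>\<bar>h\<bar>\<^sup>q\<^sup>-\<^sup>N\<close> with \<open>q = p (1 - s)\<close>.\<close>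

lemma kernel_near_bound:
  assumes s: "0 < s" "s < 1" and p: "1 < p" and d: "0 < d"
  shows "(\<integral>\<^sup>+h. indicator {h. 0 < enorm N h \<and> enorm N h < d} h * ennreal (enorm N h powr p / enorm N h powr (real N + s * p)) \<partial>leb N)
    \<le> ennreal ((4 ^ N * max 1 (d powr p) * ((1 + p * ln 2) / ln 2) / p) / (1 - s))"
proof -
  define q where "q = p * (1 - s)"
  have q: "0 < q" "q \<le> p" using s p by (auto simp: q_def)
  have "enorm N h powr p / enorm N h powr (real N + s * p) = enorm N h powr q / enorm N h powr real N" for h
  proof (cases "enorm N h = 0")
    case False
    then have "0 < enorm N h" by (simp add: less_le)
    then show ?thesis by (simp add: q_def algebra_simps flip: powr_diff)
  qed simp
  then have "(\<integral>\<^sup>+h. indicator {h. 0 < enorm N h \<and> enorm N h < d} h * ennreal (enorm N h powr p / enorm N h powr (real N + s * p)) \<partial>leb N)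
     \<le> ennreal (4 ^ N * d powr q / (1 - 2 powr (- q)))"
    using kernel_near[OF q(1) d, of N] by simp
  also have "\<dots> \<le> ennreal ((4 ^ N * max 1 (d powr p) * ((1 + p * ln 2) / ln 2) / p) / (1 - s))"
  proof (rule ennreal_leI)
    have dq: "d powr q \<le> max 1 (d powr p)"
    proof (cases "d \<le> 1")
      case True
      then have "d powr q \<le> 1 powr q" using d q by (intro powr_mono2) auto
      then show ?thesis by simp
    next
      case False
      then have "d powr q \<le> d powr p" using q by (intro powr_mono) auto
      then show ?thesis by simp
    qed
    have g: "0 \<le> 1 / (1 - 2 powr (- q))" using powr_less_one[of 2 "- q"] q by simp
    have "4 ^ N * d powr q / (1 - 2 powr (- q)) = 4 ^ N * d powr q * (1 / (1 - 2 powr (- q)))" by simp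
    also have "\<dots> \<le> 4 ^ N * max 1 (d powr p) * (((1 + p * ln 2) / ln 2) / q)"
      using dq geometric_factor_bound[OF q] g by (intro mult_mono) auto
    also have "\<dots> = (4 ^ N * max 1 (d powr p) * ((1 + p * ln 2) / ln 2) / p) / (1 - s)"
      by (simp add: q_def)
    finally show "4 ^ N * d powr q / (1 - 2 powr (- q)) \<le> (4 ^ N * max 1 (d powr p) * ((1 + p * ln 2) / ln 2) / p) / (1 - s)" .
  qed
  finally show ?thesis .
qed

lemma powr_neg_le_max:
  fixes d p t :: real
  assumes "0 < d" "0 \<le> t" "t \<le> p"
  shows "d powr (- t) \<le> max 1 (d powr (- p))"
proof (cases "1 \<le> d")
  case True
  then have "d powr (- t) \<le> d powr 0" using assms by (intro powr_mono) auto
  then show ?thesis using True by simp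
next
  case False
  then have "d powr (- t) \<le> d powr (- p)" using assms by (intro powr_mono') auto
  then show ?thesis by simp
qed

lemma kernel_far_bound:
  assumes s: "0 < s" "s < 1" and p: "1 < p" and d: "0 < d"
  shows "(\<integral>\<^sup>+h. indicator {h. d \<le> enorm N h} h * ennreal (1 / enorm N h powr (real N + s * p)) \<partial>leb N)
    \<le> ennreal ((4 ^ N * max 1 (d powr (- p)) * ((1 + p * ln 2) / ln 2) / p) / s)"
proof -
  define q where "q = s * p"
  have q: "0 < q" "q \<le> p" using s p by (auto simp: q_def mult_le_cancel_right1)
  have "(\<integral>\<^sup>+h. indicator {h. d \<le> enorm N h} h * ennreal (1 / enorm N h powr (real N + s * p)) \<partial>leb N)
     \<le> ennreal (4 ^ N * d powr (- q) / (1 - 2 powr (- q)))"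
    using kernel_far[OF q(1) d, of N] by (simp add: q_def)
  also have "\<dots> \<le> ennreal ((4 ^ N * max 1 (d powr (- p)) * ((1 + p * ln 2) / ln 2) / p) / s)"
  proof (rule ennreal_leI)
    have dq: "d powr (- q) \<le> max 1 (d powr (- p))" using d q by (intro powr_neg_le_max) auto
    have g: "0 \<le> 1 / (1 - 2 powr (- q))" using powr_less_one[of 2 "- q"] q by simp
    have "4 ^ N * d powr (- q) / (1 - 2 powr (- q)) = 4 ^ N * d powr (- q) * (1 / (1 - 2 powr (- q)))" by simp
    also have "\<dots> \<le> 4 ^ N * max 1 (d powr (- p)) * (((1 + p * ln 2) / ln 2) / q)"
      using dq geometric_factor_bound[OF q] g by (intro mult_mono) auto
    also have "\<dots> = (4 ^ N * max 1 (d powr (- p)) * ((1 + p * ln 2) / ln 2) / p) / s"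
      by (simp add: q_def mult.commute)
    finally show "4 ^ N * d powr (- q) / (1 - 2 powr (- q)) \<le> (4 ^ N * max 1 (d powr (- p)) * ((1 + p * ln 2) / ln 2) / p) / s" .
  qed
  finally show ?thesis .
qed

lemma powr_mult_young:
  fixes a b p :: real
  assumes "1 \<le> p" "0 \<le> a" "0 \<le> b"
  shows "a powr (p - 1) * b \<le> a powr p + b powr p"
proof (cases "a = 0 \<and> b = 0")
  case False
  define m where "m = max a b"
  have m: "0 < m" "a \<le> m" "b \<le> m" using False assms by (auto simp: m_def)
  have "a powr (p - 1) * b \<le> m powr (p - 1) * m" using m assms by (intro mult_mono powr_mono2) auto
  also have "\<dots> = m powr p" using m powr_add[of m "p - 1" 1] by simp
  also have "\<dots> \<le> a powr p + b powr p" by (auto simp: m_def max_def)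
  finally show ?thesis .
qed auto

lemma abs_powr_sgn_mult:
  fixes t p :: real
  shows "\<bar>\<bar>t\<bar> powr (p - 2) * t\<bar> = \<bar>t\<bar> powr (p - 1)"
proof (cases "t = 0")
  case False
  then show ?thesis using powr_add[of "\<bar>t\<bar>" "p - 2" 1] by (simp add: abs_mult)
qed simp

definition nonlocal_integrand ::
  "nat \<Rightarrow> real \<Rightarrow> ((nat \<Rightarrow> real) \<Rightarrow> real) \<Rightarrow> ((nat \<Rightarrow> real) \<Rightarrow> real) \<Rightarrow> real \<Rightarrow> (nat \<Rightarrow> real) \<Rightarrow> (nat \<Rightarrow> real) \<Rightarrow> real" where
  "nonlocal_integrand N p u v s x y =
     \<bar>u x - u y\<bar> powr (p - 2) * (u x - u y) * (v x - v y) / edist N x y powr (real N + s * p)"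

text \<open>Near the diagonal the integrand is controlled by the increments of \<open>u\<close> and \<open>v\<close>, which are estimated by weak
  gradients; away from the diagonal by the sizes of \<open>u\<close> and \<open>v\<close>, with the tail of \<open>u\<close> taking care of infinity. Since \<open>v\<close>
  vanishes off \<open>K\<close>, one of the two points may be taken in \<open>K\<close>, at the cost of symmetrizing.\<close>

context
  fixes N :: nat and p d :: real and u v :: "(nat \<Rightarrow> real) \<Rightarrow> real" and K :: "(nat \<Rightarrow> real) set"
  assumes p: "1 < p" and d: "0 < d"
    and um [measurable]: "u \<in> borel_measurable (leb N)" and vm [measurable]: "v \<in> borel_measurable (leb N)"
    and Km [measurable]: "K \<in> sets (leb N)"
    and v0: "\<And>x. x \<in> Rn N \<Longrightarrow> x \<notin> K \<Longrightarrow> v x = 0"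
begin

definition near_part :: "real \<Rightarrow> (nat \<Rightarrow> real) \<Rightarrow> (nat \<Rightarrow> real) \<Rightarrow> ennreal" where
  "near_part s x y = indicator K x * (indicator {e. 0 < e \<and> e < d} (edist N x y) * ennreal (1 / edist N x y powr (real N + s * p))
     * (ennreal (\<bar>u y - u x\<bar> powr p) + ennreal (\<bar>v y - v x\<bar> powr p)))"

definition far_part :: "real \<Rightarrow> (nat \<Rightarrow> real) \<Rightarrow> (nat \<Rightarrow> real) \<Rightarrow> ennreal" where
  "far_part s x y = indicator {e. d \<le> e} (edist N x y) * ennreal (1 / edist N x y powr (real N + s * p))
     * (ennreal (2 powr (p - 1)) * (ennreal (\<bar>u x\<bar> powr (p - 1)) + ennreal (\<bar>u y\<bar> powr (p - 1))) * ennreal \<bar>v x\<bar>)"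

lemma near_part_measurable [measurable]: "(\<lambda>z. near_part s (fst z) (snd z)) \<in> borel_measurable (leb N \<Otimes>\<^sub>M leb N)"
  unfolding near_part_def by measurable

lemma far_part_measurable [measurable]: "(\<lambda>z. far_part s (fst z) (snd z)) \<in> borel_measurable (leb N \<Otimes>\<^sub>M leb N)"
  unfolding far_part_def by measurable

text \<open>In the near region the Young inequality separates \<open>u\<close> from \<open>v\<close>; on the diagonal the integrand is \<open>0\<close>.\<close>

lemma nonlocal_integrand_le:
  assumes x: "x \<in> Rn N" and y: "y \<in> Rn N"
  shows "ennreal \<bar>nonlocal_integrand N p u v s x y\<bar>
    \<le> (near_part s x y + far_part s x y) + (near_part s y x + far_part s y x)"
proof -
  define e where "e = edist N x y"
  define k where "k = 1 / e powr (real N + s * p)"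
  have k0: "0 \<le> k" by (simp add: k_def)
  have ey: "edist N y x = e" by (simp add: e_def edist_commute)
  have I: "\<bar>nonlocal_integrand N p u v s x y\<bar> = \<bar>u x - u y\<bar> powr (p - 1) * \<bar>v x - v y\<bar> * k"
    unfolding nonlocal_integrand_def abs_divide abs_mult[of _ "v x - v y"] abs_powr_sgn_mult
    by (simp add: k_def e_def)
  have nr: "near_part s x' y' = ennreal (k * (\<bar>u x - u y\<bar> powr p + \<bar>v x - v y\<bar> powr p))"
    if "x' \<in> K" "0 < e" "e < d" "(x' = x \<and> y' = y) \<or> (x' = y \<and> y' = x)" for x' y'
  proof -
    have "edist N x' y' = e" "\<bar>u y' - u x'\<bar> = \<bar>u x - u y\<bar>" "\<bar>v y' - v x'\<bar> = \<bar>v x - v y\<bar>"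
      using that(4) ey by (auto simp: e_def abs_minus_commute)
    then have "near_part s x' y' = ennreal k * (ennreal (\<bar>u x - u y\<bar> powr p) + ennreal (\<bar>v x - v y\<bar> powr p))"
      using that(1-3) by (simp add: near_part_def k_def)
    also have "\<dots> = ennreal (k * (\<bar>u x - u y\<bar> powr p + \<bar>v x - v y\<bar> powr p))"
      using k0 by (simp flip: ennreal_plus ennreal_mult)
    finally show ?thesis .
  qed
  have yng: "\<bar>u x - u y\<bar> powr (p - 1) * \<bar>v x - v y\<bar> * k \<le> k * (\<bar>u x - u y\<bar> powr p + \<bar>v x - v y\<bar> powr p)"
    using powr_mult_young[of p "\<bar>u x - u y\<bar>" "\<bar>v x - v y\<bar>"] p k0 by (simp add: mult.commute mult_left_mono)
  consider "e = 0" | "0 < e" "e < d" "x \<in> K" | "0 < e" "e < d" "y \<in> K" | "0 < e" "e < d" "x \<notin> K" "y \<notin> K" | "d \<le> e"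
  proof -
    have "e = 0 \<or> (0 < e \<and> e < d) \<or> d \<le> e" using edist_nonneg[of N x y] unfolding e_def by linarith
    then show thesis using that by blast
  qed
  then show ?thesis
  proof cases
    case 1
    then show ?thesis unfolding I by (simp add: k_def)
  next
    case 2
    then have "ennreal \<bar>nonlocal_integrand N p u v s x y\<bar> \<le> near_part s x y"
      unfolding I using nr[of x y] yng by (simp add: ennreal_leI)
    then show ?thesis by (simp add: add.assoc add_increasing2)
  next
    case 3
    then have "ennreal \<bar>nonlocal_integrand N p u v s x y\<bar> \<le> near_part s y x"
      unfolding I using nr[of y x] yng by (simp add: ennreal_leI)
    also have "\<dots> \<le> (near_part s x y + far_part s x y) + (near_part s y x + far_part s y x)"
      by (intro add_increasing add_increasing2) auto
    finally show ?thesis .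
  next
    case 4
    then show ?thesis unfolding I using v0 x y by simp
  next
    case 5
    define c where "c = 2 powr (p - 1) * (\<bar>u x\<bar> powr (p - 1) + \<bar>u y\<bar> powr (p - 1))"
    have c0: "0 \<le> c" by (simp add: c_def)
    have uc: "\<bar>u x - u y\<bar> powr (p - 1) \<le> c"
      using powr_abs_add_le[of "p - 1" "u x" "- u y"] p by (simp add: c_def)
    have f1: "far_part s x y = ennreal (k * (c * \<bar>v x\<bar>))"
    proof -
      have "far_part s x y = ennreal k * (ennreal (2 powr (p - 1)) * (ennreal (\<bar>u x\<bar> powr (p - 1)) + ennreal (\<bar>u y\<bar> powr (p - 1))) * ennreal \<bar>v x\<bar>)"
        using 5 by (simp add: far_part_def e_def[symmetric] k_def)
      also have "\<dots> = ennreal (k * (c * \<bar>v x\<bar>))"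
        using k0 by (simp add: c_def flip: ennreal_plus ennreal_mult)
      finally show ?thesis .
    qed
    have f2: "far_part s y x = ennreal (k * (c * \<bar>v y\<bar>))"
    proof -
      have "far_part s y x = ennreal k * (ennreal (2 powr (p - 1)) * (ennreal (\<bar>u y\<bar> powr (p - 1)) + ennreal (\<bar>u x\<bar> powr (p - 1))) * ennreal \<bar>v y\<bar>)"
        using 5 by (simp add: far_part_def ey k_def)
      also have "\<dots> = ennreal (k * (c * \<bar>v y\<bar>))"
        using k0 by (simp add: c_def add.commute flip: ennreal_plus ennreal_mult)
      finally show ?thesis .
    qed
    have "\<bar>u x - u y\<bar> powr (p - 1) * \<bar>v x - v y\<bar> \<le> c * (\<bar>v x\<bar> + \<bar>v y\<bar>)"
      using uc c0 abs_triangle_ineq4[of "v x" "v y"] by (intro mult_mono) auto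
    then have "\<bar>u x - u y\<bar> powr (p - 1) * \<bar>v x - v y\<bar> * k \<le> c * (\<bar>v x\<bar> + \<bar>v y\<bar>) * k"
      using k0 by (rule mult_right_mono)
    also have "\<dots> = k * (c * \<bar>v x\<bar>) + k * (c * \<bar>v y\<bar>)" by (simp add: algebra_simps)
    finally have "ennreal \<bar>nonlocal_integrand N p u v s x y\<bar> \<le> far_part s x y + far_part s y x"
      unfolding I f1 f2 using k0 c0 by (simp add: ennreal_leI flip: ennreal_plus)
    also have "\<dots> \<le> (near_part s x y + far_part s x y) + (near_part s y x + far_part s y x)"
      by (intro add_mono add_increasing) auto
    finally show ?thesis .
  qed
qed

lemma nonlocal_integral_le:
  "(\<integral>\<^sup>+z. ennreal \<bar>nonlocal_integrand N p u v s (fst z) (snd z)\<bar> \<partial>(leb N \<Otimes>\<^sub>M leb N))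
    \<le> 2 * ((\<integral>\<^sup>+x. \<integral>\<^sup>+y. near_part s x y \<partial>leb N \<partial>leb N) + (\<integral>\<^sup>+x. \<integral>\<^sup>+y. far_part s x y \<partial>leb N \<partial>leb N))"
proof -
  let ?P = "leb N \<Otimes>\<^sub>M leb N"
  have sw: "(\<integral>\<^sup>+z. f (snd z) (fst z) \<partial>?P) = (\<integral>\<^sup>+z. f (fst z) (snd z) \<partial>?P)"
    and it: "(\<integral>\<^sup>+z. f (fst z) (snd z) \<partial>?P) = (\<integral>\<^sup>+x. \<integral>\<^sup>+y. f x y \<partial>leb N \<partial>leb N)"
    if [measurable]: "(\<lambda>z. f (fst z) (snd z)) \<in> borel_measurable ?P" for f :: "_ \<Rightarrow> _ \<Rightarrow> ennreal"
  proof -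
    show 1: "(\<integral>\<^sup>+z. f (fst z) (snd z) \<partial>?P) = (\<integral>\<^sup>+x. \<integral>\<^sup>+y. f x y \<partial>leb N \<partial>leb N)"
      using leb.nn_integral_fst[of "\<lambda>z. f (fst z) (snd z)" "leb N"] that by simp
    have m: "(\<lambda>z. f (snd z) (fst z)) \<in> borel_measurable ?P"
      using measurable_compose[OF measurable_pair_swap' that] by (simp add: case_prod_beta)
    have "(\<integral>\<^sup>+z. f (snd z) (fst z) \<partial>?P) = (\<integral>\<^sup>+y. \<integral>\<^sup>+x. f y x \<partial>leb N \<partial>leb N)"
      using lebp.nn_integral_snd[OF m] by simp
    with 1 show "(\<integral>\<^sup>+z. f (snd z) (fst z) \<partial>?P) = (\<integral>\<^sup>+z. f (fst z) (snd z) \<partial>?P)" by simp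
  qed
  have m1: "(\<lambda>z. near_part s (snd z) (fst z)) \<in> borel_measurable ?P" "(\<lambda>z. far_part s (snd z) (fst z)) \<in> borel_measurable ?P"
    using measurable_compose[OF measurable_pair_swap' near_part_measurable]
      measurable_compose[OF measurable_pair_swap' far_part_measurable] by (simp_all add: case_prod_beta)
  note [measurable] = m1
  have "(\<integral>\<^sup>+z. ennreal \<bar>nonlocal_integrand N p u v s (fst z) (snd z)\<bar> \<partial>?P)
    \<le> (\<integral>\<^sup>+z. (near_part s (fst z) (snd z) + far_part s (fst z) (snd z)) + (near_part s (snd z) (fst z) + far_part s (snd z) (fst z)) \<partial>?P)"
    by (intro nn_integral_mono nonlocal_integrand_le) (auto simp: space_pair_measure)
  also have "\<dots> = ((\<integral>\<^sup>+z. near_part s (fst z) (snd z) \<partial>?P) + (\<integral>\<^sup>+z. far_part s (fst z) (snd z) \<partial>?P))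
    + ((\<integral>\<^sup>+z. near_part s (snd z) (fst z) \<partial>?P) + (\<integral>\<^sup>+z. far_part s (snd z) (fst z) \<partial>?P))"
    by (simp add: nn_integral_add)
  also have "\<dots> = 2 * ((\<integral>\<^sup>+x. \<integral>\<^sup>+y. near_part s x y \<partial>leb N \<partial>leb N) + (\<integral>\<^sup>+x. \<integral>\<^sup>+y. far_part s x y \<partial>leb N \<partial>leb N))"
    unfolding sw[OF near_part_measurable] sw[OF far_part_measurable] it[OF near_part_measurable] it[OF far_part_measurable]
    by (simp add: mult_2)
  finally show ?thesis .
qed

lemma near_part_integral_le:
  assumes s: "0 < s" "s < 1"
    and A: "\<And>h. h \<in> cube N d \<Longrightarrow> (\<integral>\<^sup>+x. indicator K x * ennreal (\<bar>u (x \<oplus> h) - u x\<bar> powr p) \<partial>leb N) \<le> ennreal (enorm N h powr p) * A"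
    and B: "\<And>h. h \<in> cube N d \<Longrightarrow> (\<integral>\<^sup>+x. indicator K x * ennreal (\<bar>v (x \<oplus> h) - v x\<bar> powr p) \<partial>leb N) \<le> ennreal (enorm N h powr p) * B"
  shows "(\<integral>\<^sup>+x. \<integral>\<^sup>+y. near_part s x y \<partial>leb N \<partial>leb N)
    \<le> (A + B) * ennreal ((4 ^ N * max 1 (d powr p) * ((1 + p * ln 2) / ln 2) / p) / (1 - s))"
proof -
  let ?i = "\<lambda>h. indicator {h. 0 < enorm N h \<and> enorm N h < d} h :: ennreal"
  let ?k = "\<lambda>h. ennreal (1 / enorm N h powr (real N + s * p))"
  let ?g = "\<lambda>x h. indicator K x * ennreal (\<bar>u (x \<oplus> h) - u x\<bar> powr p) + indicator K x * ennreal (\<bar>v (x \<oplus> h) - v x\<bar> powr p)"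
  have ind: "(indicator {e. 0 < e \<and> e < d} (enorm N h) :: ennreal) = ?i h" for h by (simp add: indicator_def)
  have im [measurable]: "(\<lambda>h. ?i h) \<in> borel_measurable (leb N)"
    unfolding ind[symmetric] by measurable
  have sh: "(\<integral>\<^sup>+y. near_part s x y \<partial>leb N) = (\<integral>\<^sup>+h. ?i h * ?k h * ?g x h \<partial>leb N)" if x: "x \<in> Rn N" for x
  proof -
    have "(\<lambda>y. near_part s x y) \<in> borel_measurable (leb N)"
      using measurable_compose[OF measurable_Pair1'[of x "leb N" "leb N"] near_part_measurable] x by simp
    from nn_integral_translate[OF x this]
    have "(\<integral>\<^sup>+y. near_part s x y \<partial>leb N) = (\<integral>\<^sup>+h. near_part s x (h \<oplus> x) \<partial>leb N)" by simp
    also have "\<dots> = (\<integral>\<^sup>+h. ?i h * ?k h * ?g x h \<partial>leb N)"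
      by (rule nn_integral_cong) (simp add: near_part_def vadd_commute[of _ x] edist_shift' ind distrib_left mult_ac)
    finally show ?thesis .
  qed
  have "(\<integral>\<^sup>+x. \<integral>\<^sup>+y. near_part s x y \<partial>leb N \<partial>leb N) = (\<integral>\<^sup>+x. \<integral>\<^sup>+h. ?i h * ?k h * ?g x h \<partial>leb N \<partial>leb N)"
    by (rule nn_integral_cong) (simp add: sh)
  also have "\<dots> = (\<integral>\<^sup>+h. \<integral>\<^sup>+x. ?i h * ?k h * ?g x h \<partial>leb N \<partial>leb N)"
    by (rule lebp.Fubini') (simp add: case_prod_beta vadd_commute)
  also have "\<dots> \<le> (\<integral>\<^sup>+h. (A + B) * (?i h * ennreal (enorm N h powr p / enorm N h powr (real N + s * p))) \<partial>leb N)"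
  proof (rule nn_integral_mono)
    fix h assume "h \<in> space (leb N)"
    then have h: "h \<in> Rn N" by simp
    have [measurable]: "(\<lambda>x. u (x \<oplus> h)) \<in> borel_measurable (leb N)" "(\<lambda>x. v (x \<oplus> h)) \<in> borel_measurable (leb N)"
      by (rule measurable_translate_fun[OF um h], rule measurable_translate_fun[OF vm h])
    show "(\<integral>\<^sup>+x. ?i h * ?k h * ?g x h \<partial>leb N) \<le> (A + B) * (?i h * ennreal (enorm N h powr p / enorm N h powr (real N + s * p)))"
    proof (cases "0 < enorm N h \<and> enorm N h < d")
      case True
      then have hc: "h \<in> cube N d" by (intro enorm_le_cube h) auto
      have "(\<integral>\<^sup>+x. ?i h * ?k h * ?g x h \<partial>leb N) = ?k h * (\<integral>\<^sup>+x. ?g x h \<partial>leb N)"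
        using True by (simp add: nn_integral_cmult)
      also have "(\<integral>\<^sup>+x. ?g x h \<partial>leb N) = (\<integral>\<^sup>+x. indicator K x * ennreal (\<bar>u (x \<oplus> h) - u x\<bar> powr p) \<partial>leb N) + (\<integral>\<^sup>+x. indicator K x * ennreal (\<bar>v (x \<oplus> h) - v x\<bar> powr p) \<partial>leb N)"
        by (rule nn_integral_add) measurable
      also have "?k h * \<dots> \<le> ?k h * (ennreal (enorm N h powr p) * A + ennreal (enorm N h powr p) * B)"
        by (intro mult_left_mono add_mono A B hc) simp
      also have "\<dots> = (A + B) * (?k h * ennreal (enorm N h powr p))"
        by (simp add: algebra_simps)
      also have "?k h * ennreal (enorm N h powr p) = ennreal (enorm N h powr p / enorm N h powr (real N + s * p))"
        by (simp flip: ennreal_mult)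
      finally show ?thesis using True by simp
    qed simp
  qed
  also have "\<dots> = (A + B) * (\<integral>\<^sup>+h. ?i h * ennreal (enorm N h powr p / enorm N h powr (real N + s * p)) \<partial>leb N)"
    by (rule nn_integral_cmult) measurable
  also have "\<dots> \<le> (A + B) * ennreal ((4 ^ N * max 1 (d powr p) * ((1 + p * ln 2) / ln 2) / p) / (1 - s))"
    by (rule mult_left_mono[OF kernel_near_bound[OF s p d]]) simp
  finally show ?thesis .
qed

text \<open>For \<open>x\<close> in \<open>K\<close>, a subset of the ball of radius \<open>R\<close>, a far point \<open>y\<close> either lies in the ball of radius
  \<open>2 R\<close>, where the kernel is bounded, or satisfies \<open>\<bar>x - y\<bar> \<ge> \<bar>y\<bar> / 2\<close>, so that the tail of \<open>u\<close> centred at the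
  origin controls the integral.\<close>

lemma far_part_integral_le:
  assumes s: "0 < s" "s < 1" and R: "1 \<le> R" and KR: "\<And>x. x \<in> K \<Longrightarrow> enorm N x < R" and KRn: "K \<subseteq> Rn N"
  shows "(\<integral>\<^sup>+x. \<integral>\<^sup>+y. far_part s x y \<partial>leb N \<partial>leb N)
    \<le> ennreal (2 powr (p - 1)) * (
      (\<integral>\<^sup>+x. ennreal (\<bar>u x\<bar> powr (p - 1) * \<bar>v x\<bar>) \<partial>leb N)
        * ennreal ((4 ^ N * max 1 (d powr (- p)) * ((1 + p * ln 2) / ln 2) / p) / s)
      + (\<integral>\<^sup>+x. ennreal \<bar>v x\<bar> \<partial>leb N) *
        (ennreal (2 powr (real N + p)) * (\<integral>\<^sup>+y\<in>Rn N - euclid_ball N vzero (2 * R). ennreal (\<bar>u y\<bar> powr (p - 1) / edist N y vzero powr (real N + s * p)) \<partial>leb N)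
         + ennreal (max 1 (d powr (- (real N + p)))) * (\<integral>\<^sup>+y\<in>cube N (2 * R). ennreal (\<bar>u y\<bar> powr (p - 1)) \<partial>leb N)))"
    (is "_ \<le> ennreal ?c * (?W * ?kf + ?V * (?a * ?\<tau> + ?b * ?\<Lambda>))")
proof -
  let ?i = "\<lambda>x y. indicator {e. d \<le> e} (edist N x y) * ennreal (1 / edist N x y powr (real N + s * p)) :: ennreal"
  have im: "(\<lambda>y. ?i x y) \<in> borel_measurable (leb N)" if "x \<in> Rn N" for x
  proof -
    have [measurable]: "(\<lambda>y. edist N x y) \<in> borel_measurable (leb N)" by (rule measurable_edist) (use that in auto)
    show ?thesis by measurable
  qed
  have b1: "(\<integral>\<^sup>+y. ?i x y \<partial>leb N) \<le> ?kf" if x: "x \<in> Rn N" for x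
  proof -
    have "(\<integral>\<^sup>+y. ?i x y \<partial>leb N) = (\<integral>\<^sup>+h. ?i x (h \<oplus> x) \<partial>leb N)"
      by (rule nn_integral_translate[OF x, of "?i x", symmetric]) (use im[OF x] in simp)
    also have "\<dots> = (\<integral>\<^sup>+h. indicator {h. d \<le> enorm N h} h * ennreal (1 / enorm N h powr (real N + s * p)) \<partial>leb N)"
      by (rule nn_integral_cong) (simp add: edist_shift indicator_def)
    also have "\<dots> \<le> ?kf" by (rule kernel_far_bound[OF s p d])
    finally show ?thesis .
  qed
  have b2: "(\<integral>\<^sup>+y. ?i x y * ennreal (\<bar>u y\<bar> powr (p - 1)) \<partial>leb N) \<le> ?a * ?\<tau> + ?b * ?\<Lambda>" if x: "x \<in> K" for x
  proof -
    have xR: "x \<in> Rn N" using x KRn by auto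
    have bm [measurable]: "euclid_ball N vzero (2 * R) \<in> sets (leb N)"
    proof -
      have "euclid_ball N vzero (2 * R) = {x \<in> space (leb N). edist N x vzero < 2 * R}"
        by (auto simp: euclid_ball_def)
      also have "\<dots> \<in> sets (leb N)" by measurable
      finally show ?thesis .
    qed
    have "(\<integral>\<^sup>+y. ?i x y * ennreal (\<bar>u y\<bar> powr (p - 1)) \<partial>leb N)
      \<le> (\<integral>\<^sup>+y. ?a * (ennreal (\<bar>u y\<bar> powr (p - 1) / edist N y vzero powr (real N + s * p)) * indicator (Rn N - euclid_ball N vzero (2 * R)) y)
         + ?b * (ennreal (\<bar>u y\<bar> powr (p - 1)) * indicator (cube N (2 * R)) y) \<partial>leb N)"
    proof (rule nn_integral_mono)
      fix y assume "y \<in> space (leb N)"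
      then have y: "y \<in> Rn N" by simp
      define t where "t = real N + s * p"
      have t: "0 < t" "t \<le> real N + p" using s p by (auto simp: t_def mult_le_cancel_right1 add_nonneg_pos)
      have ny: "edist N y vzero = enorm N y" by (simp add: edist_def)
      show "?i x y * ennreal (\<bar>u y\<bar> powr (p - 1)) \<le> ?a * (ennreal (\<bar>u y\<bar> powr (p - 1) / edist N y vzero powr (real N + s * p)) * indicator (Rn N - euclid_ball N vzero (2 * R)) y)
         + ?b * (ennreal (\<bar>u y\<bar> powr (p - 1)) * indicator (cube N (2 * R)) y)"
      proof (cases "d \<le> edist N x y")
        case far: True
        then have e0: "0 < edist N x y" using d by linarith
        show ?thesis
        proof (cases "enorm N y < 2 * R")
          case True
          then have yc: "y \<in> cube N (2 * R)" by (intro enorm_le_cube y) auto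
          have "1 / edist N x y powr t \<le> 1 / d powr t"
            using far d t by (intro divide_left_mono powr_mono2 mult_pos_pos) auto
          also have "\<dots> = d powr (- t)" by (simp add: powr_minus divide_inverse)
          also have "\<dots> \<le> max 1 (d powr (- (real N + p)))" using d t by (intro powr_neg_le_max) auto
          finally have "?i x y * ennreal (\<bar>u y\<bar> powr (p - 1)) \<le> ?b * (ennreal (\<bar>u y\<bar> powr (p - 1)) * indicator (cube N (2 * R)) y)"
            using far yc unfolding t_def[symmetric] by (simp add: mult_right_mono ennreal_leI)
          then show ?thesis by (rule add_increasing[rotated]) simp
        next
          case False
          have "enorm N y \<le> enorm N x + edist N x y"
          proof -
            have "x \<oplus> (y - x) = y" by simp
            then have "enorm N y \<le> enorm N x + enorm N (y - x)" using enorm_triangle[of N x "y - x"] by simp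
            also have "enorm N (y - x) = edist N x y"
              using edist_commute[of N x y] by (simp only: edist_eq)
            finally show ?thesis .
          qed
          then have half: "enorm N y / 2 \<le> edist N x y" using KR[OF x] False by linarith
          have y0: "0 < enorm N y" using False R by linarith
          have "1 / edist N x y powr t \<le> 1 / (enorm N y / 2) powr t"
            using half y0 e0 t by (intro divide_left_mono powr_mono2 mult_pos_pos) auto
          also have "\<dots> = 2 powr t / enorm N y powr t" using y0 by (simp add: powr_divide)
          also have "\<dots> \<le> 2 powr (real N + p) / enorm N y powr t" using t by (intro divide_right_mono powr_mono) auto
          finally have "1 / edist N x y powr t * \<bar>u y\<bar> powr (p - 1) \<le> 2 powr (real N + p) / enorm N y powr t * \<bar>u y\<bar> powr (p - 1)"
            by (rule mult_right_mono) simp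
          then have "ennreal (1 / edist N x y powr t) * ennreal (\<bar>u y\<bar> powr (p - 1)) \<le> ?a * ennreal (\<bar>u y\<bar> powr (p - 1) / enorm N y powr t)"
            by (simp add: ennreal_leI flip: ennreal_mult)
          moreover have "y \<in> Rn N - euclid_ball N vzero (2 * R)" using False y by (auto simp: euclid_ball_def ny)
          ultimately have "?i x y * ennreal (\<bar>u y\<bar> powr (p - 1)) \<le> ?a * (ennreal (\<bar>u y\<bar> powr (p - 1) / edist N y vzero powr (real N + s * p)) * indicator (Rn N - euclid_ball N vzero (2 * R)) y)"
            using far unfolding t_def[symmetric] ny by simp
          then show ?thesis by (rule add_increasing2[rotated]) simp
        qed
      qed simp
    qed
    also have "\<dots> = (\<integral>\<^sup>+y. ?a * (ennreal (\<bar>u y\<bar> powr (p - 1) / edist N y vzero powr (real N + s * p)) * indicator (Rn N - euclid_ball N vzero (2 * R)) y) \<partial>leb N)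
         + (\<integral>\<^sup>+y. ?b * (ennreal (\<bar>u y\<bar> powr (p - 1)) * indicator (cube N (2 * R)) y) \<partial>leb N)"
    proof (rule nn_integral_add)
      have [measurable]: "Rn N - euclid_ball N vzero (2 * R) \<in> sets (leb N)" using sets.compl_sets[OF bm] by simp
      show "(\<lambda>y. ?a * (ennreal (\<bar>u y\<bar> powr (p - 1) / edist N y vzero powr (real N + s * p)) * indicator (Rn N - euclid_ball N vzero (2 * R)) y)) \<in> borel_measurable (leb N)"
        by measurable
    qed measurable
    also have "(\<integral>\<^sup>+y. ?a * (ennreal (\<bar>u y\<bar> powr (p - 1) / edist N y vzero powr (real N + s * p)) * indicator (Rn N - euclid_ball N vzero (2 * R)) y) \<partial>leb N) = ?a * ?\<tau>"
    proof (rule nn_integral_cmult)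
      have [measurable]: "Rn N - euclid_ball N vzero (2 * R) \<in> sets (leb N)" using sets.compl_sets[OF bm] by simp
      show "(\<lambda>y. ennreal (\<bar>u y\<bar> powr (p - 1) / edist N y vzero powr (real N + s * p)) * indicator (Rn N - euclid_ball N vzero (2 * R)) y) \<in> borel_measurable (leb N)"
        by measurable
    qed
    also have "(\<integral>\<^sup>+y. ?b * (ennreal (\<bar>u y\<bar> powr (p - 1)) * indicator (cube N (2 * R)) y) \<partial>leb N) = ?b * ?\<Lambda>"
      by (rule nn_integral_cmult) measurable
    finally show ?thesis .
  qed
  have "(\<integral>\<^sup>+x. \<integral>\<^sup>+y. far_part s x y \<partial>leb N \<partial>leb N)
    \<le> (\<integral>\<^sup>+x. ennreal ?c * (ennreal (\<bar>u x\<bar> powr (p - 1) * \<bar>v x\<bar>) * ?kf + ennreal \<bar>v x\<bar> * (?a * ?\<tau> + ?b * ?\<Lambda>)) \<partial>leb N)"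
  proof (rule nn_integral_mono)
    fix x assume "x \<in> space (leb N)"
    then have x: "x \<in> Rn N" by simp
    note im[OF x, measurable]
    have "(\<integral>\<^sup>+y. far_part s x y \<partial>leb N) = (\<integral>\<^sup>+y. (ennreal ?c * ennreal (\<bar>u x\<bar> powr (p - 1) * \<bar>v x\<bar>)) * ?i x y + (ennreal ?c * ennreal \<bar>v x\<bar>) * (?i x y * ennreal (\<bar>u y\<bar> powr (p - 1))) \<partial>leb N)"
      by (rule nn_integral_cong) (simp add: far_part_def ennreal_mult algebra_simps)
    also have "\<dots> = (\<integral>\<^sup>+y. (ennreal ?c * ennreal (\<bar>u x\<bar> powr (p - 1) * \<bar>v x\<bar>)) * ?i x y \<partial>leb N) + (\<integral>\<^sup>+y. (ennreal ?c * ennreal \<bar>v x\<bar>) * (?i x y * ennreal (\<bar>u y\<bar> powr (p - 1))) \<partial>leb N)"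
      by (rule nn_integral_add) measurable
    also have "(\<integral>\<^sup>+y. (ennreal ?c * ennreal (\<bar>u x\<bar> powr (p - 1) * \<bar>v x\<bar>)) * ?i x y \<partial>leb N) = (ennreal ?c * ennreal (\<bar>u x\<bar> powr (p - 1) * \<bar>v x\<bar>)) * (\<integral>\<^sup>+y. ?i x y \<partial>leb N)"
      by (rule nn_integral_cmult) measurable
    also have "(\<integral>\<^sup>+y. (ennreal ?c * ennreal \<bar>v x\<bar>) * (?i x y * ennreal (\<bar>u y\<bar> powr (p - 1))) \<partial>leb N) = (ennreal ?c * ennreal \<bar>v x\<bar>) * (\<integral>\<^sup>+y. ?i x y * ennreal (\<bar>u y\<bar> powr (p - 1)) \<partial>leb N)"
      by (rule nn_integral_cmult) measurable
    also have "(ennreal ?c * ennreal (\<bar>u x\<bar> powr (p - 1) * \<bar>v x\<bar>)) * (\<integral>\<^sup>+y. ?i x y \<partial>leb N) + (ennreal ?c * ennreal \<bar>v x\<bar>) * (\<integral>\<^sup>+y. ?i x y * ennreal (\<bar>u y\<bar> powr (p - 1)) \<partial>leb N)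
      \<le> (ennreal ?c * ennreal (\<bar>u x\<bar> powr (p - 1) * \<bar>v x\<bar>)) * ?kf + (ennreal ?c * ennreal \<bar>v x\<bar>) * (?a * ?\<tau> + ?b * ?\<Lambda>)"
    proof (rule add_mono)
      show "(ennreal ?c * ennreal \<bar>v x\<bar>) * (\<integral>\<^sup>+y. ?i x y * ennreal (\<bar>u y\<bar> powr (p - 1)) \<partial>leb N) \<le> (ennreal ?c * ennreal \<bar>v x\<bar>) * (?a * ?\<tau> + ?b * ?\<Lambda>)"
      proof (cases "x \<in> K")
        case True
        then show ?thesis by (intro mult_left_mono b2) auto
      qed (use v0[OF x] in simp)
    qed (intro mult_left_mono b1 x, simp)
    finally show "(\<integral>\<^sup>+y. far_part s x y \<partial>leb N) \<le> ennreal ?c * (ennreal (\<bar>u x\<bar> powr (p - 1) * \<bar>v x\<bar>) * ?kf + ennreal \<bar>v x\<bar> * (?a * ?\<tau> + ?b * ?\<Lambda>))"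
      by (simp add: distrib_left mult.assoc)
  qed
  also have "\<dots> = ennreal ?c * (\<integral>\<^sup>+x. ennreal (\<bar>u x\<bar> powr (p - 1) * \<bar>v x\<bar>) * ?kf + ennreal \<bar>v x\<bar> * (?a * ?\<tau> + ?b * ?\<Lambda>) \<partial>leb N)"
    by (rule nn_integral_cmult) measurable
  also have "(\<integral>\<^sup>+x. ennreal (\<bar>u x\<bar> powr (p - 1) * \<bar>v x\<bar>) * ?kf + ennreal \<bar>v x\<bar> * (?a * ?\<tau> + ?b * ?\<Lambda>) \<partial>leb N)
    = (\<integral>\<^sup>+x. ennreal (\<bar>u x\<bar> powr (p - 1) * \<bar>v x\<bar>) * ?kf \<partial>leb N) + (\<integral>\<^sup>+x. ennreal \<bar>v x\<bar> * (?a * ?\<tau> + ?b * ?\<Lambda>) \<partial>leb N)"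
    by (rule nn_integral_add) measurable
  also have "(\<integral>\<^sup>+x. ennreal (\<bar>u x\<bar> powr (p - 1) * \<bar>v x\<bar>) * ?kf \<partial>leb N) = ?W * ?kf"
    by (rule nn_integral_multc) measurable
  also have "(\<integral>\<^sup>+x. ennreal \<bar>v x\<bar> * (?a * ?\<tau> + ?b * ?\<Lambda>) \<partial>leb N) = ?V * (?a * ?\<tau> + ?b * ?\<Lambda>)"
    by (rule nn_integral_multc) measurable
  finally show ?thesis .
qed

end

lemma admissible_D:
  assumes "admissible_measure \<mu>"
  shows "finite_measure \<mu>" "sets \<mu> = sets (restrict_space borel {0..1})" "space \<mu> = {0..1}"
proof -
  show "finite_measure \<mu>" and s: "sets \<mu> = sets (restrict_space borel {0..1})"
    using assms by (auto simp: admissible_measure_def)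
  show "space \<mu> = {0..1}" using sets_eq_imp_space_eq[OF s] by (simp add: space_restrict_space)
qed

lemma admissible_measurable:
  fixes f :: "real \<Rightarrow> real"
  assumes \<mu>: "admissible_measure \<mu>"
  shows "continuous_on {0..1} f \<Longrightarrow> f \<in> borel_measurable \<mu>"
    and "(\<lambda>s. s) \<in> borel_measurable \<mu>" and "{0<..<1} \<in> sets \<mu>"
proof -
  have *: "f \<in> borel_measurable \<mu>" if "continuous_on {0..1} f" for f :: "real \<Rightarrow> real"
    by (subst measurable_cong_sets[OF admissible_D(2)[OF \<mu>] refl]) (rule borel_measurable_continuous_on_restrict[OF that])
  then show "continuous_on {0..1} f \<Longrightarrow> f \<in> borel_measurable \<mu>" .
  show "(\<lambda>s. s) \<in> borel_measurable \<mu>" by (rule *) (rule continuous_on_id)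
  show "{0<..<1} \<in> sets \<mu>"
    unfolding admissible_D(2)[OF \<mu>] by (subst sets_restrict_space_iff) auto
qed

text \<open>The nonlocal integral in the definition of a subsolution is a Bochner integral, which is \<open>0\<close> by convention
  when the integrand is not integrable. Absolute convergence is therefore what gives the weak
  formulation its meaning, and what permits it to be split into positive and negative parts. The
  kernel integrals diverge like \<open>1/(1-s)\<close> and \<open>1/s\<close>, and the constant \<open>C\<^sub>N\<^sub>,\<^sub>s\<^sub>,\<^sub>p\<close> compensates both.\<close>

theorem nonlocal_form_finite:
  assumes N: "1 \<le> N" and p: "1 < p" and \<mu>: "admissible_measure \<mu>" and U: "openin (Euclidean_space N) U"
    and tail: "u \<in> tail_space N p \<mu>"
    and wu: "\<And>i. i < N \<Longrightarrow> weak_deriv N U i u (gu i)" and wv: "\<And>i. i < N \<Longrightarrow> weak_deriv N U i v (gv i)"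
    and vm [measurable]: "v \<in> borel_measurable (leb N)"
    and K: "compact K" "K \<subseteq> U" and v0: "\<And>x. x \<in> Rn N \<Longrightarrow> x \<notin> K \<Longrightarrow> v x = 0"
    and up: "\<And>L. compact L \<Longrightarrow> L \<subseteq> U \<Longrightarrow> pint N p (cut L u) < \<infinity>"
    and gup: "\<And>L i. compact L \<Longrightarrow> L \<subseteq> U \<Longrightarrow> i < N \<Longrightarrow> pint N p (cut L (gu i)) < \<infinity>"
    and gvp: "\<And>L i. compact L \<Longrightarrow> L \<subseteq> U \<Longrightarrow> i < N \<Longrightarrow> pint N p (cut L (gv i)) < \<infinity>"
    and vp: "pint N p v < \<infinity>"
  shows "(\<integral>\<^sup>+s\<in>{0<..<1}. ennreal (C_const N s p) *
    (\<integral>\<^sup>+z. ennreal \<bar>nonlocal_integrand N p u v s (fst z) (snd z)\<bar> \<partial>(leb N \<Otimes>\<^sub>M leb N)) \<partial>\<mu>) < \<infinity>"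
proof -
  have KRn: "K \<subseteq> Rn N" using K openin_subset_Rn[OF U] by auto
  have Km [measurable]: "K \<in> sets (leb N)" by (rule sets_leb_compact[OF K(1) KRn])
  have um [measurable]: "u \<in> borel_measurable (leb N)" using tail by (simp add: tail_space_def)
  obtain d' where d': "0 < d'" "thick N K d' \<subseteq> U" using thick_subset_open[OF K U] by blast
  \<comment> \<open>A third of the available room: an increment of size \<open>d\<close>, moved coordinate by coordinate, needs a margin of \<open>3 d\<close>.\<close>
  define d where "d = d' / 3"
  have d: "0 < d" using d' by (simp add: d_def)
  let ?L = "thick N (thick N K d) (2 * d)"
  have "?L \<subseteq> thick N K (d + 2 * d)" by (rule thick_thick)
  also have "d + 2 * d = d'" by (simp add: d_def)
  finally have L: "?L \<subseteq> U" using d' by auto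
  have cL: "compact ?L" by (intro compact_thick K)
  define A where "A = ennreal (real N powr p) * (\<Sum>j<N. pint N p (cut ?L (gu j)))"
  define B where "B = ennreal (real N powr p) * (\<Sum>j<N. pint N p (cut ?L (gv j)))"
  have A: "A < \<top>" and B: "B < \<top>"
    using gup[OF cL L] gvp[OF cL L] by (auto simp: A_def B_def ennreal_mult_less_top)
  have incA: "(\<integral>\<^sup>+x. indicator K x * ennreal (\<bar>u (x \<oplus> h) - u x\<bar> powr p) \<partial>leb N) \<le> ennreal (enorm N h powr p) * A"
    if "h \<in> cube N d" for h
    unfolding A_def by (rule increment_bound[OF wu um K(1) KRn d L _ that]) (use p in auto)
  have incB: "(\<integral>\<^sup>+x. indicator K x * ennreal (\<bar>v (x \<oplus> h) - v x\<bar> powr p) \<partial>leb N) \<le> ennreal (enorm N h powr p) * B"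
    if "h \<in> cube N d" for h
    unfolding B_def by (rule increment_bound[OF wv vm K(1) KRn d L _ that]) (use p in auto)
  obtain R0 where R0: "0 < R0" "K \<subseteq> cube N R0" using compact_subset_cube[OF K(1) KRn] by metis
  define R where "R = 1 + real N * R0"
  have R: "1 \<le> R" using R0 by (simp add: R_def)
  have KR: "enorm N x < R" if "x \<in> K" for x
  proof -
    have "enorm N x \<le> (\<Sum>i<N. \<bar>x i\<bar>)" unfolding enorm_def by (rule L2_set_le_sum_abs)
    also have "\<dots> \<le> real N * R0"
      using sum_bounded_above[of "{..<N}" "\<lambda>i. \<bar>x i\<bar>" R0] R0 that by (auto simp: cube_def)
    finally show ?thesis by (simp add: R_def)
  qed
  define W where "W = (\<integral>\<^sup>+x. ennreal (\<bar>u x\<bar> powr (p - 1) * \<bar>v x\<bar>) \<partial>leb N)"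
  have W: "W < \<top>"
  proof -
    have "W \<le> (\<integral>\<^sup>+x. ennreal (\<bar>cut K u x\<bar> powr p) + ennreal (\<bar>v x\<bar> powr p) \<partial>leb N)"
      unfolding W_def
    proof (rule nn_integral_mono)
      fix x assume "x \<in> space (leb N)"
      then show "ennreal (\<bar>u x\<bar> powr (p - 1) * \<bar>v x\<bar>) \<le> ennreal (\<bar>cut K u x\<bar> powr p) + ennreal (\<bar>v x\<bar> powr p)"
        using powr_mult_young[of p "\<bar>u x\<bar>" "\<bar>v x\<bar>"] p v0[of x]
        by (cases "x \<in> K") (auto intro!: ennreal_leI simp flip: ennreal_plus)
    qed
    also have "\<dots> = pint N p (cut K u) + pint N p v"
      unfolding pint_def by (rule nn_integral_add) (simp_all add: cut_def[abs_def])
    also have "\<dots> < \<top>" using up[OF K] vp by simp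
    finally show ?thesis .
  qed
  define V where "V = (\<integral>\<^sup>+x. ennreal \<bar>v x\<bar> \<partial>leb N)"
  have V: "V < \<top>"
  proof -
    have "integrable (leb N) v"
      by (rule pint_finite_imp_integrable[OF vm vp, of R0]) (use p v0 R0 in auto)
    then show ?thesis by (simp add: V_def integrable_iff_bounded)
  qed
  define \<Lambda> where "\<Lambda> = (\<integral>\<^sup>+y\<in>cube N (2 * R). ennreal (\<bar>u y\<bar> powr (p - 1)) \<partial>leb N)"
  have \<Lambda>: "\<Lambda> < \<top>"
    using tail cube_subset_Rn[of N "2 * R"] by (auto simp: tail_space_def compactin_iff \<Lambda>_def)
  define \<tau> where "\<tau> s = (\<integral>\<^sup>+y\<in>Rn N - euclid_ball N vzero (2 * R). ennreal (\<bar>u y\<bar> powr (p - 1) / edist N y vzero powr (real N + s * p)) \<partial>leb N)" for s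
  have \<tau>m [measurable]: "\<tau> \<in> borel_measurable \<mu>"
  proof -
    have eb: "Rn N - euclid_ball N vzero (2 * R) = {x \<in> space (leb N). \<not> edist N x vzero < 2 * R}"
      by (auto simp: euclid_ball_def)
    have [measurable]: "Rn N - euclid_ball N vzero (2 * R) \<in> sets (leb N)" unfolding eb by measurable
    note [measurable] = admissible_measurable(2)[OF \<mu>]
    show ?thesis unfolding \<tau>_def
      by (rule leb.borel_measurable_nn_integral) (simp add: case_prod_beta)
  qed
  have Cm [measurable]: "(\<lambda>s. C_const N s p) \<in> borel_measurable \<mu>"
    by (rule admissible_measurable(1)[OF \<mu> C_const_cont(1)[OF N p]])
  note [measurable] = admissible_measurable(3)[OF \<mu>]
  have tailfin: "(\<integral>\<^sup>+s. indicator {0<..<1} s * (ennreal (C_const N s p) * \<tau> s) \<partial>\<mu>) < \<top>"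
  proof -
    have "Tail N p \<mu> u vzero (2 * R) < \<infinity>" using tail R by (auto simp: tail_space_def)
    then have "tail_integral N p \<mu> u vzero (2 * R) \<noteq> \<infinity>" unfolding Tail_def by (auto split: if_splits)
    moreover have "(\<integral>\<^sup>+s. indicator {0<..<1} s * (ennreal (C_const N s p) * \<tau> s) \<partial>\<mu>) \<le> tail_integral N p \<mu> u vzero (2 * R)"
      unfolding tail_integral_def \<tau>_def[symmetric]
    proof (rule nn_integral_mono)
      fix s
      show "indicator {0<..<1} s * (ennreal (C_const N s p) * \<tau> s) \<le> ennreal (C_const N s p * (2 * R) powr (s * p)) * \<tau> s * indicator {0<..<1} s"
      proof (cases "s \<in> {0<..<1}")
        case True
        have "1 \<le> (2 * R) powr (s * p)" using True R p by (intro ge_one_powr_ge_zero) auto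
        then have "C_const N s p * 1 \<le> C_const N s p * (2 * R) powr (s * p)"
          using C_const_cont(3)[OF N p True] by (intro mult_left_mono) auto
        then show ?thesis using True by (simp add: mult_right_mono ennreal_leI)
      qed simp
    qed
    ultimately show ?thesis by (simp add: less_top top_unique)
  qed
  obtain K0 where K0: "0 \<le> K0" "\<And>s. s \<in> {0<..<1} \<Longrightarrow> C_const N s p \<le> K0 * (s * (1 - s))"
    using C_const_cont(2)[OF N p] by blast
  define Bn where "Bn = 4 ^ N * max 1 (d powr p) * ((1 + p * ln 2) / ln 2) / p"
  define Bf where "Bf = 4 ^ N * max 1 (d powr (- p)) * ((1 + p * ln 2) / ln 2) / p"
  have Bnn: "0 \<le> Bn" "0 \<le> Bf" using p by (auto simp: Bn_def Bf_def)
  define c where "c = ennreal (2 powr (p - 1))"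
  define a where "a = ennreal (2 powr (real N + p))"
  define b where "b = ennreal (max 1 (d powr (- (real N + p))))"
  \<comment> \<open>The part of the bound that does not depend on \<open>s\<close>; the remaining part carries the tail of \<open>u\<close>.\<close>
  define M0 where "M0 = 2 * ((A + B) * ennreal (K0 * Bn) + c * (W * ennreal (K0 * Bf) + V * (b * \<Lambda> * ennreal K0)))"
  define M1 where "M1 = 2 * (c * (V * a))"
  have M0: "M0 < \<top>" and M1: "M1 < \<top>"
    using A B W V \<Lambda> by (simp_all add: M0_def M1_def a_def b_def c_def ennreal_mult_less_top)
  have bound: "ennreal (C_const N s p) * (\<integral>\<^sup>+z. ennreal \<bar>nonlocal_integrand N p u v s (fst z) (snd z)\<bar> \<partial>(leb N \<Otimes>\<^sub>M leb N))
      \<le> M0 + M1 * (ennreal (C_const N s p) * \<tau> s)" if s: "s \<in> {0<..<1}" for s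
  proof -
    have s': "0 < s" "s < 1" using s by auto
    let ?C = "C_const N s p"
    have C0: "0 < ?C" by (rule C_const_cont(3)[OF N p s])
    have C1: "?C * (Bn / (1 - s)) \<le> K0 * Bn"
    proof -
      have "?C * (Bn / (1 - s)) \<le> K0 * (s * (1 - s)) * (Bn / (1 - s))"
        using K0(2)[OF s] Bnn s' by (intro mult_right_mono) auto
      also have "\<dots> = K0 * Bn * s" using s' by simp
      also have "\<dots> \<le> K0 * Bn * 1" using K0 Bnn s' by (intro mult_left_mono) auto
      finally show ?thesis by simp
    qed
    have C2: "?C * (Bf / s) \<le> K0 * Bf"
    proof -
      have "?C * (Bf / s) \<le> K0 * (s * (1 - s)) * (Bf / s)"
        using K0(2)[OF s] Bnn s' by (intro mult_right_mono) auto
      also have "\<dots> = K0 * Bf * (1 - s)" using s' by simp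
      also have "\<dots> \<le> K0 * Bf * 1" using K0 Bnn s' by (intro mult_left_mono) auto
      finally show ?thesis by simp
    qed
    have C3: "?C \<le> K0"
    proof -
      have "s * (1 - s) \<le> 1 * 1" using s' by (intro mult_mono) auto
      then have "K0 * (s * (1 - s)) \<le> K0 * 1" using K0 by (intro mult_left_mono) auto
      then show ?thesis using K0(2)[OF s] by simp
    qed
    have "(\<integral>\<^sup>+z. ennreal \<bar>nonlocal_integrand N p u v s (fst z) (snd z)\<bar> \<partial>(leb N \<Otimes>\<^sub>M leb N))
      \<le> 2 * ((A + B) * ennreal (Bn / (1 - s)) + c * (W * ennreal (Bf / s) + V * (a * \<tau> s + b * \<Lambda>)))"
      unfolding Bn_def Bf_def c_def a_def b_def W_def V_def \<tau>_def \<Lambda>_def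
      by (rule order_trans[OF nonlocal_integral_le[OF p d um vm Km v0]],
          assumption, assumption,
          rule mult_left_mono[OF add_mono[OF near_part_integral_le[OF p d um vm Km v0 s' incA incB]
            far_part_integral_le[OF p d um vm Km v0 s' R KR KRn]]]) auto
    then have "ennreal ?C * (\<integral>\<^sup>+z. ennreal \<bar>nonlocal_integrand N p u v s (fst z) (snd z)\<bar> \<partial>(leb N \<Otimes>\<^sub>M leb N))
      \<le> ennreal ?C * (2 * ((A + B) * ennreal (Bn / (1 - s)) + c * (W * ennreal (Bf / s) + V * (a * \<tau> s + b * \<Lambda>))))"
      by (rule mult_left_mono) simp
    also have "\<dots> = 2 * ((A + B) * (ennreal ?C * ennreal (Bn / (1 - s))) + c * (W * (ennreal ?C * ennreal (Bf / s)) + V * (b * \<Lambda> * ennreal ?C)))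
       + M1 * (ennreal ?C * \<tau> s)"
      by (simp add: M1_def algebra_simps)
    also have "\<dots> \<le> M0 + M1 * (ennreal ?C * \<tau> s)"
      unfolding M0_def
    proof (intro add_mono mult_left_mono order_refl)
      show "ennreal ?C * ennreal (Bn / (1 - s)) \<le> ennreal (K0 * Bn)"
        using C1 C0 Bnn s' by (simp add: ennreal_leI flip: ennreal_mult)
      show "ennreal ?C * ennreal (Bf / s) \<le> ennreal (K0 * Bf)"
        using C2 C0 Bnn s' by (simp add: ennreal_leI flip: ennreal_mult)
      show "ennreal ?C \<le> ennreal K0" using C3 by (rule ennreal_leI)
    qed auto
    finally show ?thesis .
  qed
  have "(\<integral>\<^sup>+s\<in>{0<..<1}. ennreal (C_const N s p) *
    (\<integral>\<^sup>+z. ennreal \<bar>nonlocal_integrand N p u v s (fst z) (snd z)\<bar> \<partial>(leb N \<Otimes>\<^sub>M leb N)) \<partial>\<mu>)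
    \<le> (\<integral>\<^sup>+s. M0 + M1 * (indicator {0<..<1} s * (ennreal (C_const N s p) * \<tau> s)) \<partial>\<mu>)"
  proof (rule nn_integral_mono)
    fix s
    show "ennreal (C_const N s p) * (\<integral>\<^sup>+z. ennreal \<bar>nonlocal_integrand N p u v s (fst z) (snd z)\<bar> \<partial>(leb N \<Otimes>\<^sub>M leb N)) * indicator {0<..<1} s
      \<le> M0 + M1 * (indicator {0<..<1} s * (ennreal (C_const N s p) * \<tau> s))"
      using bound[of s] by (cases "s \<in> {0<..<1}") auto
  qed
  also have "\<dots> = (\<integral>\<^sup>+s. M0 \<partial>\<mu>) + (\<integral>\<^sup>+s. M1 * (indicator {0<..<1} s * (ennreal (C_const N s p) * \<tau> s)) \<partial>\<mu>)"
    by (rule nn_integral_add) measurable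
  also have "(\<integral>\<^sup>+s. M0 \<partial>\<mu>) = M0 * emeasure \<mu> (space \<mu>)" by simp
  also have "(\<integral>\<^sup>+s. M1 * (indicator {0<..<1} s * (ennreal (C_const N s p) * \<tau> s)) \<partial>\<mu>)
     = M1 * (\<integral>\<^sup>+s. indicator {0<..<1} s * (ennreal (C_const N s p) * \<tau> s) \<partial>\<mu>)"
    by (rule nn_integral_cmult) measurable
  also have "M0 * emeasure \<mu> (space \<mu>) + M1 * (\<integral>\<^sup>+s. indicator {0<..<1} s * (ennreal (C_const N s p) * \<tau> s) \<partial>\<mu>) < \<infinity>"
    using M0 M1 tailfin finite_measure.emeasure_finite[OF admissible_D(1)[OF \<mu>], of "space \<mu>"]
    by (simp add: ennreal_mult_less_top less_top)
  finally show ?thesis .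
qed

section \<open>Pointwise inequalities\<close>

text \<open>The constant with which half of \<open>Y\<^sup>p\<close> absorbs the mixed term \<open>p X Y\<^sup>p\<^sup>-\<^sup>1\<close>.\<close>

definition young_const :: "real \<Rightarrow> real" where
  "young_const p = p * (2 * p) powr (p - 1)"

lemma young_const_pos: "1 < p \<Longrightarrow> 0 < young_const p"
  by (simp add: young_const_def)

text \<open>Either \<open>Y\<close> dominates \<open>2 p X\<close>, and the mixed term is at most \<open>Y\<^sup>p / 2\<close>, or it is dominated by it, and the
  mixed term is at most a multiple of \<open>X\<^sup>p\<close>.\<close>

lemma young_absorb:
  fixes p X Y :: real
  assumes p: "1 < p" and X: "0 \<le> X" and Y: "0 \<le> Y"
  shows "p * X * Y powr (p - 1) \<le> Y powr p / 2 + young_const p * X powr p"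
proof (cases "2 * p * X \<le> Y")
  case True
  have "p * X * Y powr (p - 1) \<le> Y / 2 * Y powr (p - 1)" using True by (intro mult_right_mono) auto
  also have "\<dots> = Y powr p / 2"
    using Y powr_add[of Y "p - 1" 1] by (cases "Y = 0") (auto simp: mult.commute)
  also have "\<dots> \<le> Y powr p / 2 + young_const p * X powr p" using young_const_pos[OF p] by simp
  finally show ?thesis .
next
  case False
  have X0: "0 < X" using False X Y p by (cases "X = 0") auto
  have "p * X * Y powr (p - 1) \<le> p * X * (2 * p * X) powr (p - 1)"
    using False p X Y by (intro mult_left_mono powr_mono2) auto
  also have "(2 * p * X) powr (p - 1) = (2 * p) powr (p - 1) * X powr (p - 1)" by (rule powr_mult)
  also have "p * X * ((2 * p) powr (p - 1) * X powr (p - 1)) = young_const p * (X * X powr (p - 1))"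
    by (simp add: young_const_def)
  also have "X * X powr (p - 1) = X powr p" using X0 powr_add[of X "p - 1" 1] by (simp add: mult.commute)
  also have "young_const p * X powr p \<le> Y powr p / 2 + young_const p * X powr p" by simp
  finally show ?thesis .
qed

text \<open>With \<open>M = max A D\<close> the difference \<open>\<alpha> A\<^sup>p - \<beta> D\<^sup>p\<close> is at least \<open>(\<alpha> - \<beta>) M\<^sup>p\<close> minus a term
  proportional to \<open>\<bar>A - D\<bar>\<close>. Multiplied by \<open>(\<alpha> - \<beta>)\<^sup>p\<^sup>-\<^sup>1\<close> the first term becomes \<open>Y\<^sup>p\<close> with
  \<open>Y = (\<alpha> - \<beta>) M\<close>, the second becomes \<open>p X Y\<^sup>p\<^sup>-\<^sup>1\<close> with \<open>X = \<alpha> \<bar>A - D\<bar>\<close> and is absorbed. Finally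
  \<open>\<bar>\<alpha> A - \<beta> D\<bar> \<le> X + Y\<close>.\<close>

lemma caccioppoli_core:
  fixes p \<alpha> \<beta> A D :: real
  assumes p: "1 < p" and ab: "0 \<le> \<beta>" "\<beta> \<le> \<alpha>" and AD: "0 \<le> A" "0 \<le> D"
  shows "2 powr (- p) / 2 * abs (\<alpha> * A - \<beta> * D) powr p
    \<le> (\<alpha> - \<beta>) powr (p - 1) * (\<alpha> * A powr p - \<beta> * D powr p) + (young_const p + 1 / 2) * (\<alpha> powr p * abs (A - D) powr p)"
proof -
  define M where "M = max A D"
  define X where "X = \<alpha> * abs (A - D)"
  define Y where "Y = (\<alpha> - \<beta>) * M"
  have M: "0 \<le> M" "A \<le> M" "D \<le> M" "M - A \<le> abs (A - D)" using AD by (auto simp: M_def)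
  have X: "0 \<le> X" and Y: "0 \<le> Y" using ab M by (auto simp: X_def Y_def)
  have Yp: "Y powr q = (\<alpha> - \<beta>) powr q * M powr q" for q using ab M by (simp add: Y_def powr_mult)
  have Xp: "X powr p = \<alpha> powr p * abs (A - D) powr p" using ab by (simp add: X_def powr_mult)
  have ab1: "(\<alpha> - \<beta>) powr (p - 1) * (\<alpha> - \<beta>) = (\<alpha> - \<beta>) powr p"
    using ab powr_add[of "\<alpha> - \<beta>" "p - 1" 1] by (cases "\<alpha> = \<beta>") auto
  have tan: "M powr p - A powr p \<le> p * M powr (p - 1) * abs (A - D)"
  proof -
    have M1: "M powr (p - 1) * M = M powr p" using M powr_add[of M "p - 1" 1] by (cases "M = 0") auto
    have "p * M powr (p - 1) * A \<le> A powr p + (p - 1) * M powr p"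
      using p AD M by (intro powr_tangent) auto
    then have "M powr p - A powr p \<le> p * (M powr (p - 1) * M) - p * M powr (p - 1) * A"
      unfolding M1 by (simp add: algebra_simps)
    also have "\<dots> = p * M powr (p - 1) * (M - A)" by (simp add: algebra_simps)
    also have "\<dots> \<le> p * M powr (p - 1) * abs (A - D)" using M p by (intro mult_left_mono) auto
    finally show ?thesis .
  qed
  have "\<beta> * D powr p \<le> \<beta> * M powr p" using ab AD M p by (intro mult_left_mono powr_mono2) auto
  then have 1: "(\<alpha> - \<beta>) * M powr p - \<alpha> * (M powr p - A powr p) \<le> \<alpha> * A powr p - \<beta> * D powr p"
    by (simp add: algebra_simps)
  have "\<alpha> * (M powr p - A powr p) \<le> \<alpha> * (p * M powr (p - 1) * abs (A - D))"
    using tan ab by (intro mult_left_mono) auto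
  with 1 have "(\<alpha> - \<beta>) * M powr p - p * X * M powr (p - 1) \<le> \<alpha> * A powr p - \<beta> * D powr p"
    by (simp add: X_def mult_ac)
  then have "(\<alpha> - \<beta>) powr (p - 1) * ((\<alpha> - \<beta>) * M powr p - p * X * M powr (p - 1))
      \<le> (\<alpha> - \<beta>) powr (p - 1) * (\<alpha> * A powr p - \<beta> * D powr p)"
    by (rule mult_left_mono) simp
  also have "(\<alpha> - \<beta>) powr (p - 1) * ((\<alpha> - \<beta>) * M powr p - p * X * M powr (p - 1)) = Y powr p - p * X * Y powr (p - 1)"
    unfolding Yp ab1[symmetric] by (simp add: algebra_simps)
  finally have 2: "Y powr p / 2 \<le> (\<alpha> - \<beta>) powr (p - 1) * (\<alpha> * A powr p - \<beta> * D powr p) + young_const p * X powr p"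
    using young_absorb[OF p X Y] by simp
  have "abs (\<alpha> * A - \<beta> * D) \<le> Y + X"
  proof -
    have "\<alpha> * A - \<beta> * D = (\<alpha> - \<beta>) * A + \<beta> * (A - D)" by (simp add: algebra_simps)
    also have "abs \<dots> \<le> abs ((\<alpha> - \<beta>) * A) + abs (\<beta> * (A - D))" by (rule abs_triangle_ineq)
    also have "\<dots> \<le> Y + X"
      unfolding Y_def X_def abs_mult using ab AD M by (intro add_mono mult_mono) auto
    finally show ?thesis .
  qed
  then have "abs (\<alpha> * A - \<beta> * D) powr p \<le> abs (Y + X) powr p" using p X Y by (intro powr_mono2) auto
  also have "\<dots> \<le> 2 powr p * (Y powr p + X powr p)" using powr_abs_add_le[of p Y X] p X Y by simp
  finally have "2 powr (- p) * abs (\<alpha> * A - \<beta> * D) powr p \<le> 2 powr (- p) * (2 powr p * (Y powr p + X powr p))"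
    by (rule mult_left_mono) simp
  also have "\<dots> = Y powr p + X powr p" by (simp add: powr_minus)
  finally have 3: "2 powr (- p) / 2 * abs (\<alpha> * A - \<beta> * D) powr p \<le> Y powr p / 2 + X powr p / 2" by simp
  have "(young_const p + 1 / 2) * X powr p = young_const p * X powr p + X powr p / 2" by (simp add: algebra_simps)
  with 2 3 show ?thesis unfolding Xp[symmetric] by linarith
qed

lemma signed_power_mono:
  fixes p t \<tau> :: real
  assumes p: "1 < p" and t: "0 \<le> \<tau>" "\<tau> \<le> t"
  shows "\<tau> powr (p - 1) \<le> abs t powr (p - 2) * t"
proof (cases "t = 0")
  case False
  then have "0 < t" using t by simp
  then have "abs t powr (p - 2) * t = t powr (p - 1)" using powr_add[of t "p - 2" 1] by simp
  then show ?thesis using t p by (simp add: powr_mono2)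
qed (use t in simp)

text \<open>By symmetry \<open>b \<le> a\<close>. Truncation only decreases the increment, and if it does so strictly then
  \<open>\<beta> = 0\<close>, so that the factor \<open>\<alpha> A\<^sup>p - \<beta> D\<^sup>p\<close> is nonnegative and the increment of \<open>u\<close> may replace that
  of the truncation.\<close>

lemma caccioppoli_nonlocal_inside:
  fixes p a b k A D :: real
  assumes p: "1 < p" and AD: "0 \<le> A" "0 \<le> D"
  defines "\<alpha> \<equiv> max (a - k) 0" and "\<beta> \<equiv> max (b - k) 0"
  shows "2 powr (- p) / 2 * abs (\<alpha> * A - \<beta> * D) powr p
    \<le> abs (a - b) powr (p - 2) * (a - b) * (\<alpha> * A powr p - \<beta> * D powr p)
      + (young_const p + 1 / 2) * (max \<alpha> \<beta> powr p * abs (A - D) powr p)"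
proof -
  have main: "2 powr (- p) / 2 * abs (max (a - k) 0 * A - max (b - k) 0 * D) powr p
    \<le> abs (a - b) powr (p - 2) * (a - b) * (max (a - k) 0 * A powr p - max (b - k) 0 * D powr p)
      + (young_const p + 1 / 2) * (max (max (a - k) 0) (max (b - k) 0) powr p * abs (A - D) powr p)"
    if ba: "b \<le> a" and AD: "0 \<le> A" "0 \<le> D" for a b A D :: real
  proof -
    let ?\<alpha> = "max (a - k) 0" and ?\<beta> = "max (b - k) 0"
    have ab: "0 \<le> ?\<beta>" "?\<beta> \<le> ?\<alpha>" using ba by auto
    have mx: "max ?\<alpha> ?\<beta> = ?\<alpha>" using ab by auto
    have "(?\<alpha> - ?\<beta>) powr (p - 1) * (?\<alpha> * A powr p - ?\<beta> * D powr p)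
      \<le> abs (a - b) powr (p - 2) * (a - b) * (?\<alpha> * A powr p - ?\<beta> * D powr p)"
    proof (cases "b \<le> k")
      case True
      then have "?\<beta> = 0" by simp
      moreover have "?\<alpha> powr (p - 1) \<le> abs (a - b) powr (p - 2) * (a - b)"
        by (rule signed_power_mono[OF p]) (use True ba in auto)
      ultimately show ?thesis by (simp add: mult_right_mono)
    next
      case False
      then have "?\<alpha> - ?\<beta> = a - b" using ba by auto
      moreover have "abs (a - b) powr (p - 2) * (a - b) = (a - b) powr (p - 1)"
        using ba powr_add[of "a - b" "p - 2" 1] by (cases "a = b") auto
      ultimately show ?thesis by simp
    qed
    with caccioppoli_core[OF p ab AD] show ?thesis unfolding mx by linarith
  qed
  show ?thesis
  proof (cases "b \<le> a")
    case True
    show ?thesis unfolding \<alpha>_def \<beta>_def by (rule main[OF True AD])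
  next
    case False
    have e1: "abs (\<beta> * D - \<alpha> * A) = abs (\<alpha> * A - \<beta> * D)" "abs (D - A) = abs (A - D)" "abs (b - a) = abs (a - b)" "max \<beta> \<alpha> = max \<alpha> \<beta>" by auto
    have e2: "abs (a - b) powr (p - 2) * (b - a) * (\<beta> * D powr p - \<alpha> * A powr p) = abs (a - b) powr (p - 2) * (a - b) * (\<alpha> * A powr p - \<beta> * D powr p)"
      by (simp add: algebra_simps)
    from main[of a b D A, folded \<alpha>_def \<beta>_def] False AD show ?thesis unfolding e1 e2 by simp
  qed
qed

text \<open>A negative contribution occurs only for \<open>k < a < b\<close>, and then \<open>b - a \<le> \<beta>\<close>.\<close>

lemma caccioppoli_nonlocal_outside:
  fixes p a b k c :: real
  assumes p: "1 < p" and c: "0 \<le> c"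
  defines "\<alpha> \<equiv> max (a - k) 0" and "\<beta> \<equiv> max (b - k) 0"
  shows "- (\<beta> powr (p - 1) * (\<alpha> * c)) \<le> abs (a - b) powr (p - 2) * (a - b) * (\<alpha> * c)"
proof (cases "\<alpha> = 0")
  case False
  then have ak: "k < a" and al: "0 < \<alpha>" by (auto simp: \<alpha>_def max_def split: if_splits)
  have ac: "0 \<le> \<alpha> * c" using al c by simp
  show ?thesis
  proof (cases "b \<le> a")
    case True
    then have "0 \<le> abs (a - b) powr (p - 2) * (a - b) * (\<alpha> * c)" using ac by simp
    moreover have "0 \<le> \<beta> powr (p - 1) * (\<alpha> * c)" using ac by simp
    ultimately show ?thesis by linarith
  next
    case False
    then have "abs (a - b) powr (p - 2) * (b - a) = (b - a) powr (p - 1)"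
      using powr_add[of "b - a" "p - 2" 1] by simp
    also have "\<dots> \<le> \<beta> powr (p - 1)" using False ak p by (intro powr_mono2) (auto simp: \<beta>_def)
    finally have "abs (a - b) powr (p - 2) * (b - a) * (\<alpha> * c) \<le> \<beta> powr (p - 1) * (\<alpha> * c)"
      using ac by (rule mult_right_mono)
    then show ?thesis by (simp add: algebra_simps)
  qed
qed simp

lemma einner_le_enorm: "\<bar>einner N x y\<bar> \<le> enorm N x * enorm N y"
proof -
  have "\<bar>einner N x y\<bar> \<le> (\<Sum>i<N. \<bar>x i\<bar> * \<bar>y i\<bar>)"
    unfolding einner_def using sum_abs[of "\<lambda>i. x i * y i" "{..<N}"] by (simp add: abs_mult)
  also have "\<dots> \<le> enorm N x * enorm N y" unfolding enorm_def by (rule L2_set_mult_ineq)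
  finally show ?thesis .
qed

lemma einner_self: "einner N x x = (enorm N x)\<^sup>2"
  by (simp add: einner_def enorm_def L2_set_def sum_nonneg power2_eq_square)

text \<open>Multiplying out, the mixed term is at most \<open>p X Y\<^sup>p\<^sup>-\<^sup>1\<close> with \<open>X = \<phi> \<bar>W\<bar>\<close> and \<open>Y = w \<bar>G\<bar>\<close>, and is
  absorbed into half of \<open>Y\<^sup>p\<close>.\<close>

lemma caccioppoli_local:
  fixes p \<phi> w :: real and G W :: "nat \<Rightarrow> real"
  assumes p: "1 < p" and \<phi>: "0 \<le> \<phi>" and w: "0 \<le> w"
  shows "w powr p * enorm N G powr p / 2
    \<le> enorm N G powr (p - 2) * einner N G (\<lambda>i. G i * w powr p + \<phi> * (p * w powr (p - 1) * W i)) + young_const p * (\<phi> powr p * enorm N W powr p)"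
proof -
  define E where "E = enorm N G"
  have E: "0 \<le> E" by (simp add: E_def)
  have in1: "einner N G (\<lambda>i. G i * w powr p + \<phi> * (p * w powr (p - 1) * W i)) = w powr p * E\<^sup>2 + p * \<phi> * w powr (p - 1) * einner N G W"
  proof -
    have "einner N G (\<lambda>i. G i * w powr p + \<phi> * (p * w powr (p - 1) * W i)) = w powr p * einner N G G + p * \<phi> * w powr (p - 1) * einner N G W"
      unfolding einner_def sum_distrib_left sum.distrib[symmetric] by (intro sum.cong) (simp_all add: algebra_simps)
    then show ?thesis by (simp add: einner_self E_def)
  qed
  show ?thesis
  proof (cases "E = 0")
    case True
    then show ?thesis using young_const_pos[OF p] by (simp add: E_def)
  next
    case False
    then have E0: "0 < E" using E by simp
    define X where "X = \<phi> * enorm N W"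
    define Y where "Y = w * E"
    have X: "0 \<le> X" and Y: "0 \<le> Y" using \<phi> w E by (auto simp: X_def Y_def)
    have Yp: "Y powr q = w powr q * E powr q" for q using w E by (simp add: Y_def powr_mult)
    have Xp: "X powr p = \<phi> powr p * enorm N W powr p" using \<phi> by (simp add: X_def powr_mult)
    have e2: "E powr (p - 2) * E\<^sup>2 = E powr p" using E0 powr_add[of E "p - 2" 2] by simp
    have e1: "E powr (p - 2) * E = E powr (p - 1)" using E0 powr_add[of E "p - 2" 1] by simp
    have "- (E * enorm N W) \<le> einner N G W" using einner_le_enorm[of N G W] by (simp add: E_def)
    then have "p * \<phi> * w powr (p - 1) * (- (E * enorm N W)) \<le> p * \<phi> * w powr (p - 1) * einner N G W"
      using p \<phi> by (intro mult_left_mono) auto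
    then have "E powr (p - 2) * (w powr p * E\<^sup>2 + p * \<phi> * w powr (p - 1) * (- (E * enorm N W)))
      \<le> E powr (p - 2) * (w powr p * E\<^sup>2 + p * \<phi> * w powr (p - 1) * einner N G W)"
      by (rule mult_left_mono[OF add_left_mono]) simp
    also have "E powr (p - 2) * (w powr p * E\<^sup>2 + p * \<phi> * w powr (p - 1) * (- (E * enorm N W)))
      = w powr p * (E powr (p - 2) * E\<^sup>2) - p * X * (w powr (p - 1) * (E powr (p - 2) * E))"
      by (simp add: X_def algebra_simps)
    also have "\<dots> = Y powr p - p * X * Y powr (p - 1)" unfolding e1 e2 Yp ..
    finally have "Y powr p - p * X * Y powr (p - 1) \<le> E powr (p - 2) * einner N G (\<lambda>i. G i * w powr p + \<phi> * (p * w powr (p - 1) * W i))"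
      unfolding in1 .
    with young_absorb[OF p X Y]
    have "Y powr p / 2 \<le> E powr (p - 2) * einner N G (\<lambda>i. G i * w powr p + \<phi> * (p * w powr (p - 1) * W i)) + young_const p * X powr p"
      by linarith
    then show ?thesis unfolding Yp Xp E_def .
  qed
qed

section \<open>Testing the equation\<close>

lemma ennreal_split_le:
  fixes a F b :: real
  assumes "a \<le> F + b" "0 \<le> a" "0 \<le> b"
  shows "ennreal a + ennreal (- F) \<le> ennreal F + ennreal b"
proof (cases "0 \<le> F")
  case True
  then show ?thesis using assms by (simp add: ennreal_neg ennreal_leI flip: ennreal_plus)
next
  case False
  then show ?thesis using assms by (simp add: ennreal_neg ennreal_leI flip: ennreal_plus)
qed

text \<open>Both points in the ball: the discrete inequality. One point outside, where \<open>w\<close> vanishes: only the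
  one-sided lower bound is available, and it produces the tail term. Both outside: the integrand is \<open>0\<close>.\<close>

lemma nonlocal_pointwise:
  fixes u w :: "(nat \<Rightarrow> real) \<Rightarrow> real" and k p s :: real
  assumes p: "1 < p" and w: "\<And>x. x \<in> Rn N \<Longrightarrow> 0 \<le> w x" and out: "\<And>x. x \<in> Rn N \<Longrightarrow> x \<notin> B \<Longrightarrow> w x = 0"
    and x: "x \<in> Rn N" and y: "y \<in> Rn N"
  defines "\<phi> \<equiv> \<lambda>x. max (u x - k) 0"
  defines "e \<equiv> edist N x y powr (real N + s * p)"
  shows "2 powr (- p) / 2 * (abs (\<phi> x * w x - \<phi> y * w y) powr p / e * indicator (B \<times> B) (x, y))
    \<le> nonlocal_integrand N p u (\<lambda>x. \<phi> x * w x powr p) s x y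
      + ((young_const p + 1 / 2) * (max (\<phi> x) (\<phi> y) powr p * abs (w x - w y) powr p / e * indicator (B \<times> B) (x, y))
      + (\<phi> y powr (p - 1) / e * (\<phi> x * w x powr p) * indicator (B \<times> (Rn N - B)) (x, y)
       + \<phi> x powr (p - 1) / e * (\<phi> y * w y powr p) * indicator (B \<times> (Rn N - B)) (y, x)))"
proof -
  define q where "q = 1 / e"
  have q: "0 \<le> q" by (simp add: q_def e_def)
  define J where "J = abs (u x - u y) powr (p - 2) * (u x - u y)"
  have I: "nonlocal_integrand N p u (\<lambda>x. \<phi> x * w x powr p) s x y = J * (\<phi> x * w x powr p - \<phi> y * w y powr p) * q"
    by (simp add: nonlocal_integrand_def J_def q_def e_def)
  have de: "t / e = t * q" for t by (simp add: q_def)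
  consider "x \<in> B" "y \<in> B" | "x \<in> B" "y \<notin> B" | "x \<notin> B" "y \<in> B" | "x \<notin> B" "y \<notin> B" by blast
  then show ?thesis
  proof cases
    case 1
    have "2 powr (- p) / 2 * abs (\<phi> x * w x - \<phi> y * w y) powr p
      \<le> J * (\<phi> x * w x powr p - \<phi> y * w y powr p) + (young_const p + 1 / 2) * (max (\<phi> x) (\<phi> y) powr p * abs (w x - w y) powr p)"
      unfolding J_def \<phi>_def by (rule caccioppoli_nonlocal_inside[OF p w[OF x] w[OF y]])
    then have "2 powr (- p) / 2 * abs (\<phi> x * w x - \<phi> y * w y) powr p * q
      \<le> (J * (\<phi> x * w x powr p - \<phi> y * w y powr p) + (young_const p + 1 / 2) * (max (\<phi> x) (\<phi> y) powr p * abs (w x - w y) powr p)) * q"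
      using q by (rule mult_right_mono)
    then show ?thesis unfolding I de using 1 by (simp add: algebra_simps)
  next
    case 2
    then have wy: "w y = 0" using out y by simp
    have "- (\<phi> y powr (p - 1) * (\<phi> x * w x powr p)) \<le> J * (\<phi> x * w x powr p)"
      unfolding J_def \<phi>_def by (rule caccioppoli_nonlocal_outside[OF p]) simp
    then have "- (\<phi> y powr (p - 1) * (\<phi> x * w x powr p)) * q \<le> J * (\<phi> x * w x powr p) * q"
      using q by (rule mult_right_mono)
    then show ?thesis unfolding I de wy using 2 x y by (simp add: algebra_simps)
  next
    case 3
    then have wx: "w x = 0" using out x by simp
    have "- (\<phi> x powr (p - 1) * (\<phi> y * w y powr p)) \<le> abs (u y - u x) powr (p - 2) * (u y - u x) * (\<phi> y * w y powr p)"
      unfolding \<phi>_def by (rule caccioppoli_nonlocal_outside[OF p]) simp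
    also have "\<dots> = J * (0 - \<phi> y * w y powr p)"
      by (simp add: J_def abs_minus_commute algebra_simps)
    finally have "- (\<phi> x powr (p - 1) * (\<phi> y * w y powr p)) * q \<le> J * (0 - \<phi> y * w y powr p) * q"
      using q by (rule mult_right_mono)
    then show ?thesis unfolding I de wx using 3 x y by (simp add: algebra_simps)
  next
    case 4
    then have "w x = 0" "w y = 0" using out x y by auto
    then show ?thesis unfolding I using 4 by simp
  qed
qed

text \<open>The pointwise inequality is integrated against \<open>C\<^sub>N\<^sub>,\<^sub>s\<^sub>,\<^sub>p\<close>. The terms on the right may be infinite,
  hence the value \<open>a - b\<close> of the form is kept as its positive part \<open>a\<close> and its negative part \<open>b\<close>, both
  finite by absolute convergence, so that nothing infinite is subtracted. The factor \<open>2\<close> of the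
  tail term comes from the two orders of the points.\<close>

lemma nonlocal_part:
  fixes u w :: "(nat \<Rightarrow> real) \<Rightarrow> real" and k p :: real and \<mu> :: "real measure"
  assumes N: "1 \<le> N" and p: "1 < p" and \<mu>: "admissible_measure \<mu>"
    and um [measurable]: "u \<in> borel_measurable (leb N)" and wm [measurable]: "w \<in> borel_measurable (leb N)"
    and w: "\<And>x. x \<in> Rn N \<Longrightarrow> 0 \<le> w x" and B [measurable]: "B \<in> sets (leb N)"
    and S: "S \<in> sets (leb N)" and SB: "S \<subseteq> B" and out: "\<And>x. x \<in> Rn N \<Longrightarrow> x \<notin> S \<Longrightarrow> w x = 0"
  defines "\<phi> \<equiv> \<lambda>x. max (u x - k) 0"
  defines "v \<equiv> \<lambda>x. \<phi> x * w x powr p"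
  assumes fin: "(\<integral>\<^sup>+s\<in>{0<..<1}. ennreal (C_const N s p) *
    (\<integral>\<^sup>+z. ennreal \<bar>nonlocal_integrand N p u v s (fst z) (snd z)\<bar> \<partial>(leb N \<Otimes>\<^sub>M leb N)) \<partial>\<mu>) < \<infinity>"
  obtains a b :: real where "0 \<le> a" "0 \<le> b"
    "(LINT s:{0<..<1}|\<mu>. C_const N s p * (LINT z|(leb N \<Otimes>\<^sub>M leb N). nonlocal_integrand N p u v s (fst z) (snd z))) = a - b"
    "ennreal (2 powr (- p) / 2) * (\<integral>\<^sup>+s\<in>{0<..<1}. ennreal (C_const N s p) *
           (\<integral>\<^sup>+z\<in>B \<times> B. (case z of (x, y) \<Rightarrow>
              ennreal (\<bar>\<phi> x * w x - \<phi> y * w y\<bar> powr p / edist N x y powr (real N + s * p)))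
            \<partial>(leb N \<Otimes>\<^sub>M leb N)) \<partial>\<mu>) + ennreal b
     \<le> ennreal a + (ennreal (young_const p + 1 / 2) * (\<integral>\<^sup>+s\<in>{0<..<1}. ennreal (C_const N s p) *
            (\<integral>\<^sup>+z\<in>B \<times> B. (case z of (x, y) \<Rightarrow>
               ennreal (max (\<phi> x) (\<phi> y) powr p * \<bar>w x - w y\<bar> powr p
                 / edist N x y powr (real N + s * p)))
             \<partial>(leb N \<Otimes>\<^sub>M leb N)) \<partial>\<mu>)
       + 2 * (\<integral>\<^sup>+s\<in>{0<..<1}. ennreal (C_const N s p) *
              (esssup (restrict_space (leb N) S)
                 (\<lambda>x. \<integral>\<^sup>+y\<in>Rn N - B.
                    ennreal (\<phi> y powr (p - 1) / edist N x y powr (real N + s * p)) \<partial>leb N)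
               * (\<integral>\<^sup>+x\<in>B. ennreal (\<phi> x * w x powr p) \<partial>leb N)) \<partial>\<mu>))"
proof -
  let ?P2 = "leb N \<Otimes>\<^sub>M leb N"
  let ?M3 = "\<mu> \<Otimes>\<^sub>M ?P2"
  let ?c1 = "2 powr (- p) / 2" and ?c2 = "young_const p + 1 / 2"
  have sf2: "sigma_finite_measure ?P2" by (rule sigma_finite_pair_measure) unfold_locales
  interpret mu: finite_measure \<mu> by (rule admissible_D(1)[OF \<mu>])
  interpret M3: pair_sigma_finite \<mu> ?P2 ..
  note [measurable] = admissible_measurable(2,3)[OF \<mu>]
  have Cm [measurable]: "(\<lambda>s. C_const N s p) \<in> borel_measurable \<mu>"
    by (rule admissible_measurable(1)[OF \<mu> C_const_cont(1)[OF N p]])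
  have \<phi>m [measurable]: "\<phi> \<in> borel_measurable (leb N)" unfolding \<phi>_def by measurable
  have vm [measurable]: "v \<in> borel_measurable (leb N)" unfolding v_def by measurable
  have \<phi>0: "0 \<le> \<phi> x" for x by (simp add: \<phi>_def)
  define \<kappa> where "\<kappa> s = indicator {0<..<1} s * C_const N s p" for s :: real
  have \<kappa>m [measurable]: "\<kappa> \<in> borel_measurable \<mu>" unfolding \<kappa>_def by measurable
  have \<kappa>0: "0 \<le> \<kappa> s" for s
    using C_const_cont(3)[OF N p, of s] by (cases "s \<in> {0<..<1}") (auto simp: \<kappa>_def)
  define E where "E s z = edist N (fst z) (snd z) powr (real N + s * p)" for s z
  define I where "I s z = nonlocal_integrand N p u v s (fst z) (snd z)" for s z
  define P where "P s z = abs (\<phi> (fst z) * w (fst z) - \<phi> (snd z) * w (snd z)) powr p / E s z * indicator (B \<times> B) z" for s z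
  define Q where "Q s z = max (\<phi> (fst z)) (\<phi> (snd z)) powr p * abs (w (fst z) - w (snd z)) powr p / E s z * indicator (B \<times> B) z" for s z
  define T where "T s x y = \<phi> y powr (p - 1) / edist N x y powr (real N + s * p) * (\<phi> x * w x powr p) * indicator (B \<times> (Rn N - B)) (x, y)" for s x y
  have BB [measurable]: "B \<times> B \<in> sets ?P2" by measurable
  have BC [measurable]: "Rn N - B \<in> sets (leb N)" using sets.compl_sets[OF B] by simp
  have BBC [measurable]: "B \<times> (Rn N - B) \<in> sets ?P2" by measurable
  have Em [measurable]: "(\<lambda>q. E (fst q) (snd q)) \<in> borel_measurable ?M3" unfolding E_def by measurable
  have Im [measurable]: "(\<lambda>q. I (fst q) (snd q)) \<in> borel_measurable ?M3"
    unfolding I_def nonlocal_integrand_def by measurable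
  have Pm [measurable]: "(\<lambda>q. P (fst q) (snd q)) \<in> borel_measurable ?M3"
  proof -
    have "(\<lambda>q. indicator (B \<times> B) (snd q) :: real) \<in> borel_measurable ?M3"
      by (rule measurable_compose[OF measurable_snd borel_measurable_indicator[OF BB]])
    then show ?thesis unfolding P_def by measurable
  qed
  have Qm [measurable]: "(\<lambda>q. Q (fst q) (snd q)) \<in> borel_measurable ?M3"
  proof -
    have "(\<lambda>q. indicator (B \<times> B) (snd q) :: real) \<in> borel_measurable ?M3"
      by (rule measurable_compose[OF measurable_snd borel_measurable_indicator[OF BB]])
    then show ?thesis unfolding Q_def by measurable
  qed
  have Tm [measurable]: "(\<lambda>q. T (fst q) (fst (snd q)) (snd (snd q))) \<in> borel_measurable ?M3"
  proof -
    have "(\<lambda>q. indicator (B \<times> (Rn N - B)) (snd q) :: real) \<in> borel_measurable ?M3"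
      by (rule measurable_compose[OF measurable_snd borel_measurable_indicator[OF BBC]])
    then have [measurable]: "(\<lambda>q. indicator (B \<times> (Rn N - B)) (fst (snd q), snd (snd q)) :: real) \<in> borel_measurable ?M3" by simp
    show ?thesis unfolding T_def by measurable
  qed
  have Tm' [measurable]: "(\<lambda>q. T (fst q) (snd (snd q)) (fst (snd q))) \<in> borel_measurable ?M3"
  proof -
    have "(\<lambda>q. (fst q, (snd (snd q), fst (snd q)))) \<in> measurable ?M3 ?M3" by measurable
    from measurable_compose[OF this Tm] show ?thesis by simp
  qed
  have P0: "0 \<le> P s z" and Q0: "0 \<le> Q s z" and T0: "x \<in> Rn N \<Longrightarrow> 0 \<le> T s x y" for s z x y
    using \<phi>0 by (auto simp: P_def Q_def T_def E_def)
  define F where "F q = \<kappa> (fst q) * I (fst q) (snd q)" for q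
  have Fm [measurable]: "F \<in> borel_measurable ?M3" unfolding F_def[abs_def] by measurable
  have sec: "(\<lambda>z. G s z) \<in> borel_measurable ?P2"
    if "(\<lambda>q. G (fst q) (snd q)) \<in> borel_measurable ?M3" "s \<in> space \<mu>" for G :: "real \<Rightarrow> _ \<Rightarrow> real" and s
    using measurable_compose[OF measurable_Pair1'[OF that(2), of ?P2] that(1)] by simp
  have it: "(\<integral>\<^sup>+q. ennreal (\<kappa> (fst q)) * ennreal (G (fst q) (snd q)) \<partial>?M3)
      = (\<integral>\<^sup>+s\<in>{0<..<1}. ennreal (C_const N s p) * (\<integral>\<^sup>+z. ennreal (G s z) \<partial>?P2) \<partial>\<mu>)"
    if G [measurable]: "(\<lambda>q. G (fst q) (snd q)) \<in> borel_measurable ?M3" for G :: "real \<Rightarrow> _ \<Rightarrow> real"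
  proof -
    have "(\<integral>\<^sup>+q. ennreal (\<kappa> (fst q)) * ennreal (G (fst q) (snd q)) \<partial>?M3)
      = (\<integral>\<^sup>+s. \<integral>\<^sup>+z. ennreal (\<kappa> s) * ennreal (G s z) \<partial>?P2 \<partial>\<mu>)"
      by (subst sigma_finite_measure.nn_integral_fst[OF sf2, symmetric]) simp_all
    also have "\<dots> = (\<integral>\<^sup>+s\<in>{0<..<1}. ennreal (C_const N s p) * (\<integral>\<^sup>+z. ennreal (G s z) \<partial>?P2) \<partial>\<mu>)"
    proof (rule nn_integral_cong)
      fix s assume s: "s \<in> space \<mu>"
      note sec[OF G s, measurable]
      show "(\<integral>\<^sup>+z. ennreal (\<kappa> s) * ennreal (G s z) \<partial>?P2) = ennreal (C_const N s p) * (\<integral>\<^sup>+z. ennreal (G s z) \<partial>?P2) * indicator {0<..<1} s"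
        by (subst nn_integral_cmult) (auto simp: \<kappa>_def indicator_def)
    qed
    finally show ?thesis .
  qed
  have Fi: "integrable ?M3 F"
  proof (rule integrableI_bounded[OF Fm])
    have "(\<integral>\<^sup>+q. ennreal (norm (F q)) \<partial>?M3) = (\<integral>\<^sup>+q. ennreal (\<kappa> (fst q)) * ennreal (abs (I (fst q) (snd q))) \<partial>?M3)"
      using \<kappa>0 by (intro nn_integral_cong) (simp add: F_def abs_mult ennreal_mult)
    also have "\<dots> = (\<integral>\<^sup>+s\<in>{0<..<1}. ennreal (C_const N s p) * (\<integral>\<^sup>+z. ennreal (abs (I s z)) \<partial>?P2) \<partial>\<mu>)"
      by (rule it[of "\<lambda>s z. abs (I s z)"]) measurable
    also have "\<dots> < \<infinity>" using fin by (simp add: I_def)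
    finally show "(\<integral>\<^sup>+q. ennreal (norm (F q)) \<partial>?M3) < \<infinity>" .
  qed
  define a where "a = enn2real (\<integral>\<^sup>+q. ennreal (F q) \<partial>?M3)"
  define b where "b = enn2real (\<integral>\<^sup>+q. ennreal (- F q) \<partial>?M3)"
  have fa: "ennreal a = (\<integral>\<^sup>+q. ennreal (F q) \<partial>?M3)" and fb: "ennreal b = (\<integral>\<^sup>+q. ennreal (- F q) \<partial>?M3)"
    using Fi by (auto simp: a_def b_def real_integrable_def less_top)
  have NL: "(LINT s:{0<..<1}|\<mu>. C_const N s p * (LINT z|?P2. I s z)) = a - b"
  proof -
    have "(LINT s:{0<..<1}|\<mu>. C_const N s p * (LINT z|?P2. I s z)) = (LINT s|\<mu>. LINT z|?P2. F (s, z))"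
      unfolding set_lebesgue_integral_def
      by (rule Bochner_Integration.integral_cong) (auto simp: F_def \<kappa>_def)
    also have "\<dots> = (LINT q|?M3. F q)" by (rule M3.integral_fst'[OF Fi])
    also have "\<dots> = a - b" unfolding a_def b_def by (rule real_lebesgue_integral_def[OF Fi])
    finally show ?thesis .
  qed
  define LP where "LP = (\<integral>\<^sup>+q. ennreal (\<kappa> (fst q)) * ennreal (P (fst q) (snd q)) \<partial>?M3)"
  define LQ where "LQ = (\<integral>\<^sup>+q. ennreal (\<kappa> (fst q)) * ennreal (Q (fst q) (snd q)) \<partial>?M3)"
  define LT where "LT = (\<integral>\<^sup>+q. ennreal (\<kappa> (fst q)) * ennreal (T (fst q) (fst (snd q)) (snd (snd q))) \<partial>?M3)"
  define LT' where "LT' = (\<integral>\<^sup>+q. ennreal (\<kappa> (fst q)) * ennreal (T (fst q) (snd (snd q)) (fst (snd q))) \<partial>?M3)"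
  have "ennreal ?c1 * LP + ennreal b \<le> ennreal a + (ennreal ?c2 * LQ + (LT + LT'))"
  proof -
    have "ennreal ?c1 * LP + ennreal b = (\<integral>\<^sup>+q. ennreal ?c1 * (ennreal (\<kappa> (fst q)) * ennreal (P (fst q) (snd q))) + ennreal (- F q) \<partial>?M3)"
      unfolding LP_def fb by (subst nn_integral_add) (simp_all add: nn_integral_cmult)
    also have "\<dots> \<le> (\<integral>\<^sup>+q. ennreal (F q) + (ennreal ?c2 * (ennreal (\<kappa> (fst q)) * ennreal (Q (fst q) (snd q)))
        + (ennreal (\<kappa> (fst q)) * ennreal (T (fst q) (fst (snd q)) (snd (snd q))) + ennreal (\<kappa> (fst q)) * ennreal (T (fst q) (snd (snd q)) (fst (snd q))))) \<partial>?M3)"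
    proof (rule nn_integral_mono)
      fix q assume q: "q \<in> space ?M3"
      obtain s x y where sxy: "q = (s, (x, y))" by (metis surj_pair)
      have x: "x \<in> Rn N" and y: "y \<in> Rn N" using q by (auto simp: sxy space_pair_measure)
      have oB: "w x' = 0" if "x' \<in> Rn N" "x' \<notin> B" for x' using out that SB by auto
      have "?c1 * P s (x, y) \<le> I s (x, y) + (?c2 * Q s (x, y) + (T s x y + T s y x))"
        using nonlocal_pointwise[where N = N and w = w and B = B and u = u and k = k and s = s, OF p w oB x y]
        by (simp add: P_def Q_def T_def I_def E_def v_def \<phi>_def edist_commute[of N y x])
      from mult_left_mono[OF this \<kappa>0[of s]]
      have "\<kappa> s * (?c1 * P s (x, y)) \<le> \<kappa> s * I s (x, y) + (?c2 * (\<kappa> s * Q s (x, y)) + (\<kappa> s * T s x y + \<kappa> s * T s y x))"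
        by (simp only: distrib_left mult.left_commute)
      moreover have "0 \<le> \<kappa> s * (?c1 * P s (x, y))" using \<kappa>0 P0 by simp
      moreover have "0 \<le> ?c2 * (\<kappa> s * Q s (x, y)) + (\<kappa> s * T s x y + \<kappa> s * T s y x)"
        using \<kappa>0 Q0 T0 x y young_const_pos[OF p] by (intro add_nonneg_nonneg mult_nonneg_nonneg) auto
      ultimately have "ennreal (\<kappa> s * (?c1 * P s (x, y))) + ennreal (- (\<kappa> s * I s (x, y)))
         \<le> ennreal (\<kappa> s * I s (x, y)) + ennreal (?c2 * (\<kappa> s * Q s (x, y)) + (\<kappa> s * T s x y + \<kappa> s * T s y x))"
        by (rule ennreal_split_le)
      also have "ennreal (\<kappa> s * (?c1 * P s (x, y))) = ennreal ?c1 * (ennreal (\<kappa> s) * ennreal (P s (x, y)))"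
        using \<kappa>0[of s] P0[of s "(x, y)"]
        by (subst mult.left_commute, subst ennreal_mult[symmetric], simp, simp, subst ennreal_mult[symmetric]) simp_all
      also have "ennreal (?c2 * (\<kappa> s * Q s (x, y)) + (\<kappa> s * T s x y + \<kappa> s * T s y x))
         = ennreal ?c2 * (ennreal (\<kappa> s) * ennreal (Q s (x, y))) + (ennreal (\<kappa> s) * ennreal (T s x y) + ennreal (\<kappa> s) * ennreal (T s y x))"
        using \<kappa>0[of s] Q0[of s "(x, y)"] T0[OF x, of s y] T0[OF y, of s x] young_const_pos[OF p]
        by (subst ennreal_plus, simp, simp, subst ennreal_plus, simp, simp, subst ennreal_mult, simp, simp)
          (simp add: ennreal_mult)
      finally show "ennreal ?c1 * (ennreal (\<kappa> (fst q)) * ennreal (P (fst q) (snd q))) + ennreal (- F q)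
        \<le> ennreal (F q) + (ennreal ?c2 * (ennreal (\<kappa> (fst q)) * ennreal (Q (fst q) (snd q)))
        + (ennreal (\<kappa> (fst q)) * ennreal (T (fst q) (fst (snd q)) (snd (snd q))) + ennreal (\<kappa> (fst q)) * ennreal (T (fst q) (snd (snd q)) (fst (snd q)))))"
        by (simp add: sxy F_def)
    qed
    also have "\<dots> = ennreal a + (ennreal ?c2 * LQ + (LT + LT'))"
      unfolding LQ_def LT_def LT'_def fa
      by (subst nn_integral_add, measurable, subst nn_integral_add, measurable, subst nn_integral_add, measurable)
        (simp add: nn_integral_cmult)
    finally show ?thesis .
  qed
  moreover have "LP = (\<integral>\<^sup>+s\<in>{0<..<1}. ennreal (C_const N s p) *
           (\<integral>\<^sup>+z\<in>B \<times> B. (case z of (x, y) \<Rightarrow>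
              ennreal (\<bar>\<phi> x * w x - \<phi> y * w y\<bar> powr p / edist N x y powr (real N + s * p))) \<partial>?P2) \<partial>\<mu>)"
    unfolding LP_def it[OF Pm]
    by (intro nn_integral_cong arg_cong2[of _ _ _ _ "(*)"] refl) (auto simp: P_def E_def indicator_def)
  moreover have "LQ = (\<integral>\<^sup>+s\<in>{0<..<1}. ennreal (C_const N s p) *
            (\<integral>\<^sup>+z\<in>B \<times> B. (case z of (x, y) \<Rightarrow>
               ennreal (max (\<phi> x) (\<phi> y) powr p * \<bar>w x - w y\<bar> powr p / edist N x y powr (real N + s * p))) \<partial>?P2) \<partial>\<mu>)"
    unfolding LQ_def it[OF Qm]
    by (intro nn_integral_cong arg_cong2[of _ _ _ _ "(*)"] refl) (auto simp: Q_def E_def indicator_def)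
  moreover have LTle: "LT + LT' \<le> 2 * (\<integral>\<^sup>+s\<in>{0<..<1}. ennreal (C_const N s p) *
              (esssup (restrict_space (leb N) S)
                 (\<lambda>x. \<integral>\<^sup>+y\<in>Rn N - B.
                    ennreal (\<phi> y powr (p - 1) / edist N x y powr (real N + s * p)) \<partial>leb N)
               * (\<integral>\<^sup>+x\<in>B. ennreal (\<phi> x * w x powr p) \<partial>leb N)) \<partial>\<mu>)"
    (is "_ \<le> 2 * ?RT")
  proof -
    \<comment> \<open>Fubini: the inner integral over the complement of the ball is bounded by its essential supremum over the support of \<open>w\<close>.\<close>
    have inner: "(\<integral>\<^sup>+x. \<integral>\<^sup>+y. ennreal (T s x y) \<partial>leb N \<partial>leb N) \<le>
         esssup (restrict_space (leb N) S) (\<lambda>x. \<integral>\<^sup>+y\<in>Rn N - B. ennreal (\<phi> y powr (p - 1) / edist N x y powr (real N + s * p)) \<partial>leb N)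
               * (\<integral>\<^sup>+x\<in>B. ennreal (\<phi> x * w x powr p) \<partial>leb N)" for s
    proof -
      define \<Psi> where "\<Psi> x = (\<integral>\<^sup>+y\<in>Rn N - B. ennreal (\<phi> y powr (p - 1) / edist N x y powr (real N + s * p)) \<partial>leb N)" for x
      let ?es = "esssup (restrict_space (leb N) S) \<Psi>"
      have "AE x in restrict_space (leb N) S. \<Psi> x \<le> ?es" by (rule esssup_AE)
      then have ae: "AE x in leb N. x \<in> S \<longrightarrow> \<Psi> x \<le> ?es"
        by (subst (asm) AE_restrict_space_iff) (use sets.Int[OF S sets.top] in \<open>auto simp: Int_commute\<close>)
      have "(\<integral>\<^sup>+x. \<integral>\<^sup>+y. ennreal (T s x y) \<partial>leb N \<partial>leb N) \<le> (\<integral>\<^sup>+x. ?es * (ennreal (\<phi> x * w x powr p) * indicator B x) \<partial>leb N)"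
      proof (rule nn_integral_mono_AE)
        show "AE x in leb N. (\<integral>\<^sup>+y. ennreal (T s x y) \<partial>leb N) \<le> ?es * (ennreal (\<phi> x * w x powr p) * indicator B x)"
          using ae AE_space
        proof eventually_elim
          case (elim x)
          then have x: "x \<in> Rn N" by simp
          have [measurable]: "(\<lambda>y. edist N x y) \<in> borel_measurable (leb N)" by (rule measurable_edist) (use x in auto)
          show ?case
          proof (cases "x \<in> S")
            case True
            then have xB: "x \<in> B" using SB by auto
            have "(\<integral>\<^sup>+y. ennreal (T s x y) \<partial>leb N) = (\<integral>\<^sup>+y. ennreal (\<phi> x * w x powr p) * (ennreal (\<phi> y powr (p - 1) / edist N x y powr (real N + s * p)) * indicator (Rn N - B) y) \<partial>leb N)"
              using xB \<phi>0 by (intro nn_integral_cong) (auto simp: T_def indicator_def mult.commute simp flip: ennreal_mult)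
            also have "\<dots> = ennreal (\<phi> x * w x powr p) * \<Psi> x"
              unfolding \<Psi>_def by (rule nn_integral_cmult) measurable
            also have "\<dots> \<le> ennreal (\<phi> x * w x powr p) * ?es"
              using elim(1) True by (intro mult_left_mono) auto
            finally show ?thesis using xB by (simp add: mult.commute)
          next
            case False
            then have "T s x y = 0" for y using out[OF x] by (simp add: T_def)
            then show ?thesis by simp
          qed
        qed
      qed
      also have "\<dots> = ?es * (\<integral>\<^sup>+x\<in>B. ennreal (\<phi> x * w x powr p) \<partial>leb N)"
        by (rule nn_integral_cmult) measurable
      finally show ?thesis unfolding \<Psi>_def .
    qed
    have Ts: "(\<lambda>z. ennreal (T s (fst z) (snd z))) \<in> borel_measurable ?P2" if "s \<in> space \<mu>" for s
      using sec[of "\<lambda>s z. T s (fst z) (snd z)" s] Tm that by simp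
    have Ts': "(\<lambda>z. ennreal (T s (snd z) (fst z))) \<in> borel_measurable ?P2" if "s \<in> space \<mu>" for s
      using sec[of "\<lambda>s z. T s (snd z) (fst z)" s] Tm' that by simp
    have "LT = (\<integral>\<^sup>+s\<in>{0<..<1}. ennreal (C_const N s p) * (\<integral>\<^sup>+z. ennreal (T s (fst z) (snd z)) \<partial>?P2) \<partial>\<mu>)"
      unfolding LT_def by (rule it[of "\<lambda>s z. T s (fst z) (snd z)"]) simp
    also have "\<dots> \<le> ?RT"
    proof (rule nn_integral_mono)
      fix s assume s: "s \<in> space \<mu>"
      have "(\<integral>\<^sup>+z. ennreal (T s (fst z) (snd z)) \<partial>?P2) = (\<integral>\<^sup>+x. \<integral>\<^sup>+y. ennreal (T s x y) \<partial>leb N \<partial>leb N)"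
        using leb.nn_integral_fst[OF Ts[OF s]] by simp
      then show "ennreal (C_const N s p) * (\<integral>\<^sup>+z. ennreal (T s (fst z) (snd z)) \<partial>?P2) * indicator {0<..<1} s
        \<le> ennreal (C_const N s p) * (esssup (restrict_space (leb N) S)
                 (\<lambda>x. \<integral>\<^sup>+y\<in>Rn N - B. ennreal (\<phi> y powr (p - 1) / edist N x y powr (real N + s * p)) \<partial>leb N)
               * (\<integral>\<^sup>+x\<in>B. ennreal (\<phi> x * w x powr p) \<partial>leb N)) * indicator {0<..<1} s"
        using inner[of s] by (intro mult_right_mono mult_left_mono) auto
    qed
    finally have 1: "LT \<le> ?RT" .
    have "LT' = (\<integral>\<^sup>+s\<in>{0<..<1}. ennreal (C_const N s p) * (\<integral>\<^sup>+z. ennreal (T s (snd z) (fst z)) \<partial>?P2) \<partial>\<mu>)"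
      unfolding LT'_def by (rule it[of "\<lambda>s z. T s (snd z) (fst z)"]) simp
    also have "\<dots> \<le> ?RT"
    proof (rule nn_integral_mono)
      fix s assume s: "s \<in> space \<mu>"
      have "(\<integral>\<^sup>+z. ennreal (T s (snd z) (fst z)) \<partial>?P2) = (\<integral>\<^sup>+x. \<integral>\<^sup>+y. ennreal (T s x y) \<partial>leb N \<partial>leb N)"
        using lebp.nn_integral_snd[OF Ts'[OF s]] by simp
      then show "ennreal (C_const N s p) * (\<integral>\<^sup>+z. ennreal (T s (snd z) (fst z)) \<partial>?P2) * indicator {0<..<1} s
        \<le> ennreal (C_const N s p) * (esssup (restrict_space (leb N) S)
                 (\<lambda>x. \<integral>\<^sup>+y\<in>Rn N - B. ennreal (\<phi> y powr (p - 1) / edist N x y powr (real N + s * p)) \<partial>leb N)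
               * (\<integral>\<^sup>+x\<in>B. ennreal (\<phi> x * w x powr p) \<partial>leb N)) * indicator {0<..<1} s"
        using inner[of s] by (intro mult_right_mono mult_left_mono) auto
    qed
    finally have "LT' \<le> ?RT" .
    with 1 show ?thesis unfolding mult_2 by (rule add_mono)
  qed
  ultimately have fin_ineq: "ennreal ?c1 * (\<integral>\<^sup>+s\<in>{0<..<1}. ennreal (C_const N s p) *
           (\<integral>\<^sup>+z\<in>B \<times> B. (case z of (x, y) \<Rightarrow>
              ennreal (\<bar>\<phi> x * w x - \<phi> y * w y\<bar> powr p / edist N x y powr (real N + s * p))) \<partial>?P2) \<partial>\<mu>) + ennreal b
     \<le> ennreal a + (ennreal ?c2 * (\<integral>\<^sup>+s\<in>{0<..<1}. ennreal (C_const N s p) *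
            (\<integral>\<^sup>+z\<in>B \<times> B. (case z of (x, y) \<Rightarrow>
               ennreal (max (\<phi> x) (\<phi> y) powr p * \<bar>w x - w y\<bar> powr p / edist N x y powr (real N + s * p))) \<partial>?P2) \<partial>\<mu>)
       + 2 * (\<integral>\<^sup>+s\<in>{0<..<1}. ennreal (C_const N s p) *
              (esssup (restrict_space (leb N) S)
                 (\<lambda>x. \<integral>\<^sup>+y\<in>Rn N - B. ennreal (\<phi> y powr (p - 1) / edist N x y powr (real N + s * p)) \<partial>leb N)
               * (\<integral>\<^sup>+x\<in>B. ennreal (\<phi> x * w x powr p) \<partial>leb N)) \<partial>\<mu>))"
    using order_trans[OF _ add_left_mono[OF add_left_mono[OF LTle]]] by (simp only:)
  show ?thesis
    by (rule that[OF _ _ NL[unfolded I_def] fin_ineq]) (simp_all add: a_def b_def)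
qed

lemma enorm_powr_le:
  "1 \<le> p \<Longrightarrow> enorm N a powr p \<le> real N powr p * (\<Sum>i<N. \<bar>a i\<bar> powr p)"
  using edist_powr_le[of p N a "\<lambda>_. 0"] by (simp add: edist_def)

lemma measurable_p_Laplace_flux:
  assumes h: "\<And>i. i < N \<Longrightarrow> h i \<in> borel_measurable (leb N)" and h': "\<And>i. i < N \<Longrightarrow> h' i \<in> borel_measurable (leb N)"
  shows "(\<lambda>x. enorm N (\<lambda>i. h i x) powr (p - 2) * einner N (\<lambda>i. h i x) (\<lambda>i. h' i x)) \<in> borel_measurable (leb N)"
proof -
  have [measurable]: "(\<lambda>x. \<Sum>i<N. h i x * h' i x) \<in> borel_measurable (leb N)"
    by (intro borel_measurable_sum borel_measurable_times h h') auto
  have [measurable]: "(\<lambda>x. \<Sum>i<N. (h i x)\<^sup>2) \<in> borel_measurable (leb N)"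
    by (intro borel_measurable_sum borel_measurable_power h) auto
  show ?thesis unfolding enorm_def L2_set_def einner_def by measurable
qed

text \<open>The counterpart for the gradient term, again split into the finite parts \<open>a\<close> and \<open>b\<close>. Where \<open>u \<le> k\<close>, and off
  the support of \<open>w\<close>, the test function has gradient \<open>0\<close> and the left-hand side vanishes.\<close>

lemma local_part:
  fixes w \<phi> :: "(nat \<Rightarrow> real) \<Rightarrow> real" and g W :: "nat \<Rightarrow> (nat \<Rightarrow> real) \<Rightarrow> real" and A :: "(nat \<Rightarrow> real) set"
  assumes p: "1 < p" and gm [measurable]: "\<And>i. i < N \<Longrightarrow> g i \<in> borel_measurable (leb N)"
    and Wm [measurable]: "\<And>i. i < N \<Longrightarrow> W i \<in> borel_measurable (leb N)"
    and wm [measurable]: "w \<in> borel_measurable (leb N)" and \<phi>m [measurable]: "\<phi> \<in> borel_measurable (leb N)"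
    and A [measurable]: "A \<in> sets (leb N)" and S [measurable]: "S \<in> sets (leb N)" and SB: "S \<subseteq> B" and Bm [measurable]: "B \<in> sets (leb N)"
    and w: "\<And>x. x \<in> Rn N \<Longrightarrow> 0 \<le> w x" and \<phi>: "\<And>x. 0 \<le> \<phi> x" and \<phi>A: "\<And>x. x \<in> Rn N \<Longrightarrow> x \<notin> A \<Longrightarrow> \<phi> x = 0"
    and out: "\<And>x. x \<in> Rn N \<Longrightarrow> x \<notin> S \<Longrightarrow> w x = 0"
  defines "gv \<equiv> \<lambda>i x. (if x \<in> A then g i x else 0) * w x powr p + \<phi> x * (p * w x powr (p - 1) * W i x)"
  assumes gS: "\<And>i. i < N \<Longrightarrow> pint N p (cut S (g i)) < \<infinity>" and gvp: "\<And>i. i < N \<Longrightarrow> pint N p (gv i) < \<infinity>"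
  obtains a b :: real where "0 \<le> a" "0 \<le> b"
    "(LINT x|leb N. enorm N (\<lambda>i. g i x) powr (p - 2) * einner N (\<lambda>i. g i x) (\<lambda>i. gv i x)) = a - b"
    "ennreal (1 / 2) * (\<integral>\<^sup>+x\<in>B. ennreal (w x powr p * enorm N (\<lambda>i. if x \<in> A then g i x else 0) powr p) \<partial>leb N) + ennreal b
      \<le> ennreal a + ennreal (young_const p) * (\<integral>\<^sup>+x\<in>B. ennreal (\<phi> x powr p * enorm N (\<lambda>i. W i x) powr p) \<partial>leb N)"
proof -
  have en [measurable]: "(\<lambda>x. enorm N (\<lambda>i. h i x)) \<in> borel_measurable (leb N)" if [measurable]: "\<And>i. i < N \<Longrightarrow> h i \<in> borel_measurable (leb N)" for h
    unfolding enorm_def L2_set_def by measurable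
  have gvm [measurable]: "gv i \<in> borel_measurable (leb N)" if "i < N" for i
  proof -
    note gm[OF that, measurable] Wm[OF that, measurable]
    show ?thesis unfolding gv_def by measurable
  qed
  have gAm [measurable]: "(\<lambda>x. if x \<in> A then g i x else 0) \<in> borel_measurable (leb N)" if "i < N" for i
  proof -
    note gm[OF that, measurable]
    show ?thesis by measurable
  qed
  define f where "f x = enorm N (\<lambda>i. g i x) powr (p - 2) * einner N (\<lambda>i. g i x) (\<lambda>i. gv i x)" for x
  have fm [measurable]: "f \<in> borel_measurable (leb N)"
    unfolding f_def[abs_def] by (rule measurable_p_Laplace_flux[OF gm gvm])
  have gv0: "gv i x = 0" if "x \<in> Rn N" "x \<notin> S \<or> x \<notin> A" for i x
    using that out[of x] \<phi>A[of x] p by (auto simp: gv_def)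
  have ein0: "einner N G (\<lambda>i. 0) = 0" for G by (simp add: einner_def)
  have fi: "integrable (leb N) f"
  proof (rule integrableI_bounded[OF fm])
    have "(\<integral>\<^sup>+x. ennreal (norm (f x)) \<partial>leb N) \<le> (\<integral>\<^sup>+x. ennreal (real N powr p) * (\<Sum>i<N. ennreal (\<bar>cut S (g i) x\<bar> powr p))
        + ennreal (real N powr p) * (\<Sum>i<N. ennreal (\<bar>gv i x\<bar> powr p)) \<partial>leb N)"
    proof (rule nn_integral_mono)
      fix x assume "x \<in> space (leb N)"
      then have x: "x \<in> Rn N" by simp
      show "ennreal (norm (f x)) \<le> ennreal (real N powr p) * (\<Sum>i<N. ennreal (\<bar>cut S (g i) x\<bar> powr p))
        + ennreal (real N powr p) * (\<Sum>i<N. ennreal (\<bar>gv i x\<bar> powr p))"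
      proof (cases "x \<in> S")
        case True
        define e where "e = enorm N (\<lambda>i. g i x)"
        define e' where "e' = enorm N (\<lambda>i. gv i x)"
        have e: "0 \<le> e" "0 \<le> e'" by (auto simp: e_def e'_def)
        have "norm (f x) \<le> e powr (p - 2) * (e * e')"
          unfolding f_def e_def[symmetric] real_norm_def abs_mult
          using einner_le_enorm[of N "\<lambda>i. g i x" "\<lambda>i. gv i x"] by (simp add: e_def e'_def mult_left_mono)
        also have "\<dots> = e powr (p - 1) * e'"
          using e powr_add[of e "p - 2" 1] by (cases "e = 0") auto
        also have "\<dots> \<le> e powr p + e' powr p" using powr_mult_young[of p e e'] p e by simp
        also have "\<dots> \<le> real N powr p * (\<Sum>i<N. \<bar>g i x\<bar> powr p) + real N powr p * (\<Sum>i<N. \<bar>gv i x\<bar> powr p)"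
          unfolding e_def e'_def using p by (intro add_mono enorm_powr_le) auto
        finally have "ennreal (norm (f x)) \<le> ennreal (real N powr p * (\<Sum>i<N. \<bar>g i x\<bar> powr p) + real N powr p * (\<Sum>i<N. \<bar>gv i x\<bar> powr p))"
          by (rule ennreal_leI)
        also have "\<dots> = ennreal (real N powr p) * (\<Sum>i<N. ennreal (\<bar>g i x\<bar> powr p)) + ennreal (real N powr p) * (\<Sum>i<N. ennreal (\<bar>gv i x\<bar> powr p))"
          by (simp add: ennreal_plus ennreal_mult sum_nonneg)
        finally show ?thesis using True by simp
      qed (use gv0[OF x] in \<open>simp add: f_def ein0\<close>)
    qed
    also have "\<dots> = ennreal (real N powr p) * (\<Sum>i<N. pint N p (cut S (g i))) + ennreal (real N powr p) * (\<Sum>i<N. pint N p (gv i))"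
    proof -
      have cm: "cut S (g i) \<in> borel_measurable (leb N)" if "i < N" for i
      proof -
        note gm[OF that, measurable]
        show ?thesis unfolding cut_def[abs_def] by measurable
      qed
      have s1: "(\<lambda>x. \<Sum>i<N. ennreal (\<bar>h i x\<bar> powr p)) \<in> borel_measurable (leb N)"
        "(\<integral>\<^sup>+x. (\<Sum>i<N. ennreal (\<bar>h i x\<bar> powr p)) \<partial>leb N) = (\<Sum>i<N. pint N p (h i))"
        if h: "\<And>i. i < N \<Longrightarrow> h i \<in> borel_measurable (leb N)" for h
      proof -
        have hm: "(\<lambda>x. ennreal (\<bar>h i x\<bar> powr p)) \<in> borel_measurable (leb N)" if "i < N" for i
        proof -
          note h[OF that, measurable]
          show ?thesis by measurable
        qed
        show "(\<lambda>x. \<Sum>i<N. ennreal (\<bar>h i x\<bar> powr p)) \<in> borel_measurable (leb N)"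
          by (rule borel_measurable_sum) (use hm in auto)
        show "(\<integral>\<^sup>+x. (\<Sum>i<N. ennreal (\<bar>h i x\<bar> powr p)) \<partial>leb N) = (\<Sum>i<N. pint N p (h i))"
          unfolding pint_def by (rule nn_integral_sum) (use hm in auto)
      qed
      define Y1 Y2 where "Y1 x = (\<Sum>i<N. ennreal (\<bar>cut S (g i) x\<bar> powr p))" and "Y2 x = (\<Sum>i<N. ennreal (\<bar>gv i x\<bar> powr p))" for x
      have Ym [measurable]: "Y1 \<in> borel_measurable (leb N)" "Y2 \<in> borel_measurable (leb N)"
        unfolding Y1_def[abs_def] Y2_def[abs_def] by (rule s1(1)[OF cm], simp, rule s1(1)[OF gvm], simp)
      have Yi: "(\<Sum>i<N. pint N p (cut S (g i))) = (\<integral>\<^sup>+x. Y1 x \<partial>leb N)" "(\<Sum>i<N. pint N p (gv i)) = (\<integral>\<^sup>+x. Y2 x \<partial>leb N)"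
        unfolding Y1_def Y2_def by (rule s1(2)[OF cm, symmetric], simp, rule s1(2)[OF gvm, symmetric], simp)
      show ?thesis
        unfolding Yi Y1_def[symmetric] Y2_def[symmetric]
        by (subst nn_integral_add, measurable, subst nn_integral_cmult, measurable, subst nn_integral_cmult, measurable)
    qed
    also have "\<dots> < \<infinity>" using gS gvp by (auto simp: ennreal_mult_less_top)
    finally show "(\<integral>\<^sup>+x. ennreal (norm (f x)) \<partial>leb N) < \<infinity>" .
  qed
  define a where "a = enn2real (\<integral>\<^sup>+x. ennreal (f x) \<partial>leb N)"
  define b where "b = enn2real (\<integral>\<^sup>+x. ennreal (- f x) \<partial>leb N)"
  have fa: "ennreal a = (\<integral>\<^sup>+x. ennreal (f x) \<partial>leb N)" and fb: "ennreal b = (\<integral>\<^sup>+x. ennreal (- f x) \<partial>leb N)"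
    using fi by (auto simp: a_def b_def real_integrable_def less_top)
  have Lc: "(LINT x|leb N. f x) = a - b" unfolding a_def b_def by (rule real_lebesgue_integral_def[OF fi])
  let ?G = "\<lambda>x. enorm N (\<lambda>i. if x \<in> A then g i x else 0)"
  have Gm [measurable]: "?G \<in> borel_measurable (leb N)" by (rule en[OF gAm])
  have Wem [measurable]: "(\<lambda>x. enorm N (\<lambda>i. W i x)) \<in> borel_measurable (leb N)" by (rule en[OF Wm])
  have "ennreal (1 / 2) * (\<integral>\<^sup>+x\<in>B. ennreal (w x powr p * ?G x powr p) \<partial>leb N) + ennreal b
    = (\<integral>\<^sup>+x. ennreal (1 / 2) * (ennreal (w x powr p * ?G x powr p) * indicator B x) + ennreal (- f x) \<partial>leb N)"
    unfolding fb by (subst nn_integral_add) (simp_all add: nn_integral_cmult)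
  also have "\<dots> \<le> (\<integral>\<^sup>+x. ennreal (f x) + ennreal (young_const p) * (ennreal (\<phi> x powr p * enorm N (\<lambda>i. W i x) powr p) * indicator B x) \<partial>leb N)"
  proof (rule nn_integral_mono)
    fix x assume "x \<in> space (leb N)"
    then have x: "x \<in> Rn N" by simp
    have yp: "0 \<le> young_const p" using young_const_pos[OF p] by simp
    show "ennreal (1 / 2) * (ennreal (w x powr p * ?G x powr p) * indicator B x) + ennreal (- f x)
      \<le> ennreal (f x) + ennreal (young_const p) * (ennreal (\<phi> x powr p * enorm N (\<lambda>i. W i x) powr p) * indicator B x)"
    proof (cases "x \<in> A \<and> x \<in> S")
      case True
      then have xB: "x \<in> B" using SB by auto
      have "w x powr p * enorm N (\<lambda>i. g i x) powr p / 2 \<le> f x + young_const p * (\<phi> x powr p * enorm N (\<lambda>i. W i x) powr p)"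
        using caccioppoli_local[OF p \<phi>[of x] w[OF x], of N "\<lambda>i. g i x" "\<lambda>i. W i x"] True
        by (simp add: f_def gv_def)
      then have "ennreal (w x powr p * enorm N (\<lambda>i. g i x) powr p / 2) + ennreal (- f x)
        \<le> ennreal (f x) + ennreal (young_const p * (\<phi> x powr p * enorm N (\<lambda>i. W i x) powr p))"
        by (rule ennreal_split_le) (use yp in auto)
      moreover have "ennreal (1 / 2) * ennreal (w x powr p * enorm N (\<lambda>i. g i x) powr p) = ennreal (w x powr p * enorm N (\<lambda>i. g i x) powr p / 2)"
        by (subst ennreal_mult[symmetric]) auto
      moreover have "ennreal (young_const p) * ennreal (\<phi> x powr p * enorm N (\<lambda>i. W i x) powr p) = ennreal (young_const p * (\<phi> x powr p * enorm N (\<lambda>i. W i x) powr p))"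
        using yp by (simp add: ennreal_mult[symmetric])
      ultimately show ?thesis using True xB by simp
    next
      case False
      have f0: "f x = 0" using gv0[OF x] False by (auto simp: f_def ein0)
      have z: "w x powr p * ?G x powr p = 0"
        using False out[OF x] by (auto simp: enorm_def L2_set_def)
      show ?thesis unfolding z f0 by simp
    qed
  qed
  also have "\<dots> = ennreal a + ennreal (young_const p) * (\<integral>\<^sup>+x\<in>B. ennreal (\<phi> x powr p * enorm N (\<lambda>i. W i x) powr p) \<partial>leb N)"
    unfolding fa by (subst nn_integral_add) (simp_all add: nn_integral_cmult)
  finally have ineq: "ennreal (1 / 2) * (\<integral>\<^sup>+x\<in>B. ennreal (w x powr p * ?G x powr p) \<partial>leb N) + ennreal b
    \<le> ennreal a + ennreal (young_const p) * (\<integral>\<^sup>+x\<in>B. ennreal (\<phi> x powr p * enorm N (\<lambda>i. W i x) powr p) \<partial>leb N)" .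
  show ?thesis by (rule that[OF _ _ Lc[unfolded f_def] ineq]) (simp_all add: a_def b_def)
qed

text \<open>The gradients in the definitions are choices up to null sets and carry no measurability off \<open>U\<close>. The
  representatives \<open>g i\<close> are measurable and vanish off \<open>U\<close>.\<close>

lemma W1p_loc_representatives:
  assumes U: "openin (Euclidean_space N) U" and u: "u \<in> W1p_loc N p U"
  obtains g where "\<And>i. i < N \<Longrightarrow> g i \<in> borel_measurable (leb N)" "\<And>i. i < N \<Longrightarrow> weak_deriv N U i u (g i)"
    "\<And>i x. x \<notin> U \<Longrightarrow> g i x = 0" "AE x in leb N. x \<in> U \<longrightarrow> (\<forall>i<N. wgrad N U u x i = g i x)"
    "is_weak_gradient N U u (wgrad N U u)"
    "\<And>L. compact L \<Longrightarrow> L \<subseteq> U \<Longrightarrow> pint N p (cut L u) < \<infinity>"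
    "\<And>L i. compact L \<Longrightarrow> L \<subseteq> U \<Longrightarrow> i < N \<Longrightarrow> pint N p (cut L (g i)) < \<infinity>"
proof -
  obtain G where G: "is_weak_gradient N U u G"
    and GL: "\<And>V. compactly_inside N V U \<Longrightarrow> u \<in> Lp N p V \<and> (\<forall>i<N. (\<lambda>x. G x i) \<in> Lp N p V)"
    using u unfolding W1p_loc_def by blast
  define g where "g i = cut U (\<lambda>x. G x i)" for i
  have wd: "weak_deriv N U i u (\<lambda>x. G x i)" if "i < N" for i
    using G that by (simp add: is_weak_gradient_iff)
  have fin: "pint N p (cut L f) < \<infinity>" if L: "compact L" "L \<subseteq> U" and f: "\<And>V. compactly_inside N V U \<Longrightarrow> f \<in> Lp N p V" for L f
  proof -
    obtain V where V: "L \<subseteq> V" "compactly_inside N V U" by (rule compactly_inside_nbhd[OF L U])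
    have "pint N p (cut L f) \<le> (\<integral>\<^sup>+x\<in>V. ennreal (\<bar>f x\<bar> powr p) \<partial>leb N)"
      unfolding pint_def using V(1) by (intro nn_integral_mono) (simp add: cut_def indicator_def subset_iff)
    also have "\<dots> < \<infinity>" using f[OF V(2)] by (simp add: Lp_def)
    finally show ?thesis .
  qed
  have L1: "(\<lambda>x. G x i) \<in> L1_loc N U" if "i < N" for i
    using wd[OF that] by (simp add: weak_deriv_def)
  show ?thesis
  proof (rule that[of g])
    show "g i \<in> borel_measurable (leb N)" if "i < N" for i
      unfolding g_def by (rule L1_loc_measurable[OF U L1[OF that]])
    show "weak_deriv N U i u (g i)" if "i < N" for i
      unfolding g_def by (rule weak_deriv_cut[OF wd[OF that]])
    show "g i x = 0" if "x \<notin> U" for i x using that by (simp add: g_def)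
    show "AE x in leb N. x \<in> U \<longrightarrow> (\<forall>i<N. wgrad N U u x i = g i x)"
      using wgrad_AE(2)[OF U G] by eventually_elim (simp add: g_def)
    show "is_weak_gradient N U u (wgrad N U u)" by (rule wgrad_AE(1)[OF U G])
    show "pint N p (cut L u) < \<infinity>" if "compact L" "L \<subseteq> U" for L
      by (rule fin[OF that]) (use GL in blast)
    show "pint N p (cut L (g i)) < \<infinity>" if "compact L" "L \<subseteq> U" "i < N" for L i
    proof -
      have "cut L (g i) = cut L (\<lambda>x. G x i)"
        using that(2) by (auto simp: g_def cut_def indicator_def subset_iff fun_eq_iff)
      then show ?thesis using fin[OF that(1,2), of "\<lambda>x. G x i"] GL that(3) by simp
    qed
  qed
qed

lemma pint_dominated_finite:
  assumes [measurable]: "a \<in> borel_measurable (leb N)" "b \<in> borel_measurable (leb N)"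
    and S: "compact S" "S \<subseteq> Rn N" and p: "1 < p"
    and a: "pint N p a < \<infinity>" and b: "pint N p b < \<infinity>"
    and le: "\<And>x. x \<in> Rn N \<Longrightarrow> \<bar>f x\<bar> \<le> M * (\<bar>a x\<bar> + (\<bar>b x\<bar> + c * indicator S x))"
  shows "pint N p f < \<infinity>"
proof -
  have Sm [measurable]: "S \<in> sets (leb N)" by (rule sets_leb_compact[OF S])
  have "pint N p (\<lambda>x. c * indicator S x) = ennreal (\<bar>c\<bar> powr p) * pint N p (indicator S)"
    by (rule pint_scale) measurable
  also have "pint N p (indicator S) = (\<integral>\<^sup>+x. indicator S x \<partial>leb N)"
    unfolding pint_def using p by (intro nn_integral_cong) (auto simp: indicator_def)
  also have "\<dots> = emeasure (leb N) S" by simp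
  finally have c: "pint N p (\<lambda>x. c * indicator S x) < \<infinity>"
    using emeasure_compact_finite[OF S] by (simp add: ennreal_mult_less_top)
  have eqa: "pint N p (\<lambda>x. \<bar>h x\<bar>) = pint N p h" for h by (simp add: pint_def)
  have "pint N p (\<lambda>x. \<bar>b x\<bar> + c * indicator S x) \<le> ennreal (2 powr p) * (pint N p (\<lambda>x. \<bar>b x\<bar>) + pint N p (\<lambda>x. c * indicator S x))"
    by (rule pint_add) (use p in auto)
  also have "\<dots> < \<infinity>" using b c unfolding eqa by (simp add: ennreal_mult_less_top)
  finally have bc: "pint N p (\<lambda>x. \<bar>b x\<bar> + c * indicator S x) < \<infinity>" .
  have "pint N p (\<lambda>x. \<bar>a x\<bar> + (\<bar>b x\<bar> + c * indicator S x))
      \<le> ennreal (2 powr p) * (pint N p (\<lambda>x. \<bar>a x\<bar>) + pint N p (\<lambda>x. \<bar>b x\<bar> + c * indicator S x))"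
    by (rule pint_add) (use p in auto)
  also have "\<dots> < \<infinity>" using a bc unfolding eqa by (simp add: ennreal_mult_less_top)
  finally have abc: "pint N p (\<lambda>x. \<bar>a x\<bar> + (\<bar>b x\<bar> + c * indicator S x)) < \<infinity>" .
  have "pint N p f \<le> pint N p (\<lambda>x. M * (\<bar>a x\<bar> + (\<bar>b x\<bar> + c * indicator S x)))"
    by (rule pint_mono) (use order_trans[OF le abs_ge_self] p in auto)
  also have "\<dots> = ennreal (\<bar>M\<bar> powr p) * pint N p (\<lambda>x. \<bar>a x\<bar> + (\<bar>b x\<bar> + c * indicator S x))"
    by (rule pint_scale) measurable
  also have "\<dots> < \<infinity>" using abc by (simp add: ennreal_mult_less_top)
  finally show ?thesis .
qed

text \<open>The test function \<open>(u - k)\<^sub>+ w\<^sup>p\<close>. Its weak gradient follows from the rules for truncations and products, and its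
  integrability from the boundedness of \<open>w\<^sup>p\<close> and of its derivatives on a compact set.\<close>

lemma subsolution_test_function:
  fixes u w :: "(nat \<Rightarrow> real) \<Rightarrow> real" and g D :: "nat \<Rightarrow> (nat \<Rightarrow> real) \<Rightarrow> real" and k p :: real and N :: nat
  assumes p: "1 < p" and U: "openin (Euclidean_space N) U" and um [measurable]: "u \<in> borel_measurable (leb N)"
    and gm: "\<And>i. i < N \<Longrightarrow> g i \<in> borel_measurable (leb N)" and wu: "\<And>i. i < N \<Longrightarrow> weak_deriv N U i u (g i)"
    and up: "\<And>L. compact L \<Longrightarrow> L \<subseteq> U \<Longrightarrow> pint N p (cut L u) < \<infinity>"
    and gp: "\<And>L i. compact L \<Longrightarrow> L \<subseteq> U \<Longrightarrow> i < N \<Longrightarrow> pint N p (cut L (g i)) < \<infinity>"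
    and C: "C1c N w D S" and SU: "S \<subseteq> U" and w: "\<And>x. x \<in> Rn N \<Longrightarrow> 0 \<le> w x" and N: "1 \<le> N"
  defines "A \<equiv> {x \<in> Rn N. k < u x}"
  defines "\<phi> \<equiv> \<lambda>x. max (u x - k) 0"
  defines "v \<equiv> \<lambda>x. \<phi> x * w x powr p"
  defines "gv \<equiv> \<lambda>i x. (if x \<in> A then g i x else 0) * w x powr p + \<phi> x * (p * w x powr (p - 1) * D i x)"
  shows "A \<in> sets (leb N)"
    and "\<And>i. i < N \<Longrightarrow> weak_deriv N U i \<phi> (\<lambda>x. if x \<in> A then g i x else 0)"
    and "\<And>i. i < N \<Longrightarrow> gv i \<in> borel_measurable (leb N)"
    and "\<And>i. i < N \<Longrightarrow> weak_deriv N U i v (gv i)"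
    and "pint N p v < \<infinity>" and "\<And>i. i < N \<Longrightarrow> pint N p (gv i) < \<infinity>"
    and "\<exists>V. compactly_inside N V U \<and> v \<in> W1p_0 N p V"
proof -
  have Am: "A \<in> sets (leb N)"
  proof -
    have "{x \<in> space (leb N). k < u x} \<in> sets (leb N)" by measurable
    then show ?thesis by (simp add: A_def)
  qed
  then show "A \<in> sets (leb N)" .
  note Am [measurable]
  have cS: "compact S" and SR: "S \<subseteq> Rn N" using C1c_D(1,2)[OF C] .
  have Sm [measurable]: "S \<in> sets (leb N)" by (rule sets_leb_compact[OF cS SR])
  have wm [measurable]: "w \<in> borel_measurable (leb N)" by (rule C1c_D(7)[OF C])
  have \<phi>m [measurable]: "\<phi> \<in> borel_measurable (leb N)" unfolding \<phi>_def by measurable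
  have vm: "v \<in> borel_measurable (leb N)" unfolding v_def by measurable
  define z where "z x = w x powr p" for x
  define E where "E i x = p * w x powr (p - 1) * D i x" for i x
  have Cz: "C1c N z E S" unfolding z_def[abs_def] E_def[abs_def] by (rule C1c_powr[OF C p w])
  have zm [measurable]: "z \<in> borel_measurable (leb N)" by (rule C1c_D(7)[OF Cz])
  have Em: "E i \<in> borel_measurable (leb N)" if "i < N" for i by (rule C1c_D(8)[OF Cz that])
  have gAm: "(\<lambda>x. if x \<in> A then g i x else 0) \<in> borel_measurable (leb N)" if "i < N" for i
  proof -
    note gm[OF that, measurable]
    show ?thesis by measurable
  qed
  show wphi: "weak_deriv N U i \<phi> (\<lambda>x. if x \<in> A then g i x else 0)" if i: "i < N" for i
  proof (rule weak_deriv_cong_AE[OF U])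
    note gm[OF i, measurable]
    show "weak_deriv N U i \<phi> (\<lambda>x. if k < u x then g i x else 0)"
      unfolding \<phi>_def by (rule weak_deriv_pos_part[OF U wu[OF i] i um gm[OF i]])
    show "(\<lambda>x. if x \<in> A then g i x else 0) \<in> borel_measurable (leb N)" by (rule gAm[OF i])
    show "(\<lambda>x. if k < u x then g i x else 0) \<in> borel_measurable (leb N)" by measurable
    show "AE x in leb N. x \<in> U \<longrightarrow> (if k < u x then g i x else 0) = (if x \<in> A then g i x else 0)"
      by (rule AE_I2) (simp add: A_def)
  qed
  show gvm: "gv i \<in> borel_measurable (leb N)" if "i < N" for i
  proof -
    note gAm[OF that, measurable] Em[OF that, unfolded E_def, measurable]
    show ?thesis unfolding gv_def by measurable
  qed
  show wv: "weak_deriv N U i v (gv i)" if i: "i < N" for i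
    using weak_deriv_mult_C1c[OF U wphi[OF i] i Cz \<phi>m gAm[OF i]]
    unfolding v_def gv_def z_def E_def .
  obtain M where M: "0 \<le> M" "\<And>x. x \<in> Rn N \<Longrightarrow> \<bar>z x\<bar> \<le> M" "\<And>x i. x \<in> Rn N \<Longrightarrow> i < N \<Longrightarrow> \<bar>E i x\<bar> \<le> M"
    using C1c_bounded[OF Cz] by blast
  have v0: "v x = 0" if "x \<in> Rn N" "x \<notin> S" for x
    using C1c_D(5)[OF C that] p by (simp add: v_def)
  have gv0: "gv i x = 0" if "i < N" "x \<in> Rn N" "x \<notin> S" for i x
    using C1c_D(5)[OF C that(2,3)] p by (simp add: gv_def)
  have phile: "\<bar>\<phi> x\<bar> \<le> \<bar>u x\<bar> + \<bar>k\<bar>" for x by (auto simp: \<phi>_def)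
  have cum: "cut S u \<in> borel_measurable (leb N)" unfolding cut_def[abs_def] by measurable
  have cgm: "cut S (g i) \<in> borel_measurable (leb N)" if "i < N" for i
  proof -
    note gm[OF that, measurable]
    show ?thesis unfolding cut_def[abs_def] by measurable
  qed
  have pz: "pint N p (\<lambda>x. 0) < \<infinity>" by (simp add: pint_def)
  show vp: "pint N p v < \<infinity>"
  proof (rule pint_dominated_finite[OF _ cum cS SR p pz up[OF cS SU]])
    fix x assume x: "x \<in> Rn N"
    show "\<bar>v x\<bar> \<le> M * (\<bar>0\<bar> + (\<bar>cut S u x\<bar> + \<bar>k\<bar> * indicator S x))"
    proof (cases "x \<in> S")
      case True
      have "\<bar>v x\<bar> = \<bar>z x\<bar> * \<bar>\<phi> x\<bar>" by (simp add: v_def z_def abs_mult)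
      also have "\<dots> \<le> M * (\<bar>u x\<bar> + \<bar>k\<bar>)" by (intro mult_mono M(2)[OF x] phile M(1)) simp
      finally show ?thesis using True by simp
    qed (use v0[OF x] in simp)
  qed simp
  show gvp: "pint N p (gv i) < \<infinity>" if i: "i < N" for i
  proof (rule pint_dominated_finite[OF cgm[OF i] cum cS SR p gp[OF cS SU i] up[OF cS SU]])
    fix x assume x: "x \<in> Rn N"
    show "\<bar>gv i x\<bar> \<le> M * (\<bar>cut S (g i) x\<bar> + (\<bar>cut S u x\<bar> + \<bar>k\<bar> * indicator S x))"
    proof (cases "x \<in> S")
      case True
      let ?ga = "if x \<in> A then g i x else 0"
      have "\<bar>gv i x\<bar> \<le> \<bar>?ga * z x\<bar> + \<bar>\<phi> x * E i x\<bar>" unfolding gv_def z_def E_def by (rule abs_triangle_ineq)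
      also have "\<dots> = \<bar>z x\<bar> * \<bar>?ga\<bar> + \<bar>E i x\<bar> * \<bar>\<phi> x\<bar>" by (simp only: abs_mult mult.commute)
      also have "\<dots> \<le> M * \<bar>g i x\<bar> + M * (\<bar>u x\<bar> + \<bar>k\<bar>)"
        by (intro add_mono mult_mono M(2)[OF x] M(3)[OF x i] phile M(1)) auto
      finally show ?thesis using True by (simp add: distrib_left)
    qed (use gv0[OF i x] in simp)
  qed
  obtain V where V: "S \<subseteq> V" "compactly_inside N V U" "openin (Euclidean_space N) V" "V \<subseteq> U"
    using compactly_inside_nbhd[OF cS SU U] by blast
  have wvV: "weak_deriv N V i v (gv i)" if "i < N" for i
    by (rule weak_deriv_mono[OF wv[OF that] V(4) that])
  have "v \<in> L1_loc N V" using wvV[of 0] N by (simp add: weak_deriv_def)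
  then have "v \<in> W1p_0 N p V"
    using p by (intro W1p_0_membership[OF V(3) _ wvV cS V(1) vm v0 vp gvm gv0 gvp]) auto
  with V(2) show "\<exists>V. compactly_inside N V U \<and> v \<in> W1p_0 N p V" by blast
qed

text \<open>The combination of both parts with the tested equation. The finite quantity \<open>b + \<alpha> b'\<close> is cancelled; the
  remaining quantities may be infinite.\<close>

lemma ennreal_absorb:
  fixes a b a' b' \<alpha> c1 c2 Y :: real and LP Q T L2 R :: ennreal
  assumes nl: "ennreal c1 * LP + ennreal b \<le> ennreal a + (ennreal c2 * Q + 2 * T)"
    and lo: "ennreal (1 / 2) * L2 + ennreal b' \<le> ennreal a' + ennreal Y * R"
    and eq: "(a - b) + \<alpha> * (a' - b') \<le> 0"
    and nn: "0 \<le> a" "0 \<le> b" "0 \<le> a'" "0 \<le> b'" "0 \<le> \<alpha>" "0 < c1" "c1 \<le> 1 / 2" "0 \<le> c2" "0 \<le> Y"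
  shows "ennreal \<alpha> * L2 + LP \<le> ennreal ((c2 + 2 + Y) / c1) * (Q + T + ennreal \<alpha> * R)"
proof -
  define X where "X = ennreal c1 * LP + ennreal \<alpha> * (ennreal (1 / 2) * L2)"
  define Z where "Z = ennreal c2 * Q + 2 * T + ennreal \<alpha> * (ennreal Y * R)"
  define m where "m = b + \<alpha> * b'"
  have "ennreal \<alpha> * (ennreal (1 / 2) * L2 + ennreal b') \<le> ennreal \<alpha> * (ennreal a' + ennreal Y * R)"
    by (rule mult_left_mono[OF lo]) simp
  then have lo': "ennreal \<alpha> * (ennreal (1 / 2) * L2) + ennreal (\<alpha> * b') \<le> ennreal (\<alpha> * a') + ennreal \<alpha> * (ennreal Y * R)"
    unfolding distrib_left using nn by (simp only: ennreal_mult)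
  have "ennreal m + X = (ennreal c1 * LP + ennreal b) + (ennreal \<alpha> * (ennreal (1 / 2) * L2) + ennreal (\<alpha> * b'))"
    unfolding m_def X_def using nn by (subst ennreal_plus) (auto simp: ac_simps)
  also have "\<dots> \<le> (ennreal a + (ennreal c2 * Q + 2 * T)) + (ennreal (\<alpha> * a') + ennreal \<alpha> * (ennreal Y * R))"
    by (rule add_mono[OF nl lo'])
  also have "\<dots> = ennreal (a + \<alpha> * a') + Z"
    unfolding Z_def using nn by (subst ennreal_plus) (auto simp: ac_simps)
  also have "\<dots> \<le> ennreal m + Z"
    using eq unfolding m_def by (intro add_right_mono ennreal_leI) (simp add: algebra_simps)
  finally have XZ: "X \<le> Z" by (simp add: ennreal_add_left_cancel_le)
  have "ennreal c1 * (ennreal \<alpha> * L2 + LP) \<le> X"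
  proof -
    have "ennreal c1 * (ennreal \<alpha> * L2) \<le> ennreal (1 / 2) * (ennreal \<alpha> * L2)"
      using nn by (intro mult_right_mono ennreal_leI) auto
    then have "ennreal c1 * (ennreal \<alpha> * L2) + ennreal c1 * LP \<le> ennreal (1 / 2) * (ennreal \<alpha> * L2) + ennreal c1 * LP"
      by (rule add_right_mono)
    also have "\<dots> = X" unfolding X_def by (simp only: mult.left_commute add.commute)
    finally show ?thesis by (simp only: distrib_left)
  qed
  also note XZ
  also have "Z \<le> ennreal (c2 + 2 + Y) * (Q + T + ennreal \<alpha> * R)"
  proof -
    have "ennreal c2 * Q \<le> ennreal (c2 + 2 + Y) * Q"
      using nn by (intro mult_right_mono ennreal_leI) auto
    moreover have "2 * T \<le> ennreal (c2 + 2 + Y) * T"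
    proof -
      have "ennreal 2 * T \<le> ennreal (c2 + 2 + Y) * T" using nn by (intro mult_right_mono ennreal_leI) auto
      then show ?thesis by simp
    qed
    moreover have "ennreal \<alpha> * (ennreal Y * R) \<le> ennreal (c2 + 2 + Y) * (ennreal \<alpha> * R)"
    proof -
      have "ennreal Y * (ennreal \<alpha> * R) \<le> ennreal (c2 + 2 + Y) * (ennreal \<alpha> * R)" using nn by (intro mult_right_mono ennreal_leI) auto
      then show ?thesis by (simp only: mult.left_commute)
    qed
    ultimately show ?thesis unfolding Z_def distrib_left by (intro add_mono)
  qed
  finally have main: "ennreal c1 * (ennreal \<alpha> * L2 + LP) \<le> ennreal (c2 + 2 + Y) * (Q + T + ennreal \<alpha> * R)" .
  have "ennreal \<alpha> * L2 + LP = ennreal (1 / c1) * (ennreal c1 * (ennreal \<alpha> * L2 + LP))"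
  proof -
    have "ennreal (1 / c1) * ennreal c1 = 1"
      using nn by (subst ennreal_mult[symmetric]) auto
    then show ?thesis by (simp only: mult.assoc[symmetric] mult_1_left)
  qed
  also have "\<dots> \<le> ennreal (1 / c1) * (ennreal (c2 + 2 + Y) * (Q + T + ennreal \<alpha> * R))"
    by (rule mult_left_mono[OF main]) simp
  also have "\<dots> = ennreal ((c2 + 2 + Y) / c1) * (Q + T + ennreal \<alpha> * R)"
  proof -
    have "ennreal (1 / c1) * ennreal (c2 + 2 + Y) = ennreal ((c2 + 2 + Y) / c1)"
      using nn by (subst ennreal_mult[symmetric]) auto
    then show ?thesis by (simp only: mult.assoc[symmetric])
  qed
  finally show ?thesis .
qed

text \<open>The constant is explicit: \<open>2\<^sup>-\<^sup>p / 2\<close> is the factor of the nonlocal energy in the discrete inequality, and the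
  numerator adds up the factors of the three terms on the right.\<close>

lemma caccioppoli_subsolution:
  fixes u w :: "(nat \<Rightarrow> real) \<Rightarrow> real" and k p r :: real and N :: nat
  assumes p: "1 < p" and N: "1 \<le> N" and U: "openin (Euclidean_space N) \<Omega>" and \<mu>: "admissible_measure \<mu>"
    and sub: "weak_subsolution N p \<mu> \<Omega> u" and \<phi>: "\<phi> = (\<lambda>x. max (u x - k) 0)"
    and Bb: "B = euclid_ball N x0 r" and x0: "x0 \<in> Rn N" and BU: "B \<subseteq> \<Omega>" and w: "w \<in> Cc_infty N B" and w0: "\<And>x. x \<in> Rn N \<Longrightarrow> 0 \<le> w x"
  shows "ennreal (measure \<mu> {1}) * (\<integral>\<^sup>+x\<in>B. ennreal (w x powr p * enorm N (wgrad N \<Omega> \<phi> x) powr p) \<partial>leb N)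
      + (\<integral>\<^sup>+s\<in>{0<..<1}. ennreal (C_const N s p) *
           (\<integral>\<^sup>+z\<in>B \<times> B. (case z of (x, y) \<Rightarrow>
              ennreal (\<bar>\<phi> x * w x - \<phi> y * w y\<bar> powr p / edist N x y powr (real N + s * p)))
            \<partial>(leb N \<Otimes>\<^sub>M leb N)) \<partial>\<mu>)
      \<le> ennreal ((young_const p + 1 / 2 + 2 + young_const p) / (2 powr (- p) / 2)) *
        ((\<integral>\<^sup>+s\<in>{0<..<1}. ennreal (C_const N s p) *
            (\<integral>\<^sup>+z\<in>B \<times> B. (case z of (x, y) \<Rightarrow>
               ennreal (max (\<phi> x) (\<phi> y) powr p * \<bar>w x - w y\<bar> powr p
                 / edist N x y powr (real N + s * p)))
             \<partial>(leb N \<Otimes>\<^sub>M leb N)) \<partial>\<mu>)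
         + (\<integral>\<^sup>+s\<in>{0<..<1}. ennreal (C_const N s p) *
              (esssup (restrict_space (leb N) (supp N w))
                 (\<lambda>x. \<integral>\<^sup>+y\<in>Rn N - B.
                    ennreal (\<phi> y powr (p - 1) / edist N x y powr (real N + s * p)) \<partial>leb N)
               * (\<integral>\<^sup>+x\<in>B. ennreal (\<phi> x * w x powr p) \<partial>leb N)) \<partial>\<mu>)
         + ennreal (measure \<mu> {1}) * (\<integral>\<^sup>+x\<in>B. ennreal (\<phi> x powr p * enorm N (grad w x) powr p) \<partial>leb N))"
proof -
  have uW: "u \<in> W1p_loc N p \<Omega>" and tail: "u \<in> tail_space N p \<mu>" using sub by (simp_all add: weak_subsolution_def)
  have um [measurable]: "u \<in> borel_measurable (leb N)" using tail by (simp add: tail_space_def)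
  obtain g where gm: "\<And>i. i < N \<Longrightarrow> g i \<in> borel_measurable (leb N)" and wu: "\<And>i. i < N \<Longrightarrow> weak_deriv N \<Omega> i u (g i)"
    and g0: "\<And>i x. x \<notin> \<Omega> \<Longrightarrow> g i x = 0" and gAE: "AE x in leb N. x \<in> \<Omega> \<longrightarrow> (\<forall>i<N. wgrad N \<Omega> u x i = g i x)"
    and wgu: "is_weak_gradient N \<Omega> u (wgrad N \<Omega> u)"
    and up: "\<And>L. compact L \<Longrightarrow> L \<subseteq> \<Omega> \<Longrightarrow> pint N p (cut L u) < \<infinity>"
    and gp: "\<And>L i. compact L \<Longrightarrow> L \<subseteq> \<Omega> \<Longrightarrow> i < N \<Longrightarrow> pint N p (cut L (g i)) < \<infinity>"
    using W1p_loc_representatives[OF U uW] by blast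
  define S where "S = supp N w"
  have C: "C1c N w (\<lambda>i. pd i w) S" and SB: "S \<subseteq> B" and cS: "compact S" and SR: "S \<subseteq> Rn N"
    unfolding S_def by (rule Cc_infty_C1c[OF w])+
  have SU: "S \<subseteq> \<Omega>" using SB BU by blast
  have Sm: "S \<in> sets (leb N)" by (rule sets_leb_compact[OF cS SR])
  have Bm [measurable]: "B \<in> sets (leb N)"
  proof -
    have [measurable]: "(\<lambda>x. edist N x x0) \<in> borel_measurable (leb N)" by (rule measurable_edist) (use x0 in auto)
    have "{x \<in> space (leb N). edist N x x0 < r} \<in> sets (leb N)" by measurable
    then show ?thesis by (simp add: Bb euclid_ball_def)
  qed
  have wm [measurable]: "w \<in> borel_measurable (leb N)" by (rule C1c_D(7)[OF C])
  have Wm: "pd i w \<in> borel_measurable (leb N)" if "i < N" for i by (rule C1c_D(8)[OF C that])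
  have out: "w x = 0" if "x \<in> Rn N" "x \<notin> S" for x by (rule C1c_D(5)[OF C that])
  have \<phi>m: "\<phi> \<in> borel_measurable (leb N)" unfolding \<phi> by measurable
  have \<phi>0: "0 \<le> \<phi> x" for x by (simp add: \<phi>)
  define A where "A = {x \<in> Rn N. k < u x}"
  define v where "v x = \<phi> x * w x powr p" for x
  define gv where "gv i x = (if x \<in> A then g i x else 0) * w x powr p + \<phi> x * (p * w x powr (p - 1) * pd i w x)" for i x
  have vm: "v \<in> borel_measurable (leb N)" unfolding v_def[abs_def] using \<phi>m by measurable
  have vv: "v = (\<lambda>x. \<phi> x * w x powr p)" by (simp add: v_def fun_eq_iff)
  have gvv: "gv i = (\<lambda>x. (if x \<in> A then g i x else 0) * w x powr p + \<phi> x * (p * w x powr (p - 1) * pd i w x))" for i by (simp add: gv_def fun_eq_iff)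
  have Am: "A \<in> sets (leb N)"
    unfolding A_def by (rule subsolution_test_function(1)[where k = k, OF p U um gm wu up gp C SU w0 N])
  have wphi: "\<And>i. i < N \<Longrightarrow> weak_deriv N \<Omega> i \<phi> (\<lambda>x. if x \<in> A then g i x else 0)"
    unfolding A_def \<phi> by (rule subsolution_test_function(2)[where k = k, OF p U um gm wu up gp C SU w0 N])
  have gvm: "\<And>i. i < N \<Longrightarrow> gv i \<in> borel_measurable (leb N)"
    unfolding gvv A_def \<phi> by (rule subsolution_test_function(3)[where k = k, OF p U um gm wu up gp C SU w0 N])
  have wv: "\<And>i. i < N \<Longrightarrow> weak_deriv N \<Omega> i v (gv i)"
    unfolding vv gvv A_def \<phi> by (rule subsolution_test_function(4)[where k = k, OF p U um gm wu up gp C SU w0 N])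
  have vp: "pint N p v < \<infinity>"
    unfolding vv \<phi> by (rule subsolution_test_function(5)[where k = k, OF p U um gm wu up gp C SU w0 N])
  have gvp: "\<And>i. i < N \<Longrightarrow> pint N p (gv i) < \<infinity>"
    unfolding gvv A_def \<phi> by (rule subsolution_test_function(6)[where k = k, OF p U um gm wu up gp C SU w0 N])
  have "\<exists>V. compactly_inside N V \<Omega> \<and> v \<in> W1p_0 N p V"
    unfolding vv \<phi> by (rule subsolution_test_function(7)[where k = k, OF p U um gm wu up gp C SU w0 N])
  then obtain V where V: "compactly_inside N V \<Omega>" "v \<in> W1p_0 N p V" by blast
  have v0: "v x = 0" if "x \<in> Rn N" "x \<notin> S" for x using out[OF that] p by (simp add: v_def)
  have gv0: "gv i x = 0" if "x \<in> Rn N" "x \<notin> S" for i x using out[OF that] p by (simp add: gv_def)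
  have vnn: "0 \<le> v x" for x using \<phi>0 by (simp add: v_def)
  define NL where "NL = (LINT s:{0<..<1}|\<mu>. C_const N s p * (LINT z|(leb N \<Otimes>\<^sub>M leb N). nonlocal_integrand N p u v s (fst z) (snd z)))"
  define LO where "LO = (LINT x|leb N. enorm N (\<lambda>i. g i x) powr (p - 2) * einner N (\<lambda>i. g i x) (\<lambda>i. gv i x))"
  have gvL: "pint N p (cut L (gv i)) < \<infinity>" if "i < N" for L i
  proof -
    have "pint N p (cut L (gv i)) \<le> pint N p (gv i)" by (rule pint_mono) (use p in \<open>auto simp: cut_def indicator_def\<close>)
    also have "\<dots> < \<infinity>" by (rule gvp[OF that])
    finally show ?thesis .
  qed
  have fin: "(\<integral>\<^sup>+s\<in>{0<..<1}. ennreal (C_const N s p) *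
    (\<integral>\<^sup>+z. ennreal \<bar>nonlocal_integrand N p u v s (fst z) (snd z)\<bar> \<partial>(leb N \<Otimes>\<^sub>M leb N)) \<partial>\<mu>) < \<infinity>"
    by (rule nonlocal_form_finite[OF N p \<mu> U tail wu wv vm cS SU v0 up gp gvL vp])
  \<comment> \<open>The weak formulation, rewritten with the measurable representatives of the gradients.\<close>
  have test: "NL + measure \<mu> {1} * LO \<le> 0"
  proof -
    have "(LINT s:{0<..<1}|\<mu>. C_const N s p *
           (LINT (x, y)|(leb N \<Otimes>\<^sub>M leb N).
              \<bar>u x - u y\<bar> powr (p - 2) * (u x - u y) * (v x - v y)
                / edist N x y powr (real N + s * p)))
        + measure \<mu> {1} *
          (LINT x:\<Omega>|leb N. enorm N (wgrad N \<Omega> u x) powr (p - 2)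
              * einner N (wgrad N \<Omega> u x) (wgrad N \<Omega> v x)) \<le> 0"
      using sub V vnn unfolding weak_subsolution_def by blast
    also have "(LINT s:{0<..<1}|\<mu>. C_const N s p *
           (LINT (x, y)|(leb N \<Otimes>\<^sub>M leb N).
              \<bar>u x - u y\<bar> powr (p - 2) * (u x - u y) * (v x - v y)
                / edist N x y powr (real N + s * p))) = NL"
      unfolding NL_def nonlocal_integrand_def case_prod_beta' ..
    also have "(LINT x:\<Omega>|leb N. enorm N (wgrad N \<Omega> u x) powr (p - 2)
              * einner N (wgrad N \<Omega> u x) (wgrad N \<Omega> v x)) = LO"
    proof -
      have wgv: "is_weak_gradient N \<Omega> v (\<lambda>x i. gv i x)"
        using wv N unfolding is_weak_gradient_iff by (auto simp: weak_deriv_def)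
      note wgv' = wgrad_AE[OF U wgv]
      let ?a = "\<lambda>i. cut \<Omega> (\<lambda>x. wgrad N \<Omega> u x i)" and ?b = "\<lambda>i. cut \<Omega> (\<lambda>x. wgrad N \<Omega> v x i)"
      have am: "?a i \<in> borel_measurable (leb N)" if "i < N" for i
        by (rule L1_loc_measurable[OF U]) (use wgu that in \<open>simp add: is_weak_gradient_def\<close>)
      have bm: "?b i \<in> borel_measurable (leb N)" if "i < N" for i
        by (rule L1_loc_measurable[OF U]) (use wgv'(1) that in \<open>simp add: is_weak_gradient_def\<close>)
      have "(LINT x:\<Omega>|leb N. enorm N (wgrad N \<Omega> u x) powr (p - 2) * einner N (wgrad N \<Omega> u x) (wgrad N \<Omega> v x))
        = (LINT x|leb N. enorm N (\<lambda>i. ?a i x) powr (p - 2) * einner N (\<lambda>i. ?a i x) (\<lambda>i. ?b i x))"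
        unfolding set_lebesgue_integral_def
      proof (rule Bochner_Integration.integral_cong[OF refl])
        fix x
        show "indicator \<Omega> x *\<^sub>R (enorm N (wgrad N \<Omega> u x) powr (p - 2) * einner N (wgrad N \<Omega> u x) (wgrad N \<Omega> v x))
          = enorm N (\<lambda>i. ?a i x) powr (p - 2) * einner N (\<lambda>i. ?a i x) (\<lambda>i. ?b i x)"
          by (cases "x \<in> \<Omega>") (simp_all add: einner_def)
      qed
      also have "\<dots> = LO" unfolding LO_def
      proof (rule integral_cong_AE)
        show "(\<lambda>x. enorm N (\<lambda>i. ?a i x) powr (p - 2) * einner N (\<lambda>i. ?a i x) (\<lambda>i. ?b i x)) \<in> borel_measurable (leb N)"
          by (rule measurable_p_Laplace_flux[OF am bm])
        show "(\<lambda>x. enorm N (\<lambda>i. g i x) powr (p - 2) * einner N (\<lambda>i. g i x) (\<lambda>i. gv i x)) \<in> borel_measurable (leb N)"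
          by (rule measurable_p_Laplace_flux[OF gm gvm])
        show "AE x in leb N. enorm N (\<lambda>i. ?a i x) powr (p - 2) * einner N (\<lambda>i. ?a i x) (\<lambda>i. ?b i x)
            = enorm N (\<lambda>i. g i x) powr (p - 2) * einner N (\<lambda>i. g i x) (\<lambda>i. gv i x)"
          using gAE wgv'(2)
        proof eventually_elim
          case (elim x)
          have "einner N (\<lambda>i. ?a i x) (\<lambda>i. ?b i x) = einner N (\<lambda>i. g i x) (\<lambda>i. gv i x)"
            unfolding einner_def using elim g0 by (cases "x \<in> \<Omega>") (auto intro!: sum.cong)
          moreover have "enorm N (\<lambda>i. ?a i x) = enorm N (\<lambda>i. g i x)"
            unfolding enorm_def using elim g0 by (cases "x \<in> \<Omega>") (auto intro!: L2_set_cong)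
          ultimately show ?case by simp
        qed
      qed
      finally show ?thesis .
    qed
    finally show ?thesis .
  qed
  obtain a b where ab: "0 \<le> a" "0 \<le> b" "NL = a - b"
    and nl: "ennreal (2 powr (- p) / 2) * (\<integral>\<^sup>+s\<in>{0<..<1}. ennreal (C_const N s p) *
           (\<integral>\<^sup>+z\<in>B \<times> B. (case z of (x, y) \<Rightarrow>
              ennreal (\<bar>\<phi> x * w x - \<phi> y * w y\<bar> powr p / edist N x y powr (real N + s * p)))
            \<partial>(leb N \<Otimes>\<^sub>M leb N)) \<partial>\<mu>) + ennreal b
     \<le> ennreal a + (ennreal (young_const p + 1 / 2) * (\<integral>\<^sup>+s\<in>{0<..<1}. ennreal (C_const N s p) *
            (\<integral>\<^sup>+z\<in>B \<times> B. (case z of (x, y) \<Rightarrow>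
               ennreal (max (\<phi> x) (\<phi> y) powr p * \<bar>w x - w y\<bar> powr p
                 / edist N x y powr (real N + s * p)))
             \<partial>(leb N \<Otimes>\<^sub>M leb N)) \<partial>\<mu>)
       + 2 * (\<integral>\<^sup>+s\<in>{0<..<1}. ennreal (C_const N s p) *
              (esssup (restrict_space (leb N) S)
                 (\<lambda>x. \<integral>\<^sup>+y\<in>Rn N - B.
                    ennreal (\<phi> y powr (p - 1) / edist N x y powr (real N + s * p)) \<partial>leb N)
               * (\<integral>\<^sup>+x\<in>B. ennreal (\<phi> x * w x powr p) \<partial>leb N)) \<partial>\<mu>))"
    unfolding NL_def vv \<phi>
    by (rule nonlocal_part[where u = u and w = w and k = k, OF N p \<mu> um wm w0 Bm Sm SB out fin[unfolded vv \<phi>]])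
  obtain a' b' where ab': "0 \<le> a'" "0 \<le> b'" "LO = a' - b'"
    and lo: "ennreal (1 / 2) * (\<integral>\<^sup>+x\<in>B. ennreal (w x powr p * enorm N (\<lambda>i. if x \<in> A then g i x else 0) powr p) \<partial>leb N) + ennreal b'
       \<le> ennreal a' + ennreal (young_const p) * (\<integral>\<^sup>+x\<in>B. ennreal (\<phi> x powr p * enorm N (\<lambda>i. pd i w x) powr p) \<partial>leb N)"
    unfolding LO_def gv_def
    by (rule local_part[OF p gm Wm wm \<phi>m Am Sm SB Bm w0 \<phi>0 _ out gp[OF cS SU] gvp[unfolded gvv]]) (auto simp: A_def \<phi>)
  have L2: "(\<integral>\<^sup>+x\<in>B. ennreal (w x powr p * enorm N (wgrad N \<Omega> \<phi> x) powr p) \<partial>leb N)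
     = (\<integral>\<^sup>+x\<in>B. ennreal (w x powr p * enorm N (\<lambda>i. if x \<in> A then g i x else 0) powr p) \<partial>leb N)"
  proof (rule nn_integral_cong_AE)
    have wg: "is_weak_gradient N \<Omega> \<phi> (\<lambda>x i. if x \<in> A then g i x else 0)"
      using wphi N unfolding is_weak_gradient_iff by (auto simp: weak_deriv_def)
    show "AE x in leb N. ennreal (w x powr p * enorm N (wgrad N \<Omega> \<phi> x) powr p) * indicator B x
       = ennreal (w x powr p * enorm N (\<lambda>i. if x \<in> A then g i x else 0) powr p) * indicator B x"
      using wgrad_AE(2)[OF U wg]
    proof eventually_elim
      case (elim x)
      show ?case
      proof (cases "x \<in> B")
        case True
        then have "enorm N (wgrad N \<Omega> \<phi> x) = enorm N (\<lambda>i. if x \<in> A then g i x else 0)"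
          unfolding enorm_def using elim BU by (intro L2_set_cong) auto
        then show ?thesis by simp
      qed simp
    qed
  qed
  have c1: "2 powr (- p) / 2 \<le> (1 / 2 :: real)"
    using p powr_mono[of "- p" 0 "2 :: real"] by simp
  have test': "(a - b) + measure \<mu> {1} * (a' - b') \<le> 0" using test ab(3) ab'(3) by simp
  have Y: "0 < young_const p" by (rule young_const_pos[OF p])
  show ?thesis
    unfolding L2 grad_def S_def[symmetric]
    by (rule ennreal_absorb[OF nl lo test' ab(1,2) ab'(1,2) measure_nonneg _ c1]) (use Y in auto)
qed

theorem theorem1p1:
  fixes p :: real
  assumes "1 < p"
  shows "\<exists>C::real. 0 < C \<and>
    (\<forall>(N::nat) (\<Omega>::(nat \<Rightarrow> real) set) (\<mu>::real measure) (u::(nat \<Rightarrow> real) \<Rightarrow> real) (k::real)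
       (\<phi>::(nat \<Rightarrow> real) \<Rightarrow> real) (x0::nat \<Rightarrow> real) (r::real) (B::(nat \<Rightarrow> real) set)
       (w::(nat \<Rightarrow> real) \<Rightarrow> real) (\<alpha>::real).
      1 \<le> N \<and> bounded_domain N \<Omega> \<and> admissible_measure \<mu> \<and> \<alpha> = measure \<mu> {1} \<and>
      weak_subsolution N p \<mu> \<Omega> u \<and> \<phi> = (\<lambda>x. max (u x - k) 0) \<and>
      x0 \<in> Rn N \<and> 0 < r \<and> B = euclid_ball N x0 r \<and> B \<subseteq> \<Omega> \<and>
      w \<in> Cc_infty N B \<and> (\<forall>x\<in>Rn N. 0 \<le> w x)
      \<longrightarrow>
      ennreal \<alpha> * (\<integral>\<^sup>+x\<in>B. ennreal (w x powr p * enorm N (wgrad N \<Omega> \<phi> x) powr p) \<partial>leb N)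
      + (\<integral>\<^sup>+s\<in>{0<..<1}. ennreal (C_const N s p) *
           (\<integral>\<^sup>+z\<in>B \<times> B. (case z of (x, y) \<Rightarrow>
              ennreal (\<bar>\<phi> x * w x - \<phi> y * w y\<bar> powr p / edist N x y powr (real N + s * p)))
            \<partial>(leb N \<Otimes>\<^sub>M leb N)) \<partial>\<mu>)
      \<le> ennreal C *
        ((\<integral>\<^sup>+s\<in>{0<..<1}. ennreal (C_const N s p) *
            (\<integral>\<^sup>+z\<in>B \<times> B. (case z of (x, y) \<Rightarrow>
               ennreal (max (\<phi> x) (\<phi> y) powr p * \<bar>w x - w y\<bar> powr p
                 / edist N x y powr (real N + s * p)))
             \<partial>(leb N \<Otimes>\<^sub>M leb N)) \<partial>\<mu>)
         + (\<integral>\<^sup>+s\<in>{0<..<1}. ennreal (C_const N s p) *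
              (esssup (restrict_space (leb N) (supp N w))
                 (\<lambda>x. \<integral>\<^sup>+y\<in>Rn N - B.
                    ennreal (\<phi> y powr (p - 1) / edist N x y powr (real N + s * p)) \<partial>leb N)
               * (\<integral>\<^sup>+x\<in>B. ennreal (\<phi> x * w x powr p) \<partial>leb N)) \<partial>\<mu>)
         + ennreal \<alpha> * (\<integral>\<^sup>+x\<in>B. ennreal (\<phi> x powr p * enorm N (grad w x) powr p) \<partial>leb N)))"
proof (intro exI[of _ "(young_const p + 1 / 2 + 2 + young_const p) / (2 powr (- p) / 2)"] conjI allI impI)
  show "0 < (young_const p + 1 / 2 + 2 + young_const p) / (2 powr (- p) / 2)"
    using young_const_pos[OF assms] by (intro divide_pos_pos) auto
qed (elim conjE, hypsubst, rule caccioppoli_subsolution[OF assms], auto simp: bounded_domain_def)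

end
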